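(* Let $Y$ be an integer homology sphere such that $HF^-(Y)\cong\mathbb H^-(M)$ as graded $\mathbb F[U]$-modules for some symmetric graded root $M$, by an isomorphism carrying the involution $\iota_*$ on $HF^-(Y)$ to the involution $J_0$ of $\mathbb H^-(M)$. Suppose $HF_{\mathrm{red}}(Y)\cong\bigoplus_{i=1}^N\big(\mathcal T_{a_i}(n_i)\big)^{k_i}$, where $(a_i,n_i)\ne(a_j,n_j)$ if $i\ne j$. Then $$HF_{\mathrm{conn}}(Y)\cong\bigoplus_{i=1}^N\big(\mathcal T_{a_i}(n_i)\big)^{k_i'},\qquad k_i'=\begin{cases}0&\text{if }k_i\text{ is even},\\1&\text{if }k_i\text{ is odd}.\end{cases}$$
   Context: $\mathbb F=\mathbb Z/2\mathbb Z$, $U$ has degree $-2$, and $\mathcal T_a(n)=\mathbb F[U]/U^n$ with $\mathrm{gr}(1)=a$. Graded roots. A graded root $M$ is an infinite tree with a function $\chi:\mathrm{Vert}(M)\to\mathbb Q$ such that: $\chi(u)-\chi(v)=\pm1$ for any edge $(u,v)$; $\chi(u)\le\max\{\chi(v),\chi(w)\}$ for any edges $(u,v),(u,w)$ with $v\ne w$; $\chi$ is bounded above; $\chi^{-1}(k)$ is finite for every $k$; $\#\chi^{-1}(k)=1$ for all $k\ll0$ (in the coset of $\mathbb Z$ where $\chi$ takes values). $\mathbb H^-(M)$ is the $\mathbb F[U]$-module with $\mathbb F$-basis $\mathrm{Vert}(M)$ and $U\cdot v=w$ when $(v,w)$ is an edge with $\chi(v)-\chi(w)=1$; relative degree is twice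 the relative $\chi$-grading (so $\deg U=-2$), with an overall normalization of the absolute grading allowed. A symmetric graded root is a graded root with a $\chi$-preserving involution $J_0$ of $\mathrm{Vert}(M)$ such that $J_0$ fixes at most one vertex in each $\chi^{-1}(k)$ and $(v,w)$ is an edge iff $(J_0v,J_0w)$ is; $J_0$ induces an involution of $\mathbb H^-(M)$. Floer theory. For an integer homology sphere $Y$, $CF^-(Y)$ is the minus Heegaard Floer complex, a finitely generated free graded chain complex over $\mathbb F[U]$, normalized so that $HF^-(S^3)=\mathbb F[U]$ with $\mathrm{gr}(1)=-2$. $HF_{\mathrm{red}}(Y)$ is the $U$-torsion submodule of $HF^-(Y)$ with gradings raised by $1$ (equivalently graded as a quotient of $HF^+(Y)$). The conjugation involution $\iota$ on $CF^-(Y)$: for a pointed Heegaard diagram $(\Sigma,\boldsymbol\alpha,\boldsymbol\beta,z)$ (with almost complex structures), $\iota=\Phi\circ\eta$, where $\eta$ is the canonical isomorphism to the complex of the conjugate diagram $(-\Sigma,\boldsymbol\beta,\boldsymbol\alpha,z)$ and $\Phi$ is the homotopy equivalence induced by Heegaard moves and changes of almost complex structure back to the original. It is a grading-preserving chain map with $\iota^2\simeq\mathrm{id}$ (homotopies over $\mathbb F[U]$); $\iota_*$ is the induced map on $HF^-(Y)$. Connected homology. For $C=CF^-(Y)$, a self-local equivalence is a grading-preserving chain map $f:C\to C$ over $\mathbb F[U]$ with $f\circ\iota\simeq\iota\circ f$ inducing an isomorphism on $U^{-1}H_*(C)$. Preorder: $f\lesssim g$ if $\ker f\subseteq\ker g$;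 $f$ is maximal if $g\gtrsim f$ implies $g\lesssim f$ for every self-local equivalence $g$. $HF_{\mathrm{conn}}(Y)$ is the $U$-torsion submodule of $H_*(\operatorname{im} f)$, with gradings raised by $1$, for any maximal $f$ (well defined up to graded isomorphism). *)

theory Defs
  imports
    "HOL-Algebra.Module"
    "HOL-Algebra.AbelCoset"
    "HOL-Computational_Algebra.Polynomial"
    "HOL-Library.Z2"
    "HOL-Library.Poly_Mapping"
begin

section \<open>Graded modules over F[U], F = Z/2\<close>

text \<open>The type \<^typ>\<open>bit\<close> is the field with two elements, so F[U] is the ring of
  polynomials over it; it is packaged as a HOL-Algebra ring in order to use the locale
  \<^locale>\<open>Module.module\<close>.\<close>

definition FU :: "bit poly ring" where
  "FU = \<lparr>carrier = UNIV, monoid.mult = (*), one = 1, zero = 0, add = (+)\<rparr>"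

definition Uvar :: "bit poly" where
  "Uvar = Polynomial.monom 1 1"

text \<open>\<open>gr M d\<close> is the set of homogeneous elements of degree \<open>d\<close> (including zero). The ring
  multiplication and unit, which the HOL-Algebra record for modules inherits from rings, are
  never used.\<close>

record 'a gmod = "(bit poly, 'a) module" +
  gr :: "rat \<Rightarrow> 'a set"

locale graded_module = Module.module FU M for M :: "('a, 'm) gmod_scheme" (structure) +
  assumes gr_subgroup: "additive_subgroup (gr M d) M"
    and gr_U: "x \<in> gr M d \<Longrightarrow> Uvar \<odot>\<^bsub>M\<^esub> x \<in> gr M (d - 2)"
    and gr_decomp: "x \<in> carrier M \<Longrightarrow>
      \<exists>!c. (\<forall>d. c d \<in> gr M d) \<and> finite {d. c d \<noteq> \<zero>\<^bsub>M\<^esub>} \<and>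
           x = finsum M c {d. c d \<noteq> \<zero>\<^bsub>M\<^esub>}"

text \<open>Homogeneous F[U]-linear maps of degree \<open>e\<close>. Only the values on the carrier matter.\<close>

definition ghom :: "rat \<Rightarrow> ('a, 'm) gmod_scheme \<Rightarrow> ('b, 'n) gmod_scheme \<Rightarrow> ('a \<Rightarrow> 'b) set" where
  "ghom e M N = {f. f \<in> carrier M \<rightarrow> carrier N \<and>
     (\<forall>x\<in>carrier M. \<forall>y\<in>carrier M. f (x \<oplus>\<^bsub>M\<^esub> y) = f x \<oplus>\<^bsub>N\<^esub> f y) \<and>
     (\<forall>p. \<forall>x\<in>carrier M. f (p \<odot>\<^bsub>M\<^esub> x) = p \<odot>\<^bsub>N\<^esub> f x) \<and>
     (\<forall>d. f ` gr M d \<subseteq> gr N (d + e))}"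

definition giso :: "('a, 'm) gmod_scheme \<Rightarrow> ('b, 'n) gmod_scheme \<Rightarrow> ('a \<Rightarrow> 'b) set" where
  "giso M N = {f \<in> ghom 0 M N. bij_betw f (carrier M) (carrier N)}"

definition gisomorphic :: "('a, 'm) gmod_scheme \<Rightarrow> ('b, 'n) gmod_scheme \<Rightarrow> bool"
  (infix "\<cong>\<^sub>g\<^sub>r" 50) where
  "M \<cong>\<^sub>g\<^sub>r N \<longleftrightarrow> giso M N \<noteq> {}"

definition gsub :: "('a, 'm) gmod_scheme \<Rightarrow> 'a set \<Rightarrow> ('a, 'm) gmod_scheme" where
  "gsub M S = M\<lparr>carrier := S, gr := \<lambda>d. gr M d \<inter> S\<rparr>"

text \<open>\<open>gshift s M\<close> raises all gradings by \<open>s\<close>.\<close>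

definition gshift :: "rat \<Rightarrow> ('a, 'm) gmod_scheme \<Rightarrow> ('a, 'm) gmod_scheme" where
  "gshift s M = M\<lparr>gr := \<lambda>d. gr M (d - s)\<rparr>"

definition gquot :: "('a, 'm) gmod_scheme \<Rightarrow> 'a set \<Rightarrow> 'a set gmod" where
  "gquot M B =
    \<lparr>carrier = a_rcosets\<^bsub>M\<^esub> B, monoid.mult = undefined, one = undefined, zero = B,
     add = (\<lambda>X Y. X <+>\<^bsub>M\<^esub> Y),
     module.smult = (\<lambda>p X. \<Union>x\<in>X. B +>\<^bsub>M\<^esub> (p \<odot>\<^bsub>M\<^esub> x)),
     gr = (\<lambda>d. (\<lambda>x. B +>\<^bsub>M\<^esub> x) ` gr M d)\<rparr>"

definition gdsum :: "'i set \<Rightarrow> ('i \<Rightarrow> ('a, 'm) gmod_scheme) \<Rightarrow> ('i \<Rightarrow> 'a) gmod" where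
  "gdsum I M =
    (let S = {f \<in> \<Pi>\<^sub>E i\<in>I. carrier (M i). finite {i \<in> I. f i \<noteq> \<zero>\<^bsub>M i\<^esub>}} in
    \<lparr>carrier = S, monoid.mult = undefined, one = undefined,
     zero = (\<lambda>i\<in>I. \<zero>\<^bsub>M i\<^esub>),
     add = (\<lambda>f g. \<lambda>i\<in>I. f i \<oplus>\<^bsub>M i\<^esub> g i),
     module.smult = (\<lambda>p f. \<lambda>i\<in>I. p \<odot>\<^bsub>M i\<^esub> f i),
     gr = (\<lambda>d. {f \<in> S. \<forall>i\<in>I. f i \<in> gr (M i) d})\<rparr>)"

definition gpow :: "('a, 'm) gmod_scheme \<Rightarrow> nat \<Rightarrow> (nat \<Rightarrow> 'a) gmod" where
  "gpow M k = gdsum {..<k} (\<lambda>_. M)"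

definition torsion :: "('a, 'm) gmod_scheme \<Rightarrow> ('a, 'm) gmod_scheme" where
  "torsion M = gsub M {x \<in> carrier M. \<exists>n. (Uvar ^ n) \<odot>\<^bsub>M\<^esub> x = \<zero>\<^bsub>M\<^esub>}"

text \<open>F[U] as a graded module over itself, with 1 in degree \<open>a\<close>.\<close>

definition FU_mod :: "rat \<Rightarrow> bit poly gmod" where
  "FU_mod a =
    \<lparr>carrier = UNIV, monoid.mult = (*), one = 1, zero = 0, add = (+), module.smult = (*),
     gr = (\<lambda>d. {p. \<forall>i. Polynomial.coeff p i \<noteq> 0 \<longrightarrow> a - 2 * of_nat i = d})\<rparr>"

definition T :: "rat \<Rightarrow> nat \<Rightarrow> bit poly set gmod" where
  "T a n = gquot (FU_mod a) (range (\<lambda>p. Uvar ^ n * p))"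

text \<open>The localization of \<open>M\<close> at \<open>U\<close>: the pair \<open>(x, k)\<close> represents the fraction \<open>x / U ^ k\<close>.
  The map of localizations induced by a linear map is linear over \<open>F[U, 1/U]\<close>, so it is an
  isomorphism if and only if it is bijective.\<close>

definition Uloc_rel :: "('a, 'm) gmod_scheme \<Rightarrow> (('a \<times> nat) \<times> ('a \<times> nat)) set" where
  "Uloc_rel M = {((x, k), (y, l)). x \<in> carrier M \<and> y \<in> carrier M \<and>
     (\<exists>m. (Uvar ^ (m + l)) \<odot>\<^bsub>M\<^esub> x = (Uvar ^ (m + k)) \<odot>\<^bsub>M\<^esub> y)}"

definition Uloc :: "('a, 'm) gmod_scheme \<Rightarrow> ('a \<times> nat) set set" where
  "Uloc M = (carrier M \<times> UNIV) // Uloc_rel M"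

definition Uloc_map :: "('b, 'n) gmod_scheme \<Rightarrow> ('a \<Rightarrow> 'b) \<Rightarrow> ('a \<times> nat) set \<Rightarrow> ('b \<times> nat) set" where
  "Uloc_map N f A = Uloc_rel N `` ((\<lambda>(x, k). (f x, k)) ` A)"

definition Uloc_iso :: "('a, 'm) gmod_scheme \<Rightarrow> ('b, 'n) gmod_scheme \<Rightarrow> ('a \<Rightarrow> 'b) \<Rightarrow> bool" where
  "Uloc_iso M N f \<longleftrightarrow> bij_betw (Uloc_map N f) (Uloc M) (Uloc N)"


section \<open>Complexes with an involution up to homotopy\<close>

record 'a cx = "'a gmod" +
  bd :: "'a \<Rightarrow> 'a"

definition homology :: "('a, 'm) cx_scheme \<Rightarrow> 'a set gmod" where
  "homology C = gquot (gsub C {x \<in> carrier C. bd C x = \<zero>\<^bsub>C\<^esub>}) (bd C ` carrier C)"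

definition homology_map ::
    "('b, 'n) cx_scheme \<Rightarrow> ('a \<Rightarrow> 'b) \<Rightarrow> 'a set \<Rightarrow> 'b set" where
  "homology_map D f X = (\<Union>x\<in>X. (bd D ` carrier D) +>\<^bsub>D\<^esub> f x)"

definition chain_map :: "('a, 'm) cx_scheme \<Rightarrow> ('b, 'n) cx_scheme \<Rightarrow> ('a \<Rightarrow> 'b) \<Rightarrow> bool" where
  "chain_map C D f \<longleftrightarrow> f \<in> ghom 0 C D \<and> (\<forall>x\<in>carrier C. f (bd C x) = bd D (f x))"

definition homotopic ::
    "('a, 'm) cx_scheme \<Rightarrow> ('b, 'n) cx_scheme \<Rightarrow> ('a \<Rightarrow> 'b) \<Rightarrow> ('a \<Rightarrow> 'b) \<Rightarrow> bool" where
  "homotopic C D f g \<longleftrightarrow> (\<exists>h \<in> ghom 1 C D. \<forall>x\<in>carrier C.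
     f x \<ominus>\<^bsub>D\<^esub> g x = bd D (h x) \<oplus>\<^bsub>D\<^esub> h (bd C x))"

text \<open>Finitely generated free graded modules have a finite basis of homogeneous elements.\<close>

locale free_complex = graded_module C for C :: "('a, 'm) cx_scheme" (structure) +
  assumes bd_hom: "bd C \<in> ghom (-1) C C"
    and bd_bd: "x \<in> carrier C \<Longrightarrow> bd C (bd C x) = \<zero>\<^bsub>C\<^esub>"
    and fg_free: "\<exists>B. finite B \<and> B \<subseteq> carrier C \<and> (\<forall>b\<in>B. \<exists>d. b \<in> gr C d) \<and>
      (\<forall>x\<in>carrier C. \<exists>!c. c \<in> B \<rightarrow>\<^sub>E (UNIV :: bit poly set) \<and>
         x = finsum C (\<lambda>b. c b \<odot>\<^bsub>C\<^esub> b) B)"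

text \<open>The algebraic structure of the pair \<open>(CF\<^sup>-(Y), \<iota>)\<close> for an integer homology sphere
  \<open>Y\<close>. Holomorphic curve counts are not formalized: everything below is defined for an arbitrary
  such pair, and \<open>HF\<^sup>-(Y)\<close> is the homology of the complex.\<close>

locale iota_complex = free_complex C for C :: "('a, 'm) cx_scheme" (structure)
    and \<iota> :: "'a \<Rightarrow> 'a" +
  assumes iota_chain_map: "chain_map C C \<iota>"
    and iota_iota: "homotopic C C (\<iota> \<circ> \<iota>) id"

definition HF_red :: "('a, 'm) cx_scheme \<Rightarrow> 'a set gmod" where
  "HF_red C = gshift 1 (torsion (homology C))"

definition self_local_equivalence ::
    "('a, 'm) cx_scheme \<Rightarrow> ('a \<Rightarrow> 'a) \<Rightarrow> ('a \<Rightarrow> 'a) \<Rightarrow> bool" where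
  "self_local_equivalence C \<iota> f \<longleftrightarrow>
     chain_map C C f \<and> homotopic C C (f \<circ> \<iota>) (\<iota> \<circ> f) \<and>
     Uloc_iso (homology C) (homology C) (homology_map C f)"

definition ker_le :: "('a, 'm) cx_scheme \<Rightarrow> ('a \<Rightarrow> 'a) \<Rightarrow> ('a \<Rightarrow> 'a) \<Rightarrow> bool" where
  "ker_le C f g \<longleftrightarrow> a_kernel C C f \<subseteq> a_kernel C C g"

definition maximal_self_local_equivalence ::
    "('a, 'm) cx_scheme \<Rightarrow> ('a \<Rightarrow> 'a) \<Rightarrow> ('a \<Rightarrow> 'a) \<Rightarrow> bool" where
  "maximal_self_local_equivalence C \<iota> f \<longleftrightarrow> self_local_equivalence C \<iota> f \<and>
     (\<forall>g. self_local_equivalence C \<iota> g \<longrightarrow> ker_le C f g \<longrightarrow> ker_le C g f)"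

text \<open>The connected homology computed from \<open>f\<close>. It is independent of \<open>f\<close> up to graded isomorphism
  as long as \<open>f\<close> is a maximal self-local equivalence.\<close>

definition HF_conn :: "('a, 'm) cx_scheme \<Rightarrow> ('a \<Rightarrow> 'a) \<Rightarrow> 'a set gmod" where
  "HF_conn C f = gshift 1 (torsion (homology (gsub C (f ` carrier C))))"


section \<open>Graded roots\<close>

definition is_tree :: "'v set \<Rightarrow> ('v \<Rightarrow> 'v \<Rightarrow> bool) \<Rightarrow> bool" where
  "is_tree V E \<longleftrightarrow> V \<noteq> {} \<and>
     (\<forall>u v. E u v \<longrightarrow> u \<in> V \<and> v \<in> V \<and> u \<noteq> v \<and> E v u) \<and>
     (\<forall>u\<in>V. \<forall>v\<in>V. E\<^sup>*\<^sup>* u v) \<and>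
     \<not> (\<exists>p. length p \<ge> 3 \<and> distinct p \<and> successively E p \<and> E (last p) (hd p))"

locale graded_root =
  fixes V :: "'v set" and E :: "'v \<Rightarrow> 'v \<Rightarrow> bool" and \<chi> :: "'v \<Rightarrow> rat"
  assumes tree: "is_tree V E"
    and infinite_V: "infinite V"
    and chi_edge: "E u v \<Longrightarrow> \<chi> u - \<chi> v = 1 \<or> \<chi> u - \<chi> v = -1"
    and chi_max: "E u v \<Longrightarrow> E u w \<Longrightarrow> v \<noteq> w \<Longrightarrow> \<chi> u \<le> max (\<chi> v) (\<chi> w)"
    and chi_bdd: "\<exists>b. \<forall>v\<in>V. \<chi> v \<le> b"
    and chi_fin: "finite {v \<in> V. \<chi> v = k}"
    and chi_one: "\<exists>K. \<forall>k\<le>K. (\<exists>v\<in>V. k - \<chi> v \<in> \<int>) \<longrightarrow> card {v \<in> V. \<chi> v = k} = 1"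

locale symmetric_graded_root = graded_root V E \<chi>
  for V :: "'v set" and E :: "'v \<Rightarrow> 'v \<Rightarrow> bool" and \<chi> :: "'v \<Rightarrow> rat" +
  fixes J :: "'v \<Rightarrow> 'v"
  assumes J_closed: "v \<in> V \<Longrightarrow> J v \<in> V"
    and J_J: "v \<in> V \<Longrightarrow> J (J v) = v"
    and J_chi: "v \<in> V \<Longrightarrow> \<chi> (J v) = \<chi> v"
    and J_edge: "v \<in> V \<Longrightarrow> w \<in> V \<Longrightarrow> E v w \<longleftrightarrow> E (J v) (J w)"
    and J_fixed: "v \<in> V \<Longrightarrow> w \<in> V \<Longrightarrow> J v = v \<Longrightarrow> J w = w \<Longrightarrow> \<chi> v = \<chi> w \<Longrightarrow> v = w"

definition root_down :: "('v \<Rightarrow> 'v \<Rightarrow> bool) \<Rightarrow> ('v \<Rightarrow> rat) \<Rightarrow> 'v \<Rightarrow> 'v" where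
  "root_down E \<chi> v = (THE w. E v w \<and> \<chi> v - \<chi> w = 1)"

text \<open>Elements of the module of a graded root are finitely supported functions from the vertices
  to F, the vertex \<open>v\<close> being \<open>Poly_Mapping.single v 1\<close>. A vertex \<open>v\<close> has degree
  \<open>2 * \<chi> v + \<sigma>\<close>, where \<open>\<sigma>\<close> is the normalization of the absolute grading.\<close>

definition root_module ::
    "'v set \<Rightarrow> ('v \<Rightarrow> 'v \<Rightarrow> bool) \<Rightarrow> ('v \<Rightarrow> rat) \<Rightarrow> rat \<Rightarrow> ('v \<Rightarrow>\<^sub>0 bit) gmod" where
  "root_module V E \<chi> \<sigma> =
    \<lparr>carrier = {x. Poly_Mapping.keys x \<subseteq> V}, monoid.mult = undefined, one = undefined,
     zero = 0, add = (+),
     module.smult = (\<lambda>p x. \<Sum>i\<le>Polynomial.degree p. \<Sum>v\<in>Poly_Mapping.keys x.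
        Poly_Mapping.single ((root_down E \<chi> ^^ i) v)
          (Polynomial.coeff p i * Poly_Mapping.lookup x v)),
     gr = (\<lambda>d. {x. Poly_Mapping.keys x \<subseteq> {v \<in> V. 2 * \<chi> v + \<sigma> = d}})\<rparr>"

definition root_involution :: "('v \<Rightarrow> 'v) \<Rightarrow> ('v \<Rightarrow>\<^sub>0 bit) \<Rightarrow> ('v \<Rightarrow>\<^sub>0 bit)" where
  "root_involution J x =
     (\<Sum>v\<in>Poly_Mapping.keys x. Poly_Mapping.single (J v) (Poly_Mapping.lookup x v))"

end

theory Submission
  imports Defs
begin

text \<open>The homology of \<open>C\<close> is concentrated in degrees of one parity and \<open>C\<close> is degreewise finite and
  \<open>U\<close>-torsion free, so every graded endomorphism of \<open>H(C)\<close> is realised by a chain map and two chain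
  maps are homotopic iff they agree on homology. Self-local equivalences are therefore governed by
  the \<open>J\<close>-equivariant endomorphisms of the root module that are local isomorphisms.

  Folding every branch of the root onto a tallest branch leaving the invariant stem at the same
  level or above gives such an endomorphism \<open>\<gamma>\<close>, whose image is spanned by a symmetric subroot
  \<open>V'\<close> with strictly monotone branches. No local equivariant endomorphism can kill anything in this
  image. A maximal \<open>f\<close> has no room left either: \<open>f \<circ> g \<circ> f\<close> has the same kernel as \<open>f\<close> for every
  self-local equivalence \<open>g\<close>, in particular for a realisation \<open>g\<close> of \<open>\<gamma>\<close>, and so \<open>g\<close> identifies the
  homology of \<open>im f\<close> with the image of \<open>\<gamma>\<close>.

  The torsion of the module of \<open>V'\<close> has an explicit cyclic decomposition without repeated summands.
  In the full root, \<open>J\<close> pairs off everything away from the stem. Since the number of \<open>m\<close>-fold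
  images of the vertices at level \<open>e\<close> determines the multiplicities \<open>k\<^sub>i\<close> by a second
  difference, the parities of the \<open>k\<^sub>i\<close> depend only on the heights of the branches over the stem,
  and the odd ones are exactly the summands found for \<open>V'\<close>.\<close>

text \<open>The obstacle is that \<open>im f\<close> is known only as a subcomplex, with no basis or
  splitting at hand. Everything about it is extracted from finiteness: every graded piece of
  \<open>C\<close> is a finite space over F_2, so an injective graded self-map is bijective, and
  maximal kernels exist because only finitely many kernels occur. Kernels can only be compared for
  maps of chains; this is why \<gamma> has to be realised on \<open>C\<close> and cannot stay on
  homology. Parity of the degrees is what makes homology sufficient: the obstruction to a homotopy
  lies in a degree where every cycle bounds, or vanishes by choice.

  On the combinatorial side, no summand of the given decomposition of \<open>HF_red\<close> is
  located among the vertices. Only the sizes of \<open>U ^ m\<close> times each graded piece are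
  compared. On one level the torsion is the space of elements with even support, so these sizes are
  governed by numbers of vertices minus one. Modulo 2 such a number records only whether a stem
  vertex is reached from a given level, so its second difference detects equality of that level with
  the height of the stem at two consecutive levels, which can differ only at a jump.\<close>

abbreviation "keys \<equiv> Poly_Mapping.keys"
abbreviation "lookup \<equiv> Poly_Mapping.lookup"
abbreviation "single \<equiv> Poly_Mapping.single"

lemma FU_simps [simp]:
  "carrier FU = UNIV" "\<zero>\<^bsub>FU\<^esub> = 0" "\<one>\<^bsub>FU\<^esub> = 1" "p \<oplus>\<^bsub>FU\<^esub> q = p + q" "p \<otimes>\<^bsub>FU\<^esub> q = p * q"
  by (simp_all add: FU_def)

lemma cring_FU: "cring FU"
proof (rule cringI)
  show "abelian_group FU"
    by (rule abelian_groupI) (auto simp: algebra_simps intro: exI[of _ "- x" for x])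
  show "comm_monoid FU"
    by (rule comm_monoidI) (auto simp: algebra_simps)
qed (auto simp: algebra_simps)

lemma bit_double [simp]: "(b::bit) + b = 0"
  by (cases b) auto

lemma poly_bit_double [simp]: "(p::bit poly) + p = 0"
  by (rule poly_eqI) (simp only: coeff_add bit_double coeff_0)

lemma Uvar_power: "Uvar ^ n = monom 1 n"
  by (induction n) (simp_all add: Uvar_def monom_0 mult_monom one_pCons)

lemma pCons_Uvar: "pCons c p = [:c:] + Uvar * p"
  by (simp add: Uvar_def monom_Suc monom_0)

section \<open>Modules over \<open>F[U]\<close>\<close>

locale fu_module = Module.module FU M for M :: "('a, 'm) gmod_scheme" (structure)
begin

lemma smult_poly_closed [simp, intro]: "x \<in> carrier M \<Longrightarrow> p \<odot> x \<in> carrier M"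
  using smult_closed[of p x] by simp

lemma smult_poly_add: "x \<in> carrier M \<Longrightarrow> (p + q) \<odot> x = p \<odot> x \<oplus> q \<odot> x"
  using smult_l_distr[of p q x] by simp

lemma smult_poly_mult: "x \<in> carrier M \<Longrightarrow> (p * q) \<odot> x = p \<odot> (q \<odot> x)"
  using smult_assoc1[of p q x] by simp

lemma smult_add: "x \<in> carrier M \<Longrightarrow> y \<in> carrier M \<Longrightarrow> p \<odot> (x \<oplus> y) = p \<odot> x \<oplus> p \<odot> y"
  using smult_r_distr[of p x y] by simp

lemma smult_poly_1 [simp]: "x \<in> carrier M \<Longrightarrow> 1 \<odot> x = x"
  using smult_one[of x] by simp

lemma smult_poly_0 [simp]: "x \<in> carrier M \<Longrightarrow> 0 \<odot> x = \<zero>"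
  using smult_l_null[of x] by simp

lemma smult_zero [simp]: "p \<odot> \<zero> = \<zero>"
  using smult_r_null[of p] by simp

lemma add_self [simp]: "x \<in> carrier M \<Longrightarrow> x \<oplus> x = \<zero>"
  using smult_poly_add[of x 1 1] by simp

lemma minus_self [simp]: "x \<in> carrier M \<Longrightarrow> \<ominus> x = x"
  using M.minus_equality[of x x] by simp

lemma minus_eq_add: "x \<in> carrier M \<Longrightarrow> y \<in> carrier M \<Longrightarrow> x \<ominus> y = x \<oplus> y"
  by (simp add: M.minus_eq)

lemma add_cancel [simp]: "x \<in> carrier M \<Longrightarrow> y \<in> carrier M \<Longrightarrow> x \<oplus> (x \<oplus> y) = y"
  by (simp add: M.a_assoc[symmetric])

lemma add_eq_zero_iff: "x \<in> carrier M \<Longrightarrow> y \<in> carrier M \<Longrightarrow> x \<oplus> y = \<zero> \<longleftrightarrow> x = y"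
  using M.minus_equality[of x y] by auto

lemma smult_power_add: "x \<in> carrier M \<Longrightarrow> (Uvar ^ (m + n)) \<odot> x = (Uvar ^ m) \<odot> ((Uvar ^ n) \<odot> x)"
  by (simp add: smult_poly_mult power_add)

end

lemma fu_moduleI:
  assumes "abelian_group M"
    and "\<And>p x. x \<in> carrier M \<Longrightarrow> p \<odot>\<^bsub>M\<^esub> x \<in> carrier M"
    and "\<And>p q x. x \<in> carrier M \<Longrightarrow> (p + q) \<odot>\<^bsub>M\<^esub> x = p \<odot>\<^bsub>M\<^esub> x \<oplus>\<^bsub>M\<^esub> q \<odot>\<^bsub>M\<^esub> x"
    and "\<And>p x y. x \<in> carrier M \<Longrightarrow> y \<in> carrier M \<Longrightarrow> p \<odot>\<^bsub>M\<^esub> (x \<oplus>\<^bsub>M\<^esub> y) = p \<odot>\<^bsub>M\<^esub> x \<oplus>\<^bsub>M\<^esub> p \<odot>\<^bsub>M\<^esub> y"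
    and "\<And>p q x. x \<in> carrier M \<Longrightarrow> (p * q) \<odot>\<^bsub>M\<^esub> x = p \<odot>\<^bsub>M\<^esub> (q \<odot>\<^bsub>M\<^esub> x)"
    and "\<And>x. x \<in> carrier M \<Longrightarrow> 1 \<odot>\<^bsub>M\<^esub> x = x"
  shows "fu_module M"
  unfolding fu_module_def by (rule moduleI) (use assms cring_FU in auto)

lemma abelian_group_char2I:
  assumes "\<zero>\<^bsub>M\<^esub> \<in> carrier M"
    and "\<And>x y. x \<in> carrier M \<Longrightarrow> y \<in> carrier M \<Longrightarrow> x \<oplus>\<^bsub>M\<^esub> y \<in> carrier M"
    and "\<And>x y z. x \<in> carrier M \<Longrightarrow> y \<in> carrier M \<Longrightarrow> z \<in> carrier M \<Longrightarrow>
           (x \<oplus>\<^bsub>M\<^esub> y) \<oplus>\<^bsub>M\<^esub> z = x \<oplus>\<^bsub>M\<^esub> (y \<oplus>\<^bsub>M\<^esub> z)"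
    and "\<And>x y. x \<in> carrier M \<Longrightarrow> y \<in> carrier M \<Longrightarrow> x \<oplus>\<^bsub>M\<^esub> y = y \<oplus>\<^bsub>M\<^esub> x"
    and "\<And>x. x \<in> carrier M \<Longrightarrow> \<zero>\<^bsub>M\<^esub> \<oplus>\<^bsub>M\<^esub> x = x"
    and "\<And>x. x \<in> carrier M \<Longrightarrow> x \<oplus>\<^bsub>M\<^esub> x = \<zero>\<^bsub>M\<^esub>"
  shows "abelian_group M"
  by (rule abelian_groupI) (fact assms | use assms(6) in blast)+

text \<open>Horner induction on the polynomial; a constant coefficient is 0 or 1, so additivity
  alone takes care of it.\<close>

lemma smult_commute_of_Uvar:
  assumes M: "fu_module M" and N: "fu_module N"
    and f: "\<And>x. x \<in> carrier M \<Longrightarrow> f x \<in> carrier N"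
    and add: "\<And>x y. x \<in> carrier M \<Longrightarrow> y \<in> carrier M \<Longrightarrow> f (x \<oplus>\<^bsub>M\<^esub> y) = f x \<oplus>\<^bsub>N\<^esub> f y"
    and U: "\<And>x. x \<in> carrier M \<Longrightarrow> f (Uvar \<odot>\<^bsub>M\<^esub> x) = Uvar \<odot>\<^bsub>N\<^esub> f x"
    and x: "x \<in> carrier M"
  shows "f (p \<odot>\<^bsub>M\<^esub> x) = p \<odot>\<^bsub>N\<^esub> f x"
proof -
  interpret M: fu_module M by fact
  interpret N: fu_module N by fact
  have "f \<zero>\<^bsub>M\<^esub> \<oplus>\<^bsub>N\<^esub> f \<zero>\<^bsub>M\<^esub> = f \<zero>\<^bsub>M\<^esub>"
    using add[of "\<zero>\<^bsub>M\<^esub>" "\<zero>\<^bsub>M\<^esub>"] by simp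
  then have f0: "f \<zero>\<^bsub>M\<^esub> = \<zero>\<^bsub>N\<^esub>"
    using f[of "\<zero>\<^bsub>M\<^esub>"] by simp
  show ?thesis
    using x
  proof (induction p arbitrary: x)
    case 0
    then show ?case by (simp add: f f0)
  next
    case (pCons c p)
    have c: "f ([:c:] \<odot>\<^bsub>M\<^esub> x) = [:c:] \<odot>\<^bsub>N\<^esub> f x"
      using pCons.prems by (cases c) (simp_all add: f f0 one_pCons[symmetric])
    show ?case
      unfolding pCons_Uvar[of c p] using pCons.prems
      by (simp add: M.smult_poly_add N.smult_poly_add M.smult_poly_mult N.smult_poly_mult f add U c pCons.IH)
  qed
qed

lemma ghomI:
  assumes M: "fu_module M" and N: "fu_module N"
    and f: "\<And>x. x \<in> carrier M \<Longrightarrow> f x \<in> carrier N"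
    and add: "\<And>x y. x \<in> carrier M \<Longrightarrow> y \<in> carrier M \<Longrightarrow> f (x \<oplus>\<^bsub>M\<^esub> y) = f x \<oplus>\<^bsub>N\<^esub> f y"
    and U: "\<And>x. x \<in> carrier M \<Longrightarrow> f (Uvar \<odot>\<^bsub>M\<^esub> x) = Uvar \<odot>\<^bsub>N\<^esub> f x"
    and gr: "\<And>d x. x \<in> gr M d \<Longrightarrow> f x \<in> gr N (d + e)"
  shows "f \<in> ghom e M N"
  unfolding ghom_def
proof (intro CollectI conjI allI ballI)
  show "f \<in> carrier M \<rightarrow> carrier N" using f by blast
  show "f (x \<oplus>\<^bsub>M\<^esub> y) = f x \<oplus>\<^bsub>N\<^esub> f y" if "x \<in> carrier M" "y \<in> carrier M" for x y
    using add that .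
  show "f (p \<odot>\<^bsub>M\<^esub> x) = p \<odot>\<^bsub>N\<^esub> f x" if "x \<in> carrier M" for p x
    by (rule smult_commute_of_Uvar[OF M N f add U that])
  show "f ` gr M d \<subseteq> gr N (d + e)" for d by (rule image_subsetI) (rule gr)
qed

lemma ghomD:
  assumes "f \<in> ghom e M N"
  shows "x \<in> carrier M \<Longrightarrow> f x \<in> carrier N"
    and "x \<in> carrier M \<Longrightarrow> y \<in> carrier M \<Longrightarrow> f (x \<oplus>\<^bsub>M\<^esub> y) = f x \<oplus>\<^bsub>N\<^esub> f y"
    and "x \<in> carrier M \<Longrightarrow> f (p \<odot>\<^bsub>M\<^esub> x) = p \<odot>\<^bsub>N\<^esub> f x"
    and "x \<in> gr M d \<Longrightarrow> f x \<in> gr N (d + e)"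
proof -
  note f = assms[unfolded ghom_def mem_Collect_eq]
  note f = f[THEN conjunct1] f[THEN conjunct2, THEN conjunct1]
    f[THEN conjunct2, THEN conjunct2, THEN conjunct1] f[THEN conjunct2, THEN conjunct2, THEN conjunct2]
  show "f x \<in> carrier N" if "x \<in> carrier M" using f(1) that by (rule funcset_mem)
  show "f (x \<oplus>\<^bsub>M\<^esub> y) = f x \<oplus>\<^bsub>N\<^esub> f y" if "x \<in> carrier M" "y \<in> carrier M" using f(2) that by simp
  show "f (p \<odot>\<^bsub>M\<^esub> x) = p \<odot>\<^bsub>N\<^esub> f x" if "x \<in> carrier M" using f(3) that by simp
  show "f x \<in> gr N (d + e)" if "x \<in> gr M d" using f(4)[rule_format, of d] that by (rule subsetD[OF _ imageI])
qed

lemma ghom_zero: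
  assumes "f \<in> ghom e M N" "fu_module M" "fu_module N"
  shows "f \<zero>\<^bsub>M\<^esub> = \<zero>\<^bsub>N\<^esub>"
proof -
  interpret M: fu_module M by fact
  interpret N: fu_module N by fact
  show ?thesis
    using ghomD(3)[OF assms(1), of "\<zero>\<^bsub>M\<^esub>" 0] ghomD(1)[OF assms(1), of "\<zero>\<^bsub>M\<^esub>"] by simp
qed

lemma ghom_comp:
  assumes "f \<in> ghom e M N" "g \<in> ghom e' N P"
  shows "g \<circ> f \<in> ghom (e + e') M P"
proof -
  have "g (f x) \<in> gr P (d + (e + e'))" if "x \<in> gr M d" for d x
    using ghomD(4)[OF assms(2) ghomD(4)[OF assms(1) that]] by (simp add: add.assoc)
  then show ?thesis
    unfolding ghom_def by (simp add: ghomD[OF assms(1)] ghomD[OF assms(2)] image_subset_iff)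
qed

section \<open>Homogeneous components and the assembly of degreewise maps\<close>

sublocale graded_module \<subseteq> fu_module M
  by unfold_locales

context graded_module
begin

lemma gr_carrier: "x \<in> gr M d \<Longrightarrow> x \<in> carrier M"
  using additive_subgroup.a_subset[OF gr_subgroup[of d]] by auto

lemma gr_zero [simp, intro]: "\<zero> \<in> gr M d"
  using additive_subgroup.zero_closed[OF gr_subgroup[of d]] .

lemma gr_add: "x \<in> gr M d \<Longrightarrow> y \<in> gr M d \<Longrightarrow> x \<oplus> y \<in> gr M d"
  using additive_subgroup.a_closed[OF gr_subgroup[of d]] .

text \<open>The homogeneous component of degree \<open>d\<close>; the description is meaningful by
  \<open>gr_decomp\<close>.\<close>

definition cmp :: "rat \<Rightarrow> 'a \<Rightarrow> 'a" where
  "cmp d x = (THE c. (\<forall>d. c d \<in> gr M d) \<and> finite {d. c d \<noteq> \<zero>} \<and> x = finsum M c {d. c d \<noteq> \<zero>}) d"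

lemma cmp_props:
  assumes "x \<in> carrier M"
  shows cmp_gr: "cmp d x \<in> gr M d"
    and cmp_finite: "finite {d. cmp d x \<noteq> \<zero>}"
    and cmp_sum: "x = finsum M (\<lambda>d. cmp d x) {d. cmp d x \<noteq> \<zero>}"
  using theI'[OF gr_decomp[OF assms]] unfolding cmp_def by blast+

lemma cmp_carrier: "x \<in> carrier M \<Longrightarrow> cmp d x \<in> carrier M"
  using cmp_gr gr_carrier by blast

lemma cmp_sum_superset:
  assumes "x \<in> carrier M" "finite D" "{d. cmp d x \<noteq> \<zero>} \<subseteq> D"
  shows "x = finsum M (\<lambda>d. cmp d x) D"
proof -
  have "finsum M (\<lambda>d. cmp d x) {d. cmp d x \<noteq> \<zero>} = finsum M (\<lambda>d. cmp d x) D"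
    by (rule M.add.finprod_mono_neutral_cong_left) (use assms cmp_carrier in auto)
  then show ?thesis using cmp_sum[OF assms(1)] by simp
qed

lemma cmp_unique:
  assumes c: "\<And>d. c d \<in> gr M d" and D: "finite D" "\<And>d. d \<notin> D \<Longrightarrow> c d = \<zero>"
    and x: "x = finsum M c D"
  shows "cmp d x = c d"
proof -
  have cc: "c d \<in> carrier M" for d using c gr_carrier by blast
  have xc: "x \<in> carrier M" unfolding x by (rule M.finsum_closed) (use cc in auto)
  have sub: "{d. c d \<noteq> \<zero>} \<subseteq> D" using D by auto
  have "finsum M c {d. c d \<noteq> \<zero>} = finsum M c D"
    by (rule M.add.finprod_mono_neutral_cong_left) (use D cc in auto)
  then have *: "(\<forall>d. c d \<in> gr M d) \<and> finite {d. c d \<noteq> \<zero>} \<and> x = finsum M c {d. c d \<noteq> \<zero>}"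
    using c x finite_subset[OF sub D(1)] by simp
  show ?thesis
    unfolding cmp_def by (subst the1_equality[OF gr_decomp[OF xc]], fact *) (rule refl)
qed

lemma cmp_homogeneous:
  assumes "x \<in> gr M e"
  shows "cmp d x = (if d = e then x else \<zero>)"
  by (rule cmp_unique[where D = "{e}"]) (use assms gr_carrier in auto)

lemma cmp_add:
  assumes x: "x \<in> carrier M" and y: "y \<in> carrier M"
  shows "cmp d (x \<oplus> y) = cmp d x \<oplus> cmp d y"
proof -
  let ?D = "{d. cmp d x \<noteq> \<zero>} \<union> {d. cmp d y \<noteq> \<zero>}"
  have fin: "finite ?D" using cmp_finite x y by blast
  have "x \<oplus> y = finsum M (\<lambda>d. cmp d x) ?D \<oplus> finsum M (\<lambda>d. cmp d y) ?D"
    using cmp_sum_superset[OF x fin] cmp_sum_superset[OF y fin] by auto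
  also have "\<dots> = finsum M (\<lambda>d. cmp d x \<oplus> cmp d y) ?D"
    by (rule M.finsum_addf[symmetric]) (use cmp_carrier x y in auto)
  finally show ?thesis
    by (intro cmp_unique[where D = ?D]) (use cmp_gr x y gr_add fin in auto)
qed

text \<open>Adds the finitely many components one by one. The set \<open>S\<close> will be the whole
  carrier or the cycles, both closed under components.\<close>

lemma homogeneous_induct [consumes 2, case_names zero add]:
  assumes x: "x \<in> S" and S: "S \<subseteq> carrier M"
    and cmp_S: "\<And>x d. x \<in> S \<Longrightarrow> cmp d x \<in> S"
    and zero: "P \<zero>"
    and add: "\<And>d y z. y \<in> S \<Longrightarrow> y \<in> gr M d \<Longrightarrow> z \<in> carrier M \<Longrightarrow> P z \<Longrightarrow> P (y \<oplus> z)"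
  shows "P x"
proof -
  have *: "P (finsum M (\<lambda>d. cmp d x) D)" if "finite D" for D
    using that
  proof induction
    case (insert d D)
    have "P (cmp d x \<oplus> finsum M (\<lambda>d. cmp d x) D)"
      by (rule add[of _ d]) (use x S cmp_S cmp_gr insert cmp_carrier in auto)
    then show ?case using insert x S cmp_carrier by (subst M.finsum_insert) auto
  qed (simp add: zero)
  show ?thesis using *[OF cmp_finite[of x]] cmp_sum[of x] x S by auto
qed

lemma carrier_induct [consumes 1, case_names zero add]:
  assumes "x \<in> carrier M" "P \<zero>"
    and "\<And>d y z. y \<in> gr M d \<Longrightarrow> z \<in> carrier M \<Longrightarrow> P z \<Longrightarrow> P (y \<oplus> z)"
  shows "P x"
  by (rule homogeneous_induct[of x "carrier M" P]) (use assms cmp_carrier in auto)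

end

lemma ghom_cmp:
  assumes M: "graded_module M" and N: "graded_module N" and f: "f \<in> ghom e M N"
    and x: "x \<in> carrier M"
  shows "graded_module.cmp N (d + e) (f x) = f (graded_module.cmp M d x)"
proof -
  interpret M: graded_module M by fact
  interpret N: graded_module N by fact
  have f0: "f \<zero>\<^bsub>M\<^esub> = \<zero>\<^bsub>N\<^esub>"
    by (rule ghom_zero[OF f]) unfold_locales
  show ?thesis
    using x
  proof (induction rule: M.carrier_induct)
    case zero
    show ?case using M.cmp_homogeneous[of "\<zero>\<^bsub>M\<^esub>"] N.cmp_homogeneous[of "\<zero>\<^bsub>N\<^esub>"] f0 by simp
  next
    case (add d' y z)
    have y: "y \<in> carrier M" using add M.gr_carrier by blast
    have fy: "f y \<in> gr N (d' + e)" using ghomD(4)[OF f] add by blast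
    show ?case
      using add y M.cmp_homogeneous[OF add(1)] N.cmp_homogeneous[OF fy] f0
      by (simp add: ghomD[OF f] M.cmp_add N.cmp_add M.cmp_carrier)
  qed
qed

text \<open>Applying the maps to the components and summing defines \<open>f\<close>. This turns
  everything that is constructed one degree at a time into an element of
  \<open>ghom\<close>.\<close>

lemma (in graded_module) assemble:
  assumes gr: "\<And>d x. x \<in> gr M d \<Longrightarrow> \<phi> d x \<in> gr M (d + e)"
    and add: "\<And>d x y. x \<in> gr M d \<Longrightarrow> y \<in> gr M d \<Longrightarrow> \<phi> d (x \<oplus> y) = \<phi> d x \<oplus> \<phi> d y"
    and U: "\<And>d x. x \<in> gr M d \<Longrightarrow> \<phi> (d - 2) (Uvar \<odot> x) = Uvar \<odot> \<phi> d x"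
  shows "\<exists>f \<in> ghom e M M. \<forall>d. \<forall>x\<in>gr M d. f x = \<phi> d x"
proof -
  define f where "f x = finsum M (\<lambda>d. \<phi> d (cmp d x)) {d. cmp d x \<noteq> \<zero>}" for x
  have phi0: "\<phi> d \<zero> = \<zero>" for d
    using add[of \<zero> d \<zero>] gr[of \<zero> d] gr_carrier[of "\<phi> d \<zero>" "d + e"] by simp
  have phic: "\<phi> d (cmp d x) \<in> carrier M" if "x \<in> carrier M" for x d
    using that cmp_gr gr gr_carrier by blast
  have f_sup: "f x = finsum M (\<lambda>d. \<phi> d (cmp d x)) D"
    if "finite D" "{d. cmp d x \<noteq> \<zero>} \<subseteq> D" "x \<in> carrier M" for x D
    unfolding f_def
    by (rule M.add.finprod_mono_neutral_cong_left) (use that phic phi0 in auto)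
  have f_closed: "f x \<in> carrier M" if "x \<in> carrier M" for x
    unfolding f_def by (rule M.finsum_closed) (use that phic in auto)
  have f_add: "f (x \<oplus> y) = f x \<oplus> f y" if xy: "x \<in> carrier M" "y \<in> carrier M" for x y
  proof -
    let ?D = "{d. cmp d x \<noteq> \<zero>} \<union> {d. cmp d y \<noteq> \<zero>}"
    have fin: "finite ?D" using cmp_finite xy by blast
    have sub: "{d. cmp d (x \<oplus> y) \<noteq> \<zero>} \<subseteq> ?D" using xy by (auto simp: cmp_add)
    have "f (x \<oplus> y) = finsum M (\<lambda>d. \<phi> d (cmp d (x \<oplus> y))) ?D"
      by (rule f_sup[OF fin sub]) (use xy in auto)
    also have "\<dots> = finsum M (\<lambda>d. \<phi> d (cmp d x) \<oplus> \<phi> d (cmp d y)) ?D"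
      by (rule M.finsum_cong') (use xy phic in \<open>auto simp: cmp_add intro!: add cmp_gr\<close>)
    also have "\<dots> = finsum M (\<lambda>d. \<phi> d (cmp d x)) ?D \<oplus> finsum M (\<lambda>d. \<phi> d (cmp d y)) ?D"
      by (rule M.finsum_addf) (use phic xy in auto)
    finally show ?thesis
      using f_sup[OF fin, of x] f_sup[OF fin, of y] xy by auto
  qed
  have f_hom: "f x = \<phi> d x" if x: "x \<in> gr M d" for d x
  proof -
    have "f x = finsum M (\<lambda>d. \<phi> d (cmp d x)) {d}"
      by (rule f_sup) (use x cmp_homogeneous[OF x] gr_carrier in auto)
    then show ?thesis
      using cmp_homogeneous[OF x] gr[OF x] gr_carrier by simp
  qed
  have f0: "f \<zero> = \<zero>" using f_hom[of \<zero> 0] phi0 by simp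
  have f_U: "f (Uvar \<odot> x) = Uvar \<odot> f x" if "x \<in> carrier M" for x
    using that
  proof (induction rule: carrier_induct)
    case (add d y z)
    have "y \<in> carrier M" using add gr_carrier by blast
    then show ?case
      using add gr_U[OF add(1)] by (simp add: smult_add f_add f_hom U f_closed gr[THEN gr_carrier])
  qed (simp add: f0)
  have "f \<in> ghom e M M"
    by (rule ghomI) (use f_closed f_add f_U f_hom gr in \<open>auto simp: fu_module_axioms\<close>)
  then show ?thesis using f_hom by blast
qed

text \<open>Linear algebra over F_2 in finite size: \<open>R\<close> is an additive relation and
  \<open>f\<close> an additive choice of values on the subspace \<open>S\<close>. Adjoin one element
  at a time with an arbitrary \<open>R\<close>-related value; finiteness of \<open>P\<close> ends
  the process.\<close>

lemma (in fu_module) extend_additive: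
  assumes fin: "finite P" and PM: "P \<subseteq> carrier M"
    and P_add: "\<And>x y. x \<in> P \<Longrightarrow> y \<in> P \<Longrightarrow> x \<oplus> y \<in> P"
    and SP: "S \<subseteq> P" and S0: "\<zero> \<in> S"
    and S_add: "\<And>x y. x \<in> S \<Longrightarrow> y \<in> S \<Longrightarrow> x \<oplus> y \<in> S"
    and f_add: "\<And>x y. x \<in> S \<Longrightarrow> y \<in> S \<Longrightarrow> f (x \<oplus> y) = f x \<oplus> f y"
    and f_R: "\<And>x. x \<in> S \<Longrightarrow> R x (f x)"
    and R_tot: "\<And>x. x \<in> P \<Longrightarrow> \<exists>y. R x y"
    and R_carrier: "\<And>x y. R x y \<Longrightarrow> y \<in> carrier M"
    and R_add: "\<And>x y x' y'. R x y \<Longrightarrow> R x' y' \<Longrightarrow> R (x \<oplus> x') (y \<oplus> y')"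
  shows "\<exists>f'. (\<forall>x\<in>S. f' x = f x) \<and> (\<forall>x\<in>P. R x (f' x)) \<and>
           (\<forall>x\<in>P. \<forall>y\<in>P. f' (x \<oplus> y) = f' x \<oplus> f' y)"
  using SP S0 S_add f_add f_R
proof (induction "card (P - S)" arbitrary: S f rule: less_induct)
  case less
  note S = less.prems
  show ?case
  proof (cases "S = P")
    case True
    then show ?thesis using S by auto
  next
    case False
    then obtain x where x: "x \<in> P" "x \<notin> S" using S(1) by auto
    obtain y where y: "R x y" using R_tot x by blast
    have yc: "y \<in> carrier M" using R_carrier y .
    have xc: "x \<in> carrier M" using x PM by auto
    have Sc: "z \<in> carrier M" if "z \<in> S" for z using that S(1) PM by auto
    have fc: "f z \<in> carrier M" if "z \<in> S" for z using S(5)[OF that] R_carrier by blast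
    \<comment> \<open>Over F_2 the span of \<open>S\<close> and \<open>x\<close> is the union of
      \<open>S\<close> and its translate by \<open>x\<close>.\<close>
    define S' where "S' = S \<union> (\<lambda>s. x \<oplus> s) ` S"
    define f' where "f' z = (if z \<in> S then f z else y \<oplus> f (x \<oplus> z))" for z
    have S'c: "z \<in> carrier M" if "z \<in> S'" for z using that xc Sc unfolding S'_def by auto
    have S'_out: "x \<oplus> z \<in> S" if "z \<in> S'" "z \<notin> S" for z
      using that xc Sc unfolding S'_def by auto
    have sub: "S' \<subseteq> P" unfolding S'_def using S(1) P_add x by auto
    have x_S': "x \<in> S'" unfolding S'_def using S(2) xc by force
    have mix: "z \<oplus> w \<notin> S" if "z \<in> S" "w \<in> S'" "w \<notin> S" for z w
      using S(3)[OF that(1), of "z \<oplus> w"] that Sc S'c by auto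
    have S'_add: "z \<oplus> w \<in> S'" and f'_add: "f' (z \<oplus> w) = f' z \<oplus> f' w"
      if zw: "z \<in> S'" "w \<in> S'" for z w
    proof -
      have c: "z \<in> carrier M" "w \<in> carrier M" using zw S'c by auto
      consider "z \<in> S" "w \<in> S" | "z \<in> S" "w \<notin> S" | "z \<notin> S" "w \<in> S" | "z \<notin> S" "w \<notin> S" by blast
      then have "z \<oplus> w \<in> S' \<and> f' (z \<oplus> w) = f' z \<oplus> f' w"
      proof cases
        case 1
        then show ?thesis using S(3,4) unfolding S'_def f'_def by auto
      next
        case 2
        have xw: "x \<oplus> w \<in> S" using S'_out zw 2 by blast
        have eq: "z \<oplus> (x \<oplus> w) = x \<oplus> (z \<oplus> w)" using c xc by (simp add: M.a_ac)
        have "z \<oplus> w = x \<oplus> (z \<oplus> (x \<oplus> w))" using c xc eq by simp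
        then have "z \<oplus> w \<in> S'" unfolding S'_def using S(3)[OF 2(1) xw] by blast
        then show ?thesis
          using 2 mix[OF 2(1) zw(2) 2(2)] S(4)[OF 2(1) xw] xw fc[OF 2(1)] fc[OF xw] yc
          unfolding f'_def eq by (simp add: M.a_ac)
      next
        case 3
        have xz: "x \<oplus> z \<in> S" using S'_out zw 3 by blast
        have eq: "w \<oplus> (x \<oplus> z) = x \<oplus> (z \<oplus> w)" using c xc by (simp add: M.a_ac)
        have "z \<oplus> w = x \<oplus> (w \<oplus> (x \<oplus> z))" using c xc eq by simp
        then have "z \<oplus> w \<in> S'" unfolding S'_def using S(3)[OF 3(2) xz] by blast
        moreover have "z \<oplus> w \<notin> S" using mix[OF 3(2) zw(1) 3(1)] c by (simp add: M.a_comm)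
        ultimately show ?thesis
          using 3 S(4)[OF 3(2) xz] xz fc[OF 3(2)] fc[OF xz] yc
          unfolding f'_def eq by (simp add: M.a_ac)
      next
        case 4
        have xz: "x \<oplus> z \<in> S" "x \<oplus> w \<in> S" using S'_out zw 4 by blast+
        have eq: "z \<oplus> w = (x \<oplus> z) \<oplus> (x \<oplus> w)" using c xc by (simp add: M.a_ac)
        have inS: "z \<oplus> w \<in> S" unfolding eq using S(3) xz by blast
        have "f (z \<oplus> w) = f (x \<oplus> z) \<oplus> f (x \<oplus> w)" unfolding eq using S(4) xz by blast
        then show ?thesis
          using 4 inS fc[OF xz(1)] fc[OF xz(2)] yc unfolding f'_def S'_def by (simp add: M.a_ac)
      qed
      then show "z \<oplus> w \<in> S'" "f' (z \<oplus> w) = f' z \<oplus> f' w" by auto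
    qed
    have f'_R: "R z (f' z)" if z: "z \<in> S'" for z
    proof (cases "z \<in> S")
      case True
      then show ?thesis unfolding f'_def using S(5) by simp
    next
      case False
      have "R (x \<oplus> (x \<oplus> z)) (y \<oplus> f (x \<oplus> z))"
        by (rule R_add[OF y S(5)[OF S'_out[OF z False]]])
      then show ?thesis unfolding f'_def using False xc S'c[OF z] by simp
    qed
    have "P - S' \<subset> P - S" using x x_S' unfolding S'_def by auto
    then have "card (P - S') < card (P - S)" using fin by (intro psubset_card_mono) auto
    from less.hyps[OF this sub _ S'_add f'_add f'_R]
    obtain f'' where f'': "\<forall>x\<in>S'. f'' x = f' x" "\<forall>x\<in>P. R x (f'' x)"
      "\<forall>x\<in>P. \<forall>y\<in>P. f'' (x \<oplus> y) = f'' x \<oplus> f'' y"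
      using S(2) unfolding S'_def by blast
    then have "\<forall>x\<in>S. f'' x = f x" unfolding S'_def f'_def by auto
    then show ?thesis using f'' by blast
  qed
qed

text \<open>Works from high degrees to low ones. Above \<open>D\<close> everything is zero; in
  degree \<open>d\<close> the values on \<open>U\<close> times \<open>P (d + 2)\<close> are forced,
  consistently because \<open>U\<close> is injective, and \<open>extend_additive\<close> chooses the
  others. In this way no homogeneous basis of \<open>P\<close> has to be found, although
  \<open>P\<close> will consist of cycles or boundaries.\<close>

lemma (in graded_module) graded_lift:
  fixes P :: "rat \<Rightarrow> 'a set" and R :: "rat \<Rightarrow> 'a \<Rightarrow> 'a \<Rightarrow> bool"
  assumes bdd: "\<And>d. d > D \<Longrightarrow> gr M d = {\<zero>}"
    and fin: "\<And>d. finite (gr M d)"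
    and inj: "\<And>x. x \<in> carrier M \<Longrightarrow> Uvar \<odot> x = \<zero> \<Longrightarrow> x = \<zero>"
    and P_gr: "\<And>d. P d \<subseteq> gr M d"
    and P_zero: "\<And>d. \<zero> \<in> P d"
    and P_add: "\<And>d x y. x \<in> P d \<Longrightarrow> y \<in> P d \<Longrightarrow> x \<oplus> y \<in> P d"
    and P_U: "\<And>d x. x \<in> P d \<Longrightarrow> Uvar \<odot> x \<in> P (d - 2)"
    and R_tot: "\<And>d x. x \<in> P d \<Longrightarrow> \<exists>y. R d x y"
    and R_carrier: "\<And>d x y. R d x y \<Longrightarrow> y \<in> carrier M"
    and R_zero: "\<And>d. R d \<zero> \<zero>"
    and R_add: "\<And>d x y x' y'. R d x y \<Longrightarrow> R d x' y' \<Longrightarrow> R d (x \<oplus> x') (y \<oplus> y')"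
    and R_U: "\<And>d x y. R d x y \<Longrightarrow> R (d - 2) (Uvar \<odot> x) (Uvar \<odot> y)"
  shows "\<exists>\<phi>. \<forall>d. (\<forall>x\<in>P d. R d x (\<phi> d x)) \<and>
           (\<forall>x\<in>P d. \<forall>y\<in>P d. \<phi> d (x \<oplus> y) = \<phi> d x \<oplus> \<phi> d y) \<and>
           (\<forall>x\<in>P d. \<phi> (d - 2) (Uvar \<odot> x) = Uvar \<odot> \<phi> d x)"
proof -
  define good where "good \<phi> d \<longleftrightarrow> (\<forall>x\<in>P d. R d x (\<phi> d x)) \<and>
           (\<forall>x\<in>P d. \<forall>y\<in>P d. \<phi> d (x \<oplus> y) = \<phi> d x \<oplus> \<phi> d y)" for \<phi> d
  \<comment> \<open>Degrees are arbitrary rationals, so the induction runs over windows of width 2: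
    stage \<open>n\<close> has settled all degrees above \<open>D - 2 n\<close>, and if
    \<open>d\<close> lies in the next window then \<open>d + 2\<close> is settled.\<close>
  define Inv where "Inv n \<phi> \<longleftrightarrow> (\<forall>d > D - 2 * of_nat n. good \<phi> d) \<and>
     (\<forall>d x. d - 2 > D - 2 * of_nat n \<longrightarrow> x \<in> P d \<longrightarrow> \<phi> (d - 2) (Uvar \<odot> x) = Uvar \<odot> \<phi> d x)"
    for n :: nat and \<phi>
  have Pc: "x \<in> carrier M" if "x \<in> P d" for x d using that P_gr gr_carrier by blast
  have Uinj: "x = y" if "x \<in> carrier M" "y \<in> carrier M" "Uvar \<odot> x = Uvar \<odot> y" for x y
  proof -
    have "Uvar \<odot> (x \<oplus> y) = \<zero>" using that by (simp add: smult_add)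
    then show ?thesis using inj[of "x \<oplus> y"] that by (simp add: add_eq_zero_iff)
  qed
  have base: "Inv 0 (\<lambda>_ _. \<zero>)"
  proof -
    have "P d = {\<zero>}" if "d > D" for d using bdd[OF that] P_gr[of d] P_zero[of d] by auto
    then show ?thesis unfolding Inv_def good_def by (auto simp: R_zero)
  qed
  have step: "\<exists>\<phi>'. Inv (Suc n) \<phi>' \<and> (\<forall>d > D - 2 * of_nat n. \<phi>' d = \<phi> d)" if "Inv n \<phi>" for n \<phi>
  proof -
    have "\<exists>f. d \<le> D - 2 * of_nat n \<longrightarrow> d > D - 2 * of_nat (Suc n) \<longrightarrow>
       (\<forall>x\<in>P (d + 2). f (Uvar \<odot> x) = Uvar \<odot> \<phi> (d + 2) x) \<and> (\<forall>x\<in>P d. R d x (f x)) \<and>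
           (\<forall>x\<in>P d. \<forall>y\<in>P d. f (x \<oplus> y) = f x \<oplus> f y)" for d
    proof (cases "d > D - 2 * of_nat (Suc n)")
      case True
      then have "d + 2 > D - 2 * of_nat n" by simp
      then have gd: "good \<phi> (d + 2)" using that unfolding Inv_def by blast
      define S where "S = (\<lambda>x. Uvar \<odot> x) ` P (d + 2)"
      \<comment> \<open>The chosen preimage is unique, since multiplication by \<open>U\<close> is
        injective.\<close>
      define f where "f z = Uvar \<odot> \<phi> (d + 2) (SOME x. x \<in> P (d + 2) \<and> Uvar \<odot> x = z)" for z
      have f_eq: "f (Uvar \<odot> x) = Uvar \<odot> \<phi> (d + 2) x" if "x \<in> P (d + 2)" for x
      proof -
        have "(SOME x'. x' \<in> P (d + 2) \<and> Uvar \<odot> x' = Uvar \<odot> x) = x"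
          by (rule some_equality) (use that Uinj Pc in blast)+
        then show ?thesis unfolding f_def by simp
      qed
      have R\<phi>: "R (d + 2) x (\<phi> (d + 2) x)" if "x \<in> P (d + 2)" for x
        using gd that unfolding good_def by blast
      have \<phi>add: "\<phi> (d + 2) (x \<oplus> y) = \<phi> (d + 2) x \<oplus> \<phi> (d + 2) y"
        if "x \<in> P (d + 2)" "y \<in> P (d + 2)" for x y
        using gd that unfolding good_def by blast
      have Uadd: "Uvar \<odot> x \<oplus> Uvar \<odot> y = Uvar \<odot> (x \<oplus> y)"
        if "x \<in> P (d + 2)" "y \<in> P (d + 2)" for x y
        using that Pc by (simp add: smult_add)
      have "\<exists>f'. (\<forall>x\<in>S. f' x = f x) \<and> (\<forall>x\<in>P d. R d x (f' x)) \<and>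
           (\<forall>x\<in>P d. \<forall>y\<in>P d. f' (x \<oplus> y) = f' x \<oplus> f' y)"
      proof (rule extend_additive)
        show "finite (P d)" using fin P_gr finite_subset by blast
        show "P d \<subseteq> carrier M" using Pc by blast
        show "S \<subseteq> P d" unfolding S_def using P_U[of _ "d + 2"] by auto
        show "\<zero> \<in> S" unfolding S_def using P_zero[of "d + 2"] by force
        show "x \<oplus> y \<in> S" if "x \<in> S" "y \<in> S" for x y
          using that Uadd P_add unfolding S_def by auto
        show "f (x \<oplus> y) = f x \<oplus> f y" if xy: "x \<in> S" "y \<in> S" for x y
        proof -
          obtain x' y' where x': "x' \<in> P (d + 2)" "x = Uvar \<odot> x'" and y': "y' \<in> P (d + 2)" "y = Uvar \<odot> y'"
            using xy unfolding S_def by auto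
          have "\<phi> (d + 2) x' \<in> carrier M" "\<phi> (d + 2) y' \<in> carrier M"
            using R\<phi> x' y' R_carrier by blast+
          then show ?thesis
            using x' y' by (simp add: Uadd f_eq P_add \<phi>add smult_add)
        qed
        show "R d x (f x)" if "x \<in> S" for x
          using that R_U[OF R\<phi>] f_eq unfolding S_def by auto
      qed (use P_add R_tot R_carrier R_add in blast)+
      then obtain f' where f': "\<forall>x\<in>S. f' x = f x" "\<forall>x\<in>P d. R d x (f' x)"
           "\<forall>x\<in>P d. \<forall>y\<in>P d. f' (x \<oplus> y) = f' x \<oplus> f' y" by blast
      then have "\<forall>x\<in>P (d + 2). f' (Uvar \<odot> x) = Uvar \<odot> \<phi> (d + 2) x" using f_eq unfolding S_def by auto
      then show ?thesis using f' by blast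
    qed auto
    then obtain F where F: "\<And>d. d \<le> D - 2 * of_nat n \<Longrightarrow> d > D - 2 * of_nat (Suc n) \<Longrightarrow>
       (\<forall>x\<in>P (d + 2). F d (Uvar \<odot> x) = Uvar \<odot> \<phi> (d + 2) x) \<and> (\<forall>x\<in>P d. R d x (F d x)) \<and>
           (\<forall>x\<in>P d. \<forall>y\<in>P d. F d (x \<oplus> y) = F d x \<oplus> F d y)" by metis
    define \<phi>' where "\<phi>' d = (if d > D - 2 * of_nat n then \<phi> d else F d)" for d
    have "good \<phi>' d" if "d > D - 2 * of_nat (Suc n)" for d
      using F[of d] \<open>Inv n \<phi>\<close> that unfolding good_def Inv_def \<phi>'_def by (cases "d > D - 2 * of_nat n") auto
    moreover have "\<phi>' (d - 2) (Uvar \<odot> x) = Uvar \<odot> \<phi>' d x"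
      if "d - 2 > D - 2 * of_nat (Suc n)" "x \<in> P d" for d x
    proof -
      have d: "d > D - 2 * of_nat n" using that by simp
      show ?thesis
        using F[of "d - 2"] d \<open>Inv n \<phi>\<close> that unfolding Inv_def \<phi>'_def
        by (cases "d - 2 > D - 2 * of_nat n") auto
    qed
    ultimately have "Inv (Suc n) \<phi>'" unfolding Inv_def by blast
    then show ?thesis by (intro exI[of _ \<phi>']) (simp add: \<phi>'_def)
  qed
  from dependent_nat_choice[of Inv "\<lambda>n \<phi> \<phi>'. \<forall>d > D - 2 * of_nat n. \<phi>' d = \<phi> d"] base step
  obtain F where F: "\<And>n. Inv n (F n)" "\<And>n d. d > D - 2 * of_nat n \<Longrightarrow> F (Suc n) d = F n d"
    by metis
  have F_mono: "F m d = F n d" if "d > D - 2 * of_nat n" "m \<ge> n" for m n d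
    using that(2,1)
  proof (induction m rule: dec_induct)
    case (step m)
    have "(of_nat n :: rat) \<le> of_nat m" using step by simp
    then have "d > D - 2 * of_nat m" using step.prems by linarith
    then show ?case using F(2)[of m d] step by simp
  qed simp
  \<comment> \<open>A stage at which degree \<open>d\<close> is already settled. Later stages leave
    it unchanged, so the limit can be read off there.\<close>
  define nn where "nn d = nat \<lceil>(D - d) / 2\<rceil> + 1" for d
  have nn: "d > D - 2 * of_nat (nn d)" for d
  proof -
    have "(D - d) / 2 \<le> of_int \<lceil>(D - d) / 2\<rceil>" by simp
    also have "\<dots> \<le> of_nat (nat \<lceil>(D - d) / 2\<rceil>)" by simp
    also have "\<dots> < of_nat (nn d)" unfolding nn_def by simp
    finally show ?thesis by (simp add: field_simps)
  qed
  have any: "F (nn d) d = F n d" if "d > D - 2 * of_nat n" for n d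
    using F_mono[OF that, of "max n (nn d)"] F_mono[OF nn, of d "max n (nn d)"] by simp
  define \<phi> where "\<phi> d = F (nn d) d" for d
  have "good \<phi> d" for d using F(1)[of "nn d"] nn[of d] unfolding Inv_def \<phi>_def good_def by blast
  moreover have "\<phi> (d - 2) (Uvar \<odot> x) = Uvar \<odot> \<phi> d x" if "x \<in> P d" for d x
  proof -
    have "d > D - 2 * of_nat (nn (d - 2))" using nn[of "d - 2"] by linarith
    then have "\<phi> d = F (nn (d - 2)) d" unfolding \<phi>_def by (rule any)
    then show ?thesis using F(1)[of "nn (d - 2)"] nn[of "d - 2"] that unfolding Inv_def \<phi>_def by auto
  qed
  ultimately show ?thesis unfolding good_def by blast
qed

section \<open>Submodules and quotient modules\<close>

definition submod :: "('a, 'm) gmod_scheme \<Rightarrow> 'a set \<Rightarrow> bool" where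
  "submod M S \<longleftrightarrow> S \<subseteq> carrier M \<and> \<zero>\<^bsub>M\<^esub> \<in> S \<and> (\<forall>x\<in>S. \<forall>y\<in>S. x \<oplus>\<^bsub>M\<^esub> y \<in> S) \<and>
     (\<forall>p. \<forall>x\<in>S. p \<odot>\<^bsub>M\<^esub> x \<in> S)"

lemma submodD:
  assumes "submod M S"
  shows "x \<in> S \<Longrightarrow> x \<in> carrier M" "\<zero>\<^bsub>M\<^esub> \<in> S"
    "x \<in> S \<Longrightarrow> y \<in> S \<Longrightarrow> x \<oplus>\<^bsub>M\<^esub> y \<in> S" "x \<in> S \<Longrightarrow> p \<odot>\<^bsub>M\<^esub> x \<in> S"
  using assms unfolding submod_def by blast+

lemma gsub_simps [simp]:
  "carrier (gsub M S) = S" "\<zero>\<^bsub>gsub M S\<^esub> = \<zero>\<^bsub>M\<^esub>" "x \<oplus>\<^bsub>gsub M S\<^esub> y = x \<oplus>\<^bsub>M\<^esub> y"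
  "p \<odot>\<^bsub>gsub M S\<^esub> x = p \<odot>\<^bsub>M\<^esub> x" "gr (gsub M S) d = gr M d \<inter> S"
  by (simp_all add: gsub_def)

lemma gsub_bd [simp]: "bd (gsub C S) = bd C"
  by (simp add: gsub_def)

lemma gshift_simps [simp]:
  "carrier (gshift s M) = carrier M" "\<zero>\<^bsub>gshift s M\<^esub> = \<zero>\<^bsub>M\<^esub>"
  "x \<oplus>\<^bsub>gshift s M\<^esub> y = x \<oplus>\<^bsub>M\<^esub> y" "p \<odot>\<^bsub>gshift s M\<^esub> x = p \<odot>\<^bsub>M\<^esub> x" "gr (gshift s M) d = gr M (d - s)"
  by (simp_all add: gshift_def)

lemma ghom_image_submod:
  assumes f: "f \<in> ghom e M N" and M: "fu_module M" and N: "fu_module N"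
  shows "submod N (f ` carrier M)"
proof -
  interpret M: fu_module M by fact
  have "f x \<oplus>\<^bsub>N\<^esub> f y \<in> f ` carrier M" if "x \<in> carrier M" "y \<in> carrier M" for x y
    using that ghomD(2)[OF f, symmetric] by simp
  moreover have "p \<odot>\<^bsub>N\<^esub> f x \<in> f ` carrier M" if "x \<in> carrier M" for x p
    using that ghomD(3)[OF f, symmetric] by simp
  moreover have "\<zero>\<^bsub>N\<^esub> \<in> f ` carrier M"
    using ghom_zero[OF f M N] by (metis M.M.zero_closed image_eqI)
  ultimately show ?thesis unfolding submod_def using ghomD(1)[OF f] by auto
qed

context fu_module
begin

lemma fu_module_gsub:
  assumes "submod M S"
  shows "fu_module (gsub M S)"
proof -
  note S = submodD[OF assms]
  have "abelian_group (gsub M S)"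
    by (rule abelian_group_char2I) (use S in \<open>auto simp: M.a_ac\<close>)
  then show ?thesis
    by (rule fu_moduleI) (use S in \<open>auto simp: smult_poly_add smult_add smult_poly_mult\<close>)
qed

lemma mem_coset: "y \<in> B +> x \<longleftrightarrow> (\<exists>b\<in>B. y = b \<oplus> x)"
  by (auto simp: a_r_coset_def')

lemma coset_eq_iff:
  assumes B: "submod M B" and x: "x \<in> carrier M" and y: "y \<in> carrier M"
  shows "B +> x = B +> y \<longleftrightarrow> x \<oplus> y \<in> B"
proof
  note Bc = submodD(1)[OF B]
  assume "B +> x = B +> y"
  moreover have "x \<in> B +> x" unfolding mem_coset using submodD(2)[OF B] x by force
  ultimately obtain b where "b \<in> B" "x = b \<oplus> y" using mem_coset by auto
  then show "x \<oplus> y \<in> B" using y Bc by (simp add: M.a_assoc)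
next
  note Bc = submodD(1)[OF B]
  assume xy: "x \<oplus> y \<in> B"
  have *: "B +> u \<subseteq> B +> v" if "u \<oplus> v \<in> B" "u \<in> carrier M" "v \<in> carrier M" for u v
  proof
    fix w assume "w \<in> B +> u"
    then obtain b where b: "b \<in> B" "w = b \<oplus> u" using mem_coset by auto
    have "w = (b \<oplus> (u \<oplus> v)) \<oplus> v" using b that Bc by (simp add: M.a_ac)
    then show "w \<in> B +> v" unfolding mem_coset using submodD(3)[OF B b(1) that(1)] by blast
  qed
  show "B +> x = B +> y"
    using *[of x y] *[of y x] xy x y by (auto simp: M.a_comm)
qed

lemma coset_zero: "submod M B \<Longrightarrow> B +> \<zero> = B"
  using submodD(1)[of M B] by (force simp: mem_coset)

lemma gquot_carrier: "carrier (gquot M B) = (\<lambda>x. B +> x) ` carrier M"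
  by (auto simp: gquot_def A_RCOSETS_def')

lemma gquot_zero: "\<zero>\<^bsub>gquot M B\<^esub> = B"
  by (simp add: gquot_def)

lemma gquot_gr: "gr (gquot M B) d = (\<lambda>x. B +> x) ` gr M d"
  by (simp add: gquot_def)

lemma gquot_add:
  assumes B: "submod M B" and x: "x \<in> carrier M" and y: "y \<in> carrier M"
  shows "(B +> x) \<oplus>\<^bsub>gquot M B\<^esub> (B +> y) = B +> (x \<oplus> y)"
proof -
  note Bc = submodD(1)[OF B]
  have "set_add M (B +> x) (B +> y) = B +> (x \<oplus> y)"
  proof (intro equalityI subsetI)
    fix z assume "z \<in> set_add M (B +> x) (B +> y)"
    then obtain b c where bc: "b \<in> B" "c \<in> B" "z = (b \<oplus> x) \<oplus> (c \<oplus> y)"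
      by (auto simp: set_add_def' mem_coset)
    have "z = (b \<oplus> c) \<oplus> (x \<oplus> y)" using bc Bc x y by (simp add: M.a_ac)
    then show "z \<in> B +> (x \<oplus> y)" unfolding mem_coset using submodD(3)[OF B bc(1,2)] by blast
  next
    fix z assume "z \<in> B +> (x \<oplus> y)"
    then obtain b where b: "b \<in> B" "z = b \<oplus> (x \<oplus> y)" by (auto simp: mem_coset)
    have "z = (b \<oplus> x) \<oplus> (\<zero> \<oplus> y)" using b Bc x y by (simp add: M.a_ac)
    moreover have "b \<oplus> x \<in> B +> x" "\<zero> \<oplus> y \<in> B +> y"
      unfolding mem_coset using b submodD(2)[OF B] by blast+
    ultimately show "z \<in> set_add M (B +> x) (B +> y)" unfolding set_add_def' by blast
  qed
  then show ?thesis by (simp add: gquot_def)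
qed

lemma gquot_smult:
  assumes B: "submod M B" and x: "x \<in> carrier M"
  shows "p \<odot>\<^bsub>gquot M B\<^esub> (B +> x) = B +> (p \<odot> x)"
proof -
  note Bc = submodD(1)[OF B]
  have "B +> (p \<odot> u) = B +> (p \<odot> x)" if u: "u \<in> B +> x" for u
  proof -
    obtain b where b: "b \<in> B" "u = b \<oplus> x" using u by (auto simp: mem_coset)
    have "p \<odot> u \<oplus> p \<odot> x = p \<odot> b" using b Bc x by (simp add: smult_add M.a_assoc)
    then show ?thesis
      using coset_eq_iff[OF B, of "p \<odot> u" "p \<odot> x"] b Bc x submodD(4)[OF B b(1)] by simp
  qed
  moreover have "x \<in> B +> x" unfolding mem_coset using submodD(2)[OF B] x by force
  ultimately have "(\<Union>u\<in>B +> x. B +> (p \<odot> u)) = B +> (p \<odot> x)"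
    by (intro SUP_eq_const) blast+
  then show ?thesis by (simp add: gquot_def)
qed

lemma fu_module_gquot:
  assumes B: "submod M B"
  shows "fu_module (gquot M B)"
proof -
  have z: "\<zero>\<^bsub>gquot M B\<^esub> = B +> \<zero>" using coset_zero[OF B] by (simp add: gquot_zero)
  note ops = gquot_add[OF B] gquot_smult[OF B]
  have cases: "\<exists>x\<in>carrier M. X = B +> x" if "X \<in> carrier (gquot M B)" for X
    using that unfolding gquot_carrier by blast
  have closed: "B +> x \<in> carrier (gquot M B)" if "x \<in> carrier M" for x
    using that unfolding gquot_carrier by blast
  have ab: "abelian_group (gquot M B)"
  proof (rule abelian_group_char2I)
    fix X Y W assume "X \<in> carrier (gquot M B)" "Y \<in> carrier (gquot M B)" "W \<in> carrier (gquot M B)"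
    then obtain x y w where x: "x \<in> carrier M" "X = B +> x" and y: "y \<in> carrier M" "Y = B +> y"
      and w: "w \<in> carrier M" "W = B +> w"
      using cases by metis
    show "(X \<oplus>\<^bsub>gquot M B\<^esub> Y) \<oplus>\<^bsub>gquot M B\<^esub> W = X \<oplus>\<^bsub>gquot M B\<^esub> (Y \<oplus>\<^bsub>gquot M B\<^esub> W)"
      using x y w by (simp add: ops M.a_assoc)
  next
    fix X Y assume "X \<in> carrier (gquot M B)" "Y \<in> carrier (gquot M B)"
    then obtain x y where x: "x \<in> carrier M" "X = B +> x" and y: "y \<in> carrier M" "Y = B +> y"
      using cases by metis
    show "X \<oplus>\<^bsub>gquot M B\<^esub> Y \<in> carrier (gquot M B)" using x y by (simp add: ops closed)
    show "X \<oplus>\<^bsub>gquot M B\<^esub> Y = Y \<oplus>\<^bsub>gquot M B\<^esub> X" using x y by (simp add: ops M.a_comm)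
  next
    fix X assume "X \<in> carrier (gquot M B)"
    then obtain x where x: "x \<in> carrier M" "X = B +> x" using cases by metis
    show "\<zero>\<^bsub>gquot M B\<^esub> \<oplus>\<^bsub>gquot M B\<^esub> X = X" using x by (simp add: z ops)
    show "X \<oplus>\<^bsub>gquot M B\<^esub> X = \<zero>\<^bsub>gquot M B\<^esub>" using x by (simp add: z ops)
  qed (simp add: z closed)
  show ?thesis
  proof (rule fu_moduleI[OF ab])
    fix X Y p q assume "X \<in> carrier (gquot M B)" "Y \<in> carrier (gquot M B)"
    then obtain x y where x: "x \<in> carrier M" "X = B +> x" and y: "y \<in> carrier M" "Y = B +> y"
      using cases by metis
    show "p \<odot>\<^bsub>gquot M B\<^esub> (X \<oplus>\<^bsub>gquot M B\<^esub> Y) = p \<odot>\<^bsub>gquot M B\<^esub> X \<oplus>\<^bsub>gquot M B\<^esub> p \<odot>\<^bsub>gquot M B\<^esub> Y"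
      using x y by (simp add: ops smult_add)
  next
    fix X p q assume "X \<in> carrier (gquot M B)"
    then obtain x where x: "x \<in> carrier M" "X = B +> x" using cases by metis
    show "p \<odot>\<^bsub>gquot M B\<^esub> X \<in> carrier (gquot M B)" using x by (simp add: ops closed)
    show "(p + q) \<odot>\<^bsub>gquot M B\<^esub> X = p \<odot>\<^bsub>gquot M B\<^esub> X \<oplus>\<^bsub>gquot M B\<^esub> q \<odot>\<^bsub>gquot M B\<^esub> X"
      using x by (simp add: ops smult_poly_add)
    show "(p * q) \<odot>\<^bsub>gquot M B\<^esub> X = p \<odot>\<^bsub>gquot M B\<^esub> (q \<odot>\<^bsub>gquot M B\<^esub> X)"
      using x by (simp add: ops smult_poly_mult)
    show "1 \<odot>\<^bsub>gquot M B\<^esub> X = X" using x by (simp add: ops)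
  qed
qed

end

section \<open>Chain maps and homotopies from homology\<close>

locale graded_complex = graded_module C for C :: "('a, 'm) cx_scheme" (structure) +
  assumes bd_hom: "bd C \<in> ghom (-1) C C"
    and bd_bd: "x \<in> carrier C \<Longrightarrow> bd C (bd C x) = \<zero>"

sublocale free_complex \<subseteq> graded_complex C
  by unfold_locales (use bd_hom bd_bd in auto)

context graded_complex
begin

lemmas bd_simps [simp] = ghomD(1,3)[OF bd_hom] bd_bd
lemmas bd_add = ghomD(2)[OF bd_hom]
lemma bd_gr: "x \<in> gr C d \<Longrightarrow> bd C x \<in> gr C (d - 1)" using ghomD(4)[OF bd_hom] by simp
lemma bd_zero [simp]: "bd C \<zero> = \<zero>"
  using ghom_zero[OF bd_hom] fu_module_axioms by blast

lemma bd_cmp: "x \<in> carrier C \<Longrightarrow> cmp d (bd C x) = bd C (cmp (d + 1) x)"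
  using ghom_cmp[OF graded_module_axioms graded_module_axioms bd_hom, of x "d + 1"] by simp

section \<open>Cycles and homology classes of subcomplexes\<close>

definition subcx :: "'a set \<Rightarrow> bool" where
  "subcx I \<longleftrightarrow> submod C I \<and> (\<forall>x\<in>I. bd C x \<in> I)"

definition cyc :: "'a set \<Rightarrow> 'a set" where
  "cyc I = {z \<in> I. bd C z = \<zero>}"

text \<open>The homology class of a cycle \<open>z\<close> of the subcomplex \<open>I\<close>. It
  depends on \<open>I\<close>, because a cycle may bound in \<open>C\<close> without bounding in
  \<open>I\<close>.\<close>

definition hcl :: "'a set \<Rightarrow> 'a \<Rightarrow> 'a set" where
  "hcl I z = (bd C ` I) +> z"

lemma subcx_carrier: "subcx (carrier C)"
  unfolding subcx_def submod_def by auto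

lemma gsub_carrier: "gsub C (carrier C) = C"
proof -
  have "(\<lambda>d. gr C d \<inter> carrier C) = gr C" using gr_carrier by blast
  then show ?thesis by (simp add: gsub_def)
qed

context
  fixes I assumes I: "subcx I"
begin

lemma I_sub: "submod C I" and I_bd: "x \<in> I \<Longrightarrow> bd C x \<in> I"
  using I unfolding subcx_def by auto

lemma cyc_sub: "submod C (cyc I)"
  using submodD[OF I_sub] unfolding submod_def cyc_def by (auto simp: bd_add)

lemma bd_sub: "submod (gsub C (cyc I)) (bd C ` I)"
proof -
  note Is = submodD[OF I_sub]
  have "bd C x \<oplus> bd C y \<in> bd C ` I" if "x \<in> I" "y \<in> I" for x y
    using that Is by (simp add: bd_add[symmetric])
  moreover have "p \<odot> bd C x \<in> bd C ` I" if "x \<in> I" for x p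
    using image_eqI[OF _ Is(4)[OF that, of p], of _ "bd C"] Is(1)[OF that] by simp
  moreover have "\<zero> \<in> bd C ` I" using bd_zero Is(2) by (metis image_eqI)
  moreover have "bd C ` I \<subseteq> cyc I" using I_bd Is(1) unfolding cyc_def by auto
  ultimately show ?thesis unfolding submod_def by auto
qed

lemma homology_gsub_eq: "homology (gsub C I) = gquot (gsub C (cyc I)) (bd C ` I)"
proof -
  have "(\<lambda>d. gr C d \<inter> I \<inter> cyc I) = (\<lambda>d. gr C d \<inter> cyc I)" unfolding cyc_def by auto
  then have "gsub (gsub C I) (cyc I) = gsub C (cyc I)" by (simp add: gsub_def)
  then show ?thesis unfolding homology_def by (simp add: cyc_def)
qed

lemma hcl_coset: "(bd C ` I) +>\<^bsub>gsub C (cyc I)\<^esub> z = hcl I z"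
  unfolding hcl_def a_r_coset_def' by simp

lemmas cyc_module = fu_module_gsub[OF cyc_sub]

lemma hom_carrier: "carrier (homology (gsub C I)) = hcl I ` cyc I"
  unfolding homology_gsub_eq fu_module.gquot_carrier[OF cyc_module] hcl_coset by simp

lemma hom_add: "x \<in> cyc I \<Longrightarrow> y \<in> cyc I \<Longrightarrow> hcl I x \<oplus>\<^bsub>homology (gsub C I)\<^esub> hcl I y = hcl I (x \<oplus> y)"
  using fu_module.gquot_add[OF cyc_module bd_sub, of x y]
  unfolding homology_gsub_eq hcl_coset by simp

lemma hom_smult: "x \<in> cyc I \<Longrightarrow> p \<odot>\<^bsub>homology (gsub C I)\<^esub> hcl I x = hcl I (p \<odot> x)"
  using fu_module.gquot_smult[OF cyc_module bd_sub, of x p]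
  unfolding homology_gsub_eq hcl_coset by simp

lemma hom_zero: "\<zero>\<^bsub>homology (gsub C I)\<^esub> = hcl I \<zero>"
  using fu_module.coset_zero[OF cyc_module bd_sub]
  unfolding homology_gsub_eq fu_module.gquot_zero[OF cyc_module] hcl_coset by simp

lemma hom_gr: "gr (homology (gsub C I)) d = hcl I ` (gr C d \<inter> cyc I)"
  unfolding homology_gsub_eq fu_module.gquot_gr[OF cyc_module] hcl_coset by simp

lemma hcl_eq_iff: "x \<in> cyc I \<Longrightarrow> y \<in> cyc I \<Longrightarrow> hcl I x = hcl I y \<longleftrightarrow> x \<oplus> y \<in> bd C ` I"
  using fu_module.coset_eq_iff[OF cyc_module bd_sub, of x y] unfolding hcl_coset by simp

lemma hom_module: "fu_module (homology (gsub C I))"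
  unfolding homology_gsub_eq by (rule fu_module.fu_module_gquot[OF cyc_module bd_sub])

end

abbreviation "Z \<equiv> cyc (carrier C)"
abbreviation "cl \<equiv> hcl (carrier C)"
abbreviation "H \<equiv> homology C"

lemmas H_carrier = hom_carrier[OF subcx_carrier, unfolded gsub_carrier]
  and H_add = hom_add[OF subcx_carrier, unfolded gsub_carrier]
  and H_smult = hom_smult[OF subcx_carrier, unfolded gsub_carrier]
  and H_zero = hom_zero[OF subcx_carrier, unfolded gsub_carrier]
  and H_gr = hom_gr[OF subcx_carrier, unfolded gsub_carrier]
  and H_module = hom_module[OF subcx_carrier, unfolded gsub_carrier]
  and cl_eq_iff = hcl_eq_iff[OF subcx_carrier]
  and Z_sub = cyc_sub[OF subcx_carrier]

lemma Z_carrier: "z \<in> Z \<Longrightarrow> z \<in> carrier C" by (simp add: cyc_def)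
lemma Z_bd: "z \<in> Z \<Longrightarrow> bd C z = \<zero>" by (simp add: cyc_def)
lemma bd_Z: "x \<in> carrier C \<Longrightarrow> bd C x \<in> Z" by (simp add: cyc_def)
lemma zero_Z: "\<zero> \<in> Z" by (simp add: cyc_def)

lemma cl_zero_iff: "z \<in> Z \<Longrightarrow> cl z = cl \<zero> \<longleftrightarrow> z \<in> bd C ` carrier C"
  using cl_eq_iff[OF _ zero_Z] Z_carrier by auto

lemma chain_mapD:
  assumes "chain_map C C f"
  shows "f \<in> ghom 0 C C" "x \<in> carrier C \<Longrightarrow> f (bd C x) = bd C (f x)"
    "z \<in> Z \<Longrightarrow> f z \<in> Z" "f \<zero> = \<zero>" "x \<in> gr C d \<Longrightarrow> f x \<in> gr C d"
proof -
  show f: "f \<in> ghom 0 C C" and fb: "x \<in> carrier C \<Longrightarrow> f (bd C x) = bd C (f x)" for x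
    using assms unfolding chain_map_def by auto
  show f0: "f \<zero> = \<zero>" using ghom_zero[OF f] fu_module_axioms by blast
  show "z \<in> Z \<Longrightarrow> f z \<in> Z" using ghomD(1)[OF f] fb[of z] f0 by (auto simp: cyc_def)
  show "x \<in> gr C d \<Longrightarrow> f x \<in> gr C d" using ghomD(4)[OF f, of x d] by simp
qed

lemma homology_map_cl:
  assumes f: "chain_map C C f" and z: "z \<in> Z"
  shows "homology_map C f (cl z) = cl (f z)"
proof -
  note fD = chain_mapD[OF f] and g = ghomD[OF chain_mapD(1)[OF f]]
  have "cl (f x) = cl (f z)" if x: "x \<in> cl z" for x
  proof -
    obtain u where u: "u \<in> carrier C" "x = bd C u \<oplus> z"
      using x unfolding hcl_def mem_coset by auto
    have zc: "z \<in> carrier C" using z Z_carrier by auto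
    have "f x \<oplus> f z = bd C (f u)"
      using u zc by (simp add: g fD M.a_assoc)
    moreover have "x \<in> Z" using u z zc submodD(3)[OF Z_sub bd_Z] by auto
    ultimately show ?thesis using cl_eq_iff[OF fD(3)[OF \<open>x \<in> Z\<close>] fD(3)[OF z]] g(1) u by auto
  qed
  moreover have "z \<in> cl z"
    unfolding hcl_def mem_coset using z Z_carrier bd_zero by (metis M.l_zero M.zero_closed image_eqI)
  ultimately show ?thesis
    unfolding homology_map_def hcl_def[symmetric] by (intro SUP_eq_const) blast+
qed

lemma Z_cmp: "z \<in> Z \<Longrightarrow> cmp d z \<in> Z"
  using bd_cmp[of z "d - 1"] cmp_homogeneous[of \<zero> 0 "d - 1"] cmp_carrier by (simp add: cyc_def)

lemma Z_induct [consumes 1, case_names zero add]: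
  assumes "z \<in> Z" "P \<zero>"
    and "\<And>d y z. y \<in> Z \<Longrightarrow> y \<in> gr C d \<Longrightarrow> z \<in> carrier C \<Longrightarrow> P z \<Longrightarrow> P (y \<oplus> z)"
  shows "P z"
  by (rule homogeneous_induct[of z Z P]) (use assms Z_cmp Z_carrier in auto)

text \<open>Any primitive of \<open>b\<close> can be replaced by its component in degree
  \<open>d + 1\<close>.\<close>

lemma homogeneous_boundary:
  assumes "b \<in> bd C ` carrier C" "b \<in> gr C d"
  shows "\<exists>c\<in>gr C (d + 1). bd C c = b"
proof -
  obtain c where c: "c \<in> carrier C" "b = bd C c" using assms by auto
  have "bd C (cmp (d + 1) c) = b"
    using bd_cmp[OF c(1), of d] cmp_homogeneous[OF assms(2), of d] c by simp
  then show ?thesis using cmp_gr[OF c(1)] by blast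
qed

lemma additive_ext:
  assumes f: "\<And>x y. x \<in> carrier C \<Longrightarrow> y \<in> carrier C \<Longrightarrow> f (x \<oplus> y) = f x \<oplus> f y"
    and g: "\<And>x y. x \<in> carrier C \<Longrightarrow> y \<in> carrier C \<Longrightarrow> g (x \<oplus> y) = g x \<oplus> g y"
    and eq: "\<And>d x. x \<in> gr C d \<Longrightarrow> f x = g x"
    and x: "x \<in> carrier C"
  shows "f x = g x"
  using x
proof (induction rule: carrier_induct)
  case zero
  then show ?case by (rule eq) simp
next
  case (add d y z)
  then show ?case using f g eq gr_carrier by simp
qed

end

section \<open>Graded pieces of a finitely generated free complex\<close>

lemma Uvar_nonzero: "Uvar \<noteq> 0"
  by (simp add: Uvar_def)

text \<open>The scalars carrying degree \<open>e\<close> to degree \<open>d\<close>: zero and at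
  most one power of \<open>U\<close>.\<close>

definition mono_coeffs :: "rat \<Rightarrow> rat \<Rightarrow> bit poly set" where
  "mono_coeffs d e = {p. p = 0 \<or> (\<exists>i. p = Uvar ^ i \<and> e - 2 * of_nat i = d)}"

lemma finite_mono_coeffs: "finite (mono_coeffs d e)"
proof -
  have "mono_coeffs d e \<subseteq> {0, Uvar ^ nat \<lfloor>(e - d) / 2\<rfloor>}"
  proof
    fix p assume p: "p \<in> mono_coeffs d e"
    show "p \<in> {0, Uvar ^ nat \<lfloor>(e - d) / 2\<rfloor>}"
    proof (cases "p = 0")
      case False
      then obtain i where i: "p = Uvar ^ i" "e - 2 * of_nat i = d"
        using p unfolding mono_coeffs_def by auto
      then have "(e - d) / 2 = of_nat i" by simp
      then show ?thesis using i(1) by (simp only: floor_of_nat nat_int) simp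
    qed simp
  qed
  then show ?thesis using finite_subset by blast
qed

text \<open>Horner induction, moving a factor \<open>U\<close> into \<open>b\<close>, whose degree
  drops to \<open>e - 2\<close>. The constant term contributes only for \<open>d = e\<close> and the
  remainder only for \<open>d < e\<close>, so the two never add up.\<close>

lemma (in graded_module) cmp_smult_homogeneous:
  assumes "b \<in> gr M e"
  shows "\<exists>q\<in>mono_coeffs d e. cmp d (p \<odot> b) = q \<odot> b"
  using assms
proof (induction p arbitrary: b e)
  case 0
  then show ?case
    using gr_carrier cmp_homogeneous[of \<zero> 0 d] by (intro bexI[of _ 0]) (auto simp: mono_coeffs_def)
next
  case (pCons c p)
  note b = gr_carrier[OF pCons.prems]
  obtain q where q: "q \<in> mono_coeffs d (e - 2)" "cmp d (p \<odot> (Uvar \<odot> b)) = q \<odot> (Uvar \<odot> b)"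
    using pCons.IH[OF gr_U[OF pCons.prems]] by blast
  have "pCons c p \<odot> b = [:c:] \<odot> b \<oplus> p \<odot> (Uvar \<odot> b)"
    unfolding pCons_Uvar[of c p] using b
    by (simp add: smult_poly_add smult_poly_mult[symmetric] mult.commute)
  then have eq: "cmp d (pCons c p \<odot> b) = cmp d ([:c:] \<odot> b) \<oplus> (q * Uvar) \<odot> b"
    using b q(2) by (simp add: cmp_add smult_poly_mult)
  have c: "[:c:] \<odot> b = (if c = 0 then \<zero> else b)"
    using b by (cases c) (simp_all add: one_pCons[symmetric])
  show ?case
  proof (cases "q = 0")
    case True
    then have "cmp d (pCons c p \<odot> b) = (if c \<noteq> 0 \<and> d = e then 1 else 0) \<odot> b"
      using eq c b cmp_homogeneous[OF pCons.prems] cmp_homogeneous[of \<zero> 0 d] by simp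
    moreover have "(if c \<noteq> 0 \<and> d = e then 1 else 0) \<in> mono_coeffs d e"
      by (auto simp: mono_coeffs_def intro!: exI[of _ 0])
    ultimately show ?thesis by blast
  next
    case False
    then obtain i where i: "q = Uvar ^ i" "e - 2 - 2 * of_nat i = d"
      using q(1) unfolding mono_coeffs_def by auto
    have "d \<noteq> e"
    proof
      assume "d = e"
      then have "(of_nat i :: rat) = -1" using i(2) by linarith
      moreover have "(of_nat i :: rat) \<ge> 0" by simp
      ultimately show False by linarith
    qed
    then have "cmp d (pCons c p \<odot> b) = (Uvar ^ Suc i) \<odot> b"
      using eq c b i cmp_homogeneous[OF pCons.prems] cmp_homogeneous[of \<zero> 0 d] by (simp add: mult.commute)
    moreover have "Uvar ^ Suc i \<in> mono_coeffs d e"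
      unfolding mono_coeffs_def using i by (auto intro!: exI[of _ "Suc i"])
    ultimately show ?thesis by blast
  qed
qed

lemma (in graded_module) cmp_finsum:
  assumes "finite A" "\<And>a. a \<in> A \<Longrightarrow> f a \<in> carrier M"
  shows "cmp d (finsum M f A) = finsum M (\<lambda>a. cmp d (f a)) A"
  using assms
proof (induction A)
  case empty
  then show ?case using cmp_homogeneous[of \<zero> 0 d] by simp
next
  case (insert a A)
  have "f \<in> A \<rightarrow> carrier M" "(\<lambda>a. cmp d (f a)) \<in> A \<rightarrow> carrier M" using insert cmp_carrier by auto
  then show ?case using insert by (simp add: cmp_add cmp_carrier)
qed

lemma ex1_unique: "\<exists>!x. P x \<Longrightarrow> P a \<Longrightarrow> P b \<Longrightarrow> a = b"
  by blast

context free_complex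
begin

lemma fg_free_basis:
  obtains B where "finite B" "B \<subseteq> carrier C" "\<And>b. b \<in> B \<Longrightarrow> \<exists>d. b \<in> gr C d"
    "\<And>x. x \<in> carrier C \<Longrightarrow> \<exists>!c. c \<in> B \<rightarrow>\<^sub>E (UNIV :: bit poly set) \<and> x = finsum C (\<lambda>b. c b \<odot> b) B"
proof -
  from fg_free obtain B where B: "finite B \<and> B \<subseteq> carrier C \<and> (\<forall>b\<in>B. \<exists>d. b \<in> gr C d) \<and>
      (\<forall>x\<in>carrier C. \<exists>!c. c \<in> B \<rightarrow>\<^sub>E (UNIV :: bit poly set) \<and> x = finsum C (\<lambda>b. c b \<odot> b) B)" ..
  show thesis
    by (rule that[OF B[THEN conjunct1] B[THEN conjunct2, THEN conjunct1]
          bspec[OF B[THEN conjunct2, THEN conjunct2, THEN conjunct1]]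
          bspec[OF B[THEN conjunct2, THEN conjunct2, THEN conjunct2]]])
qed

text \<open>If \<open>c\<close> are the coordinates of \<open>x\<close>, then both \<open>U\<close>
  times \<open>c\<close> and the zero coordinates represent zero; F[U] is a domain.\<close>

lemma U_inj:
  assumes x: "x \<in> carrier C" "Uvar \<odot> x = \<zero>"
  shows "x = \<zero>"
proof -
  obtain B where B: "finite B" "B \<subseteq> carrier C" and "\<And>b. b \<in> B \<Longrightarrow> \<exists>d. b \<in> gr C d"
    and ex1: "\<And>x. x \<in> carrier C \<Longrightarrow> \<exists>!c. c \<in> B \<rightarrow>\<^sub>E (UNIV :: bit poly set) \<and> x = finsum C (\<lambda>b. c b \<odot> b) B"
    by (rule fg_free_basis) (rule that)
  obtain c where c: "c \<in> B \<rightarrow>\<^sub>E UNIV" "x = finsum C (\<lambda>b. c b \<odot> b) B"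
    using ex1_implies_ex[OF ex1[OF x(1)]] by (elim exE conjE)
  have fin: "Uvar \<odot> finsum C f A = finsum C (\<lambda>b. Uvar \<odot> f b) A"
    if "finite A" "f \<in> A \<rightarrow> carrier C" for f A
    using that by induction (auto simp: smult_add Pi_iff)
  have sum: "finsum C (\<lambda>b. (\<lambda>b\<in>B. Uvar * c b) b \<odot> b) B = Uvar \<odot> x"
  proof -
    have "finsum C (\<lambda>b. (\<lambda>b\<in>B. Uvar * c b) b \<odot> b) B = finsum C (\<lambda>b. Uvar \<odot> (c b \<odot> b)) B"
      by (rule M.finsum_cong') (use B in \<open>auto simp: smult_poly_mult\<close>)
    also have "\<dots> = Uvar \<odot> x"
      unfolding c(2) by (rule fin[symmetric]) (use B in auto)
    finally show ?thesis .
  qed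
  have sum0: "finsum C (\<lambda>b. (\<lambda>b\<in>B. 0) b \<odot> b) B = \<zero>"
  proof -
    have "finsum C (\<lambda>b. (\<lambda>b\<in>B. 0) b \<odot> b) B = finsum C (\<lambda>b. \<zero>) B"
      by (rule M.finsum_cong') (use B in auto)
    then show ?thesis by simp
  qed
  have "(\<lambda>b\<in>B. Uvar * c b) \<in> B \<rightarrow>\<^sub>E UNIV \<and> \<zero> = finsum C (\<lambda>b. (\<lambda>b\<in>B. Uvar * c b) b \<odot> b) B"
    "(\<lambda>b\<in>B. 0) \<in> B \<rightarrow>\<^sub>E UNIV \<and> \<zero> = finsum C (\<lambda>b. (\<lambda>b\<in>B. 0) b \<odot> b) B"
    unfolding sum sum0 using x(2) by (simp_all add: restrict_PiE_iff)
  then have "(\<lambda>b\<in>B. Uvar * c b) = (\<lambda>b\<in>B. 0)"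
    by (rule ex1_unique[OF ex1[OF M.zero_closed]])
  then have "c b = 0" if "b \<in> B" for b
    using that Uvar_nonzero by (metis mult_eq_0_iff restrict_apply')
  then have "x = finsum C (\<lambda>b. \<zero>) B"
    unfolding c(2) by (intro M.finsum_cong') (use B in auto)
  then show ?thesis by simp
qed

text \<open>Taking components of a basis expansion leaves coefficients in
  \<open>mono_coeffs\<close>, hence finitely many expansions in each degree, and only the zero one
  above the highest degree of a generator. With \<open>U_inj\<close> this provides what
  \<open>graded_lift\<close> asks of \<open>C\<close>.\<close>

lemma gr_finite_bounded:
  shows gr_finite: "finite (gr C d)" and gr_bounded: "\<exists>D. \<forall>d>D. gr C d = {\<zero>}"
proof -
  obtain B where B: "finite B" "B \<subseteq> carrier C" and hom: "\<And>b. b \<in> B \<Longrightarrow> \<exists>d. b \<in> gr C d"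
    and ex1: "\<And>x. x \<in> carrier C \<Longrightarrow> \<exists>!c. c \<in> B \<rightarrow>\<^sub>E (UNIV :: bit poly set) \<and> x = finsum C (\<lambda>b. c b \<odot> b) B"
    by (rule fg_free_basis) (rule that)
  obtain db where db: "\<And>b. b \<in> B \<Longrightarrow> b \<in> gr C (db b)" using hom by metis
  have rep: "\<exists>q \<in> (\<Pi>\<^sub>E b\<in>B. mono_coeffs d (db b)). x = finsum C (\<lambda>b. q b \<odot> b) B" if x: "x \<in> gr C d" for x d
  proof -
    obtain c where c: "x = finsum C (\<lambda>b. c b \<odot> b) B"
      using ex1_implies_ex[OF ex1[OF gr_carrier[OF x]]] by (elim exE conjE)
    have "\<forall>b\<in>B. \<exists>q. q \<in> mono_coeffs d (db b) \<and> cmp d (c b \<odot> b) = q \<odot> b"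
      using cmp_smult_homogeneous[OF db] by (simp add: Bex_def)
    then obtain q where q: "\<And>b. b \<in> B \<Longrightarrow> q b \<in> mono_coeffs d (db b) \<and> cmp d (c b \<odot> b) = q b \<odot> b"
      unfolding bchoice_iff by blast
    have "x = cmp d x" using cmp_homogeneous[OF x] by simp
    also have "\<dots> = finsum C (\<lambda>b. cmp d (c b \<odot> b)) B"
      unfolding c by (rule cmp_finsum) (use B in auto)
    also have "\<dots> = finsum C (\<lambda>b. (\<lambda>b\<in>B. q b) b \<odot> b) B"
      by (rule M.finsum_cong') (use B q in auto)
    finally show ?thesis using q by (intro bexI[of _ "\<lambda>b\<in>B. q b"]) auto
  qed
  have "gr C d \<subseteq> (\<lambda>q. finsum C (\<lambda>b. q b \<odot> b) B) ` (\<Pi>\<^sub>E b\<in>B. mono_coeffs d (db b))"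
    using rep by blast
  moreover have "finite (\<Pi>\<^sub>E b\<in>B. mono_coeffs d (db b))"
    by (rule finite_PiE) (use B finite_mono_coeffs in auto)
  ultimately show "finite (gr C d)" by (meson finite_imageI finite_subset)
  obtain D where D: "\<And>b. b \<in> B \<Longrightarrow> db b \<le> D"
    using bdd_above_finite[of "db ` B"] B unfolding bdd_above_def by auto
  have "gr C d = {\<zero>}" if d: "d > D" for d
  proof -
    have "x = \<zero>" if x: "x \<in> gr C d" for x
    proof -
      obtain q where q: "q \<in> (\<Pi>\<^sub>E b\<in>B. mono_coeffs d (db b))" "x = finsum C (\<lambda>b. q b \<odot> b) B"
        using rep[OF x] by blast
      have "q b = 0" if b: "b \<in> B" for b
      proof -
        have "db b - 2 * of_nat i \<noteq> d" for i
        proof -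
          have "(of_nat i :: rat) \<ge> 0" by simp
          then show ?thesis using D[OF b] d by linarith
        qed
        then show ?thesis using q(1) b unfolding mono_coeffs_def PiE_iff by auto
      qed
      then have "x = finsum C (\<lambda>b. \<zero>) B"
        unfolding q(2) by (intro M.finsum_cong') (use B in auto)
      then show ?thesis by simp
    qed
    then show ?thesis by auto
  qed
  then show "\<exists>D. \<forall>d>D. gr C d = {\<zero>}" by blast
qed

section \<open>Chain maps and homotopies built degree by degree\<close>

definition additive_lift :: "(rat \<Rightarrow> 'a set) \<Rightarrow> (rat \<Rightarrow> 'a \<Rightarrow> 'a \<Rightarrow> bool) \<Rightarrow> (rat \<Rightarrow> 'a \<Rightarrow> 'a) \<Rightarrow> bool" where
  "additive_lift P R \<phi> \<longleftrightarrow> (\<forall>d. (\<forall>x\<in>P d. R d x (\<phi> d x)) \<and>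
     (\<forall>x\<in>P d. \<forall>y\<in>P d. \<phi> d (x \<oplus> y) = \<phi> d x \<oplus> \<phi> d y) \<and>
     (\<forall>x\<in>P d. \<phi> (d - 2) (Uvar \<odot> x) = Uvar \<odot> \<phi> d x))"

lemma additive_liftD:
  assumes "additive_lift P R \<phi>"
  shows "x \<in> P d \<Longrightarrow> R d x (\<phi> d x)"
    and "x \<in> P d \<Longrightarrow> y \<in> P d \<Longrightarrow> \<phi> d (x \<oplus> y) = \<phi> d x \<oplus> \<phi> d y"
    and "x \<in> P d \<Longrightarrow> \<phi> (d - 2) (Uvar \<odot> x) = Uvar \<odot> \<phi> d x"
  using assms unfolding additive_lift_def by simp_all

lemma lift:
  assumes "\<And>d. P d \<subseteq> gr C d" "\<And>d. \<zero> \<in> P d"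
    and "\<And>d x y. x \<in> P d \<Longrightarrow> y \<in> P d \<Longrightarrow> x \<oplus> y \<in> P d"
    and "\<And>d x. x \<in> P d \<Longrightarrow> Uvar \<odot> x \<in> P (d - 2)"
    and "\<And>d x. x \<in> P d \<Longrightarrow> \<exists>y. R d x y"
    and "\<And>d x y. R d x y \<Longrightarrow> y \<in> carrier C"
    and "\<And>d. R d \<zero> \<zero>"
    and "\<And>d x y x' y'. R d x y \<Longrightarrow> R d x' y' \<Longrightarrow> R d (x \<oplus> x') (y \<oplus> y')"
    and "\<And>d x y. R d x y \<Longrightarrow> R (d - 2) (Uvar \<odot> x) (Uvar \<odot> y)"
  shows "\<exists>\<phi>. additive_lift P R \<phi>"
proof -
  obtain D where D: "\<And>d. d > D \<Longrightarrow> gr C d = {\<zero>}" using gr_bounded by blast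
  show ?thesis
    unfolding additive_lift_def by (rule graded_lift[of D P R, OF D gr_finite U_inj assms])
qed

definition Zd :: "rat \<Rightarrow> 'a set" where "Zd d = gr C d \<inter> Z"
definition Bd :: "rat \<Rightarrow> 'a set" where "Bd d = gr C d \<inter> bd C ` carrier C"

lemma Zd_closed:
  "Zd d \<subseteq> gr C d" "\<zero> \<in> Zd d" "x \<in> Zd d \<Longrightarrow> y \<in> Zd d \<Longrightarrow> x \<oplus> y \<in> Zd d" "x \<in> Zd d \<Longrightarrow> Uvar \<odot> x \<in> Zd (d - 2)"
  unfolding Zd_def using submodD[OF Z_sub] gr_add gr_U by auto

lemma Bd_closed:
  "Bd d \<subseteq> gr C d" "\<zero> \<in> Bd d" "x \<in> Bd d \<Longrightarrow> y \<in> Bd d \<Longrightarrow> x \<oplus> y \<in> Bd d" "x \<in> Bd d \<Longrightarrow> Uvar \<odot> x \<in> Bd (d - 2)"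
  unfolding Bd_def using submodD[OF bd_sub[OF subcx_carrier]] gr_add gr_U by auto

lemma Bd_Zd: "x \<in> Bd d \<Longrightarrow> x \<in> Zd d"
  unfolding Bd_def Zd_def using bd_Z by auto

lemma bd_Bd: "x \<in> gr C d \<Longrightarrow> bd C x \<in> Bd (d - 1)"
  unfolding Bd_def using bd_gr gr_carrier by auto

lemma Bd_bd: "b \<in> Bd d \<Longrightarrow> \<exists>c\<in>gr C (d + 1). bd C c = b"
  unfolding Bd_def using homogeneous_boundary by auto

lemma ZdD: "x \<in> Zd d \<Longrightarrow> x \<in> carrier C" "x \<in> Zd d \<Longrightarrow> bd C x = \<zero>" "x \<in> Zd d \<Longrightarrow> x \<in> gr C d" "x \<in> Zd d \<Longrightarrow> x \<in> Z"
  unfolding Zd_def cyc_def by auto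

text \<open>A section \<open>s\<close> of the boundary map splits every \<open>C_d\<close> as \<open>Z_d\<close> plus the image of \<open>s\<close>.\<close>

lemma section_ex:
  "\<exists>s. additive_lift Bd (\<lambda>d b c. b \<in> carrier C \<and> c \<in> gr C (d + 1) \<and> bd C c = b) s"
proof -
  define R where "R d b c \<longleftrightarrow> b \<in> carrier C \<and> c \<in> gr C (d + 1) \<and> bd C c = b" for d b c
  have "(d::rat) - 2 + 1 = d + 1 - 2" for d by simp
  then have RU: "R (d - 2) (Uvar \<odot> b) (Uvar \<odot> c)" if "R d b c" for d b c
    using that gr_U[of c "d + 1"] gr_carrier[of c "d + 1"] unfolding R_def by simp
  have Radd: "R d (x \<oplus> x') (y \<oplus> y')" if "R d x y" "R d x' y'" for d x y x' y'
    using that gr_add gr_carrier unfolding R_def by (auto simp: bd_add)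
  have Rtot: "\<exists>y. R d x y" if "x \<in> Bd d" for d x
    using Bd_bd[OF that] Bd_Zd[OF that, THEN ZdD(1)] unfolding R_def by auto
  have Rz: "R d \<zero> \<zero>" for d unfolding R_def by simp
  have Rc: "y \<in> carrier C" if "R d x y" for d x y using that gr_carrier unfolding R_def by blast
  show ?thesis
    by (rule lift[of Bd R, unfolded R_def, OF Bd_closed Rtot[unfolded R_def] Rc[unfolded R_def]
          Rz[unfolded R_def] Radd[unfolded R_def] RU[unfolded R_def]])
qed

text \<open>The projection onto the cycles along the image of the section.\<close>

lemma split_Zd:
  assumes sL: "additive_lift Bd (\<lambda>d b c. b \<in> carrier C \<and> c \<in> gr C (d + 1) \<and> bd C c = b) s"
    and c: "c \<in> gr C d"
  shows "c \<oplus> s (d - 1) (bd C c) \<in> Zd d"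
proof -
  have s: "\<And>d b. b \<in> Bd d \<Longrightarrow> s d b \<in> gr C (d + 1)" "\<And>d b. b \<in> Bd d \<Longrightarrow> bd C (s d b) = b"
    using additive_liftD(1)[OF sL] by simp_all
  have "s (d - 1) (bd C c) \<in> gr C d" using s(1)[OF bd_Bd[OF c]] by simp
  moreover have "bd C (c \<oplus> s (d - 1) (bd C c)) = \<zero>"
    using s(2)[OF bd_Bd[OF c]] c calculation gr_carrier by (simp add: bd_add)
  ultimately show ?thesis unfolding Zd_def cyc_def using c gr_add gr_carrier by auto
qed

text \<open>Lift \<Gamma> to a map \<open>\<phi>\<close> of cycles. It preserves boundaries because
  \<Gamma> preserves the zero class, so a second lift \<open>k\<close> can pick primitives of its
  values on boundaries. The splitting of chains into cycles and the image of \<open>s\<close> glues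
  the two.\<close>

lemma realize:
  assumes \<Gamma>: "\<Gamma> \<in> ghom 0 H H"
  shows "\<exists>g. chain_map C C g \<and> (\<forall>x\<in>carrier H. homology_map C g x = \<Gamma> x)"
proof -
  note G = ghomD[OF \<Gamma>]
  obtain s where sL: "additive_lift Bd (\<lambda>d b c. b \<in> carrier C \<and> c \<in> gr C (d + 1) \<and> bd C c = b) s"
    using section_ex ..
  note sD = additive_liftD[OF sL]
  have s: "\<And>d b. b \<in> Bd d \<Longrightarrow> s d b \<in> gr C (d + 1)" "\<And>d b. b \<in> Bd d \<Longrightarrow> bd C (s d b) = b"
    using sD(1) by simp_all
  note s_add = sD(2) and s_U = sD(3)
  have G0: "\<Gamma> (cl \<zero>) = cl \<zero>"
    using ghom_zero[OF \<Gamma> H_module H_module] unfolding H_zero .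
  define R where "R d z w \<longleftrightarrow> z \<in> Zd d \<and> w \<in> Zd d \<and> cl w = \<Gamma> (cl z)" for d z w
  have cl_H: "cl z \<in> carrier H" if "z \<in> Zd d" for z d using that ZdD(4) H_carrier by blast
  have "\<exists>\<phi>. additive_lift Zd R \<phi>"
  proof (rule lift[of Zd R, OF Zd_closed])
    show "\<exists>y. R d x y" if x: "x \<in> Zd d" for d x
    proof -
      have "cl x \<in> gr H d" using x unfolding H_gr Zd_def by blast
      then have "\<Gamma> (cl x) \<in> gr H d" using G(4)[of "cl x" d] by simp
      then show ?thesis unfolding R_def using x unfolding H_gr Zd_def by force
    qed
    show "y \<in> carrier C" if "R d x y" for d x y using that ZdD(1) unfolding R_def by blast
    show "R d \<zero> \<zero>" for d unfolding R_def using G0 Zd_closed(2) by simp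
    show "R d (x \<oplus> x') (y \<oplus> y')" if "R d x y" "R d x' y'" for d x y x' y'
    proof -
      have z: "x \<in> Z" "x' \<in> Z" "y \<in> Z" "y' \<in> Z" using that ZdD(4) unfolding R_def by blast+
      have "cl (y \<oplus> y') = \<Gamma> (cl (x \<oplus> x'))"
        using that G(2)[OF cl_H cl_H, of x d x' d] H_add z unfolding R_def by metis
      then show ?thesis using that Zd_closed(3) unfolding R_def by blast
    qed
    show "R (d - 2) (Uvar \<odot> x) (Uvar \<odot> y)" if "R d x y" for d x y
    proof -
      have z: "x \<in> Z" "y \<in> Z" using that ZdD(4) unfolding R_def by blast+
      have "cl (Uvar \<odot> y) = \<Gamma> (cl (Uvar \<odot> x))"
        using that G(3)[OF cl_H, of x d Uvar] H_smult z unfolding R_def by metis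
      then show ?thesis using that Zd_closed(4) unfolding R_def by blast
    qed
  qed
  then obtain \<phi> where "additive_lift Zd R \<phi>" ..
  note \<phi> = additive_liftD(1)[OF this] and \<phi>_add = additive_liftD(2)[OF this] and \<phi>_U = additive_liftD(3)[OF this]
  have \<phi>Z: "\<phi> d x \<in> Zd d" and \<phi>cl: "cl (\<phi> d x) = \<Gamma> (cl x)" if "x \<in> Zd d" for d x
    using \<phi>[OF that] unfolding R_def by auto
  have \<phi>B: "\<phi> d x \<in> Bd d" if x: "x \<in> Bd d" for d x
  proof -
    have "cl x = cl \<zero>" using cl_zero_iff[of x] Bd_Zd[OF x, THEN ZdD(4)] x unfolding Bd_def by auto
    then have "cl (\<phi> d x) = cl \<zero>" using \<phi>cl[OF Bd_Zd[OF x]] G0 by simp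
    then show ?thesis
      using cl_zero_iff[OF ZdD(4)[OF \<phi>Z[OF Bd_Zd[OF x]]]] \<phi>Z[OF Bd_Zd[OF x]] unfolding Bd_def Zd_def by auto
  qed
  define R' where "R' d b c \<longleftrightarrow> b \<in> Bd d \<and> c \<in> gr C (d + 1) \<and> bd C c = \<phi> d b" for d b c
  have \<phi>zero: "\<phi> d \<zero> = \<zero>" for d
    using \<phi>_add[OF Zd_closed(2) Zd_closed(2), of d] ZdD(1)[OF \<phi>Z[OF Zd_closed(2)], of d] by simp
  have "\<exists>k. additive_lift Bd R' k"
  proof (rule lift[of Bd R', OF Bd_closed])
    show "\<exists>y. R' d x y" if x: "x \<in> Bd d" for d x
      using Bd_bd[OF \<phi>B[OF x]] x unfolding R'_def by auto
    show "y \<in> carrier C" if "R' d x y" for d x y using that gr_carrier unfolding R'_def by blast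
    show "R' d \<zero> \<zero>" for d unfolding R'_def using \<phi>zero Bd_closed(2) by simp
    show "R' d (x \<oplus> x') (y \<oplus> y')" if "R' d x y" "R' d x' y'" for d x y x' y'
      using that \<phi>_add[OF Bd_Zd Bd_Zd] Bd_closed(3) gr_add gr_carrier unfolding R'_def
      by (auto simp: bd_add)
    have "(d::rat) - 2 + 1 = d + 1 - 2" for d by simp
    then show "R' (d - 2) (Uvar \<odot> x) (Uvar \<odot> y)" if "R' d x y" for d x y
      using that \<phi>_U[OF Bd_Zd] Bd_closed(4) gr_U[of y "d + 1"] gr_carrier[of y "d + 1"] unfolding R'_def by simp
  qed
  then obtain k where "additive_lift Bd R' k" ..
  note k = additive_liftD(1)[OF this] and k_add = additive_liftD(2)[OF this] and k_U = additive_liftD(3)[OF this]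
  have kD: "k d x \<in> gr C (d + 1)" "bd C (k d x) = \<phi> d x" if "x \<in> Bd d" for d x
    using k[OF that] unfolding R'_def by auto
  \<comment> \<open>The cycle part goes through \<open>\<phi>\<close>, while \<open>s (bd c)\<close>
    is sent to \<open>k (bd c)\<close>. As \<open>k (bd c)\<close> has boundary
    \<open>\<phi> (bd c)\<close>, the result is a chain map.\<close>
  define \<psi> where "\<psi> d c = \<phi> d (c \<oplus> s (d - 1) (bd C c)) \<oplus> k (d - 1) (bd C c)" for d c
  note sp = split_Zd[OF sL]
  have \<psi>gr: "\<psi> d c \<in> gr C (d + 0)" if c: "c \<in> gr C d" for d c
    unfolding \<psi>_def using kD(1)[OF bd_Bd[OF c]] ZdD(3)[OF \<phi>Z[OF sp[OF c]]] gr_add by simp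
  have sc: "s (d - 1) (bd C c) \<in> carrier C" if c: "c \<in> gr C d" for d c
    using s(1)[OF bd_Bd[OF c]] gr_carrier by blast
  have kc: "k (d - 1) (bd C c) \<in> carrier C" if c: "c \<in> gr C d" for d c
    using kD(1)[OF bd_Bd[OF c]] gr_carrier by blast
  have \<phi>c: "\<phi> d (c \<oplus> s (d - 1) (bd C c)) \<in> carrier C" if c: "c \<in> gr C d" for d c
    using ZdD(1)[OF \<phi>Z[OF sp[OF c]]] .
  have \<psi>add: "\<psi> d (x \<oplus> y) = \<psi> d x \<oplus> \<psi> d y" if xy: "x \<in> gr C d" "y \<in> gr C d" for d x y
  proof -
    note xyc = xy[THEN gr_carrier]
    have b: "bd C (x \<oplus> y) = bd C x \<oplus> bd C y" using xyc by (rule bd_add)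
    have 1: "x \<oplus> y \<oplus> s (d - 1) (bd C (x \<oplus> y)) = (x \<oplus> s (d - 1) (bd C x)) \<oplus> (y \<oplus> s (d - 1) (bd C y))"
      unfolding b s_add[OF xy[THEN bd_Bd]] using xyc sc[OF xy(1)] sc[OF xy(2)] by (simp add: M.a_ac)
    show ?thesis
      unfolding \<psi>_def 1 unfolding b \<phi>_add[OF sp[OF xy(1)] sp[OF xy(2)]] k_add[OF xy[THEN bd_Bd]]
      using kc[OF xy(1)] kc[OF xy(2)] \<phi>c[OF xy(1)] \<phi>c[OF xy(2)] by (simp add: M.a_ac)
  qed
  have \<psi>U: "\<psi> (d - 2) (Uvar \<odot> x) = Uvar \<odot> \<psi> d x" if x: "x \<in> gr C d" for d x
  proof -
    note xc = gr_carrier[OF x]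
    have d: "d - 2 - 1 = d - 1 - 2" by simp
    have b: "bd C (Uvar \<odot> x) = Uvar \<odot> bd C x" using xc by simp
    have 1: "Uvar \<odot> x \<oplus> s (d - 2 - 1) (bd C (Uvar \<odot> x)) = Uvar \<odot> (x \<oplus> s (d - 1) (bd C x))"
      unfolding b d s_U[OF bd_Bd[OF x]] using xc sc[OF x] by (simp add: smult_add)
    show ?thesis
      unfolding \<psi>_def 1 unfolding b d \<phi>_U[OF sp[OF x]] k_U[OF bd_Bd[OF x]]
      using kc[OF x] \<phi>c[OF x] by (simp add: smult_add)
  qed
  have assemble_\<psi>: "\<exists>f\<in>ghom 0 C C. \<forall>d. \<forall>x\<in>gr C d. f x = \<psi> d x"
    by (rule assemble) (fact \<psi>gr \<psi>add \<psi>U)+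
  obtain g where g: "g \<in> ghom 0 C C" "\<And>d x. x \<in> gr C d \<Longrightarrow> g x = \<psi> d x"
    using assemble_\<psi> by (elim bexE) simp
  have s0: "s d \<zero> = \<zero>" for d
    using s_add[OF Bd_closed(2) Bd_closed(2), of d] gr_carrier[OF s(1)[OF Bd_closed(2)], of d] by simp
  have k0: "k d \<zero> = \<zero>" for d
    using k_add[OF Bd_closed(2) Bd_closed(2), of d] gr_carrier[OF kD(1)[OF Bd_closed(2)], of d] by simp
  have \<psi>Z: "\<psi> d z = \<phi> d z" if "z \<in> Zd d" for d z
    unfolding \<psi>_def using ZdD[OF that] ZdD[OF \<phi>Z[OF that]] by (simp add: s0 k0)
  have chain: "g (bd C x) = bd C (g x)" if "x \<in> carrier C" for x
  proof (rule additive_ext[OF _ _ _ that])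
    fix d x assume x: "x \<in> gr C d"
    have "g (bd C x) = \<phi> (d - 1) (bd C x)"
      using g(2)[OF bd_gr[OF x]] \<psi>Z[OF Bd_Zd[OF bd_Bd[OF x]]] by simp
    moreover have "bd C (g x) = \<phi> (d - 1) (bd C x)"
      unfolding g(2)[OF x] \<psi>_def
      using \<phi>c[OF x] kc[OF x] kD(2)[OF bd_Bd[OF x]] ZdD[OF \<phi>Z[OF sp[OF x]]]
        ZdD[OF \<phi>Z[OF Bd_Zd[OF bd_Bd[OF x]]]] by (simp add: bd_add)
    ultimately show "g (bd C x) = bd C (g x)" by simp
  qed (use ghomD[OF g(1)] bd_add in auto)
  have cm: "chain_map C C g" unfolding chain_map_def using g(1) chain by blast
  have "cl (g z) = \<Gamma> (cl z)" if "z \<in> Z" for z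
  proof -
    have "z \<in> Z \<and> cl (g z) = \<Gamma> (cl z)"
      using that
    proof (induction rule: Z_induct)
      case zero
      show ?case using zero_Z G0 ghomD(2)[OF g(1), of \<zero> \<zero>] ghomD(1)[OF g(1), of \<zero>] by simp
    next
      case (add d y z)
      have y: "y \<in> Zd d" using add unfolding Zd_def by blast
      have 1: "cl (g y) = \<Gamma> (cl y)"
        unfolding g(2)[OF add(2)] \<psi>Z[OF y] by (rule \<phi>cl[OF y])
      note gZ = chain_mapD(3)[OF cm]
      have "cl (g (y \<oplus> z)) = cl (g y) \<oplus>\<^bsub>H\<^esub> cl (g z)"
        using add Z_carrier by (subst H_add) (auto simp: gZ ghomD[OF g(1)])
      also have "\<dots> = \<Gamma> (cl (y \<oplus> z))"
        using add 1 by (simp add: H_add[symmetric] G H_carrier)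
      finally show ?case using add submodD(3)[OF Z_sub] by blast
    qed
    then show ?thesis by simp
  qed
  then have "homology_map C g x = \<Gamma> x" if "x \<in> carrier H" for x
    using that homology_map_cl[OF cm] unfolding H_carrier by auto
  then show ?thesis using cm by blast
qed

text \<open>For cycles \<open>z\<close> choose \<open>\<phi> z\<close> with boundary
  \<open>\<delta> z\<close>. To extend to chains, the cycle
  \<open>\<phi> b \<oplus> \<delta> (s b)\<close> has to bound for each boundary \<open>b\<close>.
  If the degree \<open>d\<close> of \<open>b\<close> satisfies \<open>ev\<close>, this cycle lies in
  degree \<open>d + 1\<close>, where every cycle bounds. Otherwise all cycles of degree
  \<open>d\<close> are boundaries, and taking \<open>\<delta> \<circ> s\<close> for
  \<open>\<phi>\<close> makes the obstruction zero.\<close>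

lemma null_homotopic:
  fixes ev :: "rat \<Rightarrow> bool"
  assumes \<delta>: "chain_map C C \<delta>" and null: "\<And>z. z \<in> Z \<Longrightarrow> \<delta> z \<in> bd C ` carrier C"
    and ev_Suc: "\<And>d. ev d \<Longrightarrow> \<not> ev (d + 1)" and ev_2: "\<And>d. ev (d - 2) = ev d"
    and odd: "\<And>d. \<not> ev d \<Longrightarrow> Zd d \<subseteq> Bd d"
  shows "\<exists>h \<in> ghom 1 C C. \<forall>x\<in>carrier C. \<delta> x = bd C (h x) \<oplus> h (bd C x)"
proof -
  note \<delta>h = ghomD[OF chain_mapD(1)[OF \<delta>]] and \<delta>D = chain_mapD[OF \<delta>]
  obtain s where sL: "additive_lift Bd (\<lambda>d b c. b \<in> carrier C \<and> c \<in> gr C (d + 1) \<and> bd C c = b) s"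
    using section_ex ..
  note sD = additive_liftD[OF sL]
  have s: "\<And>d b. b \<in> Bd d \<Longrightarrow> s d b \<in> gr C (d + 1)" "\<And>d b. b \<in> Bd d \<Longrightarrow> bd C (s d b) = b"
    using sD(1) by simp_all
  note s_add = sD(2) and s_U = sD(3)
  have sc: "s d b \<in> carrier C" if "b \<in> Bd d" for d b using s(1)[OF that] gr_carrier by blast
  have Z_odd: "z \<in> Bd d" if "z \<in> Zd d" "\<not> ev d" for z d using odd that by blast
  have \<delta>B: "\<delta> z \<in> Bd d" if "z \<in> Zd d" for z d
    unfolding Bd_def using null ZdD[OF that] \<delta>D(5) by blast
  have shift: "(d::rat) - 2 + 1 = d + 1 - 2" for d by simp
  \<comment> \<open>The last clause fixes the value in degrees without homology, where
    \<open>s d z\<close> is available for every cycle, so that the obstruction below vanishes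
    there.\<close>
  define R where "R d z c \<longleftrightarrow> z \<in> Zd d \<and> c \<in> gr C (d + 1) \<and> bd C c = \<delta> z \<and> (\<not> ev d \<longrightarrow> c = \<delta> (s d z))" for d z c
  have "\<exists>\<phi>. additive_lift Zd R \<phi>"
  proof (rule lift[of Zd R, OF Zd_closed])
    show "\<exists>y. R d x y" if x: "x \<in> Zd d" for d x
    proof (cases "ev d")
      case True
      then show ?thesis using Bd_bd[OF \<delta>B[OF x]] x unfolding R_def by auto
    next
      case False
      note b = Z_odd[OF x False]
      have "\<delta> (s d x) \<in> gr C (d + 1)" using \<delta>D(5) s(1)[OF b] by blast
      moreover have "bd C (\<delta> (s d x)) = \<delta> x" using \<delta>D(2)[OF sc[OF b]] s(2)[OF b] by simp
      ultimately show ?thesis unfolding R_def using x by blast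
    qed
    show "y \<in> carrier C" if "R d x y" for d x y using that gr_carrier unfolding R_def by blast
    have "s d \<zero> = \<zero>" for d
      using s_add[OF Bd_closed(2) Bd_closed(2), of d] sc[OF Bd_closed(2), of d] by simp
    then show "R d \<zero> \<zero>" for d unfolding R_def using \<delta>D(4) Zd_closed(2) by simp
    show "R d (x \<oplus> x') (y \<oplus> y')" if r: "R d x y" "R d x' y'" for d x y x' y'
    proof -
      have z: "x \<in> Zd d" "x' \<in> Zd d" "y \<in> gr C (d + 1)" "y' \<in> gr C (d + 1)" "bd C y = \<delta> x" "bd C y' = \<delta> x'"
        using r unfolding R_def by blast+
      have "y \<oplus> y' = \<delta> (s d (x \<oplus> x'))" if "\<not> ev d"
      proof -
        have b: "x \<in> Bd d" "x' \<in> Bd d" using Z_odd z that by blast+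
        show ?thesis
          using r that unfolding R_def by (simp add: s_add[OF b] \<delta>h(2)[OF sc[OF b(1)] sc[OF b(2)]])
      qed
      then show ?thesis
        unfolding R_def using z Zd_closed(3) gr_add gr_carrier ZdD(1) by (simp add: bd_add \<delta>h(2))
    qed
    show "R (d - 2) (Uvar \<odot> x) (Uvar \<odot> y)" if r: "R d x y" for d x y
    proof -
      have z: "x \<in> Zd d" "y \<in> gr C (d + 1)" "bd C y = \<delta> x"
        using r unfolding R_def by blast+
      have "Uvar \<odot> y = \<delta> (s (d - 2) (Uvar \<odot> x))" if "\<not> ev d"
        using r that s_U[OF Z_odd[OF z(1) that]] \<delta>h(3)[OF sc[OF Z_odd[OF z(1) that]]]
        unfolding R_def by simp
      then show ?thesis
        unfolding R_def shift using z Zd_closed(4)[OF z(1)] gr_U[OF z(2)] gr_carrier[OF z(2)] ZdD(1)[OF z(1)]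
        by (simp add: ev_2 \<delta>h(3))
    qed
  qed
  then obtain \<phi> where L: "additive_lift Zd R \<phi>" ..
  note \<phi>_add = additive_liftD(2)[OF L] and \<phi>_U = additive_liftD(3)[OF L]
  have \<phi>: "\<phi> d z \<in> gr C (d + 1)" "bd C (\<phi> d z) = \<delta> z" "\<not> ev d \<Longrightarrow> \<phi> d z = \<delta> (s d z)" if "z \<in> Zd d" for d z
    using additive_liftD(1)[OF L that] unfolding R_def by blast+
  have \<phi>c: "\<phi> d z \<in> carrier C" if "z \<in> Zd d" for d z using \<phi>(1)[OF that] gr_carrier by blast
  have \<delta>s: "\<delta> (s d b) \<in> gr C (d + 1)" "\<delta> (s d b) \<in> carrier C" if "b \<in> Bd d" for d b
    using \<delta>D(5)[OF s(1)[OF that]] gr_carrier by blast+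
  \<comment> \<open>\<open>k d b\<close> is to be the value of the homotopy on \<open>s d b\<close>;
    the required boundary is what the homotopy equation at \<open>s d b\<close> demands.\<close>
  define R' where "R' d b c \<longleftrightarrow> b \<in> Bd d \<and> c \<in> gr C (d + 2) \<and> bd C c = \<phi> d b \<oplus> \<delta> (s d b)" for d b c
  have \<phi>0: "\<phi> d \<zero> = \<zero>" for d
    using \<phi>_add[OF Zd_closed(2) Zd_closed(2), of d] \<phi>c[OF Zd_closed(2), of d] by simp
  have s0: "s d \<zero> = \<zero>" for d
    using s_add[OF Bd_closed(2) Bd_closed(2), of d] sc[OF Bd_closed(2), of d] by simp
  have "\<exists>k. additive_lift Bd R' k"
  proof (rule lift[of Bd R', OF Bd_closed])
    show "\<exists>y. R' d x y" if x: "x \<in> Bd d" for d x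
    proof (cases "ev d")
      case True
      have "\<phi> d x \<oplus> \<delta> (s d x) \<in> Zd (d + 1)"
        unfolding Zd_def cyc_def
        using gr_add[OF \<phi>(1)[OF Bd_Zd[OF x]] \<delta>s(1)[OF x]] \<phi>c[OF Bd_Zd[OF x]] \<delta>s(2)[OF x]
          \<phi>(2)[OF Bd_Zd[OF x]] \<delta>D(2)[OF sc[OF x]] s(2)[OF x] \<delta>h(1)[OF ZdD(1)[OF Bd_Zd[OF x]]]
        by (simp add: bd_add)
      then have "\<phi> d x \<oplus> \<delta> (s d x) \<in> Bd (d + 1)" using Z_odd ev_Suc[OF True] by blast
      moreover have "d + 1 + 1 = d + 2" by simp
      ultimately obtain c where "c \<in> gr C (d + 2)" "bd C c = \<phi> d x \<oplus> \<delta> (s d x)"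
        using Bd_bd[of "\<phi> d x \<oplus> \<delta> (s d x)" "d + 1"] by metis
      then show ?thesis using x unfolding R'_def by blast
    next
      case False
      then have "\<phi> d x \<oplus> \<delta> (s d x) = \<zero>" using \<phi>(3)[OF Bd_Zd[OF x]] \<delta>s(2)[OF x] by simp
      then have "R' d x \<zero>" unfolding R'_def using x by simp
      then show ?thesis ..
    qed
    show "y \<in> carrier C" if "R' d x y" for d x y using that gr_carrier unfolding R'_def by blast
    show "R' d \<zero> \<zero>" for d
      unfolding R'_def using Bd_closed(2) by (simp add: \<phi>0 s0 \<delta>D(4))
    show "R' d (x \<oplus> x') (y \<oplus> y')" if r: "R' d x y" "R' d x' y'" for d x y x' y'
    proof -
      have b: "x \<in> Bd d" "x' \<in> Bd d" and y: "y \<in> gr C (d + 2)" "y' \<in> gr C (d + 2)"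
        and e: "bd C y = \<phi> d x \<oplus> \<delta> (s d x)" "bd C y' = \<phi> d x' \<oplus> \<delta> (s d x')"
        using r unfolding R'_def by blast+
      show ?thesis
        unfolding R'_def
        using Bd_closed(3)[OF b] gr_add[OF y] e y[THEN gr_carrier] \<phi>c[OF Bd_Zd[OF b(1)]] \<phi>c[OF Bd_Zd[OF b(2)]]
          \<delta>s(2)[OF b(1)] \<delta>s(2)[OF b(2)]
        by (simp add: bd_add \<phi>_add[OF Bd_Zd[OF b(1)] Bd_Zd[OF b(2)]] s_add[OF b]
            \<delta>h(2)[OF sc[OF b(1)] sc[OF b(2)]] M.a_ac)
    qed
    have "(d::rat) - 2 + 2 = d + 2 - 2" for d by simp
    then show "R' (d - 2) (Uvar \<odot> x) (Uvar \<odot> y)" if r: "R' d x y" for d x y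
    proof -
      have b: "x \<in> Bd d" and y: "y \<in> gr C (d + 2)" and e: "bd C y = \<phi> d x \<oplus> \<delta> (s d x)"
        using r unfolding R'_def by blast+
      have "Uvar \<odot> y \<in> gr C (d - 2 + 2)" using gr_U[OF y] by simp
      then show ?thesis
        unfolding R'_def
        using Bd_closed(4)[OF b] e gr_carrier[OF y] \<phi>c[OF Bd_Zd[OF b]] \<delta>s(2)[OF b]
        by (simp add: \<phi>_U[OF Bd_Zd[OF b]] s_U[OF b] \<delta>h(3)[OF sc[OF b]] smult_add)
    qed
  qed
  then obtain k where K: "additive_lift Bd R' k" ..
  note k_add = additive_liftD(2)[OF K] and k_U = additive_liftD(3)[OF K]
  have k: "k d b \<in> gr C (d + 2)" "bd C (k d b) = \<phi> d b \<oplus> \<delta> (s d b)" if "b \<in> Bd d" for d b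
    using additive_liftD(1)[OF K that] unfolding R'_def by blast+
  define \<psi> where "\<psi> d c = \<phi> d (c \<oplus> s (d - 1) (bd C c)) \<oplus> k (d - 1) (bd C c)" for d c
  note sp = split_Zd[OF sL]
  have kgr: "k (d - 1) (bd C c) \<in> gr C (d + 1)" if c: "c \<in> gr C d" for d c
  proof -
    have d: "d - 1 + 2 = d + 1" by simp
    show ?thesis using k(1)[OF bd_Bd[OF c]] unfolding d .
  qed
  have \<psi>gr: "\<psi> d c \<in> gr C (d + 1)" if c: "c \<in> gr C d" for d c
    unfolding \<psi>_def using kgr[OF c] \<phi>(1)[OF sp[OF c]] gr_add by blast
  have kc: "k (d - 1) (bd C c) \<in> carrier C" if c: "c \<in> gr C d" for d c
    using kgr[OF c] gr_carrier by blast
  note \<phi>c' = \<phi>c[OF sp] and sc' = sc[OF bd_Bd]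
  have \<psi>add: "\<psi> d (x \<oplus> y) = \<psi> d x \<oplus> \<psi> d y" if xy: "x \<in> gr C d" "y \<in> gr C d" for d x y
  proof -
    note xyc = xy[THEN gr_carrier]
    have b: "bd C (x \<oplus> y) = bd C x \<oplus> bd C y" using xyc by (rule bd_add)
    have 1: "x \<oplus> y \<oplus> s (d - 1) (bd C (x \<oplus> y)) = (x \<oplus> s (d - 1) (bd C x)) \<oplus> (y \<oplus> s (d - 1) (bd C y))"
      unfolding b s_add[OF xy[THEN bd_Bd]] using xyc sc'[OF xy(1)] sc'[OF xy(2)] by (simp add: M.a_ac)
    show ?thesis
      unfolding \<psi>_def 1 unfolding b \<phi>_add[OF sp[OF xy(1)] sp[OF xy(2)]] k_add[OF xy[THEN bd_Bd]]
      using kc[OF xy(1)] kc[OF xy(2)] \<phi>c'[OF xy(1)] \<phi>c'[OF xy(2)] by (simp add: M.a_ac)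
  qed
  have \<psi>U: "\<psi> (d - 2) (Uvar \<odot> x) = Uvar \<odot> \<psi> d x" if x: "x \<in> gr C d" for d x
  proof -
    note xc = gr_carrier[OF x]
    have d: "d - 2 - 1 = d - 1 - 2" by simp
    have b: "bd C (Uvar \<odot> x) = Uvar \<odot> bd C x" using xc by simp
    have 1: "Uvar \<odot> x \<oplus> s (d - 2 - 1) (bd C (Uvar \<odot> x)) = Uvar \<odot> (x \<oplus> s (d - 1) (bd C x))"
      unfolding b d s_U[OF bd_Bd[OF x]] using xc sc'[OF x] by (simp add: smult_add)
    show ?thesis
      unfolding \<psi>_def 1 unfolding b d \<phi>_U[OF sp[OF x]] k_U[OF bd_Bd[OF x]]
      using kc[OF x] \<phi>c'[OF x] by (simp add: smult_add)
  qed
  have "\<exists>f\<in>ghom 1 C C. \<forall>d. \<forall>x\<in>gr C d. f x = \<psi> d x"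
    by (rule assemble) (fact \<psi>gr \<psi>add \<psi>U)+
  then obtain h where h: "h \<in> ghom 1 C C" "\<And>d x. x \<in> gr C d \<Longrightarrow> h x = \<psi> d x"
    by (elim bexE) simp
  note hD = ghomD[OF h(1)]
  have k0: "k d \<zero> = \<zero>" for d
    using k_add[OF Bd_closed(2) Bd_closed(2), of d] gr_carrier[OF k(1)[OF Bd_closed(2)], of d] by simp
  have \<psi>Z: "\<psi> d z = \<phi> d z" if "z \<in> Zd d" for d z
    unfolding \<psi>_def using ZdD[OF that] \<phi>c[OF that] by (simp add: s0 k0)
  have "\<delta> x = bd C (h x) \<oplus> h (bd C x)" if "x \<in> carrier C" for x
  proof (rule additive_ext[OF _ _ _ that])
    fix x y assume "x \<in> carrier C" "y \<in> carrier C"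
    then show "bd C (h (x \<oplus> y)) \<oplus> h (bd C (x \<oplus> y)) = (bd C (h x) \<oplus> h (bd C x)) \<oplus> (bd C (h y) \<oplus> h (bd C y))"
      by (simp add: hD bd_add M.a_ac)
  next
    fix d x assume x: "x \<in> gr C d"
    note xc = gr_carrier[OF x] and b = bd_Bd[OF x]
    have 1: "h (bd C x) = \<phi> (d - 1) (bd C x)"
      using h(2)[OF bd_gr[OF x]] \<psi>Z[OF Bd_Zd[OF b]] by simp
    have 2: "bd C (h x) = \<delta> (x \<oplus> s (d - 1) (bd C x)) \<oplus> (\<phi> (d - 1) (bd C x) \<oplus> \<delta> (s (d - 1) (bd C x)))"
      unfolding h(2)[OF x] \<psi>_def bd_add[OF \<phi>c'[OF x] kc[OF x]] \<phi>(2)[OF sp[OF x]] k(2)[OF b] ..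
    have "\<delta> (s (d - 1) (bd C x)) \<in> carrier C" "\<phi> (d - 1) (bd C x) \<in> carrier C" "\<delta> x \<in> carrier C"
      using \<delta>s(2)[OF b] \<phi>c[OF Bd_Zd[OF b]] \<delta>h(1)[OF xc] by blast+
    then show "\<delta> x = bd C (h x) \<oplus> h (bd C x)"
      unfolding 1 2 \<delta>h(2)[OF xc sc'[OF x]] by (simp add: M.a_ac)
  qed (rule \<delta>h(2))
  then show ?thesis using h(1) by blast
qed

text \<open>Two chain maps that agree on homology have a sum, equal to their difference in
  characteristic 2, which sends cycles to boundaries; \<open>null_homotopic\<close> applies to
  it.\<close>

lemma homotopic_iff:
  fixes ev :: "rat \<Rightarrow> bool"
  assumes f: "chain_map C C f" and g: "chain_map C C g"
    and ev_Suc: "\<And>d. ev d \<Longrightarrow> \<not> ev (d + 1)" and ev_2: "\<And>d. ev (d - 2) = ev d"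
    and odd: "\<And>d. \<not> ev d \<Longrightarrow> Zd d \<subseteq> Bd d"
  shows "homotopic C C f g \<longleftrightarrow> (\<forall>z\<in>Z. cl (f z) = cl (g z))"
proof
  note fD = chain_mapD[OF f] and gD = chain_mapD[OF g]
  assume "homotopic C C f g"
  then obtain h where h: "h \<in> ghom 1 C C" "\<And>x. x \<in> carrier C \<Longrightarrow> f x \<ominus> g x = bd C (h x) \<oplus> h (bd C x)"
    unfolding homotopic_def by blast
  have h0: "h \<zero> = \<zero>" using ghom_zero[OF h(1)] fu_module_axioms by blast
  show "\<forall>z\<in>Z. cl (f z) = cl (g z)"
  proof
    fix z assume z: "z \<in> Z"
    have "f z \<oplus> g z = bd C (h z)"
      using h(2)[OF Z_carrier[OF z]] Z_bd[OF z] h0 Z_carrier[OF fD(3)[OF z]] Z_carrier[OF gD(3)[OF z]]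
        ghomD(1)[OF h(1) Z_carrier[OF z]] by (simp add: minus_eq_add)
    then show "cl (f z) = cl (g z)"
      using cl_eq_iff[OF fD(3)[OF z] gD(3)[OF z]] ghomD(1)[OF h(1) Z_carrier[OF z]] by simp
  qed
next
  note fD = chain_mapD[OF f] and gD = chain_mapD[OF g]
  note fh = ghomD[OF fD(1)] and gh = ghomD[OF gD(1)]
  assume eq: "\<forall>z\<in>Z. cl (f z) = cl (g z)"
  have "(\<lambda>x. f x \<oplus> g x) \<in> ghom 0 C C"
    by (rule ghomI[OF fu_module_axioms fu_module_axioms])
       (simp_all add: fh gh smult_add M.a_ac gr_add fD(5) gD(5))
  then have cm: "chain_map C C (\<lambda>x. f x \<oplus> g x)"
    unfolding chain_map_def by (simp add: fD(2) gD(2) fh gh bd_add)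
  have null: "f z \<oplus> g z \<in> bd C ` carrier C" if "z \<in> Z" for z
    using eq that cl_eq_iff[OF fD(3)[OF that] gD(3)[OF that]] by blast
  have "\<exists>h \<in> ghom 1 C C. \<forall>x\<in>carrier C. f x \<oplus> g x = bd C (h x) \<oplus> h (bd C x)"
    by (rule null_homotopic[where ev = ev]) (fact cm null ev_Suc ev_2 odd)+
  then show "homotopic C C f g"
    unfolding homotopic_def by (simp add: minus_eq_add fh gh)
qed

lemma chain_map_comp: "chain_map C C f \<Longrightarrow> chain_map C C g \<Longrightarrow> chain_map C C (f \<circ> g)"
  using ghom_comp[of g 0 C C f 0 C] unfolding chain_map_def by (auto simp: ghomD(1))

end

section \<open>Localization at \<open>U\<close>\<close>

context fu_module
begin

definition is_torsion :: "'a \<Rightarrow> bool" where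
  "is_torsion x \<longleftrightarrow> (\<exists>n. (Uvar ^ n) \<odot> x = \<zero>)"

lemma Uloc_rel_iff:
  "((x, k), (y, l)) \<in> Uloc_rel M \<longleftrightarrow> x \<in> carrier M \<and> y \<in> carrier M \<and>
     (\<exists>m. (Uvar ^ (m + l)) \<odot> x = (Uvar ^ (m + k)) \<odot> y)"
  by (simp add: Uloc_rel_def)

lemma equiv_Uloc_rel: "equiv (carrier M \<times> UNIV) (Uloc_rel M)"
proof (rule equivI)
  show "Uloc_rel M \<subseteq> (carrier M \<times> UNIV) \<times> carrier M \<times> UNIV" by (auto simp: Uloc_rel_def)
  show "refl_on (carrier M \<times> UNIV) (Uloc_rel M)"
    by (auto simp: refl_on_def Uloc_rel_iff)
  show "sym (Uloc_rel M)"
    unfolding sym_def by (auto simp: Uloc_rel_iff) metis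
  show "trans (Uloc_rel M)"
  proof (rule transI, clarify)
    fix x y z :: 'a and k l p :: nat
    assume "((x, k), (y, l)) \<in> Uloc_rel M" "((y, l), (z, p)) \<in> Uloc_rel M"
    then obtain m m' where c: "x \<in> carrier M" "y \<in> carrier M" "z \<in> carrier M"
      and m: "(Uvar ^ (m + l)) \<odot> x = (Uvar ^ (m + k)) \<odot> y"
      and m': "(Uvar ^ (m' + p)) \<odot> y = (Uvar ^ (m' + l)) \<odot> z"
      unfolding Uloc_rel_iff by blast
    have "(Uvar ^ ((m + m' + l) + p)) \<odot> x = (Uvar ^ (m' + p)) \<odot> ((Uvar ^ (m + l)) \<odot> x)"
      using c by (simp add: smult_power_add[symmetric] ac_simps)
    also have "\<dots> = (Uvar ^ (m + k)) \<odot> ((Uvar ^ (m' + p)) \<odot> y)"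
      unfolding m using c by (simp add: smult_power_add[symmetric] ac_simps)
    also have "\<dots> = (Uvar ^ ((m + m' + l) + k)) \<odot> z"
      unfolding m' using c by (simp add: smult_power_add[symmetric] ac_simps)
    finally show "((x, k), (z, p)) \<in> Uloc_rel M" unfolding Uloc_rel_iff using c by blast
  qed
qed

definition frac :: "'a \<Rightarrow> nat \<Rightarrow> ('a \<times> nat) set" where
  "frac x k = Uloc_rel M `` {(x, k)}"

lemma frac_eq_iff:
  "x \<in> carrier M \<Longrightarrow> y \<in> carrier M \<Longrightarrow>
    frac x k = frac y l \<longleftrightarrow> (\<exists>m. (Uvar ^ (m + l)) \<odot> x = (Uvar ^ (m + k)) \<odot> y)"
  unfolding frac_def using eq_equiv_class_iff[OF equiv_Uloc_rel, of "(x, k)" "(y, l)"]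
  by (simp add: Uloc_rel_iff)

lemma Uloc_eq: "Uloc M = {frac x k | x k. x \<in> carrier M}"
  unfolding Uloc_def quotient_def frac_def by auto

lemma Uloc_map_frac:
  assumes f: "f \<in> ghom e M M" and x: "x \<in> carrier M"
  shows "Uloc_map M f (frac x k) = frac (f x) k"
proof -
  note fD = ghomD[OF f]
  have sub: "frac (f y) l = frac (f x) k" if yl: "(y, l) \<in> frac x k" for y l
  proof -
    obtain m where "y \<in> carrier M" and m: "(Uvar ^ (m + l)) \<odot> x = (Uvar ^ (m + k)) \<odot> y"
      using yl unfolding frac_def by (auto simp: Uloc_rel_iff)
    moreover have "(Uvar ^ (m + k)) \<odot> f y = (Uvar ^ (m + l)) \<odot> f x"
      using m fD(3) x \<open>y \<in> carrier M\<close> by metis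
    ultimately show ?thesis using frac_eq_iff fD(1) x by blast
  qed
  have "(x, k) \<in> frac x k" unfolding frac_def using x by (auto simp: Uloc_rel_iff)
  have "Uloc_map M f A = (\<Union>p\<in>A. frac (f (fst p)) (snd p))" for A
    unfolding Uloc_map_def frac_def by (subst Image_eq_UN) (simp add: split_beta)
  then have "Uloc_map M f (frac x k) = (\<Union>p\<in>frac x k. frac (f (fst p)) (snd p))" .
  also have "\<dots> = frac (f x) k"
  proof (rule SUP_eq_const)
    show "frac x k \<noteq> {}" using \<open>(x, k) \<in> frac x k\<close> by blast
    show "frac (f (fst p)) (snd p) = frac (f x) k" if "p \<in> frac x k" for p
      using sub[of "fst p" "snd p"] that by simp
  qed
  finally show ?thesis .
qed

text \<open>A fraction vanishes exactly when its numerator is torsion, so bijectivity amounts to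
  torsion kernel and torsion cokernel. Localization is handled through this criterion from here
  on.\<close>

lemma Uloc_iso_iff:
  assumes f: "f \<in> ghom e M M"
  shows "Uloc_iso M M f \<longleftrightarrow> (\<forall>x\<in>carrier M. is_torsion (f x) \<longrightarrow> is_torsion x) \<and>
    (\<forall>y\<in>carrier M. \<exists>m. \<exists>x\<in>carrier M. f x = (Uvar ^ m) \<odot> y)"
proof
  note fD = ghomD[OF f] and mapf = Uloc_map_frac[OF f]
  have f0: "f \<zero> = \<zero>" using ghom_zero[OF f] fu_module_axioms by blast
  assume "Uloc_iso M M f"
  then have inj: "inj_on (Uloc_map M f) (Uloc M)" and surj: "Uloc_map M f ` Uloc M = Uloc M"
    unfolding Uloc_iso_def bij_betw_def by auto
  show "(\<forall>x\<in>carrier M. is_torsion (f x) \<longrightarrow> is_torsion x) \<and>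
    (\<forall>y\<in>carrier M. \<exists>m. \<exists>x\<in>carrier M. f x = (Uvar ^ m) \<odot> y)"
  proof (intro conjI ballI impI)
    fix x assume x: "x \<in> carrier M" "is_torsion (f x)"
    then obtain n where "(Uvar ^ n) \<odot> f x = \<zero>" unfolding is_torsion_def by blast
    then have "frac (f x) 0 = frac (f \<zero>) 0"
      using frac_eq_iff[OF fD(1)[OF x(1)] M.zero_closed, of 0 0] f0 by auto
    then have "Uloc_map M f (frac x 0) = Uloc_map M f (frac \<zero> 0)"
      using mapf x by simp
    then have "frac x 0 = frac \<zero> 0"
      using inj x unfolding inj_on_def Uloc_eq by blast
    then show "is_torsion x"
      using frac_eq_iff[OF x(1) M.zero_closed, of 0 0] unfolding is_torsion_def by auto
  next
    fix y assume y: "y \<in> carrier M"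
    then have "frac y 0 \<in> Uloc_map M f ` Uloc M" using surj unfolding Uloc_eq by blast
    then obtain x k where x: "x \<in> carrier M" "frac y 0 = frac (f x) k"
      using mapf unfolding Uloc_eq by auto
    then obtain m where "(Uvar ^ (m + k)) \<odot> y = (Uvar ^ (m + 0)) \<odot> f x"
      using frac_eq_iff[OF y fD(1)[OF x(1)], of 0 k] by blast
    then have "f ((Uvar ^ m) \<odot> x) = (Uvar ^ (m + k)) \<odot> y" using fD x by simp
    then show "\<exists>m. \<exists>x\<in>carrier M. f x = (Uvar ^ m) \<odot> y" using x(1) by blast
  qed
next
  note fD = ghomD[OF f] and mapf = Uloc_map_frac[OF f]
  assume "(\<forall>x\<in>carrier M. is_torsion (f x) \<longrightarrow> is_torsion x) \<and>
    (\<forall>y\<in>carrier M. \<exists>m. \<exists>x\<in>carrier M. f x = (Uvar ^ m) \<odot> y)"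
  then have tors: "\<And>x. x \<in> carrier M \<Longrightarrow> is_torsion (f x) \<Longrightarrow> is_torsion x"
    and surj: "\<And>y. y \<in> carrier M \<Longrightarrow> \<exists>m. \<exists>x\<in>carrier M. f x = (Uvar ^ m) \<odot> y" by blast+
  show "Uloc_iso M M f"
    unfolding Uloc_iso_def bij_betw_def
  proof (intro conjI inj_onI)
    fix X Y assume "X \<in> Uloc M" "Y \<in> Uloc M" and eq: "Uloc_map M f X = Uloc_map M f Y"
    then obtain x k y l where X: "x \<in> carrier M" "X = frac x k" and Y: "y \<in> carrier M" "Y = frac y l"
      unfolding Uloc_eq by blast
    have "frac (f x) k = frac (f y) l" using eq X Y mapf by simp
    then obtain m where m: "(Uvar ^ (m + l)) \<odot> f x = (Uvar ^ (m + k)) \<odot> f y"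
      using frac_eq_iff fD(1) X Y by blast
    have "f ((Uvar ^ (m + l)) \<odot> x \<oplus> (Uvar ^ (m + k)) \<odot> y) = \<zero>"
      using m X Y fD by simp
    then have "is_torsion (f ((Uvar ^ (m + l)) \<odot> x \<oplus> (Uvar ^ (m + k)) \<odot> y))"
      unfolding is_torsion_def by simp
    then have "is_torsion ((Uvar ^ (m + l)) \<odot> x \<oplus> (Uvar ^ (m + k)) \<odot> y)"
      by (rule tors[rotated]) (use X Y in simp)
    then obtain n where "(Uvar ^ n) \<odot> ((Uvar ^ (m + l)) \<odot> x \<oplus> (Uvar ^ (m + k)) \<odot> y) = \<zero>"
      unfolding is_torsion_def by blast
    then have "(Uvar ^ n) \<odot> ((Uvar ^ (m + l)) \<odot> x) = (Uvar ^ n) \<odot> ((Uvar ^ (m + k)) \<odot> y)"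
      using X Y by (simp add: smult_add add_eq_zero_iff)
    then have "(Uvar ^ ((n + m) + l)) \<odot> x = (Uvar ^ ((n + m) + k)) \<odot> y"
      using X Y by (simp add: smult_power_add[symmetric] ac_simps)
    then show "X = Y" using frac_eq_iff X Y by blast
  next
    show "Uloc_map M f ` Uloc M = Uloc M"
    proof (intro equalityI subsetI)
      fix X assume "X \<in> Uloc_map M f ` Uloc M"
      then obtain x k where "x \<in> carrier M" "X = Uloc_map M f (frac x k)" unfolding Uloc_eq by blast
      then show "X \<in> Uloc M" unfolding Uloc_eq using mapf[of x k] fD(1)[of x] by blast
    next
      fix Y assume "Y \<in> Uloc M"
      then obtain y k where Y: "y \<in> carrier M" "Y = frac y k" unfolding Uloc_eq by blast
      obtain m x where x: "x \<in> carrier M" "f x = (Uvar ^ m) \<odot> y" using surj[OF Y(1)] by blast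
      \<comment> \<open>If \<open>f x\<close> is \<open>U ^ m\<close> times \<open>y\<close>, then
        \<open>x / U ^ (k + m)\<close> is a preimage of \<open>y / U ^ k\<close>.\<close>
      have "(Uvar ^ (0 + k)) \<odot> f x = (Uvar ^ (0 + (k + m))) \<odot> y"
        unfolding x(2) using Y by (simp add: smult_power_add[symmetric] ac_simps)
      then have "frac (f x) (k + m) = frac y k" using frac_eq_iff fD(1)[OF x(1)] Y(1) by blast
      then have "Uloc_map M f (frac x (k + m)) = Y" using mapf x Y by simp
      then show "Y \<in> Uloc_map M f ` Uloc M" using x(1) unfolding Uloc_eq by blast
    qed
  qed
qed

end

section \<open>Self-local equivalences and the image of a maximal one\<close>

text \<open>The homology is concentrated in the degrees satisfying \<open>ev\<close>.\<close>

locale even_iota_complex = iota_complex C \<iota> for C :: "('a, 'm) cx_scheme" (structure) and \<iota> +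
  fixes ev :: "rat \<Rightarrow> bool"
  assumes ev_Suc: "\<And>d. ev d \<Longrightarrow> \<not> ev (d + 1)" and ev_2: "\<And>d. ev (d - 2) = ev d"
    and odd: "\<And>d. \<not> ev d \<Longrightarrow> Zd d \<subseteq> Bd d"
begin

abbreviation "\<iota>H \<equiv> homology_map C \<iota>"

text \<open>The condition that a self-local equivalence satisfies on homology;
  \<open>self_local_equivalence_iff\<close> shows that it characterizes them among chain
  maps.\<close>

definition hlocal :: "('a set \<Rightarrow> 'a set) \<Rightarrow> bool" where
  "hlocal \<Gamma> \<longleftrightarrow> \<Gamma> \<in> ghom 0 H H \<and> (\<forall>x\<in>carrier H. \<Gamma> (\<iota>H x) = \<iota>H (\<Gamma> x)) \<and> Uloc_iso H H \<Gamma>"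

lemma homology_map_ghom:
  assumes f: "chain_map C C f"
  shows "homology_map C f \<in> ghom 0 H H"
proof (rule ghomI[OF H_module H_module])
  note fD = chain_mapD[OF f] and fh = ghomD[OF chain_mapD(1)[OF f]] and cl = homology_map_cl[OF f]
  note Zs = submodD[OF Z_sub]
  show "homology_map C f X \<in> carrier H" if "X \<in> carrier H" for X
    using that cl fD(3) unfolding H_carrier by auto
  show "homology_map C f (X \<oplus>\<^bsub>H\<^esub> Y) = homology_map C f X \<oplus>\<^bsub>H\<^esub> homology_map C f Y"
    if XY: "X \<in> carrier H" "Y \<in> carrier H" for X Y
  proof -
    obtain x y where x: "x \<in> Z" "X = cl x" and y: "y \<in> Z" "Y = cl y"
      using XY unfolding H_carrier by auto
    show ?thesis using x y Zs Z_carrier by (simp add: H_add cl fD(3) fh)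
  qed
  show "homology_map C f (Uvar \<odot>\<^bsub>H\<^esub> X) = Uvar \<odot>\<^bsub>H\<^esub> homology_map C f X" if X: "X \<in> carrier H" for X
  proof -
    obtain x where x: "x \<in> Z" "X = cl x" using X unfolding H_carrier by auto
    show ?thesis using x Zs Z_carrier by (simp add: H_smult cl fD(3) fh)
  qed
  show "homology_map C f X \<in> gr H (d + 0)" if X: "X \<in> gr H d" for X d
  proof -
    obtain x where x: "x \<in> gr C d" "x \<in> Z" "X = cl x" using X unfolding H_gr by auto
    then show ?thesis using cl[OF x(2)] fD(3)[OF x(2)] fD(5)[OF x(1)] unfolding H_gr by auto
  qed
qed

text \<open>Maps matter only on carriers, and a realisation induces the prescribed map only
  there.\<close>

lemma hlocal_cong:
  assumes \<Gamma>: "hlocal \<Gamma>" and \<Delta>: "\<Delta> \<in> ghom 0 H H" and eq: "\<And>x. x \<in> carrier H \<Longrightarrow> \<Delta> x = \<Gamma> x"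
  shows "hlocal \<Delta>"
proof -
  have G: "\<Gamma> \<in> ghom 0 H H" and I: "\<And>x. x \<in> carrier H \<Longrightarrow> \<Gamma> (\<iota>H x) = \<iota>H (\<Gamma> x)" and U: "Uloc_iso H H \<Gamma>"
    using \<Gamma> unfolding hlocal_def by auto
  have "\<iota>H x \<in> carrier H" if "x \<in> carrier H" for x
    using ghomD(1)[OF homology_map_ghom[OF iota_chain_map] that] .
  moreover have "Uloc_iso H H \<Delta>"
    using U unfolding fu_module.Uloc_iso_iff[OF H_module G] fu_module.Uloc_iso_iff[OF H_module \<Delta>]
    by (simp add: eq)
  ultimately show ?thesis unfolding hlocal_def using \<Delta> eq I by simp
qed

lemma hlocal_comp:
  assumes \<Gamma>: "hlocal \<Gamma>" and \<Delta>: "hlocal \<Delta>"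
  shows "hlocal (\<Gamma> \<circ> \<Delta>)"
proof -
  interpret H: fu_module H by (rule H_module)
  have G: "\<Gamma> \<in> ghom 0 H H" and GI: "\<And>x. x \<in> carrier H \<Longrightarrow> \<Gamma> (\<iota>H x) = \<iota>H (\<Gamma> x)" and GU: "Uloc_iso H H \<Gamma>"
    using \<Gamma> unfolding hlocal_def by auto
  have D: "\<Delta> \<in> ghom 0 H H" and DI: "\<And>x. x \<in> carrier H \<Longrightarrow> \<Delta> (\<iota>H x) = \<iota>H (\<Delta> x)" and DU: "Uloc_iso H H \<Delta>"
    using \<Delta> unfolding hlocal_def by auto
  have GD: "\<Gamma> \<circ> \<Delta> \<in> ghom 0 H H" using ghom_comp[OF D G] by simp
  note gD = ghomD[OF G] and dD = ghomD[OF D]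
  have "Uloc_iso H H (\<Gamma> \<circ> \<Delta>)"
    unfolding H.Uloc_iso_iff[OF GD]
  proof (intro conjI ballI impI)
    fix x assume "x \<in> carrier H" "H.is_torsion ((\<Gamma> \<circ> \<Delta>) x)"
    then show "H.is_torsion x"
      using GU DU dD(1) unfolding H.Uloc_iso_iff[OF G] H.Uloc_iso_iff[OF D] by simp
  next
    fix y assume y: "y \<in> carrier H"
    obtain m x where x: "x \<in> carrier H" "\<Gamma> x = (Uvar ^ m) \<odot>\<^bsub>H\<^esub> y"
      using GU y unfolding H.Uloc_iso_iff[OF G] by blast
    obtain m' x' where x': "x' \<in> carrier H" "\<Delta> x' = (Uvar ^ m') \<odot>\<^bsub>H\<^esub> x"
      using DU x(1) unfolding H.Uloc_iso_iff[OF D] by blast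
    have "(\<Gamma> \<circ> \<Delta>) x' = (Uvar ^ (m' + m)) \<odot>\<^bsub>H\<^esub> y"
      using x x' y gD(3) by (simp add: H.smult_power_add)
    then show "\<exists>m. \<exists>x\<in>carrier H. (\<Gamma> \<circ> \<Delta>) x = (Uvar ^ m) \<odot>\<^bsub>H\<^esub> y" using x'(1) by blast
  qed
  then show ?thesis unfolding hlocal_def using GD GI DI dD(1) by simp
qed

lemma homology_map_comp:
  assumes "chain_map C C f" "chain_map C C g" "x \<in> carrier H"
  shows "homology_map C (f \<circ> g) x = homology_map C f (homology_map C g x)"
  using assms homology_map_cl[OF chain_map_comp[OF assms(1,2)]] chain_mapD(3)[OF assms(2)]
  by (auto simp: H_carrier homology_map_cl)

text \<open>By \<open>homotopic_iff\<close>, commuting with \<open>\<iota>\<close> up to homotopy is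
  the same as commuting strictly on homology; this is where the parity of the degrees
  enters.\<close>

lemma self_local_equivalence_iff:
  "self_local_equivalence C \<iota> f \<longleftrightarrow> chain_map C C f \<and> hlocal (homology_map C f)"
proof (cases "chain_map C C f")
  case True
  note c1 = chain_map_comp[OF True iota_chain_map] and c2 = chain_map_comp[OF iota_chain_map True]
  have "homotopic C C (f \<circ> \<iota>) (\<iota> \<circ> f) \<longleftrightarrow> (\<forall>z\<in>Z. cl ((f \<circ> \<iota>) z) = cl ((\<iota> \<circ> f) z))"
    by (rule homotopic_iff[OF c1 c2, where ev = ev]) (fact ev_Suc ev_2 odd)+
  also have "\<dots> \<longleftrightarrow> (\<forall>x\<in>carrier H. homology_map C f (\<iota>H x) = \<iota>H (homology_map C f x))"
    unfolding H_carrier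
    by (simp add: homology_map_cl[OF True] homology_map_cl[OF iota_chain_map] chain_mapD(3)[OF True]
        chain_mapD(3)[OF iota_chain_map])
  finally show ?thesis
    unfolding self_local_equivalence_def hlocal_def using True homology_map_ghom[OF True] by simp
qed (simp add: self_local_equivalence_def)

lemma self_local_equivalence_comp:
  assumes "self_local_equivalence C \<iota> f" "self_local_equivalence C \<iota> g"
  shows "self_local_equivalence C \<iota> (f \<circ> g)"
proof -
  have f: "chain_map C C f" "hlocal (homology_map C f)" and g: "chain_map C C g" "hlocal (homology_map C g)"
    using assms unfolding self_local_equivalence_iff by auto
  note c = chain_map_comp[OF f(1) g(1)]
  have "hlocal (homology_map C (f \<circ> g))"
    by (rule hlocal_cong[OF hlocal_comp[OF f(2) g(2)] homology_map_ghom[OF c]])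
       (simp add: homology_map_comp[OF f(1) g(1)])
  then show ?thesis unfolding self_local_equivalence_iff using c by simp
qed

lemma self_local_equivalence_id: "self_local_equivalence C \<iota> id"
proof -
  interpret H: fu_module H by (rule H_module)
  have c: "chain_map C C id"
    unfolding chain_map_def by (auto intro!: ghomI simp: fu_module_axioms)
  have eq: "homology_map C id x = x" if "x \<in> carrier H" for x
    using that homology_map_cl[OF c] unfolding H_carrier by auto
  have "\<iota>H x \<in> carrier H" if "x \<in> carrier H" for x
    using ghomD(1)[OF homology_map_ghom[OF iota_chain_map] that] .
  moreover have "Uloc_iso H H (homology_map C id)"
    unfolding H.Uloc_iso_iff[OF homology_map_ghom[OF c]]
    using eq H.smult_poly_closed by auto
  ultimately have "hlocal (homology_map C id)"
    unfolding hlocal_def using eq homology_map_ghom[OF c] by simp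
  then show ?thesis unfolding self_local_equivalence_iff using c by simp
qed

lemma a_kernel_eq: "a_kernel C C f = {x \<in> carrier C. f x = \<zero>}"
  by (simp add: a_kernel_def kernel_def)

text \<open>A graded map is determined on the carrier by its values on a finite homogeneous basis,
  and each value lies in a finite graded piece.\<close>

lemma finite_kernels: "finite {a_kernel C C f | f. f \<in> ghom 0 C C}"
proof -
  obtain B where B: "finite B" "B \<subseteq> carrier C" and hom: "\<And>b. b \<in> B \<Longrightarrow> \<exists>d. b \<in> gr C d"
    and ex1: "\<And>x. x \<in> carrier C \<Longrightarrow> \<exists>!c. c \<in> B \<rightarrow>\<^sub>E (UNIV :: bit poly set) \<and> x = finsum C (\<lambda>b. c b \<odot> b) B"
    by (rule fg_free_basis) (rule that)
  obtain db where db: "\<And>b. b \<in> B \<Longrightarrow> b \<in> gr C (db b)" using hom by metis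
  have f_sum: "f (finsum C (\<lambda>b. c b \<odot> b) A) = finsum C (\<lambda>b. c b \<odot> f b) A"
    if f: "f \<in> ghom 0 C C" and A: "finite A" "A \<subseteq> carrier C" for f c A
    using A
  proof (induction A)
    case empty
    then show ?case using ghom_zero[OF f] fu_module_axioms by simp
  next
    case (insert a A)
    have *: "(\<lambda>b. c b \<odot> b) \<in> A \<rightarrow> carrier C" "(\<lambda>b. c b \<odot> f b) \<in> A \<rightarrow> carrier C"
      using insert ghomD(1)[OF f] by auto
    have "finsum C (\<lambda>b. c b \<odot> b) A \<in> carrier C" using *(1) by (rule M.finsum_closed)
    then show ?case using insert * by (simp add: ghomD[OF f])
  qed
  have ker: "a_kernel C C f = a_kernel C C g"
    if fg: "f \<in> ghom 0 C C" "g \<in> ghom 0 C C" and eq: "\<And>b. b \<in> B \<Longrightarrow> f b = g b" for f g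
  proof -
    have "f x = g x" if x: "x \<in> carrier C" for x
    proof -
      obtain c where c: "x = finsum C (\<lambda>b. c b \<odot> b) B"
        using ex1_implies_ex[OF ex1[OF x]] by (elim exE conjE)
      have "finsum C (\<lambda>b. c b \<odot> f b) B = finsum C (\<lambda>b. c b \<odot> g b) B"
        by (rule M.finsum_cong') (use eq B ghomD(1)[OF fg(2)] in auto)
      then show ?thesis unfolding c f_sum[OF fg(1) B] f_sum[OF fg(2) B] .
    qed
    then show ?thesis unfolding a_kernel_eq by auto
  qed
  let ?P = "\<Pi>\<^sub>E b\<in>B. gr C (db b)"
  let ?k = "\<lambda>u. a_kernel C C (SOME f. f \<in> ghom 0 C C \<and> (\<forall>b\<in>B. f b = u b))"
  have "{a_kernel C C f | f. f \<in> ghom 0 C C} \<subseteq> ?k ` ?P"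
  proof clarify
    fix f assume f: "f \<in> ghom 0 C C"
    let ?u = "restrict f B"
    have u: "?u \<in> ?P" using ghomD(4)[OF f db] by simp
    define F where "F = (SOME f. f \<in> ghom 0 C C \<and> (\<forall>b\<in>B. f b = ?u b))"
    have F: "F \<in> ghom 0 C C \<and> (\<forall>b\<in>B. F b = ?u b)"
      unfolding F_def by (rule someI[of _ f]) (use f in simp)
    have "a_kernel C C F = a_kernel C C f"
      by (rule ker[OF conjunct1[OF F] f]) (use conjunct2[OF F] in simp)
    then have "a_kernel C C f = ?k ?u" unfolding F_def by simp
    then show "a_kernel C C f \<in> ?k ` ?P" using imageI[OF u, of ?k] by simp
  qed
  moreover have "finite ?P" by (rule finite_PiE) (use B gr_finite in auto)
  ultimately show ?thesis using finite_subset by blast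
qed

text \<open>The kernels of self-local equivalences form a finite set, nonempty because of the
  identity, so one of them is maximal under inclusion.\<close>

lemma maximal_exists: "\<exists>f. maximal_self_local_equivalence C \<iota> f"
proof -
  let ?K = "{a_kernel C C f | f. self_local_equivalence C \<iota> f}"
  have "?K \<subseteq> {a_kernel C C f | f. f \<in> ghom 0 C C}"
    unfolding self_local_equivalence_iff using chain_mapD(1) by blast
  then have "finite ?K" using finite_kernels finite_subset by blast
  moreover have "?K \<noteq> {}" using self_local_equivalence_id by blast
  ultimately obtain K where K: "K \<in> ?K" "\<forall>L\<in>?K. K \<subseteq> L \<longrightarrow> K = L"
    using finite_has_maximal[of ?K] by blast
  then obtain f where "self_local_equivalence C \<iota> f" "K = a_kernel C C f" by blast
  then show ?thesis
    unfolding maximal_self_local_equivalence_def ker_le_def using K(2) by (intro exI[of _ f]) blast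
qed

lemma subcx_image:
  assumes f: "chain_map C C f"
  shows "subcx (f ` carrier C)"
proof -
  have "bd C (f x) \<in> f ` carrier C" if "x \<in> carrier C" for x
    using that chain_mapD(2)[OF f, symmetric] by simp
  then show ?thesis
    using ghom_image_submod[OF chain_mapD(1)[OF f] fu_module_axioms fu_module_axioms]
    unfolding subcx_def by auto
qed

text \<open>Realise \<gamma> by a chain map \<open>g\<close>. Maximality makes
  \<open>f \<circ> g\<close> injective on \<open>im f\<close>, and finite graded pieces make it map
  onto \<open>im f\<close>. Therefore a cycle of \<open>im f\<close> whose image under
  \<open>g\<close> bounds in \<open>C\<close> already bounds in \<open>im f\<close>. The hypothesis
  \<open>rigid\<close>, used for the homology map of \<open>f\<close>, shows that cycles of
  \<open>im f\<close> reach all of the image of \<gamma>.\<close>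

lemma maximal_image:
  assumes max: "maximal_self_local_equivalence C \<iota> f" and \<gamma>: "hlocal \<gamma>"
    and rigid: "\<And>\<phi>. hlocal \<phi> \<Longrightarrow> \<gamma> ` carrier H \<subseteq> \<gamma> ` \<phi> ` carrier H"
  shows "homology (gsub C (f ` carrier C)) \<cong>\<^sub>g\<^sub>r gsub H (\<gamma> ` carrier H)"
proof -
  define I where "I = f ` carrier C"
  have sf: "self_local_equivalence C \<iota> f"
    and mx: "\<And>g. self_local_equivalence C \<iota> g \<Longrightarrow> a_kernel C C f \<subseteq> a_kernel C C g \<Longrightarrow> a_kernel C C g \<subseteq> a_kernel C C f"
    using max unfolding maximal_self_local_equivalence_def ker_le_def by auto
  have f: "chain_map C C f" and hf: "hlocal (homology_map C f)"
    using sf unfolding self_local_equivalence_iff by auto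
  have \<gamma>h: "\<gamma> \<in> ghom 0 H H" using \<gamma> unfolding hlocal_def by auto
  obtain g where g: "chain_map C C g" and g\<gamma>: "\<And>x. x \<in> carrier H \<Longrightarrow> homology_map C g x = \<gamma> x"
    using realize[OF \<gamma>h] by blast
  have hg: "hlocal (homology_map C g)"
    by (rule hlocal_cong[OF \<gamma> homology_map_ghom[OF g] g\<gamma>])
  have sg: "self_local_equivalence C \<iota> g" unfolding self_local_equivalence_iff using g hg by simp
  note fD = chain_mapD[OF f] and fh = ghomD[OF chain_mapD(1)[OF f]]
  note gD = chain_mapD[OF g] and gh = ghomD[OF chain_mapD(1)[OF g]]
  \<comment> \<open>This inclusion is immediate; maximality of \<open>f\<close> yields the opposite
    one.\<close>
  have "a_kernel C C f \<subseteq> a_kernel C C (f \<circ> (g \<circ> f))"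
    unfolding a_kernel_eq using gD(4) fD(4) by auto
  then have ker: "a_kernel C C (f \<circ> (g \<circ> f)) \<subseteq> a_kernel C C f"
    by (rule mx[rotated]) (intro self_local_equivalence_comp sf sg)
  have sub: "subcx I" unfolding I_def by (rule subcx_image[OF f])
  note Is = submodD[OF I_sub[OF sub]]
  define \<theta> where "\<theta> x = f (g x)" for x
  have \<theta>I: "\<theta> x \<in> I" if "x \<in> carrier C" for x unfolding \<theta>_def I_def using gh(1)[OF that] by blast
  have \<theta>_add: "\<theta> (x \<oplus> y) = \<theta> x \<oplus> \<theta> y" if "x \<in> carrier C" "y \<in> carrier C" for x y
    unfolding \<theta>_def using that by (simp add: fh gh)
  have \<theta>_zero: "x = \<zero>" if x: "x \<in> I" "\<theta> x = \<zero>" for x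
  proof -
    obtain u where u: "u \<in> carrier C" "x = f u" using x(1) unfolding I_def by blast
    then have "u \<in> a_kernel C C (f \<circ> (g \<circ> f))" using x(2) unfolding a_kernel_eq \<theta>_def by simp
    then show ?thesis using ker u unfolding a_kernel_eq by auto
  qed
  have \<theta>_inj: "x = y" if xy: "x \<in> I" "y \<in> I" "\<theta> x = \<theta> y" for x y
  proof -
    have "\<theta> (x \<oplus> y) = \<zero>" using xy \<theta>_add Is(1) \<theta>I by simp
    then have "x \<oplus> y = \<zero>" using \<theta>_zero Is(3) xy by blast
    then show ?thesis using add_eq_zero_iff Is(1) xy by blast
  qed
  \<comment> \<open>\<open>C\<close> itself is infinite, so surjectivity is deduced from injectivity
    in each finite graded piece and then extended by sums.\<close>
  have \<theta>_surj_gr: "\<theta> ` (gr C d \<inter> I) = gr C d \<inter> I" for d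
  proof (rule endo_inj_surj)
    show "finite (gr C d \<inter> I)" using gr_finite by simp
    show "\<theta> ` (gr C d \<inter> I) \<subseteq> gr C d \<inter> I"
      using \<theta>I Is(1) fD(5) gD(5) unfolding \<theta>_def by blast
    show "inj_on \<theta> (gr C d \<inter> I)" using \<theta>_inj unfolding inj_on_def by blast
  qed
  have \<theta>_surj: "\<exists>e'\<in>I. \<theta> e' = f e" if "e \<in> carrier C" for e
    using that
  proof (induction rule: carrier_induct)
    case zero
    show ?case using Is(2) fD(4) gD(4) unfolding \<theta>_def by (intro bexI[of _ \<zero>]) auto
  next
    case (add d y z)
    have y: "y \<in> carrier C" using add gr_carrier by blast
    have "f y \<in> gr C d \<inter> I" using fD(5) add y unfolding I_def by blast
    then obtain e1 where e1: "e1 \<in> I" "f y = \<theta> e1" using \<theta>_surj_gr[of d] by blast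
    obtain e2 where e2: "e2 \<in> I" "\<theta> e2 = f z" using add by blast
    have "\<theta> (e1 \<oplus> e2) = f (y \<oplus> z)" using e1 e2 \<theta>_add Is(1) fh(2)[OF y] add by simp
    then show ?case using Is(3)[OF e1(1) e2(1)] by blast
  qed
  have cyc_Z: "c \<in> Z" if "c \<in> cyc I" for c using that Is(1) unfolding cyc_def by auto
  \<comment> \<open>A primitive \<open>e\<close> of \<open>g c\<close> lies in \<open>C\<close> but
    perhaps not in \<open>I\<close>. Solving \<open>\<theta> e' = f e\<close> gives
    \<open>e'\<close> in \<open>I\<close>, and injectivity of \<open>\<theta>\<close> identifies its
    boundary with \<open>c\<close>.\<close>
  have inj: "c \<in> bd C ` I" if c: "c \<in> cyc I" "cl (g c) = cl \<zero>" for c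
  proof -
    note cZ = cyc_Z[OF c(1)]
    have cI: "c \<in> I" using c unfolding cyc_def by auto
    obtain e where e: "e \<in> carrier C" "g c = bd C e" using cl_zero_iff[OF gD(3)[OF cZ]] c(2) by blast
    obtain e' where e': "e' \<in> I" "\<theta> e' = f e" using \<theta>_surj[OF e(1)] by blast
    note e'c = Is(1)[OF e'(1)]
    have "\<theta> c = bd C (f e)" unfolding \<theta>_def e(2) by (rule fD(2)[OF e(1)])
    also have "\<dots> = \<theta> (bd C e')"
      unfolding e'(2)[symmetric] \<theta>_def using gh(1)[OF e'c] gD(2)[OF e'c] fD(2) by simp
    finally have "c = bd C e'" by (rule \<theta>_inj[OF cI I_bd[OF sub e'(1)]])
    then show ?thesis using e'(1) by blast
  qed
  \<comment> \<open>The union over representatives is the map on homology induced by the inclusion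
    of \<open>I\<close>. Following it with \<open>\<gamma>\<close> gives the class of
    \<open>g z\<close>.\<close>
  define \<Psi> where "\<Psi> X = \<gamma> (\<Union>x\<in>X. cl x)" for X
  have cl_hcl: "(\<Union>x\<in>hcl I z. cl x) = cl z" if z: "z \<in> cyc I" for z
  proof (rule SUP_eq_const)
    show "hcl I z \<noteq> {}" unfolding hcl_def a_r_coset_def' using Is(2) by blast
    fix x assume "x \<in> hcl I z"
    then obtain u where u: "u \<in> I" "x = bd C u \<oplus> z" unfolding hcl_def mem_coset by auto
    note uc = Is(1)[OF u(1)] and zZ = cyc_Z[OF z] and zc = Z_carrier[OF cyc_Z[OF z]]
    have "x \<in> Z" unfolding u(2) using submodD(3)[OF Z_sub bd_Z[OF uc] zZ] .
    moreover have "x \<oplus> z = bd C u" unfolding u(2) using uc zc by (simp add: M.a_assoc)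
    ultimately show "cl x = cl z" using cl_eq_iff zZ uc by auto
  qed
  have \<Psi>: "\<Psi> (hcl I z) = \<gamma> (cl z)" "\<Psi> (hcl I z) = cl (g z)" if z: "z \<in> cyc I" for z
  proof -
    show "\<Psi> (hcl I z) = \<gamma> (cl z)" unfolding \<Psi>_def cl_hcl[OF z] ..
    then show "\<Psi> (hcl I z) = cl (g z)"
      using g\<gamma>[of "cl z"] cyc_Z[OF z] homology_map_cl[OF g cyc_Z[OF z]] unfolding H_carrier by auto
  qed
  interpret H: fu_module H by (rule H_module)
  note \<gamma>D = ghomD[OF \<gamma>h]
  note sub\<gamma> = ghom_image_submod[OF \<gamma>h H_module H_module]
  let ?HI = "homology (gsub C I)"
  note cs = submodD[OF cyc_sub[OF sub]]
  have "\<Psi> \<in> ghom 0 ?HI (gsub H (\<gamma> ` carrier H))"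
  proof (rule ghomI[OF hom_module[OF sub] H.fu_module_gsub[OF sub\<gamma>]])
    have clH: "cl z \<in> carrier H" if "z \<in> cyc I" for z using cyc_Z[OF that] unfolding H_carrier by blast
    show "\<Psi> X \<in> carrier (gsub H (\<gamma> ` carrier H))" if "X \<in> carrier ?HI" for X
      using that \<Psi>(1) clH unfolding hom_carrier[OF sub] by auto
    show "\<Psi> (X \<oplus>\<^bsub>?HI\<^esub> Y) = \<Psi> X \<oplus>\<^bsub>gsub H (\<gamma> ` carrier H)\<^esub> \<Psi> Y"
      if XY: "X \<in> carrier ?HI" "Y \<in> carrier ?HI" for X Y
    proof -
      obtain x y where x: "x \<in> cyc I" "X = hcl I x" and y: "y \<in> cyc I" "Y = hcl I y"
        using XY unfolding hom_carrier[OF sub] by blast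
      show ?thesis
        using x y cs(3)[OF x(1) y(1)]
        by (simp add: hom_add[OF sub] \<Psi>(1) H_add[symmetric] cyc_Z \<gamma>D(2) clH)
    qed
    show "\<Psi> (Uvar \<odot>\<^bsub>?HI\<^esub> X) = Uvar \<odot>\<^bsub>gsub H (\<gamma> ` carrier H)\<^esub> \<Psi> X" if X: "X \<in> carrier ?HI" for X
    proof -
      obtain x where x: "x \<in> cyc I" "X = hcl I x" using X unfolding hom_carrier[OF sub] by blast
      show ?thesis
        using x cs(4)[OF x(1)]
        by (simp add: hom_smult[OF sub] \<Psi>(1) H_smult[symmetric] cyc_Z \<gamma>D(3) clH)
    qed
    show "\<Psi> X \<in> gr (gsub H (\<gamma> ` carrier H)) (d + 0)" if X: "X \<in> gr ?HI d" for X d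
    proof -
      obtain x where x: "x \<in> gr C d" "x \<in> cyc I" "X = hcl I x" using X unfolding hom_gr[OF sub] by blast
      have "cl x \<in> gr H d" unfolding H_gr using x(1) cyc_Z[OF x(2)] by blast
      then show ?thesis using \<Psi>(1)[OF x(2)] \<gamma>D(4)[of "cl x" d] clH[OF x(2)] x(3) by simp
    qed
  qed
  moreover have "inj_on \<Psi> (carrier ?HI)"
  proof (rule inj_onI)
    fix X Y assume XY: "X \<in> carrier ?HI" "Y \<in> carrier ?HI" and eq: "\<Psi> X = \<Psi> Y"
    obtain x y where x: "x \<in> cyc I" "X = hcl I x" and y: "y \<in> cyc I" "Y = hcl I y"
      using XY unfolding hom_carrier[OF sub] by blast
    note xZ = gD(3)[OF cyc_Z[OF x(1)]] and yZ = gD(3)[OF cyc_Z[OF y(1)]]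
    have "cl (g x) = cl (g y)" using eq \<Psi>(2) x y by simp
    then have "g x \<oplus> g y \<in> bd C ` carrier C" using cl_eq_iff[OF xZ yZ] by simp
    then have "g (x \<oplus> y) \<in> bd C ` carrier C"
      using gh(2) cyc_Z x(1) y(1) Z_carrier by simp
    then have "cl (g (x \<oplus> y)) = cl \<zero>"
      using cl_zero_iff[OF gD(3)[OF cyc_Z[OF cs(3)[OF x(1) y(1)]]]] by simp
    then have "x \<oplus> y \<in> bd C ` I" by (rule inj[OF cs(3)[OF x(1) y(1)]])
    then show "X = Y" using hcl_eq_iff[OF sub x(1) y(1)] x y by simp
  qed
  moreover have "\<Psi> ` carrier ?HI = \<gamma> ` carrier H"
  proof (intro equalityI subsetI)
    fix Y assume "Y \<in> \<Psi> ` carrier ?HI"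
    then obtain z where "z \<in> cyc I" "Y = \<Psi> (hcl I z)" unfolding hom_carrier[OF sub] by blast
    then show "Y \<in> \<gamma> ` carrier H" using \<Psi>(1) cyc_Z unfolding H_carrier by auto
  next
    fix Y assume "Y \<in> \<gamma> ` carrier H"
    \<comment> \<open>Every element of the image of \<open>\<gamma>\<close> is the image of a class
      represented by a cycle of the form \<open>f z\<close>.\<close>
    then obtain X where X: "X \<in> carrier H" "Y = \<gamma> (homology_map C f X)" using rigid[OF hf] by blast
    obtain z where z: "z \<in> Z" "X = cl z" using X(1) unfolding H_carrier by blast
    have fz: "f z \<in> cyc I" using fD(3)[OF z(1)] Z_carrier[OF z(1)] unfolding I_def cyc_def by blast
    have "Y = \<Psi> (hcl I (f z))" using X(2) \<Psi>(1)[OF fz] homology_map_cl[OF f z(1)] z(2) by simp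
    then show "Y \<in> \<Psi> ` carrier ?HI" using fz unfolding hom_carrier[OF sub] by blast
  qed
  ultimately have "\<Psi> \<in> giso ?HI (gsub H (\<gamma> ` carrier H))"
    unfolding giso_def bij_betw_def by simp
  then show ?thesis unfolding gisomorphic_def I_def by blast
qed

end

section \<open>Graded roots as levelled trees\<close>

context graded_root
begin

lemma edge_V: "E u v \<Longrightarrow> u \<in> V" "E u v \<Longrightarrow> v \<in> V" "E u v \<Longrightarrow> E v u"
  using tree unfolding is_tree_def by blast+

lemma connected: "u \<in> V \<Longrightarrow> v \<in> V \<Longrightarrow> E\<^sup>*\<^sup>* u v"
  using tree unfolding is_tree_def by blast

lemma V_nonempty: "V \<noteq> {}"
  using tree unfolding is_tree_def by blast

lemma chi_diff_Ints: "u \<in> V \<Longrightarrow> v \<in> V \<Longrightarrow> \<chi> v - \<chi> u \<in> \<int>"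
proof -
  assume uv: "u \<in> V" "v \<in> V"
  from connected[OF this] show ?thesis
  proof (induction rule: rtranclp_induct)
    case (step y z)
    have "- (\<chi> y - \<chi> z) \<in> \<int>" using chi_edge[OF step(2)] by (elim disjE) (simp_all only: Ints_minus Ints_1)
    then have "\<chi> z - \<chi> y \<in> \<int>" by simp
    then have "(\<chi> z - \<chi> y) + (\<chi> y - \<chi> u) \<in> \<int>" using step by (intro Ints_add) auto
    then show ?case by simp
  qed simp
qed

definition is_down :: "'v \<Rightarrow> 'v \<Rightarrow> bool" where
  "is_down v w \<longleftrightarrow> E v w \<and> \<chi> v - \<chi> w = 1"

text \<open>Two distinct lower neighbours would violate \<open>chi_max\<close>, both of them lying
  below \<open>v\<close>.\<close>

lemma is_down_unique: "is_down v w \<Longrightarrow> is_down v w' \<Longrightarrow> w = w'"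
  unfolding is_down_def using chi_max[of v w w'] by force

text \<open>If \<open>v\<close> had no lower neighbour, then the vertices above \<open>v\<close> would be closed under adjacency
  and hence exhaust \<open>V\<close>, which would then be finite.\<close>

lemma is_down_ex: assumes v: "v \<in> V" shows "\<exists>w. is_down v w"
proof (rule ccontr)
  assume no: "\<nexists>w. is_down v w"
  have above: "is_down\<^sup>*\<^sup>* u v" if "u \<in> V" for u
    using connected[OF v that]
  proof (induction rule: rtranclp_induct)
    case (step u u')
    consider "is_down u u'" | "is_down u' u"
      using chi_edge[OF step(2)] edge_V(3)[OF step(2)] step(2) unfolding is_down_def by force
    then show ?case
    proof cases
      case 1
      then have "u \<noteq> v" using no by blast
      with step(3) obtain w where w: "is_down u w" "is_down\<^sup>*\<^sup>* w v"
        by (auto elim: converse_rtranclpE)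
      have "w = u'" using w(1) 1 by (rule is_down_unique)
      then show ?thesis using w(2) by simp
    next
      case 2
      then show ?thesis using step(3) by (rule converse_rtranclp_into_rtranclp)
    qed
  qed simp
  have ge: "\<chi> v \<le> \<chi> u" if "is_down\<^sup>*\<^sup>* u v" for u
    using that by (induction rule: converse_rtranclp_induct) (auto simp: is_down_def)
  obtain b where b: "\<And>v. v \<in> V \<Longrightarrow> \<chi> v \<le> b" using chi_bdd by blast
  have "V \<subseteq> (\<Union>i\<in>{0..\<lceil>b - \<chi> v\<rceil>}. {w \<in> V. \<chi> w = \<chi> v + of_int i})"
  proof
    fix u assume u: "u \<in> V"
    obtain i where i: "\<chi> u - \<chi> v = of_int i" using chi_diff_Ints[OF v u] by (auto elim: Ints_cases)
    have "0 \<le> (of_int i :: rat)" using ge[OF above[OF u]] i by simp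
    moreover have "of_int i \<le> b - \<chi> v" using b[OF u] i by simp
    then have "of_int i \<le> (of_int \<lceil>b - \<chi> v\<rceil> :: rat)" by linarith
    ultimately have "i \<in> {0..\<lceil>b - \<chi> v\<rceil>}" by simp
    moreover have "\<chi> u = \<chi> v + of_int i" using i by simp
    ultimately show "u \<in> (\<Union>i\<in>{0..\<lceil>b - \<chi> v\<rceil>}. {w \<in> V. \<chi> w = \<chi> v + of_int i})" using u by blast
  qed
  moreover have "finite (\<Union>i\<in>{0..\<lceil>b - \<chi> v\<rceil>}. {w \<in> V. \<chi> w = \<chi> v + of_int i})"
    using chi_fin by blast
  ultimately show False using infinite_V finite_subset by blast
qed

lemma root_down_eq: "is_down v w \<Longrightarrow> root_down E \<chi> v = w"
  unfolding root_down_def using is_down_unique unfolding is_down_def by blast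

lemma is_down_root_down: "v \<in> V \<Longrightarrow> is_down v (root_down E \<chi> v)"
  using is_down_ex root_down_eq by metis

end

text \<open>A symmetric graded root seen through its descent map: lower neighbours exist and are
  unique, so downward paths are iterates of \<open>dn\<close>; \<open>merge\<close> makes all
  branches join; levels are integers instead of a coset of \<open>Z\<close>.\<close>

locale sroot =
  fixes V :: "'v set" and dn :: "'v \<Rightarrow> 'v" and lv :: "'v \<Rightarrow> int" and J :: "'v \<Rightarrow> 'v"
  assumes dn_V: "v \<in> V \<Longrightarrow> dn v \<in> V"
    and lv_dn: "v \<in> V \<Longrightarrow> lv (dn v) = lv v - 1"
    and lv_bdd: "\<exists>b. \<forall>v\<in>V. lv v \<le> b"
    and lv_fin: "finite {v \<in> V. lv v = k}"
    and merge: "\<exists>k0. \<forall>k\<le>k0. \<exists>w. {v \<in> V. lv v = k} = {w}"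
    and J_V: "v \<in> V \<Longrightarrow> J v \<in> V"
    and J_J: "v \<in> V \<Longrightarrow> J (J v) = v"
    and lv_J: "v \<in> V \<Longrightarrow> lv (J v) = lv v"
    and dn_J: "v \<in> V \<Longrightarrow> dn (J v) = J (dn v)"
    and J_fix: "v \<in> V \<Longrightarrow> w \<in> V \<Longrightarrow> J v = v \<Longrightarrow> J w = w \<Longrightarrow> lv v = lv w \<Longrightarrow> v = w"

lemma (in symmetric_graded_root) integral_levels:
  "\<exists>lv \<chi>0. sroot V (root_down E \<chi>) lv J \<and> (\<forall>v\<in>V. \<chi> v = \<chi>0 + of_int (lv v))"
proof -
  obtain v0 where v0: "v0 \<in> V" using V_nonempty by blast
  \<comment> \<open>The floor is exact, because all values of \<chi> lie in one coset of the
    integers.\<close>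
  define lv where "lv v = \<lfloor>\<chi> v - \<chi> v0\<rfloor>" for v
  have lv: "\<chi> v = \<chi> v0 + of_int (lv v)" if v: "v \<in> V" for v
    using chi_diff_Ints[OF v0 v] unfolding lv_def by (auto elim!: Ints_cases simp: algebra_simps)
  have lv_eq: "lv v = k \<longleftrightarrow> \<chi> v = \<chi> v0 + of_int k" if "v \<in> V" for v k
    using lv[OF that] by auto
  let ?d = "root_down E \<chi>"
  have d: "is_down v (?d v)" "?d v \<in> V" if "v \<in> V" for v
    using is_down_root_down[OF that] edge_V unfolding is_down_def by blast+
  have "sroot V ?d lv J"
  proof
    fix v assume v: "v \<in> V"
    show "?d v \<in> V" using d[OF v] by blast
    have "\<chi> v - \<chi> (?d v) = 1" using d(1)[OF v] unfolding is_down_def by blast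
    then have "(of_int (lv v) :: rat) = of_int (lv (?d v) + 1)" using lv[OF v] lv[OF d(2)[OF v]] by simp
    then show "lv (?d v) = lv v - 1" by (simp only: of_int_eq_iff)
    show "J v \<in> V" "J (J v) = v" using J_closed J_J v by auto
    show "lv (J v) = lv v" unfolding lv_def using J_chi v by simp
    have "is_down (J v) (J (?d v))"
      using d[OF v] J_edge[OF v d(2)[OF v]] J_chi v unfolding is_down_def by simp
    then show "?d (J v) = J (?d v)" by (rule root_down_eq)
  next
    fix v w assume "v \<in> V" "w \<in> V" "J v = v" "J w = w" "lv v = lv w"
    then show "v = w" using J_fixed lv by simp
  next
    obtain b where b: "\<And>v. v \<in> V \<Longrightarrow> \<chi> v \<le> b" using chi_bdd by blast
    have "lv v \<le> \<lfloor>b - \<chi> v0\<rfloor>" if "v \<in> V" for v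
      unfolding lv_def using b[OF that] by (intro floor_mono) simp
    then show "\<exists>b. \<forall>v\<in>V. lv v \<le> b" by blast
  next
    fix k
    have "{v \<in> V. lv v = k} = {v \<in> V. \<chi> v = \<chi> v0 + of_int k}" using lv_eq by blast
    then show "finite {v \<in> V. lv v = k}" using chi_fin by simp
  next
    obtain K where K: "\<And>k. k \<le> K \<Longrightarrow> (\<exists>v\<in>V. k - \<chi> v \<in> \<int>) \<Longrightarrow> card {v \<in> V. \<chi> v = k} = 1"
      using chi_one by blast
    have "\<exists>w. {v \<in> V. lv v = k} = {w}" if k: "k \<le> \<lfloor>K - \<chi> v0\<rfloor>" for k
    proof -
      have "of_int k \<le> K - \<chi> v0" using k by linarith
      then have "card {v \<in> V. \<chi> v = \<chi> v0 + of_int k} = 1"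
        by (intro K) (use v0 in \<open>auto intro!: bexI[of _ v0]\<close>)
      moreover have "{v \<in> V. lv v = k} = {v \<in> V. \<chi> v = \<chi> v0 + of_int k}" using lv_eq by blast
      ultimately show ?thesis by (metis card_1_singletonE)
    qed
    then show "\<exists>k0. \<forall>k\<le>k0. \<exists>w. {v \<in> V. lv v = k} = {w}" by blast
  qed
  then show ?thesis using lv by blast
qed

text \<open>Only meaningful for predicates that are satisfiable and bounded above.\<close>

definition gmax :: "(int \<Rightarrow> bool) \<Rightarrow> int" where
  "gmax P = (SOME m. P m \<and> (\<forall>x. P x \<longrightarrow> x \<le> m))"

lemma gmaxI:
  assumes "P x" "\<And>x. P x \<Longrightarrow> x \<le> b"
  shows "P (gmax P)" and "P y \<Longrightarrow> y \<le> gmax P"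
proof -
  let ?X = "{y \<in> {x..b}. P y}"
  have X: "finite ?X" "x \<in> ?X" using assms by (auto intro: finite_subset[of _ "{x..b}"])
  then have "Max ?X \<in> ?X" by (intro Max_in) auto
  moreover have "y \<le> Max ?X" if "P y" for y
  proof (cases "x \<le> y")
    case True
    then show ?thesis using X that assms by (intro Max_ge) auto
  next
    case False
    then show ?thesis using Max_ge[OF X] by linarith
  qed
  ultimately have "\<exists>m. P m \<and> (\<forall>x. P x \<longrightarrow> x \<le> m)" by blast
  then have "P (gmax P) \<and> (\<forall>x. P x \<longrightarrow> x \<le> gmax P)"
    unfolding gmax_def by (rule someI_ex)
  then show "P (gmax P)" "P y \<Longrightarrow> y \<le> gmax P" by auto
qed

section \<open>The stem, its jumps and the folding map\<close>

context sroot
begin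

text \<open>In the following, \<open>pr v k\<close> is the vertex at level \<open>k\<close> below \<open>v\<close> (and \<open>v\<close> itself if
  \<open>k > lv v\<close>); \<open>S\<close> is the stem of \<open>J\<close>-invariant vertices, with top level \<open>s0\<close>; \<open>st k\<close> is its vertex
  at level \<open>k\<close>, \<open>A k\<close> the greatest level of a vertex above \<open>st k\<close>, and \<open>mt v\<close> the level at which the
  path down from \<open>v\<close> meets the stem. The stem level \<open>t\<close> is a jump if \<open>A\<close> drops right after \<open>t\<close> (or
  \<open>t = s0\<close>), \<open>j k\<close> is the first jump from \<open>k\<close> on, and \<open>Y t\<close> is a vertex of greatest level above
  \<open>st t\<close>.\<close>

definition pr :: "'v \<Rightarrow> int \<Rightarrow> 'v" where
  "pr v k = (dn ^^ nat (lv v - k)) v"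

lemma dn_pow: "v \<in> V \<Longrightarrow> (dn ^^ n) v \<in> V \<and> lv ((dn ^^ n) v) = lv v - int n \<and> (dn ^^ n) (J v) = J ((dn ^^ n) v)"
  by (induction n) (auto simp: dn_V lv_dn dn_J)

lemma dn_pow_pr: "v \<in> V \<Longrightarrow> (dn ^^ n) v = pr v (lv v - int n)"
  by (simp add: pr_def)

lemma pr_V: "v \<in> V \<Longrightarrow> pr v k \<in> V"
  and lv_pr: "v \<in> V \<Longrightarrow> k \<le> lv v \<Longrightarrow> lv (pr v k) = k"
  and pr_J: "v \<in> V \<Longrightarrow> pr (J v) k = J (pr v k)"
  unfolding pr_def using dn_pow lv_J by auto

lemma pr_self [simp]: "pr v (lv v) = v"
  by (simp add: pr_def)

lemma dn_pr: "v \<in> V \<Longrightarrow> k \<le> lv v \<Longrightarrow> dn (pr v k) = pr v (k - 1)"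
proof -
  assume "k \<le> lv v"
  then have "nat (lv v - (k - 1)) = Suc (nat (lv v - k))" by simp
  then show ?thesis by (simp add: pr_def)
qed

lemma pr_pr: "v \<in> V \<Longrightarrow> l \<le> k \<Longrightarrow> k \<le> lv v \<Longrightarrow> pr (pr v k) l = pr v l"
proof -
  assume a: "v \<in> V" "l \<le> k" "k \<le> lv v"
  have "nat (k - l) + nat (lv v - k) = nat (lv v - l)" using a by simp
  then have "(dn ^^ nat (k - l)) ((dn ^^ nat (lv v - k)) v) = (dn ^^ nat (lv v - l)) v"
    by (metis comp_apply funpow_add)
  then show ?thesis using lv_pr[OF a(1,3)] by (simp add: pr_def)
qed

lemma pr_dn: "v \<in> V \<Longrightarrow> k < lv v \<Longrightarrow> pr (dn v) k = pr v k"
  using pr_pr[of v k "lv v - 1"] dn_pr[of v "lv v"] by simp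

definition S :: "'v set" where "S = {v \<in> V. J v = v}"

lemma S_V: "v \<in> S \<Longrightarrow> v \<in> V" and S_J: "v \<in> S \<Longrightarrow> J v = v" by (auto simp: S_def)

lemma S_unique: "v \<in> S \<Longrightarrow> w \<in> S \<Longrightarrow> lv v = lv w \<Longrightarrow> v = w"
  using J_fix by (auto simp: S_def)

lemma S_pr: "v \<in> S \<Longrightarrow> pr v k \<in> S"
  using pr_V pr_J[of v k] by (auto simp: S_def)

definition low :: int where "low = (SOME k0. \<forall>k\<le>k0. \<exists>w. {v \<in> V. lv v = k} = {w})"

lemma low: "k \<le> low \<Longrightarrow> \<exists>w. {v \<in> V. lv v = k} = {w}"
  using someI_ex[OF merge] unfolding low_def by blast

text \<open>\<open>J\<close> preserves levels, so it fixes the only vertex of a low level. In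
  particular the stem is nonempty.\<close>

lemma low_S: assumes v: "v \<in> V" "lv v \<le> low" shows "v \<in> S"
proof -
  obtain w where w: "{u \<in> V. lv u = lv v} = {w}" using low[OF v(2)] by blast
  have "v \<in> {u \<in> V. lv u = lv v}" "J v \<in> {u \<in> V. lv u = lv v}" using v lv_J J_V by auto
  then show ?thesis unfolding w S_def using v by auto
qed

lemma S_low: assumes "k \<le> low" shows "\<exists>v\<in>S. lv v = k"
proof -
  obtain w where "{v \<in> V. lv v = k} = {w}" using low[OF assms] ..
  then have w: "w \<in> V" "lv w = k" by auto
  then have "w \<in> S" using low_S assms by simp
  then show ?thesis using w by blast
qed

definition bd_lv :: int where "bd_lv = (SOME b. \<forall>v\<in>V. lv v \<le> b)"

lemma bd_lv: "v \<in> V \<Longrightarrow> lv v \<le> bd_lv"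
  using someI_ex[OF lv_bdd] unfolding bd_lv_def by blast

definition s0 :: int where "s0 = gmax (\<lambda>k. \<exists>v\<in>S. lv v = k)"

lemma s0: "\<exists>v\<in>S. lv v = s0" and s0_ge: "v \<in> S \<Longrightarrow> lv v \<le> s0"
proof -
  let ?P = "\<lambda>k. \<exists>v\<in>S. lv v = k"
  have P: "?P low" "\<And>k. ?P k \<Longrightarrow> k \<le> bd_lv" using S_low[of low] bd_lv S_V by auto
  show "\<exists>v\<in>S. lv v = s0" unfolding s0_def using gmaxI(1)[of ?P, OF P] .
  show "v \<in> S \<Longrightarrow> lv v \<le> s0" unfolding s0_def using gmaxI(2)[of ?P, OF P] by blast
qed

definition st :: "int \<Rightarrow> 'v" where "st k = (THE v. v \<in> S \<and> lv v = k)"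

lemma st_eq: "v \<in> S \<Longrightarrow> st (lv v) = v"
  unfolding st_def using S_unique by blast

lemma st: "k \<le> s0 \<Longrightarrow> st k \<in> S" "k \<le> s0 \<Longrightarrow> lv (st k) = k"
proof -
  assume k: "k \<le> s0"
  obtain v where v: "v \<in> S" "lv v = s0" using s0 by blast
  have w: "pr v k \<in> S" "lv (pr v k) = k" using S_pr lv_pr S_V k v by auto
  then show "st k \<in> S" "lv (st k) = k" using st_eq by fastforce+
qed

lemma pr_st: "k \<le> l \<Longrightarrow> l \<le> s0 \<Longrightarrow> pr (st l) k = st k"
  using st_eq[OF S_pr[OF st(1)], of l k] lv_pr[OF S_V[OF st(1)], of l k] st(2)[of l] by simp

definition A :: "int \<Rightarrow> int" where
  "A k = gmax (\<lambda>h. \<exists>u\<in>V. lv u = h \<and> k \<le> h \<and> pr u k = st k)"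

lemma A_ex: "k \<le> s0 \<Longrightarrow> \<exists>u\<in>V. lv u = A k \<and> pr u k = st k"
  and A_ge: "k \<le> s0 \<Longrightarrow> k \<le> A k"
  and A_ub: "k \<le> s0 \<Longrightarrow> u \<in> V \<Longrightarrow> k \<le> lv u \<Longrightarrow> pr u k = st k \<Longrightarrow> lv u \<le> A k"
proof -
  assume k: "k \<le> s0"
  let ?P = "\<lambda>h. \<exists>u\<in>V. lv u = h \<and> k \<le> h \<and> pr u k = st k"
  have P: "?P k" "\<And>h. ?P h \<Longrightarrow> h \<le> bd_lv"
    using bd_lv st[OF k] S_V pr_self[of "st k"] by (auto intro!: bexI[of _ "st k"])
  note g = gmaxI[of ?P, OF P, folded A_def]
  show "\<exists>u\<in>V. lv u = A k \<and> pr u k = st k" "k \<le> A k" using g(1) by blast+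
  show "lv u \<le> A k" if "u \<in> V" "k \<le> lv u" "pr u k = st k" using g(2) that by blast
qed

lemma A_mono: assumes "k \<le> l" "l \<le> s0" shows "A l \<le> A k"
proof -
  obtain u where u: "u \<in> V" "lv u = A l" "pr u l = st l" using A_ex assms(2) by blast
  have "l \<le> lv u" using A_ge assms u by simp
  then have "pr u k = st k" using pr_pr[of u k l] u assms pr_st by simp
  then show ?thesis using A_ub[of k u] u assms \<open>l \<le> lv u\<close> by simp
qed

definition mt :: "'v \<Rightarrow> int" where "mt v = gmax (\<lambda>k. k \<le> lv v \<and> pr v k \<in> S)"

lemma mt: "v \<in> V \<Longrightarrow> mt v \<le> lv v" "v \<in> V \<Longrightarrow> pr v (mt v) \<in> S"
  and mt_ge: "v \<in> V \<Longrightarrow> k \<le> lv v \<Longrightarrow> pr v k \<in> S \<Longrightarrow> k \<le> mt v"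
proof -
  assume v: "v \<in> V"
  let ?P = "\<lambda>k. k \<le> lv v \<and> pr v k \<in> S"
  have P: "?P (min low (lv v))" "\<And>k. ?P k \<Longrightarrow> k \<le> lv v"
    using low_S[OF pr_V[OF v, of "min low (lv v)"]] lv_pr[OF v] by auto
  note g = gmaxI[of ?P, OF P, folded mt_def]
  show "mt v \<le> lv v" "pr v (mt v) \<in> S" using g(1) by blast+
  show "k \<le> mt v" if "k \<le> lv v" "pr v k \<in> S" using g(2) that by blast
qed

lemma mt_iff: "v \<in> V \<Longrightarrow> k \<le> lv v \<Longrightarrow> pr v k \<in> S \<longleftrightarrow> k \<le> mt v"
  using mt_ge mt S_pr[of "pr v (mt v)" k] pr_pr[of v k "mt v"] by auto

lemma pr_eq_st: "v \<in> V \<Longrightarrow> k \<le> mt v \<Longrightarrow> pr v k = st k"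
  using mt_iff[of v k] mt(1)[of v] st_eq[of "pr v k"] lv_pr[of v k] by simp

lemma pr_eq_st_iff: "v \<in> V \<Longrightarrow> k \<le> lv v \<Longrightarrow> k \<le> s0 \<Longrightarrow> pr v k = st k \<longleftrightarrow> k \<le> mt v"
  using pr_eq_st mt_ge st(1) by auto

lemma mt_s0: "v \<in> V \<Longrightarrow> mt v \<le> s0"
  using s0_ge[OF mt(2)] lv_pr[OF _ mt(1)] by simp

lemma lv_le_A: "v \<in> V \<Longrightarrow> k \<le> mt v \<Longrightarrow> lv v \<le> A k"
  using A_ub[of k v] pr_eq_st[of v k] mt(1)[of v] mt_s0[of v] by simp

lemma mt_S: "v \<in> S \<Longrightarrow> mt v = lv v"
  using mt_ge[of v "lv v"] mt(1)[of v] S_V[of v] by simp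

lemma mt_notS: "v \<in> V \<Longrightarrow> v \<notin> S \<Longrightarrow> mt v < lv v"
  using mt(1,2)[of v] pr_self[of v] by (metis order_le_imp_less_or_eq)

lemma mt_J: "v \<in> V \<Longrightarrow> mt (J v) = mt v"
proof -
  assume v: "v \<in> V"
  have "pr (J v) k \<in> S \<longleftrightarrow> pr v k \<in> S" for k
    using pr_J[OF v, of k] pr_V[OF v, of k] J_V[of "pr v k"] J_J[of "pr v k"] unfolding S_def by auto
  then show ?thesis unfolding mt_def using lv_J[OF v] by simp
qed

lemma mt_pr: assumes "v \<in> V" "k \<le> lv v" shows "mt (pr v k) = min (mt v) k"
proof (rule antisym)
  note p = pr_V[OF assms(1), of k] and l = lv_pr[OF assms]
  have "pr (pr v k) (mt (pr v k)) = pr v (mt (pr v k))"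
    using pr_pr[OF assms(1) _ assms(2)] mt(1)[OF p] l by simp
  then have "mt (pr v k) \<le> mt v" using mt(2)[OF p] mt(1)[OF p] l assms mt_ge by simp
  then show "mt (pr v k) \<le> min (mt v) k" using mt(1)[OF p] l by simp
  have "pr (pr v k) (min (mt v) k) = pr v (min (mt v) k)"
    using pr_pr[OF assms(1) _ assms(2)] by simp
  moreover have "pr v (min (mt v) k) \<in> S" using mt_iff[OF assms(1)] mt(1)[OF assms(1)] by simp
  ultimately show "min (mt v) k \<le> mt (pr v k)" using mt_ge[OF p] l by simp
qed

lemma mt_dn: "v \<in> V \<Longrightarrow> v \<notin> S \<Longrightarrow> mt (dn v) = mt v"
  using mt_pr[of v "lv v - 1"] dn_pr[of v "lv v"] mt_notS[of v] by simp

definition j :: "int \<Rightarrow> int" where "j k = gmax (\<lambda>t. t \<le> s0 \<and> A t = A k)"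

lemma j: "k \<le> s0 \<Longrightarrow> j k \<le> s0" "k \<le> s0 \<Longrightarrow> A (j k) = A k" "k \<le> s0 \<Longrightarrow> k \<le> j k"
  "k \<le> s0 \<Longrightarrow> t \<le> s0 \<Longrightarrow> A t = A k \<Longrightarrow> t \<le> j k"
proof -
  assume k: "k \<le> s0"
  let ?P = "\<lambda>t. t \<le> s0 \<and> A t = A k"
  have P: "?P k" "\<And>t. ?P t \<Longrightarrow> t \<le> s0" using k by auto
  note g = gmaxI[of ?P, OF P, folded j_def]
  show "j k \<le> s0" "A (j k) = A k" using g(1) by blast+
  show "k \<le> j k" using g(2) P(1) by blast
  show "t \<le> j k" if "t \<le> s0" "A t = A k" using g(2) that by blast
qed

definition jump :: "int \<Rightarrow> bool" where "jump t \<longleftrightarrow> t \<le> s0 \<and> j t = t"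

lemma jump_j: "k \<le> s0 \<Longrightarrow> jump (j k)"
  unfolding jump_def using j(1,2,3,4)[of k] j(3,4)[of "j k"] j(1,2)[of "j k"] by force

lemma jump_s0: "jump s0"
  unfolding jump_def using j(1,3)[of s0] by simp

lemma jump_le: "jump t \<Longrightarrow> t \<le> s0" unfolding jump_def by simp

text \<open>\<open>A\<close> is weakly decreasing, and a jump is the last level at which
  \<open>A\<close> takes its value.\<close>

lemma jump_less: assumes "jump t" "t < u" "u \<le> s0" shows "A u < A t"
proof -
  have "A u \<le> A t" using A_mono assms by simp
  moreover have "A u \<noteq> A t" using j(4)[of t u] assms unfolding jump_def by auto
  ultimately show ?thesis by simp
qed

lemma jumpI: assumes "t \<le> s0" "t < s0 \<Longrightarrow> A (t + 1) < A t" shows "jump t"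
proof -
  have "j t = t"
  proof (rule ccontr)
    assume "j t \<noteq> t"
    then have "t < j t" using j(3)[OF assms(1)] by simp
    then show False using assms j(1,2)[OF assms(1)] A_mono[of "t + 1" "j t"] by simp
  qed
  then show ?thesis unfolding jump_def using assms by simp
qed

definition Y :: "int \<Rightarrow> 'v" where "Y t = (SOME u. u \<in> V \<and> lv u = A t \<and> pr u t = st t)"

lemma Y: "t \<le> s0 \<Longrightarrow> Y t \<in> V \<and> lv (Y t) = A t \<and> pr (Y t) t = st t"
  unfolding Y_def by (rule someI_ex) (use A_ex[of t] in blast)

lemma Y_V: "jump t \<Longrightarrow> Y t \<in> V" and lv_Y: "jump t \<Longrightarrow> lv (Y t) = A t" and pr_Y: "jump t \<Longrightarrow> pr (Y t) t = st t"
  using Y jump_le by auto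

text \<open>If \<open>Y t\<close> stayed on the stem up to \<open>t + 1\<close>, then
  \<open>A (t + 1)\<close> would be at least \<open>A t\<close>, against the drop after the jump
  \<open>t\<close>.\<close>

lemma mt_Y: assumes "jump t" shows "mt (Y t) = t"
proof -
  note t = jump_le[OF assms] and Yt = Y_V[OF assms] lv_Y[OF assms]
  have "t \<le> mt (Y t)" using mt_ge[OF Yt(1), of t] pr_Y[OF assms] st(1)[OF t] Yt(2) A_ge[OF t] by simp
  moreover have False if "t < mt (Y t)"
  proof -
    have "t + 1 \<le> s0" using mt_s0[OF Yt(1)] that by simp
    moreover have "A t \<le> A (t + 1)" using lv_le_A[OF Yt(1), of "t + 1"] that Yt(2) by simp
    ultimately show False using jump_less[OF assms, of "t + 1"] by simp
  qed
  ultimately show ?thesis by force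
qed

text \<open>A choice of one branch out of every pair of branches swapped by \<open>J\<close>.\<close>

definition cr :: "'v \<Rightarrow> 'v" where "cr v = pr v (mt v + 1)"

definition side :: "'v \<Rightarrow> bool" where "side v \<longleftrightarrow> cr v = (SOME x. x \<in> {cr v, J (cr v)})"

text \<open>\<open>v\<close> and \<open>J v\<close> determine the same unordered pair, from which
  one element is chosen. The pair has two elements because \<open>cr v\<close> lies just off the
  stem.\<close>

lemma side_J: assumes v: "v \<in> V" "v \<notin> S" shows "side (J v) \<longleftrightarrow> \<not> side v"
proof -
  have l: "mt v + 1 \<le> lv v" using mt_notS[OF v] by simp
  have c: "cr v \<in> V" "cr v \<notin> S" unfolding cr_def using pr_V v mt_iff[OF v(1) l] by auto
  have cJ: "cr (J v) = J (cr v)" unfolding cr_def using pr_J v mt_J by simp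
  have "{cr (J v), J (cr (J v))} = {cr v, J (cr v)}" unfolding cJ using J_J c by auto
  moreover have "(SOME x. x \<in> {cr v, J (cr v)}) \<in> {cr v, J (cr v)}" by (rule someI[of _ "cr v"]) simp
  moreover have "cr v \<noteq> J (cr v)" using c unfolding S_def by auto
  ultimately show ?thesis unfolding side_def cJ by auto
qed

lemma side_dn: assumes v: "v \<in> V" "dn v \<notin> S" shows "side (dn v) = side v"
proof -
  have vS: "v \<notin> S" using v S_pr[of v "lv v - 1"] dn_pr[of v "lv v"] by auto
  have "mt v + 1 < lv v"
  proof -
    have "mt v < lv v - 1"
      using mt_notS[OF dn_V[OF v(1)] v(2)] mt_dn[OF v(1) vS] lv_dn[OF v(1)] by simp
    then show ?thesis by simp
  qed
  then have "cr (dn v) = cr v" unfolding cr_def mt_dn[OF v(1) vS] using pr_dn v by simp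
  then show ?thesis unfolding side_def by simp
qed

text \<open>\<open>A\<close> has the same value at \<open>mt v\<close> and at
  \<open>j (mt v)\<close>, so the branch of \<open>Y\<close> at this jump is tall enough to receive
  \<open>v\<close>. Using \<open>side\<close> to choose between it and its mirror image makes the
  folding commute with \<open>J\<close>.\<close>

definition fold_map :: "'v \<Rightarrow> 'v" where
  "fold_map v = (if v \<in> S then v else
     let u = pr (Y (j (mt v))) (lv v) in if side v then u else J u)"

text \<open>A jump with \<open>A t = t\<close>, possible only for \<open>t = s0\<close>, adds no
  branch.\<close>

definition V' :: "'v set" where
  "V' = S \<union> {pr (Y t) k | t k. jump t \<and> t < k \<and> k \<le> A t} \<union> {J (pr (Y t) k) | t k. jump t \<and> t < k \<and> k \<le> A t}"

lemma V'_cases [consumes 1, case_names stem path path_J]: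
  assumes "v \<in> V'"
  obtains "v \<in> S" | t where "jump t" "t < lv v" "lv v \<le> A t" "pr (Y t) (lv v) = v"
    | t where "jump t" "t < lv v" "lv v \<le> A t" "J (pr (Y t) (lv v)) = v"
proof -
  have "lv (pr (Y t) k) = k" "lv (J (pr (Y t) k)) = k" if "jump t" "k \<le> A t" for t k
    using that lv_pr[OF Y_V] lv_Y lv_J pr_V[OF Y_V] by auto
  then show thesis using assms that unfolding V'_def by auto
qed

lemma V'_V: "v \<in> V' \<Longrightarrow> v \<in> V"
  unfolding V'_def using S_V pr_V[OF Y_V] J_V by auto

lemma V'_pathI: assumes "jump t" "k \<le> A t" shows "pr (Y t) k \<in> V'" "J (pr (Y t) k) \<in> V'"
proof -
  have "pr (Y t) k \<in> V' \<and> J (pr (Y t) k) \<in> V'"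
  proof (cases "t < k")
    case True
    then show ?thesis unfolding V'_def using assms by blast
  next
    case False
    then have "pr (Y t) k \<in> S" using mt_iff[OF Y_V[OF assms(1)], of k] mt_Y[OF assms(1)] lv_Y[OF assms(1)] assms by simp
    then show ?thesis unfolding V'_def using S_J by auto
  qed
  then show "pr (Y t) k \<in> V'" "J (pr (Y t) k) \<in> V'" by auto
qed

lemma V'_J: assumes "v \<in> V'" shows "J v \<in> V'"
  using assms
proof (cases rule: V'_cases)
  case stem
  then show ?thesis using S_J unfolding V'_def by auto
next
  case (path t)
  then show ?thesis using V'_pathI(2) by metis
next
  case (path_J t)
  then have "J v = pr (Y t) (lv v)" using J_J[OF pr_V[OF Y_V]] by metis
  then show ?thesis using V'_pathI(1) path_J by simp
qed

lemma V'_dn: assumes "v \<in> V'" shows "dn v \<in> V'"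
  using assms
proof (cases rule: V'_cases)
  case stem
  then show ?thesis using S_pr[of v "lv v - 1"] dn_pr[of v "lv v"] S_V unfolding V'_def by auto
next
  case (path t)
  then have "dn v = pr (Y t) (lv v - 1)" using dn_pr[OF Y_V, of t "lv v"] lv_Y by metis
  then show ?thesis using V'_pathI(1)[of t "lv v - 1"] path by simp
next
  case (path_J t)
  then have "dn v = J (pr (Y t) (lv v - 1))"
    using dn_pr[OF Y_V, of t "lv v"] lv_Y dn_J[OF pr_V[OF Y_V]] by metis
  then show ?thesis using V'_pathI(2)[of t "lv v - 1"] path_J by simp
qed

lemma jump_mt: "v \<in> V \<Longrightarrow> jump (j (mt v))"
  using jump_j mt_s0 by blast

lemma lv_le_target: "v \<in> V \<Longrightarrow> lv v \<le> A (j (mt v))"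
  using lv_le_A[of v "mt v"] j(2)[OF mt_s0] by simp

lemma fold_map_V': assumes v: "v \<in> V" shows "fold_map v \<in> V'"
  unfolding fold_map_def Let_def
  using V'_pathI[OF jump_mt[OF v] lv_le_target[OF v]] by (auto simp: V'_def)

lemma lv_fold_map: assumes v: "v \<in> V" shows "lv (fold_map v) = lv v"
  unfolding fold_map_def Let_def
  using lv_pr[OF Y_V[OF jump_mt[OF v]]] lv_Y[OF jump_mt[OF v]] lv_le_target[OF v]
    lv_J[OF pr_V[OF Y_V[OF jump_mt[OF v]]]] by simp

lemma fold_map_S: "v \<in> S \<Longrightarrow> fold_map v = v"
  by (simp add: fold_map_def)

lemma fold_map_J: assumes v: "v \<in> V" shows "fold_map (J v) = J (fold_map v)"
proof (cases "v \<in> S")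
  case True
  then show ?thesis using S_J by (simp add: fold_map_def)
next
  case False
  have "J v \<notin> S" using False v J_J unfolding S_def by auto
  then show ?thesis
    using False side_J[OF v False] mt_J[OF v] lv_J[OF v] J_J[OF pr_V[OF Y_V[OF jump_mt[OF v]]]]
    by (simp add: fold_map_def Let_def)
qed

text \<open>Off the stem both sides descend along the same target branch. When \<open>dn v\<close>
  reaches the stem, at level \<open>mt v\<close>, the target path is on the stem too, because its
  branch leaves at \<open>j (mt v)\<close>, which is not below \<open>mt v\<close>.\<close>

lemma fold_map_dn: assumes v: "v \<in> V" shows "fold_map (dn v) = dn (fold_map v)"
proof (cases "v \<in> S")
  case True
  then have "dn v \<in> S" using S_pr[of v "lv v - 1"] dn_pr[of v "lv v"] v by auto
  then show ?thesis using True by (simp add: fold_map_S)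
next
  case False
  let ?t = "j (mt v)"
  note jt = jump_mt[OF v]
  note Yt = Y_V[OF jt] lv_Y[OF jt]
  have d: "dn (pr (Y ?t) (lv v)) = pr (Y ?t) (lv v - 1)"
    using dn_pr[OF Yt(1)] Yt(2) lv_le_target[OF v] by simp
  have dJ: "dn (J (pr (Y ?t) (lv v))) = J (pr (Y ?t) (lv v - 1))"
    using d dn_J[OF pr_V[OF Yt(1)]] by simp
  show ?thesis
  proof (cases "dn v \<in> S")
    case True
    have m: "mt v = lv v - 1" using mt_S[OF True] mt_dn[OF v False] lv_dn[OF v] by simp
    have "dn v = st (mt v)" using st_eq[OF True] m lv_dn[OF v] by simp
    moreover have "pr (Y ?t) (mt v) = st (mt v)"
      using pr_eq_st[OF Yt(1)] mt_Y[OF jt] j(3)[OF mt_s0[OF v]] by simp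
    moreover have "J (st (mt v)) = st (mt v)" using S_J st(1) mt_s0[OF v] by simp
    ultimately show ?thesis using True False d dJ m by (simp add: fold_map_def Let_def)
  next
    case nS: False
    then show ?thesis
      using False d dJ side_dn[OF v nS] mt_dn[OF v False] lv_dn[OF v] by (simp add: fold_map_def Let_def)
  qed
qed

end

section \<open>Linear maps on the span of the vertices\<close>

text \<open>Push-forward along a map of vertices. The involution is \<open>lin J\<close>, and
  \<open>U\<close> will act as \<open>lin dn\<close>.\<close>

definition lin :: "('v \<Rightarrow> 'w) \<Rightarrow> ('v \<Rightarrow>\<^sub>0 bit) \<Rightarrow> ('w \<Rightarrow>\<^sub>0 bit)" where
  "lin f x = (\<Sum>v\<in>keys x. single (f v) (lookup x v))"

abbreviation vert :: "'v \<Rightarrow> 'v \<Rightarrow>\<^sub>0 bit" where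
  "vert v \<equiv> single v 1"

lemma pm_double [simp]: "(x :: 'v \<Rightarrow>\<^sub>0 bit) + x = 0"
  by (rule poly_mapping_eqI) (simp only: lookup_add bit_double lookup_zero)

lemma lookup_eq_1: "v \<in> keys x \<Longrightarrow> lookup x v = (1::bit)"
  by (metis bit_not_zero_iff in_keys_iff)

lemma lookup_bit: "lookup x v = (if v \<in> keys x then 1 else (0::bit))"
  by (simp add: lookup_eq_1 in_keys_iff)

lemma lin_superset:
  assumes "finite B" "keys x \<subseteq> B"
  shows "lin f x = (\<Sum>v\<in>B. single (f v) (lookup x v))"
  unfolding lin_def by (rule sum.mono_neutral_left) (use assms in \<open>auto simp: in_keys_iff\<close>)

lemma lin_add: "lin f (x + y) = lin f x + lin f y"
proof -
  let ?B = "keys x \<union> keys y"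
  have "lin f (x + y) = (\<Sum>v\<in>?B. single (f v) (lookup (x + y) v))"
    by (rule lin_superset) (use keys_add[of x y] in auto)
  also have "\<dots> = (\<Sum>v\<in>?B. single (f v) (lookup x v)) +
     (\<Sum>v\<in>?B. single (f v) (lookup y v))"
    by (simp only: lookup_add single_add sum.distrib)
  also have "\<dots> = lin f x + lin f y"
    using lin_superset[of ?B x f] lin_superset[of ?B y f] by simp
  finally show ?thesis .
qed

lemma lin_zero [simp]: "lin f 0 = 0"
  by (simp add: lin_def)

lemma lin_vert [simp]: "lin f (vert v) = vert (f v)"
  by (simp add: lin_def)

lemma lin_sum: "lin f (sum g I) = (\<Sum>i\<in>I. lin f (g i))"
  by (induction I rule: infinite_finite_induct) (simp_all add: lin_add)

lemma pm_eq_sum_vert: "x = (\<Sum>v\<in>keys x. vert v)" for x :: "'v \<Rightarrow>\<^sub>0 bit"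
proof (rule poly_mapping_eqI)
  fix w
  have "lookup (\<Sum>v\<in>keys x. vert v) w =
     (\<Sum>v\<in>keys x. if v = w then 1 else (0::bit))"
    by (simp add: lookup_sum lookup_single when_def)
  also have "\<dots> = lookup x w" by (simp add: lookup_bit sum.delta)
  finally show "lookup x w = lookup (\<Sum>v\<in>keys x. vert v) w" ..
qed

lemma span_induct [consumes 1, case_names zero add]:
  fixes x :: "'v \<Rightarrow>\<^sub>0 bit"
  assumes keys: "keys x \<subseteq> X" and zero: "P 0"
    and add: "\<And>v y. v \<in> X \<Longrightarrow> P y \<Longrightarrow> P (vert v + y)"
  shows "P x"
proof -
  have *: "P (\<Sum>v\<in>K. vert v)" if "finite K" "K \<subseteq> X" for K
    using that by (induction K) (simp_all add: zero add)
  show ?thesis by (subst pm_eq_sum_vert[of x], rule *) (use keys in simp_all)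
qed

lemma lin_eq_sum: "lin f x = (\<Sum>v\<in>keys x. vert (f v))"
  by (subst pm_eq_sum_vert[of x]) (simp only: lin_sum lin_vert)

lemma lin_lin: "lin f (lin g x) = lin (\<lambda>v. f (g v)) x"
  by (simp only: lin_eq_sum[of g] lin_eq_sum[of "\<lambda>v. f (g v)"] lin_sum lin_vert)

lemma lin_pow_pow: "lin (f ^^ m) (lin (f ^^ n) x) = lin (f ^^ (m + n)) x" for f :: "'v \<Rightarrow> 'v"
  by (simp add: lin_lin funpow_add o_def)

lemma lin_cong: "(\<And>v. v \<in> keys x \<Longrightarrow> f v = g v) \<Longrightarrow> lin f x = lin g x"
  unfolding lin_def by (rule sum.cong) auto

lemma lin_id: "(\<And>v. v \<in> keys x \<Longrightarrow> f v = v) \<Longrightarrow> lin f x = x"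
  using lin_cong[of x f "\<lambda>v. v"] pm_eq_sum_vert[of x] lin_eq_sum[of "\<lambda>v. v" x] by simp

lemma keys_lin: "keys (lin f x) \<subseteq> f ` keys x"
  unfolding lin_eq_sum by (rule order_trans[OF keys_sum]) auto

lemma keys_add_subset: "keys x \<subseteq> X \<Longrightarrow> keys y \<subseteq> X \<Longrightarrow> keys (x + y) \<subseteq> X"
  using keys_add[of x y] by blast

text \<open>The sum of the coefficients over \<open>X\<close>, written as a coefficient of a push-forward in order
  to inherit its functoriality.\<close>

definition sm :: "'v set \<Rightarrow> ('v \<Rightarrow>\<^sub>0 bit) \<Rightarrow> bit" where
  "sm X x = lookup (lin (\<lambda>v. v \<in> X) x) True"

lemma sm_add: "sm X (x + y) = sm X x + sm X y"
  by (simp add: sm_def lin_add lookup_add)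

lemma sm_zero [simp]: "sm X 0 = 0"
  by (simp add: sm_def)

lemma sm_vert: "sm X (vert v) = (if v \<in> X then 1 else 0)"
  by (simp add: sm_def lookup_single)

lemma sm_lin: "sm X (lin f x) = sm {v. f v \<in> X} x"
  by (simp add: sm_def lin_lin)

lemma sm_sum: "sm X (sum g I) = (\<Sum>i\<in>I. sm X (g i))"
  by (induction I rule: infinite_finite_induct) (simp_all add: sm_add)

lemma sm_cong: "(\<And>v. v \<in> keys x \<Longrightarrow> v \<in> X \<longleftrightarrow> v \<in> X') \<Longrightarrow> sm X x = sm X' x"
  unfolding sm_def by (subst lin_cong) auto

lemma sm_card: "sm X x = of_nat (card (keys x \<inter> X))"
proof -
  have "sm X x = (\<Sum>v\<in>keys x. if v \<in> X then 1 else 0)"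
    by (subst pm_eq_sum_vert[of x]) (simp only: sm_sum sm_vert)
  also have "\<dots> = (\<Sum>v\<in>keys x \<inter> X. 1)"
    by (simp add: sum.If_cases)
  finally show ?thesis by simp
qed

lemma sm_singleton: "sm {v} x = lookup x v"
  by (cases "v \<in> keys x") (simp_all add: sm_card lookup_bit)

lemma sm_Un: "X \<inter> X' = {} \<Longrightarrow> sm (X \<union> X') x = sm X x + sm X' x"
  unfolding sm_card by (simp add: Int_Un_distrib card_Un_disjoint Int_commute inf_left_commute disjoint_iff)

text \<open>The augmentation; its kernel on a single level is the torsion, see
  \<open>tors_iff_eps\<close>.\<close>

abbreviation eps :: "('v \<Rightarrow>\<^sub>0 bit) \<Rightarrow> bit" where "eps \<equiv> sm UNIV"

lemma eps_lin: "eps (lin f x) = eps x"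
  by (simp add: sm_lin)

lemma of_nat_bit: "(of_nat n :: bit) = (if even n then 0 else 1)"
  by (induction n) auto

lemma even_card_involution:
  assumes "finite X" "\<And>x. x \<in> X \<Longrightarrow> J x \<in> X" "\<And>x. x \<in> X \<Longrightarrow> J (J x) = x" "\<And>x. x \<in> X \<Longrightarrow> J x \<noteq> x"
  shows "even (card X)"
  using assms
proof (induction "card X" arbitrary: X rule: less_induct)
  case less
  show ?case
  proof (cases "X = {}")
    case False
    then obtain x where x: "x \<in> X" by blast
    note J = less.prems(2-4)
    let ?X = "X - {x, J x}"
    have "card ?X < card X" using x less.prems(1) by (intro psubset_card_mono) auto
    moreover have "J y \<in> ?X" if "y \<in> ?X" for y using that J x by (metis DiffD1 DiffD2 DiffI insertE insertI1 insertI2 singletonD)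
    ultimately have "even (card ?X)" using less by (intro less.hyps) auto
    moreover have "card X = card ?X + 2"
    proof -
      have "card {x, J x} = 2" using J(3)[OF x] by auto
      moreover have "card {x, J x} \<le> card X" using x J less.prems(1) by (intro card_mono) auto
      ultimately show ?thesis using x J less.prems(1) by (subst card_Diff_subset) auto
    qed
    ultimately show ?thesis by simp
  qed simp
qed

lemma parity_involution:
  assumes "finite X" "\<And>x. x \<in> X \<Longrightarrow> J x \<in> X" "\<And>x. x \<in> X \<Longrightarrow> J (J x) = x"
  shows "even (card X) \<longleftrightarrow> even (card {x \<in> X. J x = x})"
proof -
  have "even (card {x \<in> X. J x \<noteq> x})"
    by (rule even_card_involution[of _ J]) (use assms in auto)
  moreover have "card X = card ({x \<in> X. J x = x} \<union> {x \<in> X. J x \<noteq> x})"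
    by (rule arg_cong[where f = card]) auto
  then have "card X = card {x \<in> X. J x = x} + card {x \<in> X. J x \<noteq> x}"
    using assms(1) by (subst (asm) card_Un_disjoint) auto
  ultimately show ?thesis by simp
qed

section \<open>Rigidity of the monotone subroot\<close>

context sroot
begin

definition L :: "int \<Rightarrow> 'v set" where "L k = {v \<in> V. lv v = k}"

text \<open>The support is \<open>J\<close>-stable, and at level \<open>k\<close> only the stem
  vertex is fixed; all other vertices of the support come in pairs.\<close>

lemma lin_J_invariant_eps:
  assumes y: "keys y \<subseteq> L k" and k: "k \<le> s0" and inv: "lin J y = y"
  shows "eps y = lookup y (st k)"
proof -
  let ?K = "keys y"
  have KV: "v \<in> V" "lv v = k" if "v \<in> ?K" for v using that y unfolding L_def by auto
  have "J v \<in> ?K" if "v \<in> ?K" for v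
  proof -
    have "lookup y (J v) = sm {u. J u = J v} y"
      using sm_lin[of "{J v}" J y] sm_singleton[of "J v" y] unfolding inv by simp
    also have "\<dots> = sm {v} y" by (rule sm_cong) (metis J_J KV(1) mem_Collect_eq singletonD singletonI that)
    finally show ?thesis using that by (simp add: sm_singleton in_keys_iff)
  qed
  then have "even (card ?K) \<longleftrightarrow> even (card {v \<in> ?K. J v = v})"
    using J_J KV by (intro parity_involution) auto
  moreover have "{v \<in> ?K. J v = v} = ?K \<inter> {st k}"
    using st[OF k] st_eq KV unfolding S_def by force
  ultimately have "even (card ?K) \<longleftrightarrow> even (card (?K \<inter> {st k}))" by simp
  then show ?thesis
    unfolding sm_singleton[symmetric] sm_card of_nat_bit by simp
qed

text \<open>A branch of \<open>V'\<close> that passes over \<open>st t\<close> leaves the stem at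
  some jump \<open>t'\<close> not below \<open>t\<close>, and reaching level \<open>A t\<close>
  forces \<open>t' = t\<close> by \<open>jump_less\<close>.\<close>

lemma above_jump:
  assumes t: "jump t" and v: "v \<in> V'" "lv v = A t" "pr v t = st t"
  shows "v = Y t \<or> v = J (Y t)"
proof -
  note t0 = jump_le[OF t]
  note vV = V'_V[OF v(1)]
  have tv: "t \<le> lv v" using A_ge[OF t0] v by simp
  have path: "t' = t" if "jump t'" "A t \<le> A t'" "t \<le> t'" for t'
    using jump_less[OF t, of t'] that jump_le[OF that(1)] by force
  from v(1) show ?thesis
  proof (cases rule: V'_cases)
    case stem
    \<comment> \<open>A stem vertex at a level \<open>A t > t\<close> would make
      \<open>A (t + 1)\<close> at least \<open>A t\<close>. So \<open>A t = t\<close>, and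
      \<open>Y t\<close> is the stem vertex itself.\<close>
    have "A t \<le> t"
    proof (rule ccontr)
      assume "\<not> A t \<le> t"
      then have "t + 1 \<le> lv v" using v by simp
      moreover have "lv v \<le> A (t + 1)"
        by (rule lv_le_A[OF vV]) (use mt_S[OF stem] calculation in simp)
      moreover have "t + 1 \<le> s0" using calculation s0_ge[OF stem] by simp
      ultimately show False using jump_less[OF t, of "t + 1"] v by simp
    qed
    then have "A t = t" using A_ge[OF t0] by simp
    then show ?thesis using v pr_Y[OF t] lv_Y[OF t] pr_self[of v] pr_self[of "Y t"] by simp
  next
    case (path t')
    note Y' = Y_V[OF path(1)] lv_Y[OF path(1)]
    have "pr (Y t') t = st t" using path(4) v(3) pr_pr[OF Y'(1), of t "lv v"] path(3) Y'(2) tv by simp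
    then have "t \<le> t'" using pr_eq_st_iff[OF Y'(1), of t] mt_Y[OF path(1)] tv path(3) Y'(2) t0 by simp
    then have "t' = t" using path(1,3) v(2) \<open>\<And>t'. jump t' \<Longrightarrow> A t \<le> A t' \<Longrightarrow> t \<le> t' \<Longrightarrow> t' = t\<close> by simp
    then show ?thesis using path(4) v(2) lv_Y[OF t] pr_self[of "Y t"] by simp
  next
    case (path_J t')
    note Y' = Y_V[OF path_J(1)] lv_Y[OF path_J(1)]
    have Jv: "J v = pr (Y t') (lv v)" using J_J[OF pr_V[OF Y'(1)], of "lv v"] unfolding path_J(4) .
    have "pr (J v) t = st t" using pr_J[OF vV] v(3) S_J[OF st(1)[OF t0]] by simp
    then have "pr (Y t') t = st t" using Jv pr_pr[OF Y'(1), of t "lv v"] path_J(3) Y'(2) tv by simp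
    then have "t \<le> t'" using pr_eq_st_iff[OF Y'(1), of t] mt_Y[OF path_J(1)] tv path_J(3) Y'(2) t0 by simp
    then have "t' = t" using path_J(1,3) v(2) \<open>\<And>t'. jump t' \<Longrightarrow> A t \<le> A t' \<Longrightarrow> t \<le> t' \<Longrightarrow> t' = t\<close> by simp
    then show ?thesis using path_J(4) v(2) lv_Y[OF t] pr_self[of "Y t"] by simp
  qed
qed

text \<open>A vertex \<open>Y t\<close> can only be sent to itself or to its mirror image, plus lower-order terms
  on longer branches: since the image of \<open>Y t\<close> becomes \<open>J\<close>-invariant at level \<open>t\<close> and has odd
  coefficient sum, an odd number of its vertices lie above the invariant vertex at level \<open>t\<close>.\<close>

lemma rigid:
  assumes add: "\<And>x y. keys x \<subseteq> V' \<Longrightarrow> keys y \<subseteq> V' \<Longrightarrow> \<phi> (x + y) = \<phi> x + \<phi> y"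
    and V': "\<And>x. keys x \<subseteq> V' \<Longrightarrow> keys (\<phi> x) \<subseteq> V'"
    and lev: "\<And>v. v \<in> V' \<Longrightarrow> keys (\<phi> (vert v)) \<subseteq> L (lv v)"
    and dn: "\<And>x. keys x \<subseteq> V' \<Longrightarrow> \<phi> (lin dn x) = lin dn (\<phi> x)"
    and J: "\<And>x. keys x \<subseteq> V' \<Longrightarrow> \<phi> (lin J x) = lin J (\<phi> x)"
    and eps: "\<And>v. v \<in> V' \<Longrightarrow> eps (\<phi> (vert v)) = 1"
    and x: "keys x \<subseteq> V'"
  shows "\<exists>x'. keys x' \<subseteq> V' \<and> \<phi> x' = x"
proof -
  define Im where "Im = \<phi> ` {x. keys x \<subseteq> V'}"
  have Im_add: "y + z \<in> Im" if yz: "y \<in> Im" "z \<in> Im" for y z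
  proof -
    obtain y' z' where y': "keys y' \<subseteq> V'" "y = \<phi> y'" and z': "keys z' \<subseteq> V'" "z = \<phi> z'"
      using yz unfolding Im_def by blast
    have "y + z = \<phi> (y' + z')" unfolding y'(2) z'(2) using add[OF y'(1) z'(1)] by simp
    then show ?thesis unfolding Im_def using keys_add_subset[OF y'(1) z'(1)] by blast
  qed
  have "\<phi> 0 = 0" using add[of 0 0] by (metis pm_double add_0 empty_subsetI keys_zero)
  then have Im_0: "0 \<in> Im" unfolding Im_def by (metis (mono_tags) empty_subsetI image_eqI keys_zero mem_Collect_eq)
  have V'_lin: "keys (lin f y) \<subseteq> V'" if "keys y \<subseteq> V'" "\<And>v. v \<in> V' \<Longrightarrow> f v \<in> V'" for f y
    using keys_lin[of f y] that by blast
  have Im_dn: "vert (dn v) \<in> Im" if vI: "vert v \<in> Im" for v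
  proof -
    obtain y where y: "keys y \<subseteq> V'" "vert v = \<phi> y" using vI unfolding Im_def by blast
    then have "vert (dn v) = \<phi> (lin dn y)" using dn[OF y(1)] lin_vert[of dn v] by metis
    then show ?thesis unfolding Im_def using V'_lin[of y dn] y(1) V'_dn by blast
  qed
  have Im_J: "vert (J v) \<in> Im" if vI: "vert v \<in> Im" for v
  proof -
    obtain y where y: "keys y \<subseteq> V'" "vert v = \<phi> y" using vI unfolding Im_def by blast
    then have "vert (J v) = \<phi> (lin J y)" using J[OF y(1)] lin_vert[of J v] by metis
    then show ?thesis unfolding Im_def using V'_lin[of y J] y(1) V'_J by blast
  qed
  have "vert ((dn ^^ n) v) \<in> Im" if "vert v \<in> Im" for v n
    using that by (induction n) (auto intro: Im_dn)
  then have Im_pr: "vert (pr v k) \<in> Im" if "vert v \<in> Im" for v k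
    using that unfolding pr_def by blast
  have Im_span: "y \<in> Im" if "keys y \<subseteq> X" "\<And>v. v \<in> X \<Longrightarrow> vert v \<in> Im" for y X
    using that(1) by (induction rule: span_induct) (use Im_0 Im_add that(2) in auto)
  have Im_Y: "vert (Y t) \<in> Im" if "jump t" for t
    using that
  \<comment> \<open>Branches are treated in order of decreasing height, with \<open>bd_lv\<close> as
    a bound for the heights.\<close>
  proof (induction t rule: measure_induct_rule[where f = "\<lambda>t. nat (bd_lv - A t)"])
    case (less t)
    note t = less.prems and t0 = jump_le[OF less.prems]
    note Yt = Y_V[OF t] lv_Y[OF t]
    have YV': "Y t \<in> V'" using V'_pathI(1)[OF t, of "A t"] Yt(2) pr_self[of "Y t"] by simp
    have JY: "J (Y t) \<in> V'" using V'_J[OF YV'] .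
    \<comment> \<open>Such a vertex lies on a branch of \<open>V'\<close> leaving the stem at a jump
      below \<open>t\<close>; this branch is taller and is covered by the induction
      hypothesis.\<close>
    have higher: "vert v \<in> Im" if v: "v \<in> V'" "lv v = A t" "v \<noteq> Y t" "v \<noteq> J (Y t)" for v
    proof -
      have nst: "pr v t \<noteq> st t" using above_jump[OF t v(1,2)] v(3,4) by blast
      have tl: "t \<le> lv v" using A_ge[OF t0] v(2) by simp
      have Im_t': "vert (Y t') \<in> Im" if t': "jump t'" "lv v \<le> A t'" "\<not> t \<le> t'" for t'
      proof (rule less.IH[OF _ t'(1)])
        have "A t < A t'" using jump_less[OF t'(1), of t] t'(3) t0 by simp
        moreover have "A t' \<le> bd_lv" using bd_lv[OF Y_V[OF t'(1)]] lv_Y[OF t'(1)] by simp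
        ultimately show "nat (bd_lv - A t') < nat (bd_lv - A t)" by simp
      qed
      from v(1) show ?thesis
      proof (cases rule: V'_cases)
        case stem
        then have "pr v t = st t" using pr_eq_st[OF S_V[OF stem], of t] mt_S[OF stem] tl by simp
        then show ?thesis using nst by simp
      next
        case (path t')
        have "\<not> t \<le> t'"
        proof
          assume "t \<le> t'"
          then have "pr (Y t') t = st t" using pr_eq_st[OF Y_V[OF path(1)]] mt_Y[OF path(1)] by simp
          then show False
            using nst path(4) pr_pr[OF Y_V[OF path(1)], of t "lv v"] path(3) lv_Y[OF path(1)] tl by simp
        qed
        then show ?thesis using Im_pr[OF Im_t'[OF path(1,3)], of "lv v"] path(4) by simp
      next
        case (path_J t')
        have "\<not> t \<le> t'"
        proof
          assume "t \<le> t'"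
          then have "pr (Y t') t = st t" using pr_eq_st[OF Y_V[OF path_J(1)]] mt_Y[OF path_J(1)] by simp
          moreover have "pr v t = J (pr (pr (Y t') (lv v)) t)"
            using path_J(4) pr_J[OF pr_V[OF Y_V[OF path_J(1)]], of "lv v" t] by simp
          ultimately show False
            using nst pr_pr[OF Y_V[OF path_J(1)], of t "lv v"] path_J(3) lv_Y[OF path_J(1)] tl
              S_J[OF st(1)[OF t0]] by simp
        qed
        then show ?thesis using Im_J[OF Im_pr[OF Im_t'[OF path_J(1,3)], of "lv v"]] path_J(4) by simp
      qed
    qed
    define y where "y = \<phi> (vert (Y t))"
    have y: "keys y \<subseteq> V'" "keys y \<subseteq> L (A t)" "eps y = 1" "y \<in> Im"
      unfolding y_def Im_def using V' lev[OF YV'] eps[OF YV'] YV' Yt(2) by auto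
    define n where "n = nat (A t - t)"
    have prn: "(dn ^^ n) v = pr v t" if "v \<in> V" "lv v = A t" for v unfolding pr_def n_def that ..
    have phi_pow: "\<phi> (lin (dn ^^ m) x) = lin (dn ^^ m) (\<phi> x)" if "keys x \<subseteq> V'" for m x
    proof (induction m)
      case 0
      then show ?case by (simp add: lin_id)
    next
      case (Suc m)
      have "(dn ^^ m) v \<in> V'" if "v \<in> V'" for v using that by (induction m) (auto intro: V'_dn)
      then have "keys (lin (dn ^^ m) x) \<subseteq> V'" using V'_lin[of x "dn ^^ m"] that by blast
      then have "\<phi> (lin dn (lin (dn ^^ m) x)) = lin dn (lin (dn ^^ m) (\<phi> x))" using dn Suc by simp
      then show ?case by (simp add: lin_lin)
    qed
    \<comment> \<open>Pushed down to level \<open>t\<close>, the element \<open>y\<close> becomes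
      the image of the invariant vertex \<open>st t\<close>. It is therefore
      \<open>J\<close>-invariant, and its odd coefficient sum equals the coefficient at
      \<open>st t\<close>.\<close>
    define z where "z = lin (dn ^^ n) y"
    have z_eq: "z = \<phi> (vert (st t))"
      using phi_pow[of "vert (Y t)" n] YV' prn[OF Yt] pr_Y[OF t] unfolding z_def y_def by simp
    have stV': "st t \<in> V'" using st(1)[OF t0] unfolding V'_def by blast
    have "lin J z = z"
      unfolding z_eq using J[of "vert (st t)"] stV' S_J[OF st(1)[OF t0]] by simp
    moreover have "keys z \<subseteq> L t" unfolding z_eq using lev[OF stV'] st(2)[OF t0] by simp
    ultimately have "eps z = lookup z (st t)" using lin_J_invariant_eps t0 by blast
    then have 1: "sm {v. (dn ^^ n) v = st t} y = 1"
      using y(3) unfolding z_def eps_lin sm_singleton[symmetric] sm_lin by simp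
    have "sm {v. (dn ^^ n) v = st t} y = sm {Y t, J (Y t)} y"
    proof (rule sm_cong)
      fix v assume "v \<in> keys y"
      then have v: "v \<in> V'" "v \<in> V" "lv v = A t" using y unfolding L_def by auto
      have "pr (J (Y t)) t = st t" using pr_J[OF Yt(1)] pr_Y[OF t] S_J[OF st(1)[OF t0]] by simp
      then show "v \<in> {v. (dn ^^ n) v = st t} \<longleftrightarrow> v \<in> {Y t, J (Y t)}"
        using above_jump[OF t v(1,3)] prn[OF v(2,3)] pr_Y[OF t] by auto
    qed
    then have odd: "sm {Y t, J (Y t)} y = 1" using 1 by simp
    have rest: "r \<in> Im" if "keys r \<subseteq> keys y - {Y t, J (Y t)}" for r
      by (rule Im_span[OF that]) (use higher y in \<open>auto simp: L_def\<close>)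
    have "vert (Y t) \<in> Im \<or> vert (J (Y t)) \<in> Im"
    proof -
      have "\<exists>u\<in>{Y t, J (Y t)}. keys y \<inter> {Y t, J (Y t)} = {u}"
      proof -
        have "odd (card (keys y \<inter> {Y t, J (Y t)}))"
          using odd unfolding sm_card of_nat_bit by (simp split: if_splits)
        moreover have "card (keys y \<inter> {Y t, J (Y t)}) \<le> card {Y t, J (Y t)}"
          by (rule card_mono) auto
        moreover have "card {Y t, J (Y t)} \<le> 2" by (simp add: card_insert_if)
        ultimately have "odd (card (keys y \<inter> {Y t, J (Y t)}))"
          and "card (keys y \<inter> {Y t, J (Y t)}) \<le> 2" by simp_all
        moreover have "c = 1" if "odd c" "c \<le> 2" for c :: nat using that by presburger
        ultimately have "card (keys y \<inter> {Y t, J (Y t)}) = 1" by blast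
        then obtain u where "keys y \<inter> {Y t, J (Y t)} = {u}" by (rule card_1_singletonE)
        then show ?thesis by (intro bexI[of _ u]) blast+
      qed
      then obtain u where u: "u \<in> {Y t, J (Y t)}" "keys y \<inter> {Y t, J (Y t)} = {u}" by blast
      \<comment> \<open>Up to vertices already known to lie in the image, \<open>y\<close> is the
        single vertex \<open>u\<close>.\<close>
      have "keys (vert u + y) \<subseteq> keys y - {Y t, J (Y t)}"
      proof
        fix v assume "v \<in> keys (vert u + y)"
        then have "lookup (vert u) v + lookup y v \<noteq> 0"
          by (simp add: in_keys_iff lookup_add)
        then have "v \<noteq> u" "v \<in> keys y" using u(2)
          by (auto simp: lookup_single when_def lookup_bit split: if_splits)
        then show "v \<in> keys y - {Y t, J (Y t)}" using u(2) by blast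
      qed
      then have "vert u + y \<in> Im" by (rule rest)
      then have "vert u + y + y \<in> Im" using Im_add y(4) by blast
      then have "vert u \<in> Im" by (simp add: add.assoc)
      then show ?thesis using u(1) by blast
    qed
    then show ?case using Im_J[of "J (Y t)"] J_J[OF Yt(1)] by auto
  qed
  have "vert v \<in> Im" if "v \<in> V'" for v
    using that
  proof (cases rule: V'_cases)
    case stem
    \<comment> \<open>The whole stem lies on the downward path from \<open>Y s0\<close>.\<close>
    have "v = pr (Y s0) (lv v)"
      using pr_eq_st[OF Y_V[OF jump_s0], of "lv v"] mt_Y[OF jump_s0] s0_ge[OF stem] st_eq[OF stem] by simp
    then show ?thesis using Im_pr[OF Im_Y[OF jump_s0]] by metis
  next
    case (path t)
    then show ?thesis using Im_pr[OF Im_Y] by metis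
  next
    case (path_J t)
    then show ?thesis using Im_J[OF Im_pr[OF Im_Y]] by metis
  qed
  then have "x \<in> Im" using Im_span[OF x] by blast
  then show ?thesis unfolding Im_def by blast
qed

section \<open>Cyclic generators for the monotone subroot and their dual functionals\<close>

text \<open>\<open>odd_pair d l\<close> lists the cyclic summands of the torsion for the subroot \<open>V'\<close>: generators
  at level \<open>d\<close> of length \<open>l\<close>. Each jump \<open>r\<close> contributes \<open>Y r + J (Y r)\<close>, which dies on reaching the
  stem at level \<open>r\<close>, and the difference of \<open>Y r'\<close>, for the next jump \<open>r'\<close>, and the vertex of the
  branch of \<open>Y r\<close> at the same level, which also dies at level \<open>r\<close>. The functionals \<open>cogen d l c\<close>,
  \<open>c < l\<close>, are dual to the multiples \<open>U\<^sup>c\<close> of the generators.\<close>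

definition odd_pair :: "int \<Rightarrow> nat \<Rightarrow> bool" where
  "odd_pair d l \<longleftrightarrow> 0 < l \<and> jump (d - int l) \<and>
     (A (d - int l) = d \<or> d - int l < s0 \<and> A (d - int l + 1) = d)"

definition gen :: "int \<Rightarrow> nat \<Rightarrow> 'v \<Rightarrow>\<^sub>0 bit" where
  "gen d l = (let r = d - int l in
     if A r = d then vert (Y r) + vert (J (Y r)) else vert (pr (Y r) d) + vert (Y (j (r + 1))))"

definition cogen :: "int \<Rightarrow> nat \<Rightarrow> nat \<Rightarrow> ('v \<Rightarrow>\<^sub>0 bit) \<Rightarrow> bit" where
  "cogen d l c x = (let r = d - int l; k = d - int c in
     if A r = d then sm {J (pr (Y r) k)} x else sm {v \<in> V. lv v = k \<and> mt v \<le> r} x)"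

lemma odd_pair_cases:
  assumes "odd_pair d l"
  obtains (mirror) "jump (d - int l)" "A (d - int l) = d" "0 < l"
  | (next_jump) "jump (d - int l)" "d - int l < s0" "A (d - int l + 1) = d" "d < A (d - int l)" "0 < l"
  using assms jump_less[of "d - int l" "d - int l + 1"] unfolding odd_pair_def by force

lemma mt_pr_Y: "jump r \<Longrightarrow> k \<le> A r \<Longrightarrow> mt (pr (Y r) k) = min r k"
  using mt_pr[OF Y_V, of r k] lv_Y mt_Y by simp

lemma lv_pr_Y: "jump r \<Longrightarrow> k \<le> A r \<Longrightarrow> lv (pr (Y r) k) = k"
  using lv_pr[OF Y_V, of r k] lv_Y by simp

lemma jump_next: assumes "r < s0" shows "jump (j (r + 1))" "A (j (r + 1)) = A (r + 1)" "r < j (r + 1)"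
  using jump_j[of "r + 1"] j(2,3)[of "r + 1"] assms by auto

text \<open>\<open>A\<close> is constant from \<open>r' + 1\<close> up to \<open>j (r' + 1)\<close>,
  so a jump \<open>r\<close> with \<open>r' < r < j (r' + 1)\<close> would contradict
  \<open>jump_less\<close>.\<close>

lemma jump_next_le: assumes "jump r" "jump r'" "r' < r" shows "j (r' + 1) \<le> r"
proof (rule ccontr)
  assume n: "\<not> j (r' + 1) \<le> r"
  have r's: "r' < s0" using assms jump_le by force
  note nj = jump_next[OF r's]
  have "A (j (r' + 1)) < A r" using jump_less[OF assms(1), of "j (r' + 1)"] n jump_le[OF nj(1)] by simp
  moreover have "A r \<le> A (r' + 1)" using A_mono[of "r' + 1" r] assms jump_le by simp
  ultimately show False using nj(2) by simp
qed

lemma dn_pow_pr_Y: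
  assumes "jump r" "k \<le> A r"
  shows "(dn ^^ i) (pr (Y r) k) = pr (Y r) (k - int i)" "(dn ^^ i) (J (pr (Y r) k)) = J (pr (Y r) (k - int i))"
proof -
  note v = pr_V[OF Y_V[OF assms(1)], of k]
  have l: "lv (pr (Y r) k) = k" using lv_pr_Y[OF assms] .
  show 1: "(dn ^^ i) (pr (Y r) k) = pr (Y r) (k - int i)"
    using dn_pow_pr[OF v, of i] l pr_pr[OF Y_V[OF assms(1)], of "k - int i" k] assms lv_Y by simp
  show "(dn ^^ i) (J (pr (Y r) k)) = J (pr (Y r) (k - int i))"
    using dn_pow[OF v, of i] 1 by simp
qed

lemma gen_pow:
  assumes "odd_pair d l"
  shows "A (d - int l) = d \<Longrightarrow> lin (dn ^^ i) (gen d l) =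
      vert (pr (Y (d - int l)) (d - int i)) + vert (J (pr (Y (d - int l)) (d - int i)))"
    and "A (d - int l) \<noteq> d \<Longrightarrow> lin (dn ^^ i) (gen d l) =
      vert (pr (Y (d - int l)) (d - int i)) + vert (pr (Y (j (d - int l + 1))) (d - int i))"
proof -
  assume a: "A (d - int l) = d"
  have jr: "jump (d - int l)" using assms unfolding odd_pair_def by blast
  have "pr (Y (d - int l)) d = Y (d - int l)" using pr_self[of "Y (d - int l)"] lv_Y[OF jr] a by simp
  then show "lin (dn ^^ i) (gen d l) =
      vert (pr (Y (d - int l)) (d - int i)) + vert (J (pr (Y (d - int l)) (d - int i)))"
    using dn_pow_pr_Y[OF jr, of d i] a by (simp add: gen_def Let_def lin_add)
next
  assume a: "A (d - int l) \<noteq> d"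
  show "lin (dn ^^ i) (gen d l) =
      vert (pr (Y (d - int l)) (d - int i)) + vert (pr (Y (j (d - int l + 1))) (d - int i))"
    using assms
  proof (cases rule: odd_pair_cases)
    case mirror
    then show ?thesis using a by simp
  next
    case next_jump
    note nj = jump_next[OF next_jump(2)]
    have "pr (Y (j (d - int l + 1))) d = Y (j (d - int l + 1))"
      using pr_self[of "Y (j (d - int l + 1))"] lv_Y[OF nj(1)] nj(2) next_jump(3) by simp
    then show ?thesis
      using dn_pow_pr_Y(1)[OF next_jump(1), of d i] dn_pow_pr_Y(1)[OF nj(1), of d i] nj(2) next_jump(3,4) a
      by (simp add: gen_def Let_def lin_add)
  qed
qed

lemma keys_gen: assumes "odd_pair d l" shows "keys (gen d l) \<subseteq> V' \<inter> L d"
  using assms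
proof (cases rule: odd_pair_cases)
  case mirror
  have "Y (d - int l) \<in> V'" using V'_pathI(1)[OF mirror(1), of d] mirror(2) pr_self[of "Y (d - int l)"] lv_Y[OF mirror(1)] by simp
  then have "{Y (d - int l), J (Y (d - int l))} \<subseteq> V' \<inter> L d"
    using V'_J lv_Y[OF mirror(1)] mirror(2) V'_V lv_J J_V unfolding L_def by auto
  then show ?thesis
    using keys_add_subset[of "vert (Y (d - int l))" "V' \<inter> L d" "vert (J (Y (d - int l)))"] mirror(2)
    by (simp add: gen_def Let_def)
next
  case next_jump
  note nj = jump_next[OF next_jump(2)]
  have "Y (j (d - int l + 1)) \<in> V' \<inter> L d"
    using V'_pathI(1)[OF nj(1), of d] pr_self[of "Y (j (d - int l + 1))"] lv_Y[OF nj(1)] nj(2) next_jump(3) Y_V[OF nj(1)]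
    unfolding L_def by simp
  moreover have "pr (Y (d - int l)) d \<in> V' \<inter> L d"
    using V'_pathI(1)[OF next_jump(1), of d] lv_pr_Y[OF next_jump(1), of d] next_jump(4) pr_V[OF Y_V[OF next_jump(1)]]
    unfolding L_def by simp
  ultimately show ?thesis
    using keys_add_subset[of "vert (pr (Y (d - int l)) d)" "V' \<inter> L d" "vert (Y (j (d - int l + 1)))"] next_jump(4)
    by (simp add: gen_def Let_def)
qed

lemma gen_torsion: assumes "odd_pair d l" shows "lin (dn ^^ l) (gen d l) = 0"
  using assms
proof (cases rule: odd_pair_cases)
  case mirror
  have "pr (Y (d - int l)) (d - int l) = st (d - int l)" using pr_Y[OF mirror(1)] .
  then show ?thesis using gen_pow(1)[OF assms mirror(2), of l] S_J[OF st(1)[OF jump_le[OF mirror(1)]]] by simp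
next
  case next_jump
  note nj = jump_next[OF next_jump(2)]
  have "pr (Y (d - int l)) (d - int l) = st (d - int l)" using pr_Y[OF next_jump(1)] .
  moreover have "pr (Y (j (d - int l + 1))) (d - int l) = st (d - int l)"
    using pr_eq_st[OF Y_V[OF nj(1)], of "d - int l"] mt_Y[OF nj(1)] nj(3) by simp
  ultimately show ?thesis using gen_pow(2)[OF assms, of l] next_jump(4) by simp
qed

lemma cogen_add: "cogen d l c (x + y) = cogen d l c x + cogen d l c y"
  unfolding cogen_def Let_def sm_add
  by (cases "A (d - int l) = d") (simp_all only: if_True if_False simp_thms)

lemma cogen_zero [simp]: "cogen d l c 0 = 0"
  by (simp add: cogen_def Let_def)

text \<open>In the first case the functional is the coefficient at a mirror vertex, which occurs
  only in a mirror generator of the same jump. In the second it counts vertices at level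
  \<open>k\<close> that leave the stem at or below \<open>r\<close>: a mirror pair is counted twice
  or not at all, and the difference belonging to \<open>r'\<close> is counted once exactly when
  \<open>r'\<close> is at most \<open>r\<close> but its next jump is not, that is for
  \<open>r' = r\<close>.\<close>

lemma cogen_gen:
  assumes p: "odd_pair d l" and p': "odd_pair d' l'" and c: "c < l"
  shows "cogen d l c (lin (dn ^^ i) (gen d' l')) = (if d = d' \<and> l = l' \<and> i = c then 1 else 0)"
proof -
  define r r' k k' where "r = d - int l" and "r' = d' - int l'" and "k = d - int c" and "k' = d' - int i"
  have jr: "jump r" and jr': "jump r'" using p p' unfolding odd_pair_def r_def r'_def by blast+
  have rk: "r < k" using c unfolding r_def k_def by simp
  have kA: "k \<le> A r"
    using p unfolding k_def r_def by (cases rule: odd_pair_cases) auto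
  have kA': "k' \<le> A r'"
    using p' unfolding k'_def r'_def by (cases rule: odd_pair_cases) auto
  have eq_iff: "d = d' \<and> l = l' \<and> i = c \<longleftrightarrow> r = r' \<and> d = d' \<and> k = k'"
    unfolding r_def r'_def k_def k'_def by auto
  note l1 = lv_pr_Y[OF jr kA] lv_pr_Y[OF jr' kA'] and V1 = pr_V[OF Y_V[OF jr], of k] pr_V[OF Y_V[OF jr'], of k']
  note m1 = mt_pr_Y[OF jr kA] mt_pr_Y[OF jr' kA']
  have nS: "J (pr (Y r) k) \<noteq> pr (Y r) k"
  proof
    assume "J (pr (Y r) k) = pr (Y r) k"
    then have "pr (Y r) k \<in> S" using V1 unfolding S_def by simp
    then have "mt (pr (Y r) k) = k" using mt_S l1 by simp
    then show False using m1 rk by simp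
  qed
  have same: "r' = r" if "u \<in> {pr (Y r') k', J (pr (Y r') k')}" "u = J (pr (Y r) k)" for u
  proof -
    have "lv u = k'" using that(1) l1 lv_J V1 by auto
    moreover have "lv u = k" using that(2) l1 lv_J V1 by auto
    ultimately have kk: "k' = k" by simp
    have "mt u = min r' k'" using that(1) m1 mt_J V1 by auto
    moreover have "mt u = min r k" using that(2) m1 mt_J V1 by auto
    ultimately show ?thesis using kk rk by (simp add: min_def split: if_splits)
  qed
  show ?thesis
  proof (cases "A r = d")
    case True
    then have cg: "cogen d l c x = sm {J (pr (Y r) k)} x" for x
      unfolding cogen_def Let_def r_def k_def by simp
    \<comment> \<open>A vertex on a chosen branch is never this mirror vertex: level and
      \<open>mt\<close> would force the same jump, and then \<open>nS\<close> excludes it.\<close>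
    have no: "pr (Y r'') k' \<noteq> J (pr (Y r) k)" if "jump r''" "k' \<le> A r''" for r''
    proof
      assume e: "pr (Y r'') k' = J (pr (Y r) k)"
      have "lv (pr (Y r'') k') = k" using e l1 lv_J V1 by simp
      then have kk: "k' = k" using lv_pr_Y that by simp
      have "min r'' k' = min r k" using e m1 mt_J V1 mt_pr_Y[OF that] by simp
      then have "r'' = r" using kk rk by (simp add: min_def split: if_splits)
      then show False using e kk nS by simp
    qed
    show ?thesis
    proof (cases "A r' = d'")
      case T': True
      have g: "lin (dn ^^ i) (gen d' l') = vert (pr (Y r') k') + vert (J (pr (Y r') k'))"
        using gen_pow(1)[OF p', of i, folded r'_def k'_def] T' by simp
      have "J (pr (Y r') k') = J (pr (Y r) k) \<longleftrightarrow> r = r' \<and> k = k'"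
        using same[of "J (pr (Y r') k')"] l1 lv_J V1 by (metis insertI1 insertI2)
      moreover have "r = r' \<and> k = k' \<longleftrightarrow> r = r' \<and> d = d' \<and> k = k'" using True T' by auto
      ultimately show ?thesis
        unfolding cg g eq_iff sm_add sm_vert using no[OF jr' kA'] by auto
    next
      case F': False
      have g: "lin (dn ^^ i) (gen d' l') = vert (pr (Y r') k') + vert (pr (Y (j (r' + 1))) k')"
        using gen_pow(2)[OF p', of i, folded r'_def k'_def] F' by simp
      have r's: "r' < s0" and Ad: "A (r' + 1) = d'" using p' F' unfolding odd_pair_def r'_def by auto
      have "k' \<le> A (j (r' + 1))" using jump_next(2)[OF r's] Ad unfolding k'_def by simp
      then show ?thesis
        unfolding cg g eq_iff sm_add sm_vert
        using no[OF jr' kA'] no[OF jump_next(1)[OF r's]] True F' by auto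
    qed
  next
    case False
    then have cg: "cogen d l c x = sm {v \<in> V. lv v = k \<and> mt v \<le> r} x" for x
      unfolding cogen_def Let_def r_def k_def by simp
    show ?thesis
    proof (cases "A r' = d'")
      case T': True
      have g: "lin (dn ^^ i) (gen d' l') = vert (pr (Y r') k') + vert (J (pr (Y r') k'))"
        using gen_pow(1)[OF p', of i, folded r'_def k'_def] T' by simp
      have "\<not> (r = r' \<and> d = d' \<and> k = k')" using False T' by auto
      then show ?thesis
        unfolding cg g eq_iff sm_add sm_vert using V1 lv_J mt_J J_V by auto
    next
      case F': False
      have g: "lin (dn ^^ i) (gen d' l') = vert (pr (Y r') k') + vert (pr (Y (j (r' + 1))) k')"
        using gen_pow(2)[OF p', of i, folded r'_def k'_def] F' by simp
      have r's: "r' < s0" and Ad: "A (r' + 1) = d'" using p' F' unfolding odd_pair_def r'_def by auto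
      have rs: "r < s0" and Ad1: "A (r + 1) = d" using p False unfolding odd_pair_def r_def by auto
      note nj = jump_next[OF r's]
      have kn: "k' \<le> A (j (r' + 1))" using nj(2) Ad unfolding k'_def by simp
      note l2 = lv_pr_Y[OF nj(1) kn] and V2 = pr_V[OF Y_V[OF nj(1)], of k'] and m2 = mt_pr_Y[OF nj(1) kn]
      have "r = r' \<and> d = d' \<and> k = k' \<longleftrightarrow> r = r' \<and> k = k'" using Ad Ad1 by auto
      moreover have "j (r' + 1) \<le> r" if "r' < r" using jump_next_le[OF jr jr' that] .
      moreover have "\<not> j (r' + 1) \<le> r" if "\<not> r' < r" using nj(3) that by simp
      ultimately show ?thesis
        unfolding cg g eq_iff sm_add sm_vert using V1 l1 m1 V2 l2 m2 rk by (auto simp: min_le_iff_disj)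
    qed
  qed
qed

text \<open>The functionals of the first kind remove all mirror vertices. Chosen branches are then
  removed from the tallest down: among the vertices counted by a functional of the second kind,
  those of branches leaving below \<open>r\<close> are taller and already gone, so one coefficient
  remains. The rest lies on the stem, one vertex per level, and is killed by the level sums.\<close>

lemma cogen_joint:
  assumes x: "keys x \<subseteq> V'" and e: "\<And>k. sm (L k) x = 0"
    and z: "\<And>d l c. odd_pair d l \<Longrightarrow> c < l \<Longrightarrow> cogen d l c x = 0"
  shows "x = 0"
proof -
  let ?K = "keys x"
  have KJ: "J (pr (Y r) k) \<notin> ?K" if r: "jump r" "r < k" "k \<le> A r" for r k
  proof -
    define l where "l = nat (A r - r)"
    have l: "A r - int l = r" "0 < l" using r unfolding l_def by auto
    then have p: "odd_pair (A r) l" unfolding odd_pair_def using r by simp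
    have "nat (A r - k) < l" "A r - int (nat (A r - k)) = k" using r unfolding l_def by auto
    then have "sm {J (pr (Y r) k)} x = 0"
      using z[OF p, of "nat (A r - k)"] l unfolding cogen_def Let_def by simp
    then show ?thesis unfolding sm_singleton by (simp add: in_keys_iff)
  qed
  have KY: "pr (Y r) k \<notin> ?K" if "jump r" "r < k" "k \<le> A r" for r k
    using that
  proof (induction r rule: measure_induct_rule[where f = "\<lambda>r. nat (bd_lv - A r)"])
    case (less r)
    note r = less.prems
    let ?X = "{v \<in> V. lv v = k \<and> mt v \<le> r}"
    have "sm ?X x = sm {pr (Y r) k} x"
    proof (rule sm_cong)
      fix u assume u: "u \<in> ?K"
      show "u \<in> ?X \<longleftrightarrow> u \<in> {pr (Y r) k}"
      proof
        assume "u \<in> {pr (Y r) k}"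
        then show "u \<in> ?X"
          using lv_pr_Y[OF r(1,3)] mt_pr_Y[OF r(1,3)] pr_V[OF Y_V[OF r(1)]] r(2) by simp
      next
        assume uX: "u \<in> ?X"
        have "u \<in> V'" using u x by blast
        then show "u \<in> {pr (Y r) k}"
        proof (cases rule: V'_cases)
          case stem
          then have "mt u = lv u" by (rule mt_S)
          then show ?thesis using uX r(2) by simp
        next
          case (path t)
          have tr: "t \<le> r" using uX mt_pr_Y[OF path(1), of "lv u"] path by (simp add: min_def split: if_splits)
          have "t = r"
          proof (rule ccontr)
            assume "t \<noteq> r"
            then have "A r < A t" using jump_less[OF path(1), of r] tr jump_le[OF r(1)] by simp
            moreover have "A t \<le> bd_lv" using bd_lv[OF Y_V[OF path(1)]] lv_Y[OF path(1)] by simp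
            ultimately have "pr (Y t) k \<notin> ?K" using less.IH[of t] path uX by simp
            then show False using path(4) u uX by simp
          qed
          then show ?thesis using path(4) uX by simp
        next
          case (path_J t)
          then show ?thesis using KJ[OF path_J(1-3)] u by simp
        qed
      qed
    qed
    then have X: "sm ?X x = lookup x (pr (Y r) k)" by (simp add: sm_singleton)
    have "sm ?X x = 0"
    proof (cases "r < s0 \<and> k \<le> A (r + 1)")
      case True
      define d l where "d = A (r + 1)" and "l = nat (A (r + 1) - r)"
      have l: "d - int l = r" "0 < l" using A_ge[of "r + 1"] True unfolding d_def l_def by auto
      then have p: "odd_pair d l" unfolding odd_pair_def using r True unfolding d_def by simp
      have c: "nat (d - k) < l" "d - int (nat (d - k)) = k" using r True unfolding d_def l_def by auto
      have "A r \<noteq> d" using jump_less[OF r(1), of "r + 1"] True unfolding d_def by simp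
      then show ?thesis using z[OF p c(1)] l c(2) unfolding cogen_def Let_def by simp
    next
      \<comment> \<open>No branch leaving above \<open>r\<close> reaches level \<open>k\<close>, so
        the count is the sum over the whole level.\<close>
      case False
      have "sm ?X x = sm (L k) x"
      proof (rule sm_cong)
        fix u assume "u \<in> ?K"
        then have uV: "u \<in> V" using x V'_V by blast
        have "mt u \<le> r" if "lv u = k"
        proof (rule ccontr)
          assume "\<not> mt u \<le> r"
          then have "r + 1 \<le> mt u" by simp
          then show False using lv_le_A[OF uV] mt_s0[OF uV] that False by force
        qed
        then show "u \<in> ?X \<longleftrightarrow> u \<in> L k" unfolding L_def by auto
      qed
      then show ?thesis using e by simp
    qed
    then show ?case using X by (simp add: in_keys_iff)
  qed
  have "?K = {}"
  proof (rule ccontr)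
    assume "?K \<noteq> {}"
    then obtain v where v: "v \<in> ?K" by blast
    have KS: "u \<in> S" if u: "u \<in> ?K" for u
    proof -
      have "u \<in> V'" using x u by blast
      then show ?thesis
      proof (cases rule: V'_cases)
        case (path t)
        then show ?thesis using KY[OF path(1-3)] u by simp
      next
        case (path_J t)
        then show ?thesis using KJ[OF path_J(1-3)] u by simp
      qed
    qed
    have "sm (L (lv v)) x = sm {v} x"
      by (rule sm_cong) (use KS S_unique v S_V in \<open>auto simp: L_def\<close>)
    then show False using e v by (simp add: sm_singleton in_keys_iff)
  qed
  then show "x = 0" by simp
qed

text \<open>Moving down by \<open>n\<close> carries the coefficient sum of level \<open>k\<close> to
  that of level \<open>k - n\<close>.\<close>

lemma torsion_sm:
  assumes x: "keys x \<subseteq> V" and t: "lin (dn ^^ n) x = 0"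
  shows "sm (L k) x = 0"
proof -
  have "sm (L k) x = sm {v. (dn ^^ n) v \<in> L (k - int n)} x"
    by (rule sm_cong) (use x dn_pow in \<open>auto simp: L_def\<close>)
  then show ?thesis using t sm_lin[of "L (k - int n)" "dn ^^ n" x] by simp
qed

end

section \<open>Cyclic decompositions and their multiplicities\<close>

text \<open>The class of \<open>p\<close> modulo \<open>U ^ n\<close>; as a set it is independent of
  the degree \<open>a\<close> of the generator.\<close>

definition tcos :: "nat \<Rightarrow> bit poly \<Rightarrow> bit poly set" where
  "tcos n p = (\<Union>h\<in>range (\<lambda>q. Uvar ^ n * q). {h + p})"

lemma FU_mod_simps [simp]:
  "carrier (FU_mod a) = UNIV" "\<zero>\<^bsub>FU_mod a\<^esub> = 0" "p \<oplus>\<^bsub>FU_mod a\<^esub> q = p + q" "p \<odot>\<^bsub>FU_mod a\<^esub> q = p * q"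
  by (simp_all add: FU_mod_def)

lemma fu_module_FU_mod: "fu_module (FU_mod a)"
proof -
  have "abelian_group (FU_mod a)"
    by (rule abelian_group_char2I) (simp_all add: add.assoc add.commute del: mult_2[symmetric])
  then show ?thesis by (rule fu_moduleI) (simp_all add: algebra_simps)
qed

lemma ideal_submod: "submod (FU_mod a) (range (\<lambda>p. Uvar ^ n * p))"
  unfolding submod_def by (auto simp: distrib_left[symmetric] mult.left_commute intro: range_eqI[of _ _ 0])

lemma FU_mod_coset: "range (\<lambda>p. Uvar ^ n * p) +>\<^bsub>FU_mod a\<^esub> p = tcos n p"
  by (simp add: a_r_coset_def' tcos_def)

lemma T_carrier: "carrier (T a n) = range (tcos n)"
  unfolding T_def fu_module.gquot_carrier[OF fu_module_FU_mod] FU_mod_coset by simp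

lemma T_add: "tcos n p \<oplus>\<^bsub>T a n\<^esub> tcos n q = tcos n (p + q)"
  unfolding T_def FU_mod_coset[where a = a, symmetric]
  by (subst fu_module.gquot_add[OF fu_module_FU_mod ideal_submod]) simp_all

lemma T_smult: "q \<odot>\<^bsub>T a n\<^esub> tcos n p = tcos n (q * p)"
  unfolding T_def FU_mod_coset[where a = a, symmetric]
  by (subst fu_module.gquot_smult[OF fu_module_FU_mod ideal_submod]) simp_all

lemma T_gr: "gr (T a n) d = tcos n ` {p. \<forall>i. coeff p i \<noteq> 0 \<longrightarrow> a - 2 * of_nat i = d}"
  unfolding T_def fu_module.gquot_gr[OF fu_module_FU_mod] FU_mod_coset by (simp add: FU_mod_def)

lemma tcos_eq_iff: "tcos n p = tcos n q \<longleftrightarrow> (\<forall>c<n. coeff p c = coeff q c)"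
proof -
  have "tcos n p = tcos n q \<longleftrightarrow> p + q \<in> range (\<lambda>p. Uvar ^ n * p)"
    unfolding FU_mod_coset[where a = 0, symmetric]
    by (subst fu_module.coset_eq_iff[OF fu_module_FU_mod ideal_submod]) simp_all
  also have "\<dots> \<longleftrightarrow> monom 1 n dvd p + q"
    unfolding Uvar_power dvd_def by auto
  also have "\<dots> \<longleftrightarrow> (\<forall>c<n. coeff p c + coeff q c = 0)"
    unfolding monom_1_dvd_iff' coeff_add ..
  also have "\<dots> \<longleftrightarrow> (\<forall>c<n. coeff p c = coeff q c)"
  proof -
    have "(b + c = 0) = (b = c)" for b c :: bit by (cases b; cases c) simp_all
    then show ?thesis by simp
  qed
  finally show ?thesis .
qed

lemma gdsum_finite:
  assumes "finite I"
  shows "carrier (gdsum I M) = (\<Pi>\<^sub>E i\<in>I. carrier (M i))"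
    and "f \<oplus>\<^bsub>gdsum I M\<^esub> g = (\<lambda>i\<in>I. f i \<oplus>\<^bsub>M i\<^esub> g i)"
    and "p \<odot>\<^bsub>gdsum I M\<^esub> f = (\<lambda>i\<in>I. p \<odot>\<^bsub>M i\<^esub> f i)"
    and "gr (gdsum I M) d = {f \<in> \<Pi>\<^sub>E i\<in>I. carrier (M i). \<forall>i\<in>I. f i \<in> gr (M i) d}"
  using assms by (auto simp: gdsum_def Let_def)

lemma gpow_simps:
  "carrier (gpow M k) = (\<Pi>\<^sub>E j\<in>{..<k}. carrier M)"
  "f \<oplus>\<^bsub>gpow M k\<^esub> g = (\<lambda>j\<in>{..<k}. f j \<oplus>\<^bsub>M\<^esub> g j)"
  "p \<odot>\<^bsub>gpow M k\<^esub> f = (\<lambda>j\<in>{..<k}. p \<odot>\<^bsub>M\<^esub> f j)"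
  "gr (gpow M k) d = {f \<in> \<Pi>\<^sub>E j\<in>{..<k}. carrier M. \<forall>j\<in>{..<k}. f j \<in> gr M d}"
  unfolding gpow_def by (simp_all add: gdsum_finite)

text \<open>The functionals \<open>lam i c\<close> are dual to \<open>U ^ c\<close> times
  \<open>W i\<close> and separate points. Subtracting from \<open>x\<close> the combination with
  coefficients \<open>lam i c x\<close> leaves an element killed by all of them, hence zero. So
  separation yields spanning, and also that \<open>U ^ n i\<close> kills \<open>W i\<close>.\<close>

lemma cyclic_decomposition:
  fixes M :: "('a, 'm) gmod_scheme" and I :: "'i set" and k :: "'i \<Rightarrow> nat"
  assumes M: "fu_module M" and I: "finite I" and k: "\<And>i. i \<in> I \<Longrightarrow> k i \<le> 1"
    and W: "\<And>i. i \<in> I \<Longrightarrow> k i = 1 \<Longrightarrow> W i \<in> carrier M"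
    and lam_add: "\<And>i c x y. x \<in> carrier M \<Longrightarrow> y \<in> carrier M \<Longrightarrow> lam i c (x \<oplus>\<^bsub>M\<^esub> y) = (lam i c x + lam i c y :: bit)"
    and lam_dual: "\<And>i j c p. i \<in> I \<Longrightarrow> k i = 1 \<Longrightarrow> j \<in> I \<Longrightarrow> k j = 1 \<Longrightarrow> c < n i \<Longrightarrow>
      lam i c (p \<odot>\<^bsub>M\<^esub> W j) = (if i = j then coeff p c else 0)"
    and joint: "\<And>x. x \<in> carrier M \<Longrightarrow> (\<And>i c. i \<in> I \<Longrightarrow> k i = 1 \<Longrightarrow> c < n i \<Longrightarrow> lam i c x = 0) \<Longrightarrow> x = \<zero>\<^bsub>M\<^esub>"
    and lam_gr: "\<And>i c d x. i \<in> I \<Longrightarrow> k i = 1 \<Longrightarrow> c < n i \<Longrightarrow> x \<in> gr M d \<Longrightarrow> a i - 2 * of_nat c \<noteq> d \<Longrightarrow> lam i c x = 0"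
    and gr_sub: "\<And>d. gr M d \<subseteq> carrier M"
  shows "M \<cong>\<^sub>g\<^sub>r gdsum I (\<lambda>i. gpow (T (a i) (n i)) (k i))"
proof -
  interpret M: fu_module M by (rule M)
  define Q where "Q = {i \<in> I. k i = 1}"
  have Q: "finite Q" "\<And>i. i \<in> Q \<Longrightarrow> i \<in> I" "\<And>i. i \<in> Q \<Longrightarrow> k i = 1" "\<And>i. i \<in> I \<Longrightarrow> k i = 1 \<Longrightarrow> i \<in> Q"
    unfolding Q_def using I by auto
  define comb where "comb q = finsum M (\<lambda>i. q i \<odot>\<^bsub>M\<^esub> W i) Q" for q
  have W': "W i \<in> carrier M" if "i \<in> Q" for i using W Q that by blast
  have comb_closed: "comb q \<in> carrier M" for q
    unfolding comb_def by (rule M.M.finsum_closed) (use W' in auto)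
  have lam0: "lam i c \<zero>\<^bsub>M\<^esub> = 0" for i c
    using lam_add[of "\<zero>\<^bsub>M\<^esub>" "\<zero>\<^bsub>M\<^esub>" i c] by (cases "lam i c \<zero>\<^bsub>M\<^esub>") simp_all
  have lam_sum: "lam i c (finsum M f R) = (\<Sum>j\<in>R. lam i c (f j))" if "finite R" "f \<in> R \<rightarrow> carrier M" for i c f R
    using that
  proof (induction R)
    case (insert r R)
    then have f: "f \<in> R \<rightarrow> carrier M" "f r \<in> carrier M" by auto
    have "finsum M f (insert r R) = f r \<oplus>\<^bsub>M\<^esub> finsum M f R"
      using insert(1,2) f by (rule M.M.finsum_insert)
    then show ?case
      unfolding sum.insert[OF insert(1,2)]
      by (simp only: lam_add[OF f(2) M.M.finsum_closed[OF f(1)]] insert.IH[OF f(1)])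
  qed (simp add: lam0)
  have smult_sum: "p \<odot>\<^bsub>M\<^esub> finsum M f R = finsum M (\<lambda>i. p \<odot>\<^bsub>M\<^esub> f i) R"
    if "finite R" "f \<in> R \<rightarrow> carrier M" for p f R
    using that
  proof (induction R)
    case (insert r R)
    then have "f \<in> R \<rightarrow> carrier M" "f r \<in> carrier M" "(\<lambda>i. p \<odot>\<^bsub>M\<^esub> f i) \<in> R \<rightarrow> carrier M" by auto
    then show ?case using insert by (simp add: M.smult_add)
  qed simp
  have smult_comb: "p \<odot>\<^bsub>M\<^esub> comb q = comb (\<lambda>i. p * q i)" for p q
  proof -
    have "p \<odot>\<^bsub>M\<^esub> comb q = finsum M (\<lambda>i. p \<odot>\<^bsub>M\<^esub> (q i \<odot>\<^bsub>M\<^esub> W i)) Q"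
      unfolding comb_def by (rule smult_sum) (use Q W' in auto)
    also have "\<dots> = comb (\<lambda>i. p * q i)"
      unfolding comb_def by (rule M.M.finsum_cong') (use W' in \<open>auto simp: M.smult_poly_mult\<close>)
    finally show ?thesis .
  qed
  have lam_comb: "lam i c (comb q) = coeff (q i) c" if i: "i \<in> Q" "c < n i" for i c q
  proof -
    have "lam i c (comb q) = (\<Sum>j\<in>Q. lam i c (q j \<odot>\<^bsub>M\<^esub> W j))"
      unfolding comb_def by (rule lam_sum) (use Q W' in auto)
    also have "\<dots> = (\<Sum>j\<in>Q. if i = j then coeff (q j) c else 0)"
    proof (rule sum.cong[OF refl])
      fix j assume "j \<in> Q"
      then show "lam i c (q j \<odot>\<^bsub>M\<^esub> W j) = (if i = j then coeff (q j) c else 0)"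
        by (intro lam_dual[OF Q(2)[OF i(1)] Q(3)[OF i(1)] Q(2) Q(3) i(2)])
    qed
    also have "\<dots> = coeff (q i) c" unfolding sum.delta'[OF Q(1)] using i(1) by (rule if_P)
    finally show ?thesis .
  qed
  \<comment> \<open>The coordinate of \<open>x\<close> at \<open>W i\<close>, represented by its
    polynomial of degree below \<open>n i\<close>.\<close>
  define P where "P i x = (\<Sum>c<n i. monom (lam i c x) c)" for i x
  have coeff_P: "coeff (P i x) c = (if c < n i then lam i c x else 0)" for i x c
    unfolding P_def by (simp add: coeff_sum)
  have span: "x = comb (\<lambda>i. P i x)" if x: "x \<in> carrier M" for x
  proof -
    have "x \<oplus>\<^bsub>M\<^esub> comb (\<lambda>i. P i x) = \<zero>\<^bsub>M\<^esub>"
    proof (rule joint)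
      fix i c assume i: "i \<in> I" "k i = 1" "c < n i"
      have "lam i c (x \<oplus>\<^bsub>M\<^esub> comb (\<lambda>i. P i x)) = lam i c x + lam i c x"
        unfolding lam_add[OF x comb_closed] lam_comb[OF Q(4)[OF i(1,2)] i(3)] coeff_P using i by (simp only: if_True)
      then show "lam i c (x \<oplus>\<^bsub>M\<^esub> comb (\<lambda>i. P i x)) = 0" by (simp only: bit_double)
    qed (use x comb_closed in auto)
    then show ?thesis using M.add_eq_zero_iff x comb_closed by blast
  qed
  have lam_smult: "lam i c (p \<odot>\<^bsub>M\<^esub> x) = coeff (p * P i x) c"
    if "i \<in> Q" "c < n i" "x \<in> carrier M" for i c p x
    by (subst span[OF that(3)]) (simp only: smult_comb lam_comb[OF that(1,2)])
  define \<Theta> where "\<Theta> x = (\<lambda>i\<in>I. \<lambda>j\<in>{..<k i}. tcos (n i) (P i x))" for x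
  let ?G = "gdsum I (\<lambda>i. gpow (T (a i) (n i)) (k i))"
  note G = gdsum_finite[OF I] gpow_simps
  have kQ: "i \<in> Q" if "i \<in> I" "j < k i" for i j
    using k[OF that(1)] that by (intro Q(4)) auto
  have "\<Theta> \<in> ghom 0 M ?G"
    unfolding ghom_def
  proof (intro CollectI conjI allI ballI funcsetI)
    show "\<Theta> x \<in> carrier ?G" for x
      unfolding \<Theta>_def by (auto simp: G T_carrier)
    show "\<Theta> (x \<oplus>\<^bsub>M\<^esub> y) = \<Theta> x \<oplus>\<^bsub>?G\<^esub> \<Theta> y" if x: "x \<in> carrier M" and y: "y \<in> carrier M" for x y
    proof -
      have "P i (x \<oplus>\<^bsub>M\<^esub> y) = P i x + P i y" for i
        unfolding P_def lam_add[OF x y] add_monom[symmetric] sum.distrib ..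
      then show ?thesis unfolding \<Theta>_def by (auto simp: G T_add intro!: ext)
    qed
    show "\<Theta> (p \<odot>\<^bsub>M\<^esub> x) = p \<odot>\<^bsub>?G\<^esub> \<Theta> x" if x: "x \<in> carrier M" for p x
    proof -
      have "tcos (n i) (P i (p \<odot>\<^bsub>M\<^esub> x)) = tcos (n i) (p * P i x)" if "i \<in> Q" for i
        unfolding tcos_eq_iff coeff_P using lam_smult[OF that _ x] by simp
      then show ?thesis unfolding \<Theta>_def by (auto simp: G T_smult kQ intro!: ext)
    qed
    show "\<Theta> ` gr M d \<subseteq> gr ?G (d + 0)" for d
    proof (rule image_subsetI)
      fix x assume x: "x \<in> gr M d"
      have "a i - 2 * of_nat c = d" if "i \<in> Q" "coeff (P i x) c \<noteq> 0" for i c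
      proof (rule ccontr)
        assume "a i - 2 * of_nat c \<noteq> d"
        then have "c < n i \<Longrightarrow> lam i c x = 0"
          using lam_gr[OF Q(2)[OF that(1)] Q(3)[OF that(1)] _ x] by blast
        then show False using that(2) unfolding coeff_P by (cases "c < n i") simp_all
      qed
      then show "\<Theta> x \<in> gr ?G (d + 0)"
        unfolding \<Theta>_def by (auto simp: G T_carrier T_gr kQ)
    qed
  qed
  moreover have "bij_betw \<Theta> (carrier M) (carrier ?G)"
    unfolding bij_betw_def
  proof (intro conjI inj_onI)
    fix x y assume x: "x \<in> carrier M" and y: "y \<in> carrier M" and eq: "\<Theta> x = \<Theta> y"
    have "x \<oplus>\<^bsub>M\<^esub> y = \<zero>\<^bsub>M\<^esub>"
    proof (rule joint)
      fix i c assume i: "i \<in> I" "k i = 1" "c < n i"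
      have "\<Theta> x i 0 = \<Theta> y i 0" using eq by simp
      then have "tcos (n i) (P i x) = tcos (n i) (P i y)" unfolding \<Theta>_def using i by simp
      then have "lam i c x = lam i c y" using i(3) unfolding tcos_eq_iff coeff_P by simp
      then show "lam i c (x \<oplus>\<^bsub>M\<^esub> y) = 0" by (simp only: lam_add[OF x y] bit_double)
    qed (use x y in auto)
    then show "x = y" using M.add_eq_zero_iff x y by blast
  next
    show "\<Theta> ` carrier M = carrier ?G"
    proof (intro equalityI subsetI)
      fix F assume "F \<in> \<Theta> ` carrier M"
      then show "F \<in> carrier ?G" unfolding \<Theta>_def by (auto simp: G T_carrier)
    next
      fix F assume F: "F \<in> carrier ?G"
      have "\<exists>p. F i 0 = tcos (n i) p" if i: "i \<in> Q" for i
      proof -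
        have "F i \<in> (\<Pi>\<^sub>E j\<in>{..<k i}. range (tcos (n i)))" using F Q(2)[OF i] by (auto simp: G T_carrier)
        then have "F i 0 \<in> range (tcos (n i))" using Q(3)[OF i] by auto
        then show ?thesis by blast
      qed
      then obtain p where p: "\<And>i. i \<in> Q \<Longrightarrow> F i 0 = tcos (n i) (p i)" by metis
      have "F = \<Theta> (comb p)"
      proof
        fix i
        show "F i = \<Theta> (comb p) i"
        proof (cases "i \<in> I")
          case True
          then have Fi: "F i \<in> (\<Pi>\<^sub>E j\<in>{..<k i}. range (tcos (n i)))" using F by (auto simp: G T_carrier)
          show ?thesis
          proof
            fix j'
            show "F i j' = \<Theta> (comb p) i j'"
            proof (cases "j' < k i")
              case j': True
              then have "j' = 0" "i \<in> Q" using k[OF True] kQ[OF True j'] by auto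
              moreover have "tcos (n i) (p i) = tcos (n i) (P i (comb p))" if "i \<in> Q"
                unfolding tcos_eq_iff coeff_P using lam_comb[OF that] by simp
              ultimately show ?thesis unfolding \<Theta>_def using p True j' by simp
            next
              case False
              then show ?thesis unfolding \<Theta>_def using Fi True by (auto simp: PiE_iff extensional_def)
            qed
          qed
        next
          case False
          then show ?thesis unfolding \<Theta>_def using F by (auto simp: G PiE_iff extensional_def)
        qed
      qed
      then show "F \<in> \<Theta> ` carrier M" using comb_closed by blast
    qed
  qed
  ultimately show ?thesis unfolding gisomorphic_def giso_def by blast
qed

section \<open>Ranks of powers of \<open>U\<close> on sums of cyclic modules\<close>

lemma image_PiE:
  "(\<lambda>f. \<lambda>i\<in>I. h i (f i)) ` (\<Pi>\<^sub>E i\<in>I. S i) = (\<Pi>\<^sub>E i\<in>I. h i ` S i)"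
proof (intro equalityI subsetI)
  fix g assume g: "g \<in> (\<Pi>\<^sub>E i\<in>I. h i ` S i)"
  then have "\<forall>i\<in>I. \<exists>y. y \<in> S i \<and> g i = h i y" by (auto simp: PiE_iff)
  then obtain f where f: "\<forall>i\<in>I. f i \<in> S i \<and> g i = h i (f i)" unfolding bchoice_iff by blast
  have "g = (\<lambda>i\<in>I. h i (restrict f I i))"
    using f g by (auto simp: PiE_iff extensional_def)
  moreover have "restrict f I \<in> (\<Pi>\<^sub>E i\<in>I. S i)" using f by auto
  ultimately show "g \<in> (\<lambda>f. \<lambda>i\<in>I. h i (f i)) ` (\<Pi>\<^sub>E i\<in>I. S i)" by (rule image_eqI)
qed auto

lemma PiE_subset_eq:
  assumes "\<And>i. i \<in> I \<Longrightarrow> S i \<subseteq> R i"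
  shows "{f \<in> \<Pi>\<^sub>E i\<in>I. R i. \<forall>i\<in>I. f i \<in> S i} = (\<Pi>\<^sub>E i\<in>I. S i)"
proof (rule Set.set_eqI)
  fix f
  show "f \<in> {f \<in> \<Pi>\<^sub>E i\<in>I. R i. \<forall>i\<in>I. f i \<in> S i} \<longleftrightarrow> f \<in> (\<Pi>\<^sub>E i\<in>I. S i)"
    unfolding mem_Collect_eq PiE_iff using assms by blast
qed

text \<open>The space \<open>U ^ m\<close> times the degree \<open>d\<close> part. Its dimension
  over F_2, read off from the cardinality, is the invariant from which the multiplicities are
  recovered.\<close>

definition upow :: "('a, 'm) gmod_scheme \<Rightarrow> nat \<Rightarrow> rat \<Rightarrow> 'a set" where
  "upow M m d = (\<lambda>x. (Uvar ^ m) \<odot>\<^bsub>M\<^esub> x) ` gr M d"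

lemma T_gr_subset: "gr (T a n) d \<subseteq> carrier (T a n)"
  unfolding T_gr T_carrier by blast

text \<open>The rank of \<open>U\<^sup>m\<close> on the degree \<open>d\<close> part of \<open>T a n\<close>.\<close>

definition hit :: "rat \<Rightarrow> nat \<Rightarrow> nat \<Rightarrow> rat \<Rightarrow> nat" where
  "hit a n m d = (if \<exists>c. a - 2 * of_nat c = d \<and> c + m < n then 1 else 0)"

lemma card_upow_T: "card (upow (T a n) m d) = 2 ^ hit a n m d"
proof (cases "\<exists>c. a - 2 * of_nat c = d")
  case True
  then obtain c where c: "a - 2 * of_nat c = d" by blast
  have c': "a - 2 * of_nat i = d \<longleftrightarrow> i = c" for i unfolding c[symmetric] by auto
  have P: "{p :: bit poly. \<forall>i. coeff p i \<noteq> 0 \<longrightarrow> a - 2 * of_nat i = d} = {0, monom 1 c}"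
  proof (intro equalityI subsetI)
    fix p :: "bit poly" assume "p \<in> {p. \<forall>i. coeff p i \<noteq> 0 \<longrightarrow> a - 2 * of_nat i = d}"
    then have p: "coeff p i = 0" if "i \<noteq> c" for i using that c' by blast
    have "p = monom (coeff p c) c"
      by (rule poly_eqI) (simp add: p coeff_monom)
    then show "p \<in> {0, monom 1 c}"
      by (cases "coeff p c = 0") auto
  qed (auto simp: coeff_monom c' split: if_splits)
  have "upow (T a n) m d = {tcos n 0, tcos n (monom 1 (m + c))}"
    unfolding upow_def T_gr P by (simp add: T_smult Uvar_power mult_monom)
  moreover have "tcos n 0 = tcos n (monom 1 (m + c)) \<longleftrightarrow> \<not> c + m < n"
    unfolding tcos_eq_iff by (auto simp: coeff_monom)
  moreover have "(\<exists>c. a - 2 * of_nat c = d \<and> c + m < n) \<longleftrightarrow> c + m < n" using c' by auto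
  ultimately show ?thesis by (cases "c + m < n") (simp_all add: hit_def)
next
  case False
  then have P: "{p :: bit poly. \<forall>i. coeff p i \<noteq> 0 \<longrightarrow> a - 2 * of_nat i = d} = {0}"
    by (auto simp: poly_eq_iff)
  have "upow (T a n) m d = {tcos n 0}"
    unfolding upow_def T_gr P by (simp add: T_smult)
  moreover have "hit a n m d = 0" using False unfolding hit_def by auto
  ultimately show ?thesis by simp
qed

lemma card_upow_gpow:
  assumes "gr M d \<subseteq> carrier M"
  shows "card (upow (gpow M k) m d) = card (upow M m d) ^ k"
proof -
  have "gr (gpow M k) d = (\<Pi>\<^sub>E j\<in>{..<k}. gr M d)"
    unfolding gpow_simps by (rule PiE_subset_eq) (rule assms)
  then have "upow (gpow M k) m d = (\<Pi>\<^sub>E j\<in>{..<k}. upow M m d)"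
    unfolding upow_def image_PiE[symmetric] by (simp add: gpow_simps)
  then show ?thesis by (simp add: card_PiE)
qed

lemma card_upow_gdsum:
  assumes "finite I" "\<And>i. i \<in> I \<Longrightarrow> gr (M i) d \<subseteq> carrier (M i)"
  shows "card (upow (gdsum I M) m d) = (\<Prod>i\<in>I. card (upow (M i) m d))"
proof -
  have "gr (gdsum I M) d = (\<Pi>\<^sub>E i\<in>I. gr (M i) d)"
    unfolding gdsum_finite[OF assms(1)] by (rule PiE_subset_eq) (rule assms(2))
  then have "upow (gdsum I M) m d = (\<Pi>\<^sub>E i\<in>I. upow (M i) m d)"
    unfolding upow_def image_PiE[symmetric] by (simp add: gdsum_finite[OF assms(1)])
  then show ?thesis using assms(1) by (simp add: card_PiE)
qed

lemma gpow_gr_subset: "gr (gpow M k) d \<subseteq> carrier (gpow M k)"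
  by (auto simp: gpow_simps)

lemma card_upow_cyclic_sum:
  assumes "finite I"
  shows "card (upow (gdsum I (\<lambda>i. gpow (T (a i) (n i)) (k i))) m d) = 2 ^ (\<Sum>i\<in>I. k i * hit (a i) (n i) m d)"
proof -
  have "card (upow (gdsum I (\<lambda>i. gpow (T (a i) (n i)) (k i))) m d) = (\<Prod>i\<in>I. (2 ^ hit (a i) (n i) m d) ^ k i)"
    by (subst card_upow_gdsum[OF assms gpow_gr_subset])
       (simp add: card_upow_gpow[OF T_gr_subset] card_upow_T)
  also have "\<dots> = (\<Prod>i\<in>I. 2 ^ (k i * hit (a i) (n i) m d))"
    by (simp add: power_mult[symmetric] mult.commute)
  finally show ?thesis by (simp add: power_sum)
qed

text \<open>The coefficient functionals on a sum of cyclic modules separate its elements, and each of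
  them is supported in a single degree. This replaces the verification that the sum is a graded
  module.\<close>

definition ccoeff :: "('i \<Rightarrow> nat) \<Rightarrow> 'i \<Rightarrow> nat \<Rightarrow> nat \<Rightarrow> ('i \<Rightarrow> nat \<Rightarrow> bit poly set) \<Rightarrow> bit" where
  "ccoeff n i j c F = coeff (SOME p. F i j = tcos (n i) p) c"

context
  fixes I :: "'i set" and a :: "'i \<Rightarrow> rat" and n k :: "'i \<Rightarrow> nat" and G
  assumes I: "finite I" and G_eq: "G = gdsum I (\<lambda>i. gpow (T (a i) (n i)) (k i))"
begin

lemma G_carrier: "carrier G = (\<Pi>\<^sub>E i\<in>I. \<Pi>\<^sub>E j\<in>{..<k i}. range (tcos (n i)))"
  unfolding G_eq by (simp add: gdsum_finite[OF I] gpow_simps T_carrier)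

lemma ccoeff_eq: "F i j = tcos (n i) p \<Longrightarrow> c < n i \<Longrightarrow> ccoeff n i j c F = coeff p c"
proof -
  assume F: "F i j = tcos (n i) p" and c: "c < n i"
  have "F i j = tcos (n i) (SOME p. F i j = tcos (n i) p)" by (rule someI[of _ p]) (rule F)
  then show ?thesis using c unfolding F ccoeff_def tcos_eq_iff by simp
qed

lemma G_coset: "F \<in> carrier G \<Longrightarrow> i \<in> I \<Longrightarrow> j < k i \<Longrightarrow> \<exists>p. F i j = tcos (n i) p"
proof -
  assume F: "F \<in> carrier G" and i: "i \<in> I" and j: "j < k i"
  have "F i \<in> (\<Pi>\<^sub>E j\<in>{..<k i}. range (tcos (n i)))" using F i unfolding G_carrier by (rule PiE_mem)
  then have "F i j \<in> range (tcos (n i))" using j by auto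
  then show ?thesis by blast
qed

lemma ccoeff_add:
  assumes F: "F \<in> carrier G" "F' \<in> carrier G" and i: "i \<in> I" "j < k i" "c < n i"
  shows "ccoeff n i j c (F \<oplus>\<^bsub>G\<^esub> F') = ccoeff n i j c F + ccoeff n i j c F'"
proof -
  obtain p where p: "F i j = tcos (n i) p" using G_coset[OF F(1) i(1,2)] by blast
  obtain p' where p': "F' i j = tcos (n i) p'" using G_coset[OF F(2) i(1,2)] by blast
  have "(F \<oplus>\<^bsub>G\<^esub> F') i j = tcos (n i) (p + p')"
    using i p p' unfolding G_eq by (simp add: gdsum_finite[OF I] gpow_simps T_add)
  then have "ccoeff n i j c (F \<oplus>\<^bsub>G\<^esub> F') = coeff (p + p') c" using i(3) by (rule ccoeff_eq)
  moreover have "ccoeff n i j c F = coeff p c" using p i(3) by (rule ccoeff_eq)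
  moreover have "ccoeff n i j c F' = coeff p' c" using p' i(3) by (rule ccoeff_eq)
  ultimately show ?thesis by (simp only: coeff_add)
qed

lemma ccoeff_gr:
  assumes F: "F \<in> gr G d" and i: "i \<in> I" "j < k i" "c < n i" and d: "a i - 2 * of_nat c \<noteq> d"
  shows "ccoeff n i j c F = 0"
proof -
  have "F i j \<in> gr (T (a i) (n i)) d"
    using F i unfolding G_eq by (simp add: gdsum_finite[OF I] gpow_simps)
  then obtain p where p: "F i j = tcos (n i) p" "\<forall>i'. coeff p i' \<noteq> 0 \<longrightarrow> a i - 2 * of_nat i' = d"
    unfolding T_gr by blast
  have "ccoeff n i j c F = coeff p c" using p(1) i(3) by (rule ccoeff_eq)
  then show ?thesis using p(2) d by auto
qed

lemma G_gr_carrier: "gr G d \<subseteq> carrier G"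
  unfolding G_eq by (auto simp: gdsum_finite[OF I])

lemma ccoeff_ext:
  assumes F: "F \<in> carrier G" "F' \<in> carrier G"
    and eq: "\<And>i j c. i \<in> I \<Longrightarrow> j < k i \<Longrightarrow> c < n i \<Longrightarrow> ccoeff n i j c F = ccoeff n i j c F'"
  shows "F = F'"
proof (rule PiE_ext[OF F[unfolded G_carrier]])
  fix i assume i: "i \<in> I"
  show "F i = F' i"
  proof (rule PiE_ext[OF PiE_mem[OF F(1)[unfolded G_carrier] i] PiE_mem[OF F(2)[unfolded G_carrier] i]])
    fix j assume j: "j \<in> {..<k i}"
    obtain p where p: "F i j = tcos (n i) p" using G_coset[OF F(1) i] j by blast
    obtain p' where p': "F' i j = tcos (n i) p'" using G_coset[OF F(2) i] j by blast
    have "coeff p c = coeff p' c" if c: "c < n i" for c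
    proof -
      have "ccoeff n i j c F = coeff p c" using p c by (rule ccoeff_eq)
      moreover have "ccoeff n i j c F' = coeff p' c" using p' c by (rule ccoeff_eq)
      ultimately show ?thesis using eq[OF i _ c, of j] j by simp
    qed
    then show "F i j = F' i j" unfolding p p' tcos_eq_iff by blast
  qed
qed

end

text \<open>Supplies the module laws of the root module from those of homology, in place of a
  verification from its explicit scalar multiplication.\<close>

lemma fu_module_giso:
  assumes M: "fu_module M" and f: "f \<in> giso M N" and N: "abelian_group N"
  shows "fu_module N"
proof -
  interpret M: fu_module M by (rule M)
  interpret N: abelian_group N by (rule N)
  have h: "f \<in> ghom 0 M N" and b: "f ` carrier M = carrier N"
    using f unfolding giso_def bij_betw_def by auto
  note fD = ghomD[OF h]
  have pre: "\<exists>x\<in>carrier M. y = f x" if "y \<in> carrier N" for y using that b by blast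
  show ?thesis
  proof (rule fu_moduleI[OF N])
    fix x y p q assume "x \<in> carrier N" "y \<in> carrier N"
    then obtain u v where u: "u \<in> carrier M" "x = f u" and v: "v \<in> carrier M" "y = f v" using pre by metis
    show "p \<odot>\<^bsub>N\<^esub> (x \<oplus>\<^bsub>N\<^esub> y) = p \<odot>\<^bsub>N\<^esub> x \<oplus>\<^bsub>N\<^esub> p \<odot>\<^bsub>N\<^esub> y"
      using u v by (simp add: fD(2,3)[symmetric] M.smult_add)
  next
    fix x p q assume "x \<in> carrier N"
    then obtain u where u: "u \<in> carrier M" "x = f u" using pre by metis
    show "p \<odot>\<^bsub>N\<^esub> x \<in> carrier N" using u fD(1) by (simp add: fD(3)[symmetric])
    show "(p + q) \<odot>\<^bsub>N\<^esub> x = p \<odot>\<^bsub>N\<^esub> x \<oplus>\<^bsub>N\<^esub> q \<odot>\<^bsub>N\<^esub> x"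
      using u by (simp add: fD(2,3)[symmetric] M.smult_poly_add)
    show "(p * q) \<odot>\<^bsub>N\<^esub> x = p \<odot>\<^bsub>N\<^esub> (q \<odot>\<^bsub>N\<^esub> x)"
      using u by (simp add: fD(3)[symmetric] M.smult_poly_mult)
    show "1 \<odot>\<^bsub>N\<^esub> x = x" using u by (simp add: fD(3)[symmetric])
  qed
qed

text \<open>Such an element is given by an arbitrary subset of \<open>X - {u}\<close>; whether
  \<open>u\<close> belongs to the support is then forced by parity.\<close>

lemma card_even_span:
  fixes X :: "'v set"
  assumes "finite X" "u \<in> X"
  shows "card {x :: 'v \<Rightarrow>\<^sub>0 bit. keys x \<subseteq> X \<and> eps x = 0} = 2 ^ (card X - 1)"
proof -
  let ?S = "{x :: 'v \<Rightarrow>\<^sub>0 bit. keys x \<subseteq> X \<and> eps x = 0}"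
  let ?f = "\<lambda>x :: 'v \<Rightarrow>\<^sub>0 bit. keys x - {u}"
  have "bij_betw ?f ?S (Pow (X - {u}))"
    unfolding bij_betw_def
  proof (intro conjI inj_onI)
    fix x y assume x: "x \<in> ?S" and y: "y \<in> ?S" and eq: "?f x = ?f y"
    have "sm (- {u}) x = sm (- {u}) y"
    proof -
      have "keys x \<inter> - {u} = keys y \<inter> - {u}" using eq by blast
      then show ?thesis unfolding sm_card by simp
    qed
    moreover have "eps z = sm {u} z + sm (- {u}) z" for z :: "'v \<Rightarrow>\<^sub>0 bit"
      using sm_Un[of "{u}" "- {u}" z] by (simp add: Compl_partition)
    ultimately have "sm {u} x + sm (- {u}) x = sm {u} y + sm (- {u}) x" using x y by simp
    then have "sm {u} x = sm {u} y" by (rule add_right_imp_eq)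
    show "x = y"
    proof (rule poly_mapping_eqI)
      fix v
      show "lookup x v = lookup y v"
      proof (cases "v = u")
        case True
        then show ?thesis using \<open>sm {u} x = sm {u} y\<close> by (simp add: sm_singleton)
      next
        case False
        then have "v \<in> keys x \<longleftrightarrow> v \<in> keys y" using eq by blast
        then show ?thesis unfolding lookup_bit by simp
      qed
    qed
  next
    show "?f ` ?S = Pow (X - {u})"
    proof (intro equalityI subsetI)
      fix Q assume Q: "Q \<in> Pow (X - {u})"
      then have fin: "finite Q" using assms(1) finite_subset by blast
      define y where "y = (\<Sum>v\<in>Q. vert v)"
      have ly: "lookup y w = (if w \<in> Q then 1 else 0)" for w
        unfolding y_def by (simp add: lookup_sum lookup_single when_def fin sum.delta)
      define x where "x = y + (if eps y = 0 then 0 else vert u)"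
      have kx: "w \<in> keys x \<longleftrightarrow> w \<in> Q" if "w \<noteq> u" for w
        using that unfolding x_def by (simp add: in_keys_iff lookup_add ly lookup_single)
      have "eps x = 0"
        unfolding x_def sm_add by (cases "eps y = 0") (simp_all add: sm_vert)
      moreover have "keys x \<subseteq> X"
      proof
        fix w assume "w \<in> keys x"
        then show "w \<in> X" using kx[of w] Q assms(2) by (cases "w = u") auto
      qed
      moreover have "?f x = Q"
      proof (rule Set.set_eqI)
        fix w show "w \<in> ?f x \<longleftrightarrow> w \<in> Q" using kx[of w] Q by (cases "w = u") auto
      qed
      ultimately show "Q \<in> ?f ` ?S" by blast
    qed auto
  qed
  then have "card ?S = card (Pow (X - {u}))" by (rule bij_betw_same_card)
  also have "\<dots> = 2 ^ (card X - 1)" using assms by (simp add: card_Pow)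
  finally show ?thesis .
qed

section \<open>Torsion of the root module, level by level\<close>

context sroot
begin

text \<open>\<open>root_module\<close> with \<chi> written as \<open>\<chi>0\<close> plus an integer
  level; the two agree for \<open>s = \<sigma> + 2 * \<chi>0\<close>.\<close>

definition RM :: "rat \<Rightarrow> ('v \<Rightarrow>\<^sub>0 bit) gmod" where
  "RM s =
    \<lparr>carrier = {x. keys x \<subseteq> V}, monoid.mult = undefined, one = undefined,
     zero = 0, add = (+),
     module.smult = (\<lambda>p x. \<Sum>i\<le>degree p. \<Sum>v\<in>keys x.
        single ((dn ^^ i) v) (coeff p i * lookup x v)),
     gr = (\<lambda>d. {x. keys x \<subseteq> {v \<in> V. 2 * of_int (lv v) + s = d}})\<rparr>"

lemma RM_simps [simp]:
  "carrier (RM s) = {x. keys x \<subseteq> V}" "\<zero>\<^bsub>RM s\<^esub> = 0" "x \<oplus>\<^bsub>RM s\<^esub> y = x + y"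
  "gr (RM s) d = {x. keys x \<subseteq> {v \<in> V. 2 * of_int (lv v) + s = d}}"
  by (simp_all add: RM_def)

lemma RM_smult: "p \<odot>\<^bsub>RM s\<^esub> x = (\<Sum>i\<le>degree p. if coeff p i = 0 then 0 else lin (dn ^^ i) x)"
  unfolding RM_def by (auto simp: lin_def intro!: sum.cong)

lemma RM_U: "(Uvar ^ m) \<odot>\<^bsub>RM s\<^esub> x = lin (dn ^^ m) x"
proof -
  have "(Uvar ^ m) \<odot>\<^bsub>RM s\<^esub> x = (\<Sum>i\<le>m. if i = m then lin (dn ^^ i) x else 0)"
    unfolding RM_smult Uvar_power degree_monom_eq[OF one_neq_zero]
    by (rule sum.cong[OF refl]) (simp add: coeff_monom)
  then show ?thesis by simp
qed

lemma RM_abelian_group: "abelian_group (RM s)"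
  by (rule abelian_group_char2I) (simp_all add: keys_add_subset add.assoc add.commute)

definition tors :: "('v \<Rightarrow>\<^sub>0 bit) \<Rightarrow> bool" where "tors x \<longleftrightarrow> (\<exists>n. lin (dn ^^ n) x = 0)"

lemma finite_L: "finite (L k)"
  unfolding L_def by (rule lv_fin)

text \<open>Push down to a level with a single vertex \<open>w\<close>: what remains is the
  coefficient sum times \<open>w\<close>.\<close>

lemma tors_iff_eps:
  assumes x: "keys x \<subseteq> L k"
  shows "tors x \<longleftrightarrow> eps x = 0"
proof
  assume "tors x"
  then show "eps x = 0" unfolding tors_def using eps_lin[of _ x] by (metis sm_zero)
next
  assume e: "eps x = 0"
  define n where "n = nat (k - low)"
  have "k - int n \<le> low" unfolding n_def by simp
  from low[OF this] obtain w where w: "{v \<in> V. lv v = k - int n} = {w}" ..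
  have "lin (dn ^^ n) x = lin (\<lambda>_. w) x"
  proof (rule lin_cong)
    fix v assume "v \<in> keys x"
    then have "v \<in> V" "lv v = k" using x unfolding L_def by auto
    then have "(dn ^^ n) v \<in> {v \<in> V. lv v = k - int n}" using dn_pow[of v n] by simp
    then show "(dn ^^ n) v = w" unfolding w by simp
  qed
  also have "\<dots> = 0"
  proof (rule poly_mapping_eqI)
    fix u
    have "sm {u} (lin (\<lambda>_. w) x) = 0"
      unfolding sm_lin using e by (cases "w = u") (simp_all add: sm_card)
    then show "lookup (lin (\<lambda>_. w) x) u = lookup 0 u" by (simp add: sm_singleton)
  qed
  finally show "tors x" unfolding tors_def by blast
qed

text \<open>The torsion in level \<open>e\<close> consists of the elements with even support, whence the subtraction.\<close>

definition rk :: "int \<Rightarrow> nat \<Rightarrow> nat" where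
  "rk e m = card ((dn ^^ m) ` L e) - 1"

text \<open>\<open>U ^ m\<close> maps the torsion of level \<open>e\<close> onto all elements with
  even support in the image vertices: lift such an element by choosing a preimage of each
  vertex.\<close>

lemma card_tors_level:
  "card (lin (dn ^^ m) ` {x. keys x \<subseteq> L e \<and> tors x}) = 2 ^ rk e m"
proof -
  have "{x. keys x \<subseteq> L e \<and> tors x} = {x. keys x \<subseteq> L e \<and> eps x = 0}"
    using tors_iff_eps by blast
  moreover have "lin (dn ^^ m) ` {x. keys x \<subseteq> L e \<and> eps x = 0} =
     {x. keys x \<subseteq> (dn ^^ m) ` L e \<and> eps x = 0}"
  proof (intro equalityI subsetI)
    fix y assume "y \<in> lin (dn ^^ m) ` {x. keys x \<subseteq> L e \<and> eps x = 0}"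
    then obtain x where x: "y = lin (dn ^^ m) x" "keys x \<subseteq> L e" "eps x = 0" by blast
    then show "y \<in> {x. keys x \<subseteq> (dn ^^ m) ` L e \<and> eps x = 0}"
      using order_trans[OF keys_lin[of "dn ^^ m" x] image_mono[OF x(2), of "dn ^^ m"]] eps_lin[of "dn ^^ m" x]
      by simp
  next
    fix y assume y: "y \<in> {x. keys x \<subseteq> (dn ^^ m) ` L e \<and> eps x = 0}"
    define r where "r = inv_into (L e) (dn ^^ m)"
    have r: "r w \<in> L e" "(dn ^^ m) (r w) = w" if "w \<in> keys y" for w
      using that y inv_into_into[of w "dn ^^ m" "L e"] f_inv_into_f[of w "dn ^^ m" "L e"] unfolding r_def by auto
    have "keys (lin r y) \<subseteq> L e" using keys_lin[of r y] r by blast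
    moreover have "eps (lin r y) = 0" using y by (simp add: eps_lin)
    moreover have "lin (dn ^^ m) (lin r y) = y" unfolding lin_lin by (rule lin_id) (rule r)
    ultimately show "y \<in> lin (dn ^^ m) ` {x. keys x \<subseteq> L e \<and> eps x = 0}" by (metis (mono_tags, lifting) image_eqI mem_Collect_eq)
  qed
  moreover have "card {x :: 'v \<Rightarrow>\<^sub>0 bit. keys x \<subseteq> (dn ^^ m) ` L e \<and> eps x = 0} = 2 ^ rk e m"
  proof (cases "L e = {}")
    \<comment> \<open>For an empty level the truncated subtraction in \<open>rk\<close> gives 0,
      which is the dimension of the zero space.\<close>
    case True
    then have "{x :: 'v \<Rightarrow>\<^sub>0 bit. keys x \<subseteq> (dn ^^ m) ` L e \<and> eps x = 0} = {0}" by auto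
    then show ?thesis using True by (simp add: rk_def)
  next
    case False
    then obtain u where "u \<in> L e" by blast
    then show ?thesis unfolding rk_def using finite_L by (intro card_even_span[of _ "(dn ^^ m) u"]) auto
  qed
  ultimately show ?thesis by simp
qed

end

lemma hit_eq:
  assumes "a = d + 2 * of_int z"
  shows "hit a n m d = (if 0 \<le> z \<and> z + int m < int n then 1 else 0)"
proof -
  have "(\<exists>c. a - 2 * of_nat c = d \<and> c + m < n) \<longleftrightarrow> 0 \<le> z \<and> z + int m < int n"
  proof
    assume "\<exists>c. a - 2 * of_nat c = d \<and> c + m < n"
    then obtain c where c: "a - 2 * of_nat c = d" "c + m < n" by blast
    have "(of_int z :: rat) = of_int (int c)" using c(1) assms by simp
    then have "z = int c" by (simp only: of_int_eq_iff)
    then show "0 \<le> z \<and> z + int m < int n" using c(2) by simp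
  next
    assume z: "0 \<le> z \<and> z + int m < int n"
    then obtain c where c: "z = int c" using nonneg_int_cases by blast
    then have "a - 2 * of_nat c = d" using assms by simp
    moreover have "c + m < n" using z c by simp
    ultimately show "\<exists>c. a - 2 * of_nat c = d \<and> c + m < n" by blast
  qed
  then show ?thesis by (simp add: hit_def)
qed

lemma hit_nonzero: "hit a n m d \<noteq> 0 \<Longrightarrow> \<exists>z. a = d + 2 * of_int z"
proof -
  assume "hit a n m d \<noteq> 0"
  then obtain c where "a - 2 * of_nat c = d" unfolding hit_def by (auto split: if_splits)
  then have "a = d + 2 * of_int (int c)" by simp
  then show ?thesis by blast
qed

text \<open>Passing from \<open>m\<close> to \<open>Suc m\<close> in degree \<open>d\<close> detects
  whether the summand has an element there killed by \<open>U ^ Suc m\<close> but not by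
  \<open>U ^ m\<close>. The same test in degree \<open>d + 2\<close>, with \<open>m\<close> raised
  by one, detects when this element is a multiple of \<open>U\<close>. What is left is the
  generator; signs disappear modulo 2.\<close>

lemma hit_second_difference:
  "odd (hit a n m d + hit a n (Suc m) d + hit a n (Suc m) (d + 2) + hit a n (Suc (Suc m)) (d + 2)) \<longleftrightarrow>
     a = d \<and> n = Suc m"
proof (cases "\<exists>z. a = d + 2 * of_int z")
  case True
  then obtain z where z: "a = d + 2 * of_int z" by blast
  then have z': "a = (d + 2) + 2 * of_int (z - 1)" by simp
  show ?thesis unfolding hit_eq[OF z] hit_eq[OF z'] using z by auto
next
  case False
  then have "\<nexists>z. a = (d + 2) + 2 * of_int z"
  proof -
    have "a = d + 2 * of_int (z + 1)" if "a = (d + 2) + 2 * of_int z" for z using that by simp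
    then show ?thesis using False by blast
  qed
  then have "hit a n m' d = 0" "hit a n m' (d + 2) = 0" for m' using False hit_nonzero by blast+
  then show ?thesis using False by (auto intro: exI[of _ 0])
qed

lemma fu_module_gshift: assumes "fu_module M" shows "fu_module (gshift s M)"
proof -
  interpret M: fu_module M by fact
  have "abelian_group (gshift s M)"
    by (rule abelian_group_char2I) (simp_all add: M.M.a_ac)
  then show ?thesis by (rule fu_moduleI) (simp_all add: M.smult_poly_add M.smult_add M.smult_poly_mult)
qed

lemma torsion_simps [simp]:
  "carrier (torsion M) = {x \<in> carrier M. \<exists>n. (Uvar ^ n) \<odot>\<^bsub>M\<^esub> x = \<zero>\<^bsub>M\<^esub>}" "\<zero>\<^bsub>torsion M\<^esub> = \<zero>\<^bsub>M\<^esub>"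
  "x \<oplus>\<^bsub>torsion M\<^esub> y = x \<oplus>\<^bsub>M\<^esub> y" "p \<odot>\<^bsub>torsion M\<^esub> x = p \<odot>\<^bsub>M\<^esub> x"
  "gr (torsion M) d = gr M d \<inter> {x \<in> carrier M. \<exists>n. (Uvar ^ n) \<odot>\<^bsub>M\<^esub> x = \<zero>\<^bsub>M\<^esub>}"
  by (simp_all add: torsion_def)

lemma (in fu_module) torsion_submod:
  "submod M {x \<in> carrier M. \<exists>n. (Uvar ^ n) \<odot> x = \<zero>}"
proof -
  have "\<exists>n. (Uvar ^ n) \<odot> (x \<oplus> y) = \<zero>"
    if "x \<in> carrier M" "y \<in> carrier M" "(Uvar ^ m) \<odot> x = \<zero>" "(Uvar ^ n) \<odot> y = \<zero>" for x y m n
  proof -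
    have "(Uvar ^ (m + n)) \<odot> (x \<oplus> y) = (Uvar ^ (n + m)) \<odot> x \<oplus> (Uvar ^ (m + n)) \<odot> y"
      using that(1,2) by (simp only: smult_add add.commute)
    also have "\<dots> = \<zero>" unfolding smult_power_add[OF that(1)] smult_power_add[OF that(2)] that(3,4) by simp
    finally show ?thesis by blast
  qed
  moreover have "\<exists>n. (Uvar ^ n) \<odot> (p \<odot> x) = \<zero>" if "x \<in> carrier M" "(Uvar ^ n) \<odot> x = \<zero>" for x p n
  proof -
    have "(Uvar ^ n) \<odot> (p \<odot> x) = p \<odot> ((Uvar ^ n) \<odot> x)"
      using that(1) by (simp add: smult_poly_mult[symmetric] mult.commute)
    then show ?thesis using that(2) by auto
  qed
  ultimately show ?thesis unfolding submod_def by auto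
qed

lemma fu_module_torsion: "fu_module M \<Longrightarrow> fu_module (torsion M)"
  unfolding torsion_def by (rule fu_module.fu_module_gsub[OF _ fu_module.torsion_submod])

lemma giso_torsion:
  assumes M: "fu_module M" and N: "fu_module N" and f: "M \<cong>\<^sub>g\<^sub>r N"
  shows "gshift s (torsion M) \<cong>\<^sub>g\<^sub>r gshift s (torsion N)"
proof -
  obtain f where f: "f \<in> ghom 0 M N" "inj_on f (carrier M)" "f ` carrier M = carrier N"
    using f unfolding gisomorphic_def giso_def bij_betw_def by auto
  note fD = ghomD[OF f(1)]
  interpret M: fu_module M by (rule M)
  have f0: "f \<zero>\<^bsub>M\<^esub> = \<zero>\<^bsub>N\<^esub>" by (rule ghom_zero[OF f(1) M N])
  have iff: "(Uvar ^ n) \<odot>\<^bsub>N\<^esub> f x = \<zero>\<^bsub>N\<^esub> \<longleftrightarrow> (Uvar ^ n) \<odot>\<^bsub>M\<^esub> x = \<zero>\<^bsub>M\<^esub>" if "x \<in> carrier M" for x n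
  proof -
    have "(Uvar ^ n) \<odot>\<^bsub>N\<^esub> f x = f ((Uvar ^ n) \<odot>\<^bsub>M\<^esub> x)" using fD(3) that by simp
    then show ?thesis using inj_on_eq_iff[OF f(2), of "(Uvar ^ n) \<odot>\<^bsub>M\<^esub> x" "\<zero>\<^bsub>M\<^esub>"] f0 that by simp
  qed
  have "f \<in> ghom 0 (gshift s (torsion M)) (gshift s (torsion N))"
  proof (rule ghomI[OF fu_module_gshift[OF fu_module_torsion[OF M]] fu_module_gshift[OF fu_module_torsion[OF N]]])
    fix d x assume "x \<in> gr (gshift s (torsion M)) d"
    then show "f x \<in> gr (gshift s (torsion N)) (d + 0)" using iff fD(1) fD(4)[of x "d - s"] by auto
  qed (use iff fD in auto)
  moreover have "f ` {x \<in> carrier M. \<exists>n. (Uvar ^ n) \<odot>\<^bsub>M\<^esub> x = \<zero>\<^bsub>M\<^esub>} = {x \<in> carrier N. \<exists>n. (Uvar ^ n) \<odot>\<^bsub>N\<^esub> x = \<zero>\<^bsub>N\<^esub>}"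
    unfolding f(3)[symmetric] using iff by (auto simp: image_iff)
  moreover have "inj_on f {x \<in> carrier M. \<exists>n. (Uvar ^ n) \<odot>\<^bsub>M\<^esub> x = \<zero>\<^bsub>M\<^esub>}"
    by (rule inj_on_subset[OF f(2)]) blast
  ultimately show ?thesis unfolding gisomorphic_def giso_def bij_betw_def by auto
qed

lemma gisomorphic_trans:
  assumes "M \<cong>\<^sub>g\<^sub>r N" "N \<cong>\<^sub>g\<^sub>r P"
  shows "M \<cong>\<^sub>g\<^sub>r P"
proof -
  obtain f g where "f \<in> ghom 0 M N" "bij_betw f (carrier M) (carrier N)"
    "g \<in> ghom 0 N P" "bij_betw g (carrier N) (carrier P)"
    using assms unfolding gisomorphic_def giso_def by auto
  then have "g \<circ> f \<in> giso M P" unfolding giso_def using ghom_comp[of f 0 M N g 0 P] bij_betw_trans by auto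
  then show ?thesis unfolding gisomorphic_def by blast
qed

section \<open>Parity of the ranks and the odd multiplicities\<close>

context sroot
begin

text \<open>Cut a tallest branch over the stem vertex at level \<open>e\<close>.\<close>

lemma stem_image:
  assumes "e - int m \<le> s0"
  shows "st (e - int m) \<in> (dn ^^ m) ` L e \<longleftrightarrow> e \<le> A (e - int m)"
proof
  assume "st (e - int m) \<in> (dn ^^ m) ` L e"
  then obtain u where u: "u \<in> V" "lv u = e" "(dn ^^ m) u = st (e - int m)" unfolding L_def by auto
  then show "e \<le> A (e - int m)" using A_ub[OF assms u(1)] dn_pow_pr[OF u(1), of m] by simp
next
  assume e: "e \<le> A (e - int m)"
  obtain u where u: "u \<in> V" "lv u = A (e - int m)" "pr u (e - int m) = st (e - int m)"
    using A_ex[OF assms] by blast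
  have p: "pr u e \<in> V" "lv (pr u e) = e" using pr_V lv_pr u e by auto
  have "(dn ^^ m) (pr u e) = st (e - int m)"
    using dn_pow_pr[OF p(1), of m] p(2) pr_pr[OF u(1), of "e - int m" e] u e by simp
  then show "st (e - int m) \<in> (dn ^^ m) ` L e" using p unfolding L_def by force
qed

text \<open>The image vertices form a \<open>J\<close>-stable set whose only possible fixed point is
  the stem vertex, so their number is odd exactly when \<open>stem_image\<close> applies;
  \<open>rk\<close> is one less.\<close>

lemma rk_parity:
  "odd (rk e m) \<longleftrightarrow> L e \<noteq> {} \<and> \<not> (e - int m \<le> s0 \<and> e \<le> A (e - int m))"
proof (cases "L e = {}")
  case False
  let ?X = "(dn ^^ m) ` L e"
  have fin: "finite ?X" using finite_L by simp
  have XV: "v \<in> V \<and> lv v = e - int m" if "v \<in> ?X" for v using that dn_pow unfolding L_def by auto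
  have JX: "J v \<in> ?X" if vX: "v \<in> ?X" for v
  proof -
    obtain u where "u \<in> L e" "v = (dn ^^ m) u" using vX by blast
    then have "J u \<in> L e" "J v = (dn ^^ m) (J u)" using J_V lv_J dn_pow unfolding L_def by auto
    then show ?thesis by blast
  qed
  have "even (card ?X) \<longleftrightarrow> even (card {v \<in> ?X. J v = v})"
    using fin JX J_J XV by (intro parity_involution) auto
  also have "\<dots> \<longleftrightarrow> \<not> (e - int m \<le> s0 \<and> e \<le> A (e - int m))"
  proof (cases "e - int m \<le> s0")
    case True
    have F: "{v \<in> ?X. J v = v} = ?X \<inter> {st (e - int m)}"
    proof (intro equalityI subsetI)
      fix v assume v: "v \<in> {v \<in> ?X. J v = v}"
      then have "v \<in> S" "lv v = e - int m" using XV unfolding S_def by auto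
      then show "v \<in> ?X \<inter> {st (e - int m)}" using st_eq v by force
    next
      fix v assume "v \<in> ?X \<inter> {st (e - int m)}"
      then show "v \<in> {v \<in> ?X. J v = v}" using S_J[OF st(1)[OF True]] by auto
    qed
    show ?thesis
      unfolding F using stem_image[OF True] True by (cases "st (e - int m) \<in> ?X") auto
  next
    case n: False
    have F: "{v \<in> ?X. J v = v} = {}"
    proof -
      have "\<not> J v = v" if "v \<in> ?X" for v
        using XV[OF that] s0_ge[of v] n unfolding S_def by auto
      then show ?thesis by blast
    qed
    show ?thesis unfolding F using n by simp
  qed
  finally have "even (card ?X) \<longleftrightarrow> \<not> (e - int m \<le> s0 \<and> e \<le> A (e - int m))" .
  moreover have "card ?X \<noteq> 0" using fin False by auto
  then have "card ?X = Suc (rk e m)" unfolding rk_def by simp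
  ultimately show ?thesis using False by simp
qed (simp add: rk_def)

text \<open>The conditions on \<open>L\<close> cancel, since a level reached over the stem is
  nonempty. What remains is odd iff exactly one of \<open>A r\<close> and \<open>A (r + 1)\<close>
  equals \<open>d\<close>, where \<open>r = d - int (Suc m)\<close>; the two heights then differ, so
  \<open>r\<close> is a jump. For \<open>r = s0\<close> only \<open>A r\<close> is present.\<close>

lemma rk_second_difference:
  "odd (rk d m + rk d (Suc m) + rk (d + 1) (Suc m) + rk (d + 1) (Suc (Suc m))) \<longleftrightarrow> odd_pair d (Suc m)"
proof -
  define r where "r = d - int (Suc m)"
  have lv: "d - int m = r + 1" "d - int (Suc m) = r" "d + 1 - int (Suc m) = r + 1" "d + 1 - int (Suc (Suc m)) = r"
    unfolding r_def by auto
  have rd: "r < d" unfolding r_def by simp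
  define ab where "ab t e \<longleftrightarrow> t \<le> s0 \<and> e \<le> A t" for t e
  have ne: "L e \<noteq> {}" if abt: "ab t e" "t \<le> e" for t e
  proof -
    obtain u where u: "u \<in> V" "lv u = A t" using A_ex abt unfolding ab_def by blast
    have "pr u e \<in> L e" unfolding L_def using pr_V lv_pr u abt unfolding ab_def by simp
    then show ?thesis by blast
  qed
  have mono: "ab r e" if "ab (r + 1) e" for e
    using that A_mono[of r "r + 1"] unfolding ab_def by auto
  have p: "odd (rk d m) \<longleftrightarrow> L d \<noteq> {} \<and> \<not> ab (r + 1) d" "odd (rk d (Suc m)) \<longleftrightarrow> L d \<noteq> {} \<and> \<not> ab r d"
    "odd (rk (d + 1) (Suc m)) \<longleftrightarrow> L (d + 1) \<noteq> {} \<and> \<not> ab (r + 1) (d + 1)"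
    "odd (rk (d + 1) (Suc (Suc m))) \<longleftrightarrow> L (d + 1) \<noteq> {} \<and> \<not> ab r (d + 1)"
    unfolding rk_parity lv ab_def by (rule refl)+
  have odd_sum: "odd (x + y) \<longleftrightarrow> odd x \<noteq> odd y" for x y :: nat by simp
  have x1: "odd (rk d m + rk d (Suc m)) \<longleftrightarrow> ab r d \<and> \<not> ab (r + 1) d"
    unfolding odd_sum p
    using ne[of r d] mono[of d] rd by auto
  have x2: "odd (rk (d + 1) (Suc m) + rk (d + 1) (Suc (Suc m))) \<longleftrightarrow> ab r (d + 1) \<and> \<not> ab (r + 1) (d + 1)"
    unfolding odd_sum p
    using ne[of r "d + 1"] mono[of "d + 1"] rd by auto
  have "odd (rk d m + rk d (Suc m) + rk (d + 1) (Suc m) + rk (d + 1) (Suc (Suc m))) \<longleftrightarrow>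
     (odd (rk d m + rk d (Suc m)) \<noteq> odd (rk (d + 1) (Suc m) + rk (d + 1) (Suc (Suc m))))"
    by auto
  also have "\<dots> \<longleftrightarrow> odd_pair d (Suc m)"
    unfolding x1 x2 odd_pair_def lv(2)
  proof (cases "r \<le> s0")
    case True
    show "((ab r d \<and> \<not> ab (r + 1) d) \<noteq> (ab r (d + 1) \<and> \<not> ab (r + 1) (d + 1))) \<longleftrightarrow>
      0 < Suc m \<and> jump r \<and> (A r = d \<or> r < s0 \<and> A (r + 1) = d)"
    proof (cases "r = s0")
      case eq: True
      show ?thesis using jump_s0 unfolding eq ab_def by auto
    next
      case False
      then have rs: "r < s0" using True by simp
      have le: "A (r + 1) \<le> A r" using A_mono[of r "r + 1"] rs by simp
      have j: "jump r \<longleftrightarrow> A (r + 1) < A r" using jumpI[of r] jump_less[of r "r + 1"] rs by auto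
      show ?thesis unfolding ab_def j using rs le by auto
    qed
  next
    case False
    then show "((ab r d \<and> \<not> ab (r + 1) d) \<noteq> (ab r (d + 1) \<and> \<not> ab (r + 1) (d + 1))) \<longleftrightarrow>
      0 < Suc m \<and> jump r \<and> (A r = d \<or> r < s0 \<and> A (r + 1) = d)"
      using jump_le unfolding ab_def by auto
  qed
  finally show ?thesis .
qed

text \<open>Since the pairs are distinct, at most one index has a given generator degree and length,
  and the parity of the weighted second difference is the parity of its multiplicity. The same
  second difference is known for \<open>rk\<close>.\<close>

lemma odd_multiplicity:
  fixes I :: "'i set" and a :: "'i \<Rightarrow> rat" and n k :: "'i \<Rightarrow> nat"
  assumes I: "finite I" and dist: "\<And>i i'. i \<in> I \<Longrightarrow> i' \<in> I \<Longrightarrow> i \<noteq> i' \<Longrightarrow> (a i, n i) \<noteq> (a i', n i')"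
    and on: "\<And>e m. (\<Sum>i\<in>I. k i * hit (a i) (n i) m (2 * of_int e + s)) = rk e m"
    and off: "\<And>D m. \<nexists>e. D = 2 * of_int e + s \<Longrightarrow> (\<Sum>i\<in>I. k i * hit (a i) (n i) m D) = 0"
  shows "i \<in> I \<Longrightarrow> 0 < n i \<Longrightarrow> odd (k i) \<Longrightarrow> \<exists>d. a i = 2 * of_int d + s \<and> odd_pair d (n i)"
    and "odd_pair d l \<Longrightarrow> \<exists>i\<in>I. a i = 2 * of_int d + s \<and> n i = l \<and> odd (k i)"
proof -
  define c where "c D m i = hit (a i) (n i) m D + hit (a i) (n i) (Suc m) D + hit (a i) (n i) (Suc m) (D + 2)
     + hit (a i) (n i) (Suc (Suc m)) (D + 2)" for D m i
  have c: "odd (c D m i) \<longleftrightarrow> a i = D \<and> n i = Suc m" for D m i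
    unfolding c_def by (rule hit_second_difference)
  have sum: "(\<Sum>i\<in>I. k i * c D m i) = (\<Sum>i\<in>I. k i * hit (a i) (n i) m D) + (\<Sum>i\<in>I. k i * hit (a i) (n i) (Suc m) D)
     + (\<Sum>i\<in>I. k i * hit (a i) (n i) (Suc m) (D + 2)) + (\<Sum>i\<in>I. k i * hit (a i) (n i) (Suc (Suc m)) (D + 2))" for D m
    unfolding c_def by (simp add: sum.distrib distrib_left)
  have odd_sum: "odd (\<Sum>i\<in>I. k i * c D m i) \<longleftrightarrow> (\<exists>i\<in>I. a i = D \<and> n i = Suc m \<and> odd (k i))" for D m
  proof (cases "\<exists>i\<in>I. a i = D \<and> n i = Suc m")
    case True
    then obtain i where i: "i \<in> I" "a i = D" "n i = Suc m" by blast
    have uniq: "i' = i" if "i' \<in> I" "a i' = D" "n i' = Suc m" for i' using dist[of i i'] i that by auto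
    have "even (\<Sum>i'\<in>I - {i}. k i' * c D m i')"
    proof (rule dvd_sum)
      fix i' assume "i' \<in> I - {i}"
      then have "\<not> odd (c D m i')" unfolding c using uniq[of i'] by blast
      then show "even (k i' * c D m i')" by simp
    qed
    moreover have "(\<Sum>i\<in>I. k i * c D m i) = k i * c D m i + (\<Sum>i'\<in>I - {i}. k i' * c D m i')"
      by (rule sum.remove[OF I i(1)])
    moreover have "odd (c D m i)" using c i by simp
    ultimately have "odd (\<Sum>i\<in>I. k i * c D m i) \<longleftrightarrow> odd (k i)" by (simp only: even_add even_mult_iff) simp
    moreover have "(\<exists>i'\<in>I. a i' = D \<and> n i' = Suc m \<and> odd (k i')) \<longleftrightarrow> odd (k i)"
    proof
      assume "\<exists>i'\<in>I. a i' = D \<and> n i' = Suc m \<and> odd (k i')"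
      then obtain i' where i': "i' \<in> I" "a i' = D" "n i' = Suc m" "odd (k i')" by blast
      then show "odd (k i)" using uniq[OF i'(1-3)] by simp
    qed (use i in blast)
    ultimately show ?thesis by simp
  next
    case False
    have "even (\<Sum>i\<in>I. k i * c D m i)"
    proof (rule dvd_sum)
      fix i assume "i \<in> I"
      then have "\<not> odd (c D m i)" unfolding c using False by blast
      then show "even (k i * c D m i)" by simp
    qed
    then show ?thesis using False by auto
  qed
  have D2: "2 * of_int e + s + 2 = 2 * of_int (e + 1) + s" for e by simp
  have main: "odd_pair d (Suc m) \<longleftrightarrow> (\<exists>i\<in>I. a i = 2 * of_int d + s \<and> n i = Suc m \<and> odd (k i))" for d m
    unfolding odd_sum[symmetric] sum D2 on rk_second_difference ..
  show "\<exists>i\<in>I. a i = 2 * of_int d + s \<and> n i = l \<and> odd (k i)" if p: "odd_pair d l"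
  proof -
    obtain m where "l = Suc m" using p unfolding odd_pair_def by (cases l) auto
    then show ?thesis using main p by blast
  qed
  show "\<exists>d. a i = 2 * of_int d + s \<and> odd_pair d (n i)" if i: "i \<in> I" "0 < n i" "odd (k i)"
  proof -
    obtain m where m: "n i = Suc m" using i(2) by (cases "n i") auto
    show ?thesis
    proof (cases "\<exists>e. a i = 2 * of_int e + s")
      case True
      then obtain e where "a i = 2 * of_int e + s" by blast
      then show ?thesis using main[of e m] i m by auto
    next
      \<comment> \<open>A generator outside the degrees \<open>s + 2 Z\<close> would give an odd
        second difference of ranks that all vanish.\<close>
      case False
      have "\<nexists>e. a i + 2 = 2 * of_int e + s"
      proof
        assume "\<exists>e. a i + 2 = 2 * of_int e + s"
        then obtain e where "a i + 2 = 2 * of_int e + s" by blast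
        then have "a i = 2 * of_int (e - 1) + s" by (simp add: algebra_simps)
        then show False using False by blast
      qed
      then have "(\<Sum>i'\<in>I. k i' * c (a i) m i') = 0" unfolding sum using off False by simp
      moreover have "odd (\<Sum>i'\<in>I. k i' * c (a i) m i')" unfolding odd_sum using i m by blast
      ultimately show ?thesis by simp
    qed
  qed
qed

end

definition restr :: "'v set \<Rightarrow> ('v \<Rightarrow>\<^sub>0 bit) \<Rightarrow> ('v \<Rightarrow>\<^sub>0 bit)" where
  "restr X x = (\<Sum>v\<in>keys x \<inter> X. vert v)"

lemma lookup_restr: "lookup (restr X x) w = (if w \<in> X then lookup x w else 0)"
proof -
  have "lookup (restr X x) w = (if w \<in> keys x \<inter> X then 1 else 0)"
    unfolding restr_def by (simp add: lookup_sum lookup_single when_def sum.delta)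
  then show ?thesis unfolding lookup_bit[of x w] by simp
qed

lemma restr_add: "restr X (x + y) = restr X x + restr X y"
proof (rule poly_mapping_eqI)
  fix w
  show "lookup (restr X (x + y)) w = lookup (restr X x + restr X y) w"
    unfolding lookup_restr lookup_add by (cases "w \<in> X") (simp_all only: if_True if_False add_0)
qed

lemma restr_zero [simp]: "restr X 0 = 0"
  by (simp add: restr_def)

lemma keys_restr: "keys (restr X x) = keys x \<inter> X"
  by (auto simp: in_keys_iff lookup_restr split: if_splits)

lemma restr_id: "keys x \<subseteq> X \<Longrightarrow> restr X x = x"
  by (rule poly_mapping_eqI) (auto simp: lookup_restr in_keys_iff)

lemma restr_disjoint: "keys x \<inter> X = {} \<Longrightarrow> restr X x = 0"
  by (simp add: restr_def)

lemma restr_Un: "X \<inter> X' = {} \<Longrightarrow> restr (X \<union> X') x = restr X x + restr X' x"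
proof (rule poly_mapping_eqI)
  fix w assume "X \<inter> X' = {}"
  then show "lookup (restr (X \<union> X') x) w = lookup (restr X x + restr X' x) w"
    unfolding lookup_restr lookup_add by (cases "w \<in> X"; cases "w \<in> X'") auto
qed

section \<open>Torsion of the monotone subroot as a sum of cyclic modules\<close>

context sroot
begin

lemma tors_add: assumes "tors x" "tors y" shows "tors (x + y)"
proof -
  obtain m n where "lin (dn ^^ m) x = 0" "lin (dn ^^ n) y = 0" using assms unfolding tors_def by blast
  then have "lin (dn ^^ (m + n)) (x + y) = 0"
    unfolding lin_add by (metis lin_pow_pow add.commute add_0 lin_zero)
  then show ?thesis unfolding tors_def by blast
qed

lemma tors_zero [simp]: "tors 0"
  unfolding tors_def by simp

lemma gen_tors: "odd_pair d l \<Longrightarrow> tors (gen d l)"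
  unfolding tors_def using gen_torsion by blast

lemma cogen_sum: "cogen d l c (sum g X) = (\<Sum>i\<in>X. cogen d l c (g i))"
  by (induction X rule: infinite_finite_induct) (simp_all only: cogen_zero sum.infinite sum.empty sum.insert cogen_add if_False not_False_eq_True)

lemma cogen_level:
  assumes p: "odd_pair d l" and c: "c < l" and x: "keys x \<inter> L (d - int c) = {}"
    and V: "keys x \<subseteq> V"
  shows "cogen d l c x = 0"
proof -
  have jr: "jump (d - int l)" using p unfolding odd_pair_def by blast
  have "J (pr (Y (d - int l)) (d - int c)) \<in> L (d - int c)" if "A (d - int l) = d"
    unfolding L_def using lv_pr_Y[OF jr, of "d - int c"] pr_V[OF Y_V[OF jr]] lv_J J_V that by simp
  then have "keys x \<inter> {J (pr (Y (d - int l)) (d - int c))} = {}" if "A (d - int l) = d"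
    using that x by blast
  moreover have "keys x \<inter> {v \<in> V. lv v = d - int c \<and> mt v \<le> d - int l} = {}"
    using x unfolding L_def by blast
  ultimately show ?thesis
    unfolding cogen_def Let_def sm_card by (cases "A (d - int l) = d") simp_all
qed

text \<open>Feeds \<open>gen\<close> and \<open>cogen\<close> into
  \<open>cyclic_decomposition\<close>. The hypotheses \<open>pair\<close> and \<open>ex\<close>
  match the indices of odd multiplicity and positive length with the pairs satisfying
  \<open>odd_pair\<close>; the joint separation is \<open>cogen_joint\<close>.\<close>

lemma monotone_decomposition:
  fixes I :: "'i set" and a :: "'i \<Rightarrow> rat" and n k :: "'i \<Rightarrow> nat"
  assumes R: "fu_module (RM s)" and I: "finite I"
    and dist: "\<And>i i'. i \<in> I \<Longrightarrow> i' \<in> I \<Longrightarrow> i \<noteq> i' \<Longrightarrow> (a i, n i) \<noteq> (a i', n i')"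
    and pair: "\<And>i. i \<in> I \<Longrightarrow> 0 < n i \<Longrightarrow> odd (k i) \<Longrightarrow> \<exists>d. a i = 2 * of_int d + (s + 1) \<and> odd_pair d (n i)"
    and ex: "\<And>d l. odd_pair d l \<Longrightarrow> \<exists>i\<in>I. a i = 2 * of_int d + (s + 1) \<and> n i = l \<and> odd (k i)"
  shows "gshift 1 (torsion (gsub (RM s) {x. keys x \<subseteq> V'})) \<cong>\<^sub>g\<^sub>r
    gdsum I (\<lambda>i. gpow (T (a i) (n i)) (if even (k i) then 0 else 1))"
proof -
  interpret R: fu_module "RM s" by (rule R)
  let ?X = "{x :: 'v \<Rightarrow>\<^sub>0 bit. keys x \<subseteq> V'}"
  let ?M = "gshift 1 (torsion (gsub (RM s) ?X))"
  have V'X: "keys (lin (dn ^^ i) x) \<subseteq> V'" if "keys x \<subseteq> V'" for i x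
  proof -
    have "(dn ^^ i) v \<in> V'" if "v \<in> V'" for v using that by (induction i) (auto intro: V'_dn)
    then show ?thesis using keys_lin[of "dn ^^ i" x] that by blast
  qed
  have sum_X: "keys (sum g B) \<subseteq> V'" if "\<And>i. i \<in> B \<Longrightarrow> keys (g i) \<subseteq> V'" for g and B :: "nat set"
    by (rule order_trans[OF keys_sum]) (use that in blast)
  have "submod (RM s) ?X"
    unfolding submod_def
  proof (intro conjI ballI allI)
    show "?X \<subseteq> carrier (RM s)" using V'_V by auto
    show "x \<oplus>\<^bsub>RM s\<^esub> y \<in> ?X" if "x \<in> ?X" "y \<in> ?X" for x y using that keys_add_subset by simp
    show "p \<odot>\<^bsub>RM s\<^esub> x \<in> ?X" if "x \<in> ?X" for p x
      unfolding RM_smult mem_Collect_eq by (rule sum_X) (use V'X that in auto)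
  qed simp
  then have MX: "fu_module (gsub (RM s) ?X)" by (rule R.fu_module_gsub)
  have M: "fu_module ?M" by (rule fu_module_gshift[OF fu_module_torsion[OF MX]])
  have carr: "carrier ?M = {x. keys x \<subseteq> V' \<and> tors x}"
    by (auto simp: RM_U tors_def)
  \<comment> \<open>The level of a generator of degree \<open>a i\<close>. The extra 1 undoes the
    shift of gradings, and the floor is exact for the indices that matter.\<close>
  define dd where "dd i = \<lfloor>(a i - (s + 1)) / 2\<rfloor>" for i
  have dd: "a i = 2 * of_int (dd i) + (s + 1) \<and> odd_pair (dd i) (n i)" if i: "i \<in> I" "0 < n i" "odd (k i)" for i
  proof -
    obtain d where d: "a i = 2 * of_int d + (s + 1)" "odd_pair d (n i)" using pair[OF i] by blast
    then have "dd i = d" unfolding dd_def by simp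
    then show ?thesis using d by simp
  qed
  \<comment> \<open>A summand of length 0 is the zero module and has no pair
    \<open>odd_pair\<close>, so its generator is zero.\<close>
  define W where "W i = (if 0 < n i then gen (dd i) (n i) else 0)" for i
  define lam where "lam i c = cogen (dd i) (n i) c" for i c
  have k1: "(if even (k i) then 0 else 1) = (1::nat) \<longleftrightarrow> odd (k i)" for i by simp
  show ?thesis
  proof (rule cyclic_decomposition[where W = W and lam = lam, OF M I])
    show "(if even (k i) then 0 else 1) \<le> (1::nat)" for i by simp
    show "W i \<in> carrier ?M" if "i \<in> I" "(if even (k i) then 0 else 1) = (1::nat)" for i
    proof (cases "0 < n i")
      case True
      then have "odd_pair (dd i) (n i)" using dd[OF that(1)] that(2) unfolding k1 by simp
      then show ?thesis unfolding carr W_def using True keys_gen gen_tors by auto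
    qed (unfold carr W_def, simp)
    show "lam i c (x \<oplus>\<^bsub>?M\<^esub> y) = lam i c x + lam i c y" for i c x y
      unfolding lam_def by (simp only: gshift_simps torsion_simps gsub_simps RM_simps cogen_add)
    show "lam i c (p \<odot>\<^bsub>?M\<^esub> W j) = (if i = j then coeff p c else 0)"
      if i: "i \<in> I" "(if even (k i) then 0 else 1) = (1::nat)" and j: "j \<in> I" "(if even (k j) then 0 else 1) = (1::nat)"
        and c: "c < n i" for i j c p
    proof -
      have pi: "odd_pair (dd i) (n i)" using dd[OF i(1)] i(2) c unfolding k1 by simp
      have "p \<odot>\<^bsub>?M\<^esub> W j = (\<Sum>q\<le>degree p. if coeff p q = 0 then 0 else lin (dn ^^ q) (W j))"
        by (simp add: RM_smult)
      then have eq: "lam i c (p \<odot>\<^bsub>?M\<^esub> W j) =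
        (\<Sum>q\<le>degree p. lam i c (if coeff p q = 0 then 0 else lin (dn ^^ q) (W j)))"
        unfolding lam_def by (simp only: cogen_sum)
      have lw: "lam i c (lin (dn ^^ q) (W j)) = (if i = j \<and> q = c then 1 else 0)" for q
      proof (cases "0 < n j")
        case True
        then have pj: "odd_pair (dd j) (n j)" using dd[OF j(1)] j(2) unfolding k1 by simp
        have "dd i = dd j \<and> n i = n j \<and> q = c \<longleftrightarrow> i = j \<and> q = c"
          using dist[OF i(1) j(1)] dd[OF i(1)] dd[OF j(1)] i(2) j(2) c True unfolding k1 by auto
        then show ?thesis unfolding lam_def W_def using cogen_gen[OF pi pj c, of q] True by simp
      next
        case False
        then show ?thesis using c unfolding lam_def W_def by auto
      qed
      have "lam i c (p \<odot>\<^bsub>?M\<^esub> W j) =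
        (\<Sum>q\<le>degree p. if q = c then (if i = j then coeff p c else 0) else 0)"
        unfolding eq
      proof (rule sum.cong[OF refl])
        fix q
        have "lam i c (if coeff p q = 0 then 0 else lin (dn ^^ q) (W j)) =
          (if coeff p q = 0 then 0 else if i = j \<and> q = c then 1 else 0)"
          using lw[of q] by (simp add: lam_def)
        also have "\<dots> = (if q = c then (if i = j then coeff p c else 0) else 0)"
          by (cases "coeff p q = 0") auto
        finally show "lam i c (if coeff p q = 0 then 0 else lin (dn ^^ q) (W j)) =
          (if q = c then (if i = j then coeff p c else 0) else 0)" .
      qed
      also have "\<dots> = (if i = j then coeff p c else 0)"
        by (simp add: sum.delta coeff_eq_0)
      finally show ?thesis .
    qed
    show "x = \<zero>\<^bsub>?M\<^esub>"
      if x: "x \<in> carrier ?M"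
        and z: "\<And>i c. i \<in> I \<Longrightarrow> (if even (k i) then 0 else 1) = (1::nat) \<Longrightarrow> c < n i \<Longrightarrow> lam i c x = 0" for x
    proof -
      have xV: "keys x \<subseteq> V'" "tors x" using x unfolding carr by auto
      have "x = 0"
      proof (rule cogen_joint[OF xV(1)])
        show "sm (L e) x = 0" for e
          using xV V'_V torsion_sm[of x _ e] unfolding tors_def by blast
        show "cogen d l c x = 0" if p: "odd_pair d l" and c: "c < l" for d l c
        proof -
          obtain i where i: "i \<in> I" "a i = 2 * of_int d + (s + 1)" "n i = l" "odd (k i)" using ex[OF p] by blast
          have "dd i = d" unfolding dd_def i(2) by simp
          then show ?thesis using z[OF i(1), of c] i c unfolding lam_def by simp
        qed
      qed
      then show ?thesis by simp
    qed
    show "lam i c x = 0"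
      if i: "i \<in> I" "(if even (k i) then 0 else 1) = (1::nat)" and c: "c < n i" and x: "x \<in> gr ?M d"
        and d: "a i - 2 * of_nat c \<noteq> d" for i c d x
    proof -
      have p: "odd_pair (dd i) (n i)" and ai: "a i = 2 * of_int (dd i) + (s + 1)"
        using dd[OF i(1)] i(2) c unfolding k1 by auto
      have k: "keys x \<subseteq> {v \<in> V. 2 * of_int (lv v) + s = d - 1}" using x by simp
      have "keys x \<inter> L (dd i - int c) = {}"
      proof -
        have "lv v \<noteq> dd i - int c" if "2 * of_int (lv v) + s = d - 1" for v
          using that d ai by auto
        then show ?thesis using k unfolding L_def by blast
      qed
      then show ?thesis unfolding lam_def by (rule cogen_level[OF p c]) (use k in auto)
    qed
    show "gr ?M d \<subseteq> carrier ?M" for d by auto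
  qed
qed

lemma fold_span: "keys x \<subseteq> V \<Longrightarrow> keys (lin fold_map x) \<subseteq> V'"
  using keys_lin[of fold_map x] fold_map_V' by blast

lemma fold_comm:
  assumes "keys x \<subseteq> V"
  shows "lin fold_map (lin dn x) = lin dn (lin fold_map x)" "lin fold_map (lin J x) = lin J (lin fold_map x)"
proof -
  have V: "v \<in> V" if "v \<in> keys x" for v using assms that by blast
  show "lin fold_map (lin dn x) = lin dn (lin fold_map x)"
    unfolding lin_lin by (rule lin_cong) (rule fold_map_dn[OF V])
  show "lin fold_map (lin J x) = lin J (lin fold_map x)"
    unfolding lin_lin by (rule lin_cong) (rule fold_map_J[OF V])
qed

lemma fold_level: "keys x \<subseteq> L e \<Longrightarrow> keys (lin fold_map x) \<subseteq> L e"
proof -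
  have "fold_map v \<in> L e" if "v \<in> L e" for v
    using that V'_V[OF fold_map_V'[of v]] lv_fold_map[of v] unfolding L_def by simp
  then have "fold_map ` L e \<subseteq> L e" by blast
  moreover assume "keys x \<subseteq> L e"
  ultimately show ?thesis using keys_lin[of fold_map x] by blast
qed

text \<open>On \<open>V'\<close> the folding need not be the identity: it may exchange a branch with
  its mirror image, because \<open>side\<close> and \<open>Y\<close> are chosen independently.
  Surjectivity is therefore taken from \<open>rigid\<close>.\<close>

lemma fold_surj:
  assumes "keys x \<subseteq> V'"
  shows "\<exists>x'. keys x' \<subseteq> V \<and> lin fold_map x' = x"
proof -
  have VV: "keys y \<subseteq> V" if "keys y \<subseteq> V'" for y :: "'v \<Rightarrow>\<^sub>0 bit" using that V'_V by blast
  have "\<exists>x'. keys x' \<subseteq> V' \<and> lin fold_map x' = x"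
  proof (rule rigid[OF _ _ _ _ _ _ assms])
    show "keys (lin fold_map (vert v)) \<subseteq> L (lv v)" if "v \<in> V'" for v
      using fold_level[of "vert v" "lv v"] V'_V[OF that] unfolding L_def by simp
  qed (use VV fold_span fold_comm V'_V in \<open>simp_all add: lin_add eps_lin sm_vert\<close>)
  then show ?thesis using VV by blast
qed

end

section \<open>Connected homology\<close>

locale root_complex = iota_complex C \<iota> + sroot V dn lv J
  for C :: "('c, 'm) cx_scheme" (structure) and \<iota> :: "'c \<Rightarrow> 'c"
    and V :: "'v set" and dn lv J +
  fixes s :: rat and \<Phi> :: "'c set \<Rightarrow> 'v \<Rightarrow>\<^sub>0 bit"
  assumes \<Phi>: "\<Phi> \<in> giso (homology C) (RM s)"
    and \<Phi>_iota: "x \<in> carrier (homology C) \<Longrightarrow> \<Phi> (homology_map C \<iota> x) = lin J (\<Phi> x)"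
begin

lemma \<Phi>_hom: "\<Phi> \<in> ghom 0 H (RM s)" and \<Phi>_inj: "inj_on \<Phi> (carrier H)"
  and \<Phi>_image: "\<Phi> ` carrier H = {x. keys x \<subseteq> V}"
  using \<Phi> unfolding giso_def bij_betw_def by auto

lemma RM_module: "fu_module (RM s)"
  by (rule fu_module_giso[OF H_module \<Phi> RM_abelian_group])

lemma \<Phi>_add: "x \<in> carrier H \<Longrightarrow> y \<in> carrier H \<Longrightarrow> \<Phi> (x \<oplus>\<^bsub>H\<^esub> y) = \<Phi> x + \<Phi> y"
  using ghomD(2)[OF \<Phi>_hom, of x y] by simp

lemma \<Phi>_U: "x \<in> carrier H \<Longrightarrow> \<Phi> ((Uvar ^ m) \<odot>\<^bsub>H\<^esub> x) = lin (dn ^^ m) (\<Phi> x)"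
  using ghomD(3)[OF \<Phi>_hom, of x "Uvar ^ m"] by (simp add: RM_U)

lemma \<Phi>_zero: "\<Phi> \<zero>\<^bsub>H\<^esub> = 0"
  using ghom_zero[OF \<Phi>_hom H_module RM_module] by simp

lemma \<Phi>_keys: "x \<in> carrier H \<Longrightarrow> keys (\<Phi> x) \<subseteq> V"
  using \<Phi>_image by blast

definition LD :: "rat \<Rightarrow> 'v set" where "LD d = {v \<in> V. 2 * of_int (lv v) + s = d}"

lemma \<Phi>_gr: "x \<in> gr H d \<Longrightarrow> keys (\<Phi> x) \<subseteq> LD d"
  using ghomD(4)[OF \<Phi>_hom, of x d] unfolding LD_def by simp

lemma LD_L: "LD (2 * of_int e + s) = L e"
  unfolding LD_def L_def by auto

lemma LD_empty: "\<nexists>e. d = 2 * of_int e + s \<Longrightarrow> LD d = {}"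
  unfolding LD_def by blast

abbreviation "ev d \<equiv> \<exists>e::int. d = 2 * of_int e + s"

text \<open>The root module lives in the degrees \<open>s + 2 Z\<close>; in any other degree the
  class of a cycle has an image without support, so the cycle bounds.\<close>

lemma even_complex: "even_iota_complex C \<iota> (\<lambda>d. ev d)"
proof
  show "\<not> ev (d + 1)" if "ev d" for d
  proof
    obtain e where e: "d = 2 * of_int e + s" using \<open>ev d\<close> by blast
    assume "ev (d + 1)"
    then obtain e' where "d + 1 = 2 * of_int e' + s" by blast
    then have "(of_int (2 * e + 1) :: rat) = of_int (2 * e')" using e by simp
    then have "2 * e + 1 = 2 * e'" by (simp only: of_int_eq_iff)
    then show False by presburger
  qed
  show "ev (d - 2) = ev d" for d
  proof
    assume "ev (d - 2)"
    then obtain e where "d - 2 = 2 * of_int e + s" by blast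
    then have "d = 2 * of_int (e + 1) + s" by (simp add: algebra_simps)
    then show "ev d" by blast
  next
    assume "ev d"
    then obtain e where "d = 2 * of_int e + s" by blast
    then have "d - 2 = 2 * of_int (e - 1) + s" by (simp add: algebra_simps)
    then show "ev (d - 2)" by blast
  qed
  show "Zd d \<subseteq> Bd d" if "\<not> ev d" for d
  proof
    fix z assume z: "z \<in> Zd d"
    have zZ: "z \<in> Z" and zd: "z \<in> gr C d" using ZdD z by blast+
    have "cl z \<in> gr H d" unfolding H_gr using zZ zd by blast
    then have "keys (\<Phi> (cl z)) = {}" using \<Phi>_gr[of "cl z" d] LD_empty that by blast
    then have "\<Phi> (cl z) = \<Phi> (cl \<zero>)" using \<Phi>_zero unfolding H_zero by simp
    then have "cl z = cl \<zero>" using \<Phi>_inj zZ zero_Z unfolding H_carrier inj_on_def by blast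
    then show "z \<in> Bd d" unfolding Bd_def using cl_zero_iff[OF zZ] zd by blast
  qed
qed

sublocale even_iota_complex C \<iota> "\<lambda>d. ev d"
  by (rule even_complex)

definition \<Psi> :: "('v \<Rightarrow>\<^sub>0 bit) \<Rightarrow> 'c set" where "\<Psi> = inv_into (carrier H) \<Phi>"

lemma \<Psi>_carrier: "keys y \<subseteq> V \<Longrightarrow> \<Psi> y \<in> carrier H"
  and \<Phi>_\<Psi>: "keys y \<subseteq> V \<Longrightarrow> \<Phi> (\<Psi> y) = y"
proof -
  assume "keys y \<subseteq> V"
  then have "y \<in> \<Phi> ` carrier H" unfolding \<Phi>_image by simp
  then show "\<Psi> y \<in> carrier H" "\<Phi> (\<Psi> y) = y" unfolding \<Psi>_def by (rule inv_into_into, rule f_inv_into_f)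
qed

lemma \<Psi>_\<Phi>: "x \<in> carrier H \<Longrightarrow> \<Psi> (\<Phi> x) = x"
  unfolding \<Psi>_def by (rule inv_into_f_f[OF \<Phi>_inj])

lemma \<Phi>_eqI: "x \<in> carrier H \<Longrightarrow> y \<in> carrier H \<Longrightarrow> \<Phi> x = \<Phi> y \<Longrightarrow> x = y"
  using \<Phi>_inj unfolding inj_on_def by blast

lemma \<Psi>_add: "keys x \<subseteq> V \<Longrightarrow> keys y \<subseteq> V \<Longrightarrow> \<Psi> (x + y) = \<Psi> x \<oplus>\<^bsub>H\<^esub> \<Psi> y"
proof -
  interpret H: fu_module H by (rule H_module)
  assume "keys x \<subseteq> V" "keys y \<subseteq> V"
  then show ?thesis
    by (intro \<Phi>_eqI) (simp_all add: \<Psi>_carrier keys_add_subset \<Phi>_\<Psi> \<Phi>_add)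
qed

lemma keys_dn_pow: "keys x \<subseteq> V \<Longrightarrow> keys (lin (dn ^^ m) x) \<subseteq> V"
proof -
  assume "keys x \<subseteq> V"
  then have "(dn ^^ m) ` keys x \<subseteq> V" using dn_pow by blast
  then show ?thesis using keys_lin[of "dn ^^ m" x] by (rule order_trans[rotated])
qed

lemma \<Psi>_U: "keys x \<subseteq> V \<Longrightarrow> \<Psi> (lin (dn ^^ m) x) = (Uvar ^ m) \<odot>\<^bsub>H\<^esub> \<Psi> x"
proof -
  interpret H: fu_module H by (rule H_module)
  assume x: "keys x \<subseteq> V"
  show ?thesis
    by (rule \<Phi>_eqI) (simp_all add: x \<Psi>_carrier keys_dn_pow \<Phi>_\<Psi> \<Phi>_U)
qed

lemma is_torsion_iff: "x \<in> carrier H \<Longrightarrow> (\<exists>n. (Uvar ^ n) \<odot>\<^bsub>H\<^esub> x = \<zero>\<^bsub>H\<^esub>) \<longleftrightarrow> tors (\<Phi> x)"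
proof -
  interpret H: fu_module H by (rule H_module)
  assume x: "x \<in> carrier H"
  have "(Uvar ^ n) \<odot>\<^bsub>H\<^esub> x = \<zero>\<^bsub>H\<^esub> \<longleftrightarrow> lin (dn ^^ n) (\<Phi> x) = 0" for n
    using \<Phi>_U[OF x, of n] \<Phi>_zero \<Phi>_eqI[of "(Uvar ^ n) \<odot>\<^bsub>H\<^esub> x" "\<zero>\<^bsub>H\<^esub>"] x by auto
  then show ?thesis unfolding tors_def by simp
qed

text \<open>\<open>giso\<close> only says that \<open>\<Phi>\<close> preserves degrees.
  Compatibility with components yields the same for its inverse, in
  \<open>\<Psi>_gr\<close>.\<close>

lemma restr_\<Phi>: assumes "z \<in> Z" shows "restr (LD d) (\<Phi> (cl z)) = \<Phi> (cl (cmp d z))"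
proof -
  have "z \<in> Z \<and> restr (LD d) (\<Phi> (cl z)) = \<Phi> (cl (cmp d z))"
    using assms
  proof (induction rule: Z_induct)
    case zero
    have "cmp d \<zero> = \<zero>" using cmp_homogeneous[of \<zero> 0 d] by simp
    then show ?case using \<Phi>_zero zero_Z unfolding H_zero by simp
  next
    case (add e y z)
    have yZ: "y \<in> Z" and zZ: "z \<in> Z" using add by auto
    have "cl y \<in> gr H e" unfolding H_gr using add by blast
    then have ky: "keys (\<Phi> (cl y)) \<subseteq> LD e" by (rule \<Phi>_gr)
    have 1: "restr (LD d) (\<Phi> (cl y)) = \<Phi> (cl (cmp d y))"
    proof (cases "d = e")
      case True
      then show ?thesis using restr_id[OF ky] cmp_homogeneous[OF add(2), of d] by simp
    next
      case False
      then have "LD e \<inter> LD d = {}" unfolding LD_def by auto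
      then have "restr (LD d) (\<Phi> (cl y)) = 0" using ky by (intro restr_disjoint) blast
      then show ?thesis using False cmp_homogeneous[OF add(2), of d] \<Phi>_zero unfolding H_zero by simp
    qed
    have clH: "cl u \<in> carrier H" if "u \<in> Z" for u unfolding H_carrier using that by blast
    have "\<Phi> (cl (y \<oplus> z)) = \<Phi> (cl y) + \<Phi> (cl z)"
      unfolding H_add[OF yZ zZ, symmetric] by (rule \<Phi>_add[OF clH[OF yZ] clH[OF zZ]])
    moreover have "cmp d (y \<oplus> z) = cmp d y \<oplus> cmp d z" using cmp_add yZ zZ Z_carrier by blast
    moreover have "\<Phi> (cl (cmp d y \<oplus> cmp d z)) = \<Phi> (cl (cmp d y)) + \<Phi> (cl (cmp d z))"
      unfolding H_add[OF Z_cmp[OF yZ] Z_cmp[OF zZ], symmetric]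
      by (rule \<Phi>_add[OF clH[OF Z_cmp[OF yZ]] clH[OF Z_cmp[OF zZ]]])
    ultimately show ?case using 1 add submodD(3)[OF Z_sub yZ zZ] by (simp add: restr_add)
  qed
  then show ?thesis by simp
qed

lemma \<Psi>_gr: assumes "keys y \<subseteq> LD d" shows "\<Psi> y \<in> gr H d"
proof -
  have yV: "keys y \<subseteq> V" using assms unfolding LD_def by blast
  obtain z where z: "z \<in> Z" "\<Psi> y = cl z" using \<Psi>_carrier[OF yV] unfolding H_carrier by blast
  have "\<Phi> (cl z) = y" using \<Phi>_\<Psi>[OF yV] z by simp
  then have "\<Phi> (cl (cmp d z)) = y" using restr_\<Phi>[OF z(1), of d] restr_id[OF assms] by simp
  then have "\<Psi> y = cl (cmp d z)" using \<Psi>_\<Phi>[of "cl (cmp d z)"] Z_cmp[OF z(1)] unfolding H_carrier by auto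
  then show ?thesis unfolding H_gr using Z_cmp[OF z(1)] cmp_gr[OF Z_carrier[OF z(1)]] by blast
qed

definition \<gamma> :: "'c set \<Rightarrow> 'c set" where "\<gamma> X = \<Psi> (lin fold_map (\<Phi> X))"

lemma fold_V: "keys x \<subseteq> V \<Longrightarrow> keys (lin fold_map x) \<subseteq> V"
  using fold_span V'_V by blast

lemma \<Phi>_\<gamma>: "X \<in> carrier H \<Longrightarrow> \<Phi> (\<gamma> X) = lin fold_map (\<Phi> X)"
  unfolding \<gamma>_def by (rule \<Phi>_\<Psi>[OF fold_V[OF \<Phi>_keys]])

lemma fold_LD: "keys x \<subseteq> LD d \<Longrightarrow> keys (lin fold_map x) \<subseteq> LD d"
proof (cases "ev d")
  case True
  then obtain e where e: "d = 2 * of_int e + s" by blast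
  assume "keys x \<subseteq> LD d"
  then show ?thesis unfolding e LD_L by (rule fold_level)
next
  case False
  assume "keys x \<subseteq> LD d"
  then have "x = 0" using LD_empty[OF False] by simp
  then show ?thesis by simp
qed

lemma \<gamma>_ghom: "\<gamma> \<in> ghom 0 H H"
proof (rule ghomI[OF H_module H_module])
  interpret H: fu_module H by (rule H_module)
  note V1 = fold_V[OF \<Phi>_keys]
  show "\<gamma> X \<in> carrier H" if "X \<in> carrier H" for X
    unfolding \<gamma>_def by (rule \<Psi>_carrier[OF V1[OF that]])
  show "\<gamma> (X \<oplus>\<^bsub>H\<^esub> X') = \<gamma> X \<oplus>\<^bsub>H\<^esub> \<gamma> X'" if "X \<in> carrier H" "X' \<in> carrier H" for X X'
    unfolding \<gamma>_def \<Phi>_add[OF that] lin_add by (rule \<Psi>_add[OF V1[OF that(1)] V1[OF that(2)]])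
  show "\<gamma> (Uvar \<odot>\<^bsub>H\<^esub> X) = Uvar \<odot>\<^bsub>H\<^esub> \<gamma> X" if "X \<in> carrier H" for X
    unfolding \<gamma>_def using \<Phi>_U[OF that, of 1] fold_comm(1)[OF \<Phi>_keys[OF that]] \<Psi>_U[OF V1[OF that], of 1] by simp
  show "\<gamma> X \<in> gr H (d + 0)" if "X \<in> gr H d" for X d
    unfolding \<gamma>_def using \<Psi>_gr[OF fold_LD[OF \<Phi>_gr[OF that]]] by simp
qed

lemma low_pow:
  assumes "keys x \<subseteq> V"
  shows "\<exists>m. keys (lin (dn ^^ m) x) \<subseteq> S"
proof -
  define m where "m = nat (bd_lv - low)"
  have "(dn ^^ m) v \<in> S" if "v \<in> V" for v
    using dn_pow[OF that, of m] bd_lv[OF that] unfolding m_def by (intro low_S) auto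
  then have "(dn ^^ m) ` keys x \<subseteq> S" using assms by blast
  then show ?thesis using keys_lin[of "dn ^^ m" x] by blast
qed

lemma fold_dn_pow:
  assumes "keys x \<subseteq> V"
  shows "lin fold_map (lin (dn ^^ m) x) = lin (dn ^^ m) (lin fold_map x)"
proof (induction m)
  case 0
  show ?case by (simp add: lin_id)
next
  case (Suc m)
  have "lin fold_map (lin dn (lin (dn ^^ m) x)) = lin dn (lin fold_map (lin (dn ^^ m) x))"
    by (rule fold_comm(1)[OF keys_dn_pow[OF assms]])
  then show ?case unfolding Suc by (simp add: lin_lin)
qed

text \<open>A high power of \<open>U\<close> pushes any element onto the stem, where the folding is
  the identity. So \<gamma> agrees with the identity after multiplication by powers of
  \<open>U\<close>.\<close>

lemma \<gamma>_hlocal: "hlocal \<gamma>"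
proof -
  interpret H: fu_module H by (rule H_module)
  have \<gamma>c: "\<gamma> x \<in> carrier H" if "x \<in> carrier H" for x using ghomD(1)[OF \<gamma>_ghom that] .
  have \<iota>c: "\<iota>H x \<in> carrier H" if "x \<in> carrier H" for x
    using ghomD(1)[OF homology_map_ghom[OF iota_chain_map] that] .
  have stab: "lin fold_map y = y" if "keys y \<subseteq> S" for y
    by (rule lin_id) (use that fold_map_S in blast)
  have comm: "\<gamma> (\<iota>H x) = \<iota>H (\<gamma> x)" if x: "x \<in> carrier H" for x
  proof (rule \<Phi>_eqI[OF \<gamma>c[OF \<iota>c[OF x]] \<iota>c[OF \<gamma>c[OF x]]])
    show "\<Phi> (\<gamma> (\<iota>H x)) = \<Phi> (\<iota>H (\<gamma> x))"
      unfolding \<Phi>_\<gamma>[OF \<iota>c[OF x]] \<Phi>_iota[OF x] \<Phi>_iota[OF \<gamma>c[OF x]] \<Phi>_\<gamma>[OF x]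
      by (rule fold_comm(2)[OF \<Phi>_keys[OF x]])
  qed
  have "Uloc_iso H H \<gamma>"
    unfolding H.Uloc_iso_iff[OF \<gamma>_ghom]
  proof (intro conjI ballI impI)
    fix x assume x: "x \<in> carrier H" and t: "H.is_torsion (\<gamma> x)"
    have "tors (lin fold_map (\<Phi> x))"
      using t is_torsion_iff[OF \<gamma>c[OF x]] \<Phi>_\<gamma>[OF x] unfolding H.is_torsion_def by simp
    then obtain n where n: "lin (dn ^^ n) (lin fold_map (\<Phi> x)) = 0" unfolding tors_def by blast
    obtain m where m: "keys (lin (dn ^^ m) (\<Phi> x)) \<subseteq> S" using low_pow[OF \<Phi>_keys[OF x]] by blast
    have "lin (dn ^^ m) (\<Phi> x) = lin (dn ^^ m) (lin fold_map (\<Phi> x))"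
      using stab[OF m] fold_dn_pow[OF \<Phi>_keys[OF x], of m] by simp
    then have "lin (dn ^^ n) (lin (dn ^^ m) (\<Phi> x)) = lin (dn ^^ m) (lin (dn ^^ n) (lin fold_map (\<Phi> x)))"
      by (simp only: lin_pow_pow add.commute)
    then have "lin (dn ^^ (n + m)) (\<Phi> x) = 0" unfolding n lin_pow_pow by simp
    then show "H.is_torsion x" using is_torsion_iff[OF x] unfolding tors_def H.is_torsion_def by blast
  next
    fix y assume y: "y \<in> carrier H"
    obtain m where m: "keys (lin (dn ^^ m) (\<Phi> y)) \<subseteq> S" using low_pow[OF \<Phi>_keys[OF y]] by blast
    have c: "(Uvar ^ m) \<odot>\<^bsub>H\<^esub> y \<in> carrier H" using y by simp
    have "\<gamma> ((Uvar ^ m) \<odot>\<^bsub>H\<^esub> y) = (Uvar ^ m) \<odot>\<^bsub>H\<^esub> y"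
      by (rule \<Phi>_eqI[OF \<gamma>c[OF c] c]) (simp only: \<Phi>_\<gamma>[OF c] \<Phi>_U[OF y] stab[OF m])
    then show "\<exists>m. \<exists>x\<in>carrier H. \<gamma> x = (Uvar ^ m) \<odot>\<^bsub>H\<^esub> y" using c by blast
  qed
  then show ?thesis unfolding hlocal_def using \<gamma>_ghom comm by blast
qed

text \<open>\<open>rigid\<close> is applied to the folding after \<open>\<phi>\<close>, as a
  self-map of the span of \<open>V'\<close>. Its condition on \<open>eps\<close> holds because a
  vertex is not torsion, a local map keeps it so, and on one level torsion is the kernel of
  \<open>eps\<close>.\<close>

lemma \<gamma>_rigid:
  assumes \<phi>: "hlocal \<phi>"
  shows "\<gamma> ` carrier H \<subseteq> \<gamma> ` \<phi> ` carrier H"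
proof
  interpret H: fu_module H by (rule H_module)
  have \<phi>h: "\<phi> \<in> ghom 0 H H" and \<phi>\<iota>: "\<And>x. x \<in> carrier H \<Longrightarrow> \<phi> (\<iota>H x) = \<iota>H (\<phi> x)" and \<phi>U: "Uloc_iso H H \<phi>"
    using \<phi> unfolding hlocal_def by auto
  note \<phi>D = ghomD[OF \<phi>h]
  fix X assume "X \<in> \<gamma> ` carrier H"
  then obtain X0 where X0: "X0 \<in> carrier H" "X = \<gamma> X0" by blast
  define \<phi>' where "\<phi>' y = \<Phi> (\<phi> (\<Psi> y))" for y
  define f where "f y = lin fold_map (\<phi>' y)" for y
  have VV: "keys y \<subseteq> V" if "keys y \<subseteq> V'" for y :: "'v \<Rightarrow>\<^sub>0 bit" using that V'_V by blast
  have \<phi>'V: "keys (\<phi>' y) \<subseteq> V" if "keys y \<subseteq> V" for y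
    unfolding \<phi>'_def by (rule \<Phi>_keys[OF \<phi>D(1)[OF \<Psi>_carrier[OF that]]])
  have \<phi>'_dn: "\<phi>' (lin dn y) = lin dn (\<phi>' y)" if y: "keys y \<subseteq> V" for y
    unfolding \<phi>'_def using \<Psi>_U[OF y, of 1] \<phi>D(3)[OF \<Psi>_carrier[OF y], of Uvar] \<Phi>_U[OF \<phi>D(1)[OF \<Psi>_carrier[OF y]], of 1] by simp
  have \<phi>'_J: "\<phi>' (lin J y) = lin J (\<phi>' y)" if y: "keys y \<subseteq> V" for y
  proof -
    note c = \<Psi>_carrier[OF y]
    have \<iota>c: "\<iota>H (\<Psi> y) \<in> carrier H" using ghomD(1)[OF homology_map_ghom[OF iota_chain_map] c] .
    have "\<Phi> (\<iota>H (\<Psi> y)) = lin J y" unfolding \<Phi>_iota[OF c] \<Phi>_\<Psi>[OF y] ..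
    then have "\<Psi> (lin J y) = \<iota>H (\<Psi> y)" using \<Psi>_\<Phi>[OF \<iota>c] by simp
    then show ?thesis unfolding \<phi>'_def using \<phi>\<iota>[OF c] \<Phi>_iota[OF \<phi>D(1)[OF c]] by simp
  qed
  have \<phi>'_level: "keys (\<phi>' (vert v)) \<subseteq> L (lv v)" if v: "v \<in> V" for v
  proof -
    have "\<Psi> (vert v) \<in> gr H (2 * of_int (lv v) + s)"
      by (rule \<Psi>_gr) (use v in \<open>simp add: LD_def\<close>)
    then have "\<phi> (\<Psi> (vert v)) \<in> gr H (2 * of_int (lv v) + s)"
      using \<phi>D(4)[of "\<Psi> (vert v)" "2 * of_int (lv v) + s"] by simp
    then show ?thesis unfolding \<phi>'_def using \<Phi>_gr LD_L by metis
  qed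
  have \<phi>'_eps: "eps (\<phi>' (vert v)) = 1" if v: "v \<in> V" for v
  proof (rule ccontr)
    assume "eps (\<phi>' (vert v)) \<noteq> 1"
    then have "eps (\<phi>' (vert v)) = 0" by simp
    then have "tors (\<phi>' (vert v))" using tors_iff_eps[OF \<phi>'_level[OF v]] by simp
    moreover have vV: "keys (vert v) \<subseteq> V" using v by simp
    note c = \<Psi>_carrier[OF vV]
    ultimately have "H.is_torsion (\<phi> (\<Psi> (vert v)))"
      using is_torsion_iff[OF \<phi>D(1)[OF c]] unfolding \<phi>'_def H.is_torsion_def by simp
    then have "H.is_torsion (\<Psi> (vert v))" using \<phi>U c unfolding H.Uloc_iso_iff[OF \<phi>h] by blast
    then have "tors (vert v)" using is_torsion_iff[OF c] \<Phi>_\<Psi>[OF vV] unfolding H.is_torsion_def by simp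
    then have "eps (vert v) = 0" using tors_iff_eps[of "vert v" "lv v"] v unfolding L_def by simp
    then show False by (simp add: sm_vert)
  qed
  have "\<exists>x'. keys x' \<subseteq> V' \<and> f x' = lin fold_map (\<Phi> X0)"
  proof (rule rigid)
    show "f (x + y) = f x + f y" if x: "keys x \<subseteq> V'" and y: "keys y \<subseteq> V'" for x y
      unfolding f_def \<phi>'_def \<Psi>_add[OF VV[OF x] VV[OF y]]
        \<phi>D(2)[OF \<Psi>_carrier[OF VV[OF x]] \<Psi>_carrier[OF VV[OF y]]]
        \<Phi>_add[OF \<phi>D(1)[OF \<Psi>_carrier[OF VV[OF x]]] \<phi>D(1)[OF \<Psi>_carrier[OF VV[OF y]]]] lin_add ..
    show "keys (f x) \<subseteq> V'" if "keys x \<subseteq> V'" for x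
      unfolding f_def by (rule fold_span[OF \<phi>'V[OF VV[OF that]]])
    show "keys (f (vert v)) \<subseteq> L (lv v)" if "v \<in> V'" for v
      unfolding f_def by (rule fold_level[OF \<phi>'_level[OF V'_V[OF that]]])
    show "f (lin dn x) = lin dn (f x)" if x: "keys x \<subseteq> V'" for x
      unfolding f_def \<phi>'_dn[OF VV[OF x]] by (rule fold_comm(1)[OF \<phi>'V[OF VV[OF x]]])
    show "f (lin J x) = lin J (f x)" if x: "keys x \<subseteq> V'" for x
      unfolding f_def \<phi>'_J[OF VV[OF x]] by (rule fold_comm(2)[OF \<phi>'V[OF VV[OF x]]])
    show "eps (f (vert v)) = 1" if "v \<in> V'" for v
      unfolding f_def eps_lin by (rule \<phi>'_eps[OF V'_V[OF that]])
    show "keys (lin fold_map (\<Phi> X0)) \<subseteq> V'" by (rule fold_span[OF \<Phi>_keys[OF X0(1)]])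
  qed
  then obtain x' where x': "keys x' \<subseteq> V'" "f x' = lin fold_map (\<Phi> X0)" by blast
  note c = \<Psi>_carrier[OF VV[OF x'(1)]]
  have "\<gamma> (\<phi> (\<Psi> x')) = X" using x'(2) unfolding X0(2) \<gamma>_def f_def \<phi>'_def by simp
  then show "X \<in> \<gamma> ` \<phi> ` carrier H" using c by blast
qed

lemma \<gamma>_image: "gsub H (\<gamma> ` carrier H) \<cong>\<^sub>g\<^sub>r gsub (RM s) {x. keys x \<subseteq> V'}"
  and gsub_modules: "fu_module (gsub H (\<gamma> ` carrier H))" "fu_module (gsub (RM s) {x. keys x \<subseteq> V'})"
proof -
  interpret H: fu_module H by (rule H_module)
  interpret R: fu_module "RM s" by (rule RM_module)
  note \<gamma>D = ghomD[OF \<gamma>_ghom]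
  have im: "\<Phi> ` \<gamma> ` carrier H = {x. keys x \<subseteq> V'}"
  proof (intro equalityI subsetI)
    fix x assume "x \<in> \<Phi> ` \<gamma> ` carrier H"
    then obtain X where X: "X \<in> carrier H" "x = \<Phi> (\<gamma> X)" by blast
    show "x \<in> {x. keys x \<subseteq> V'}"
      unfolding X(2) \<Phi>_\<gamma>[OF X(1)] mem_Collect_eq by (rule fold_span[OF \<Phi>_keys[OF X(1)]])
  next
    fix x :: "'v \<Rightarrow>\<^sub>0 bit" assume "x \<in> {x. keys x \<subseteq> V'}"
    then obtain x' where x': "keys x' \<subseteq> V" "lin fold_map x' = x" using fold_surj by blast
    have "\<Phi> (\<gamma> (\<Psi> x')) = x" unfolding \<Phi>_\<gamma>[OF \<Psi>_carrier[OF x'(1)]] \<Phi>_\<Psi>[OF x'(1)] by (rule x'(2))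
    then show "x \<in> \<Phi> ` \<gamma> ` carrier H" using \<Psi>_carrier[OF x'(1)] by blast
  qed
  note sub\<gamma> = ghom_image_submod[OF \<gamma>_ghom H_module H_module]
  show 1: "fu_module (gsub H (\<gamma> ` carrier H))" by (rule H.fu_module_gsub[OF sub\<gamma>])
  have "submod (RM s) {x. keys x \<subseteq> V'}"
    using ghom_image_submod[OF ghom_comp[OF \<gamma>_ghom \<Phi>_hom] H_module RM_module]
    unfolding image_comp[symmetric] im .
  then show 2: "fu_module (gsub (RM s) {x. keys x \<subseteq> V'})" by (rule R.fu_module_gsub)
  note sc = submodD(1)[OF sub\<gamma>]
  have "\<Phi> \<in> ghom 0 (gsub H (\<gamma> ` carrier H)) (gsub (RM s) {x. keys x \<subseteq> V'})"
  proof (rule ghomI[OF 1 2])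
    show "\<Phi> x \<in> gr (gsub (RM s) {x. keys x \<subseteq> V'}) (d + 0)"
      if "x \<in> gr (gsub H (\<gamma> ` carrier H)) d" for x d
      using that im ghomD(4)[OF \<Phi>_hom, of x d] by auto
  qed (use im sc ghomD(2,3)[OF \<Phi>_hom] in auto)
  moreover have "inj_on \<Phi> (\<gamma> ` carrier H)" by (rule inj_on_subset[OF \<Phi>_inj]) (use sc in blast)
  ultimately show "gsub H (\<gamma> ` carrier H) \<cong>\<^sub>g\<^sub>r gsub (RM s) {x. keys x \<subseteq> V'}"
    unfolding gisomorphic_def giso_def bij_betw_def using im by auto
qed

lemma HF_conn_maximal:
  assumes "maximal_self_local_equivalence C \<iota> f"
  shows "HF_conn C f \<cong>\<^sub>g\<^sub>r gshift 1 (torsion (gsub (RM s) {x. keys x \<subseteq> V'}))"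
proof -
  have f: "chain_map C C f"
    using assms unfolding maximal_self_local_equivalence_def self_local_equivalence_iff by blast
  have "homology (gsub C (f ` carrier C)) \<cong>\<^sub>g\<^sub>r gsub H (\<gamma> ` carrier H)"
    by (rule maximal_image[OF assms \<gamma>_hlocal \<gamma>_rigid])
  then have "homology (gsub C (f ` carrier C)) \<cong>\<^sub>g\<^sub>r gsub (RM s) {x. keys x \<subseteq> V'}"
    using \<gamma>_image by (rule gisomorphic_trans)
  then show ?thesis
    unfolding HF_conn_def by (rule giso_torsion[OF hom_module[OF subcx_image[OF f]] gsub_modules(2)])
qed

text \<open>Compares the sizes of \<open>U ^ m\<close> times a graded piece on the two sides of the
  given isomorphism; the 1 added to \<open>s\<close> is the grading shift in \<open>HF_red\<close>.
  The delicate point is that an element of degree \<open>d + 1\<close> in the sum comes from one of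
  degree \<open>d\<close> in the root module.\<close>

lemma multiplicity_rk:
  fixes I :: "'i set" and a :: "'i \<Rightarrow> rat" and n k :: "'i \<Rightarrow> nat"
  assumes I: "finite I" and red: "HF_red C \<cong>\<^sub>g\<^sub>r gdsum I (\<lambda>i. gpow (T (a i) (n i)) (k i))"
  shows "(\<Sum>i\<in>I. k i * hit (a i) (n i) m (2 * of_int e + (s + 1))) = rk e m"
    and "\<nexists>e. D = 2 * of_int e + (s + 1) \<Longrightarrow> (\<Sum>i\<in>I. k i * hit (a i) (n i) m D) = 0"
proof -
  interpret H: fu_module H by (rule H_module)
  define G where "G = gdsum I (\<lambda>i. gpow (T (a i) (n i)) (k i))"
  obtain \<kappa> where \<kappa>: "\<kappa> \<in> ghom 0 (HF_red C) G" "inj_on \<kappa> (carrier (HF_red C))"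
    "\<kappa> ` carrier (HF_red C) = carrier G"
    using red unfolding gisomorphic_def giso_def bij_betw_def G_def by auto
  note \<kappa>D = ghomD[OF \<kappa>(1)]
  define TT where "TT = {x. keys x \<subseteq> V \<and> tors x}"
  have TT_H: "\<Psi> x \<in> carrier (HF_red C)" if "x \<in> TT" for x
    unfolding HF_red_def using that \<Psi>_carrier[of x] is_torsion_iff[OF \<Psi>_carrier] \<Phi>_\<Psi>[of x] unfolding TT_def by simp
  have TT_add: "x + y \<in> TT" if "x \<in> TT" "y \<in> TT" for x y
    using that keys_add_subset tors_add unfolding TT_def by auto
  define \<mu> where "\<mu> x = \<kappa> (\<Psi> x)" for x
  have \<mu>_add: "\<mu> (x + y) = \<mu> x \<oplus>\<^bsub>G\<^esub> \<mu> y" if x: "x \<in> TT" and y: "y \<in> TT" for x y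
  proof -
    have "\<Psi> (x + y) = \<Psi> x \<oplus>\<^bsub>HF_red C\<^esub> \<Psi> y"
      using \<Psi>_add[of x y] x y unfolding TT_def HF_red_def by simp
    then show ?thesis unfolding \<mu>_def using \<kappa>D(2)[OF TT_H[OF x] TT_H[OF y]] by simp
  qed
  have \<mu>_carrier: "\<mu> x \<in> carrier G" if "x \<in> TT" for x unfolding \<mu>_def by (rule \<kappa>D(1)[OF TT_H[OF that]])
  have \<mu>_U: "\<mu> (lin (dn ^^ m) x) = (Uvar ^ m) \<odot>\<^bsub>G\<^esub> \<mu> x" if x: "x \<in> TT" for x m
  proof -
    have "\<Psi> (lin (dn ^^ m) x) = (Uvar ^ m) \<odot>\<^bsub>HF_red C\<^esub> \<Psi> x"
      using \<Psi>_U[of x m] x unfolding TT_def HF_red_def by simp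
    then show ?thesis unfolding \<mu>_def using \<kappa>D(3)[OF TT_H[OF x], of "Uvar ^ m"] by simp
  qed
  have \<mu>_inj: "x = y" if x: "x \<in> TT" and y: "y \<in> TT" and eq: "\<mu> x = \<mu> y" for x y
  proof -
    have "\<Psi> x = \<Psi> y" by (rule inj_onD[OF \<kappa>(2) eq[unfolded \<mu>_def] TT_H[OF x] TT_H[OF y]])
    moreover have "\<Phi> (\<Psi> x) = x" "\<Phi> (\<Psi> y) = y" using x y \<Phi>_\<Psi> unfolding TT_def by blast+
    ultimately show ?thesis by metis
  qed
  have \<mu>_surj: "\<exists>x\<in>TT. F = \<mu> x" if F: "F \<in> carrier G" for F
  proof -
    obtain X where X: "X \<in> carrier (HF_red C)" "F = \<kappa> X" using F \<kappa>(3) by blast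
    have XH: "X \<in> carrier H" using X(1) unfolding HF_red_def by simp
    then have "tors (\<Phi> X)" using X(1) is_torsion_iff[OF XH] unfolding HF_red_def by simp
    then have "\<Phi> X \<in> TT" unfolding TT_def using \<Phi>_keys[OF XH] by simp
    moreover have "F = \<mu> (\<Phi> X)" unfolding \<mu>_def \<Psi>_\<Phi>[OF XH] by (rule X(2))
    ultimately show ?thesis by blast
  qed
  have \<mu>_gr: "\<mu> x \<in> gr G (d + 1)" if x: "x \<in> TT" "keys x \<subseteq> LD d" for x d
  proof -
    have "\<Psi> x \<in> gr (HF_red C) (d + 1)"
      unfolding HF_red_def using \<Psi>_gr[OF x(2)] TT_H[OF x(1)] unfolding HF_red_def by simp
    then show ?thesis unfolding \<mu>_def using \<kappa>D(4)[of "\<Psi> x" "d + 1"] by simp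
  qed
  have lin_TT: "lin (dn ^^ m) x \<in> TT" if x: "x \<in> TT" for x m
  proof -
    obtain n where "lin (dn ^^ n) x = 0" using \<open>x \<in> TT\<close> unfolding TT_def tors_def by blast
    moreover have "lin (dn ^^ n) (lin (dn ^^ m) x) = lin (dn ^^ m) (lin (dn ^^ n) x)"
      by (simp only: lin_pow_pow add.commute)
    ultimately have "tors (lin (dn ^^ m) x)" unfolding tors_def by (metis lin_zero)
    then show ?thesis using x keys_dn_pow unfolding TT_def by simp
  qed
  have restr_TT: "restr (LD d) x \<in> TT" if x: "x \<in> TT" for x d
  proof (cases "ev d")
    case True
    then obtain e where e: "d = 2 * of_int e + s" by blast
    have k: "keys (restr (L e) x) \<subseteq> L e" by (simp add: keys_restr)
    have "eps (restr (L e) x) = sm (L e) x"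
      unfolding sm_card by (simp add: keys_restr)
    also have "\<dots> = 0" using x torsion_sm unfolding TT_def tors_def by blast
    finally have "tors (restr (L e) x)" using tors_iff_eps[OF k] by simp
    then show ?thesis unfolding e LD_L TT_def using k unfolding L_def by blast
  next
    case False
    then show ?thesis using LD_empty restr_disjoint[of x "{}"] unfolding TT_def by simp
  qed
  note cI = I G_def
  \<comment> \<open>A preimage \<open>x\<close> could have components in several degrees.
    Functionals supported in degree \<open>d + 1\<close> see only its component in degree
    \<open>d\<close>, and all others vanish both on \<open>F\<close> and on the image of this
    component, so the two coincide.\<close>
  have graded: "\<exists>x\<in>TT. keys x \<subseteq> LD d \<and> F = \<mu> x" if F: "F \<in> gr G (d + 1)" for F d
  proof -
    have FG: "F \<in> carrier G" using G_gr_carrier[OF cI] F by blast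
    obtain x where x: "x \<in> TT" "F = \<mu> x" using \<mu>_surj[OF FG] by blast
    define dg where "dg v = 2 * of_int (lv v) + s" for v
    have LD_dg: "LD d' = {v \<in> V. dg v = d'}" for d' unfolding LD_def dg_def ..
    \<comment> \<open>Induction on a finite set \<open>E\<close> of degrees that are kept. A
      functional supported in degree \<open>D\<close> sees exactly the component of \<open>x\<close>
      in degree \<open>D - 1\<close>, again because of the shift.\<close>
    have part: "restr {v \<in> V. dg v \<in> E} x \<in> TT \<and>
      (\<forall>i\<in>I. \<forall>j<k i. \<forall>c<n i. ccoeff n i j c (\<mu> (restr {v \<in> V. dg v \<in> E} x)) =
         (if a i - 2 * of_nat c - 1 \<in> E then ccoeff n i j c (\<mu> (restr (LD (a i - 2 * of_nat c - 1)) x)) else 0))"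
      if "finite E" for E
      using that
    proof (induction E)
      case empty
      have r0: "restr {v \<in> V. dg v \<in> {}} x = 0" by (rule restr_disjoint) simp
      have T0: "(0 :: 'v \<Rightarrow>\<^sub>0 bit) \<in> TT" unfolding TT_def by simp
      have "ccoeff n i j c (\<mu> 0) = 0" if "i \<in> I" "j < k i" "c < n i" for i j c
      proof -
        have "ccoeff n i j c (\<mu> (0 + 0)) = ccoeff n i j c (\<mu> 0) + ccoeff n i j c (\<mu> 0)"
          unfolding \<mu>_add[OF T0 T0] by (rule ccoeff_add[OF cI \<mu>_carrier[OF T0] \<mu>_carrier[OF T0] that])
        then show ?thesis by (cases "ccoeff n i j c (\<mu> 0)") simp_all
      qed
      then show ?case using r0 T0 by simp
    next
      case (insert d' E)
      have U: "{v \<in> V. dg v \<in> insert d' E} = LD d' \<union> {v \<in> V. dg v \<in> E}" unfolding LD_dg by blast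
      have disj: "LD d' \<inter> {v \<in> V. dg v \<in> E} = {}" using insert(2) unfolding LD_dg by blast
      note r = restr_Un[OF disj, of x, folded U]
      have t1: "restr (LD d') x \<in> TT" by (rule restr_TT[OF x(1)])
      have t2: "restr {v \<in> V. dg v \<in> E} x \<in> TT" using insert.IH by blast
      have "ccoeff n i j c (\<mu> (restr {v \<in> V. dg v \<in> insert d' E} x)) =
         (if a i - 2 * of_nat c - 1 \<in> insert d' E then ccoeff n i j c (\<mu> (restr (LD (a i - 2 * of_nat c - 1)) x)) else 0)"
        if i: "i \<in> I" "j < k i" "c < n i" for i j c
      proof -
        let ?d = "a i - 2 * of_nat c - 1"
        have sum: "ccoeff n i j c (\<mu> (restr {v \<in> V. dg v \<in> insert d' E} x)) =
          ccoeff n i j c (\<mu> (restr (LD d') x)) + ccoeff n i j c (\<mu> (restr {v \<in> V. dg v \<in> E} x))"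
          unfolding r \<mu>_add[OF t1 t2] by (rule ccoeff_add[OF cI \<mu>_carrier[OF t1] \<mu>_carrier[OF t2] i])
        have IH: "ccoeff n i j c (\<mu> (restr {v \<in> V. dg v \<in> E} x)) =
          (if ?d \<in> E then ccoeff n i j c (\<mu> (restr (LD ?d) x)) else 0)" using insert.IH i by blast
        show ?thesis
        proof (cases "?d = d'")
          case True
          then have "?d \<notin> E" using insert(2) by simp
          then show ?thesis unfolding sum IH using True by simp
        next
          case False
          have "keys (restr (LD d') x) \<subseteq> LD d'" by (simp add: keys_restr)
          then have "ccoeff n i j c (\<mu> (restr (LD d') x)) = 0"
            by (intro ccoeff_gr[OF cI \<mu>_gr[OF t1] i]) (use False in auto)
          then show ?thesis unfolding sum IH using False by simp
        qed
      qed
      then show ?case using TT_add[OF t1 t2] r by simp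
    qed
    let ?E = "dg ` keys x"
    have "restr {v \<in> V. dg v \<in> ?E} x = x"
      by (rule restr_id) (use x in \<open>auto simp: TT_def\<close>)
    then have cc: "ccoeff n i j c F = (if a i - 2 * of_nat c - 1 \<in> ?E then ccoeff n i j c (\<mu> (restr (LD (a i - 2 * of_nat c - 1)) x)) else 0)"
      if "i \<in> I" "j < k i" "c < n i" for i j c
      using part[of ?E] that x(2) by simp
    let ?x = "restr (LD d) x"
    have tx: "?x \<in> TT" by (rule restr_TT[OF x(1)])
    have kx: "keys ?x \<subseteq> LD d" by (simp add: keys_restr)
    have "F = \<mu> ?x"
    proof (rule ccoeff_ext[OF cI FG \<mu>_carrier[OF tx]])
      fix i j c assume i: "i \<in> I" "j < k i" "c < n i"
      show "ccoeff n i j c F = ccoeff n i j c (\<mu> ?x)"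
      proof (cases "a i - 2 * of_nat c = d + 1")
        case True
        then have d: "a i - 2 * of_nat c - 1 = d" by simp
        show ?thesis
        proof (cases "d \<in> ?E")
          case True
          then show ?thesis using cc[OF i] unfolding d by simp
        next
          case False
          have "restr (LD d) x = 0" by (rule restr_disjoint) (use False in \<open>auto simp: LD_dg\<close>)
          moreover have "restr {v \<in> V. dg v \<in> {}} x = 0" by (rule restr_disjoint) simp
          ultimately have "ccoeff n i j c (\<mu> ?x) = 0" using part[of "{}"] i by simp
          then show ?thesis using cc[OF i] False unfolding d by simp
        qed
      next
        case False
        then show ?thesis
          using ccoeff_gr[OF cI F i False] ccoeff_gr[OF cI \<mu>_gr[OF tx kx] i False] by simp
      qed
    qed
    then show ?thesis using tx kx by blast
  qed
  have card: "2 ^ (\<Sum>i\<in>I. k i * hit (a i) (n i) m (d + 1)) = card (lin (dn ^^ m) ` {x \<in> TT. keys x \<subseteq> LD d})" for m d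
  proof -
    let ?N = "{x \<in> TT. keys x \<subseteq> LD d}"
    have "gr G (d + 1) = \<mu> ` ?N" using graded \<mu>_gr by blast
    then have "upow G m (d + 1) = (\<lambda>x. (Uvar ^ m) \<odot>\<^bsub>G\<^esub> \<mu> x) ` ?N"
      by (simp add: upow_def image_image)
    also have "\<dots> = (\<lambda>x. \<mu> (lin (dn ^^ m) x)) ` ?N"
      by (rule image_cong[OF refl]) (simp add: \<mu>_U)
    also have "\<dots> = \<mu> ` lin (dn ^^ m) ` ?N" by (simp add: image_image)
    finally have "upow G m (d + 1) = \<mu> ` lin (dn ^^ m) ` ?N" .
    moreover have "inj_on \<mu> (lin (dn ^^ m) ` ?N)"
    proof (rule inj_onI)
      fix x y assume "x \<in> lin (dn ^^ m) ` ?N" "y \<in> lin (dn ^^ m) ` ?N" and eq: "\<mu> x = \<mu> y"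
      then have "x \<in> TT" "y \<in> TT" using lin_TT by blast+
      then show "x = y" using eq by (rule \<mu>_inj)
    qed
    ultimately have "card (upow G m (d + 1)) = card (lin (dn ^^ m) ` ?N)" by (simp add: card_image)
    then show ?thesis unfolding G_def card_upow_cyclic_sum[OF I] .
  qed
  show "(\<Sum>i\<in>I. k i * hit (a i) (n i) m (2 * of_int e + (s + 1))) = rk e m"
  proof -
    have "{x \<in> TT. keys x \<subseteq> LD (2 * of_int e + s)} = {x. keys x \<subseteq> L e \<and> tors x}"
      unfolding LD_L TT_def L_def by blast
    then have "(2::nat) ^ (\<Sum>i\<in>I. k i * hit (a i) (n i) m (2 * of_int e + s + 1)) = 2 ^ rk e m"
      using card[of m "2 * of_int e + s"] card_tors_level by simp
    then show ?thesis by (simp add: add.assoc)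
  qed
  show "(\<Sum>i\<in>I. k i * hit (a i) (n i) m D) = 0" if D: "\<nexists>e. D = 2 * of_int e + (s + 1)"
  proof -
    have "\<not> ev (D - 1)"
    proof
      assume "ev (D - 1)"
      then obtain e where "D - 1 = 2 * of_int e + s" by blast
      then have "D = 2 * of_int e + (s + 1)" by (simp add: algebra_simps)
      then show False using D by blast
    qed
    then have "{x \<in> TT. keys x \<subseteq> LD (D - 1)} = {0}" using LD_empty[of "D - 1"] unfolding TT_def by auto
    then have "(2::nat) ^ (\<Sum>i\<in>I. k i * hit (a i) (n i) m D) = 1" using card[of m "D - 1"] by simp
    then show ?thesis by simp
  qed
qed

theorem connected_homology:
  fixes I :: "'i set" and a :: "'i \<Rightarrow> rat" and n k :: "'i \<Rightarrow> nat"
  assumes I: "finite I" and red: "HF_red C \<cong>\<^sub>g\<^sub>r gdsum I (\<lambda>i. gpow (T (a i) (n i)) (k i))"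
    and dist: "\<And>i i'. i \<in> I \<Longrightarrow> i' \<in> I \<Longrightarrow> i \<noteq> i' \<Longrightarrow> (a i, n i) \<noteq> (a i', n i')"
    and f: "maximal_self_local_equivalence C \<iota> f"
  shows "HF_conn C f \<cong>\<^sub>g\<^sub>r gdsum I (\<lambda>i. gpow (T (a i) (n i)) (if even (k i) then 0 else 1))"
proof (rule gisomorphic_trans[OF HF_conn_maximal[OF f] monotone_decomposition[OF RM_module I]])
  note mr = multiplicity_rk[OF I red]
  show "(a i, n i) \<noteq> (a i', n i')" if "i \<in> I" "i' \<in> I" "i \<noteq> i'" for i i' using dist that .
  show "\<exists>d. a i = 2 * of_int d + (s + 1) \<and> odd_pair d (n i)" if "i \<in> I" "0 < n i" "odd (k i)" for i
    by (rule odd_multiplicity(1)[where k = k, OF I dist mr that])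
  show "\<exists>i\<in>I. a i = 2 * of_int d + (s + 1) \<and> n i = l \<and> odd (k i)" if "odd_pair d l" for d l
    by (rule odd_multiplicity(2)[where k = k, OF I dist mr that])
qed

end

theorem corollary1p17:
  fixes C :: "'c cx" and \<iota> :: "'c \<Rightarrow> 'c"
    and V :: "'v set" and E :: "'v \<Rightarrow> 'v \<Rightarrow> bool" and \<chi> :: "'v \<Rightarrow> rat" and J :: "'v \<Rightarrow> 'v"
    and \<sigma> :: rat
    and N :: nat and a :: "nat \<Rightarrow> rat" and n k :: "nat \<Rightarrow> nat"
  assumes "iota_complex C \<iota>"
    and "symmetric_graded_root V E \<chi> J"
    and "\<exists>\<phi> \<in> giso (homology C) (root_module V E \<chi> \<sigma>).
           \<forall>x\<in>carrier (homology C). \<phi> (homology_map C \<iota> x) = root_involution J (\<phi> x)"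
    and "HF_red C \<cong>\<^sub>g\<^sub>r gdsum {1..N} (\<lambda>i. gpow (T (a i) (n i)) (k i))"
    and "\<And>i j. i \<in> {1..N} \<Longrightarrow> j \<in> {1..N} \<Longrightarrow> i \<noteq> j \<Longrightarrow> (a i, n i) \<noteq> (a j, n j)"
  shows "(\<exists>f. maximal_self_local_equivalence C \<iota> f) \<and>
         (\<forall>f. maximal_self_local_equivalence C \<iota> f \<longrightarrow>
            HF_conn C f \<cong>\<^sub>g\<^sub>r
              gdsum {1..N} (\<lambda>i. gpow (T (a i) (n i)) (if even (k i) then 0 else 1)))"
proof -
  obtain lv \<chi>0 where root: "sroot V (root_down E \<chi>) lv J" and \<chi>: "\<And>v. v \<in> V \<Longrightarrow> \<chi> v = \<chi>0 + of_int (lv v)"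
    using symmetric_graded_root.integral_levels[OF assms(2)] by blast
  \<comment> \<open>The base value \<open>\<chi>0\<close> of the levels is absorbed into the
    normalization of the grading.\<close>
  have "{v \<in> V. 2 * \<chi> v + \<sigma> = d} = {v \<in> V. 2 * of_int (lv v) + (\<sigma> + 2 * \<chi>0) = d}" for d
    using \<chi> by (auto simp: algebra_simps)
  then have RM: "root_module V E \<chi> \<sigma> = sroot.RM V (root_down E \<chi>) lv (\<sigma> + 2 * \<chi>0)"
    unfolding root_module_def sroot.RM_def[OF root] by simp
  have inv: "root_involution J x = lin J x" for x
    unfolding root_involution_def lin_def ..
  obtain \<Phi> where \<Phi>: "\<Phi> \<in> giso (homology C) (sroot.RM V (root_down E \<chi>) lv (\<sigma> + 2 * \<chi>0))"
    "\<And>x. x \<in> carrier (homology C) \<Longrightarrow> \<Phi> (homology_map C \<iota> x) = lin J (\<Phi> x)"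
    using assms(3) unfolding RM inv by blast
  interpret root_complex C \<iota> V "root_down E \<chi>" lv J "\<sigma> + 2 * \<chi>0" \<Phi>
    by (rule root_complex.intro[OF assms(1) root root_complex_axioms.intro]) (fact \<Phi>)+
  show ?thesis
    using maximal_exists connected_homology[OF finite_atLeastAtMost assms(4,5)] by blast
qed

end
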